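(* Let $k$ be a field, $C$ a coalgebra over $k$, and let $B\subseteq P$ be a principal $C$-extension. Then: (1) There exists a strong connection. (2) $P$ is a projective left $B$-module and a projective right $B$-module. (3) $B$ is a direct summand of $P$ as a left $B$-module and as a right $B$-module. (4) $P$ is a faithfully flat left $B$-module and a faithfully flat right $B$-module. (5) $P$ is coflat as a left $C$-comodule and as a right $C$-comodule.
   Context: Algebras are associative and unital, coalgebras coassociative and counital, all over a field $k$; $\otimes=\otimes_k$. $C$-extension: let $C$ be a coalgebra and let $P$ be an algebra that is also a right $C$-comodule via $\Delta_P:P\to P\otimes C$. Put $B=P^{co\,C}:=\{b\in P \mid \Delta_P(bp)=b\,\Delta_P(p)\ \text{for all } p\in P\}$. The inclusion $B\subseteq P$ is called a $C$-extension. A $C$-extension $B\subseteq P$ is principal if: (1) $can_R: P\otimes_B P\to P\otimes C$, $p\otimes_B p'\mapsto p\,\Delta_P(p')$, is bijective; (2) $\psi:C\otimes P\to P\otimes C$, $c\otimes p\mapsto can_R(can_R^{-1}(1\otimes c)\,p)$, is bijective; (3) there is a group-like element $e\in C$ such that $\Delta_P(p)=\psi(e\otimes p)$ for all $p\in P$; (4) $P$ is $C$-equivariantly projective as a left $B$-module: for all left $B$-modules $M,N$ that are right $C$-comodules with $B$-linear coactions, every $B$-linear $C$-colinear epimorphism $\pi:M\to N$ split as a $C$-comodule map, and every $B$-linear $C$-colinear $f:P\to N$, there is a $B$-linear $C$-colinear $g:P\to M$ with $\pi\circ g=f$. $P$ is a right $C$-comodule via $\Delta_P$ and a left $C$-comodule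 via ${}_P\Delta:P\to C\otimes P$, ${}_P\Delta(p)=\psi^{-1}(p\otimes e)$. Strong connection: a left $B$-linear right $C$-colinear map $s:P\to B\otimes P$ (with $B\otimes P$ a left $B$-module via the first factor and a right $C$-comodule via $\mathrm{id}\otimes\Delta_P$) that splits the multiplication map $B\otimes P\to P$ and satisfies $s(1)=1\otimes 1$. Cotensor product: for a right $C$-comodule $(V,\Delta_V)$ and a left $C$-comodule $(W,{}_W\Delta)$, $V\Box_C W:=\ker(\mathrm{id}\otimes{}_W\Delta-\Delta_V\otimes\mathrm{id})\subseteq V\otimes W$. A right (resp. left) $C$-comodule $M$ is coflat if the functor $M\Box_C-$ (resp. $-\Box_C M$) is exact. *)

theory Defs
  imports "HOL-Algebra.Algebra"
begin

section \<open>Modules over noncommutative rings\<close>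

text \<open>
  The locale \<open>module\<close> of HOL-Algebra requires a commutative ring of scalars; it is used below
  for vector spaces over the ground field.  Modules over an arbitrary ring reuse its record type,
  the ring fields \<open>mult\<close> and \<open>one\<close> of the record being irrelevant.
\<close>

locale left_module = R?: ring R + M?: abelian_group M
  for R :: "('r, 'x) ring_scheme" (structure) and M :: "('r, 'm, 'y) module_scheme" (structure) +
  assumes smult_closed:
      "\<lbrakk>a \<in> carrier R; x \<in> carrier M\<rbrakk> \<Longrightarrow> a \<odot>\<^bsub>M\<^esub> x \<in> carrier M"
    and smult_l_distr:
      "\<lbrakk>a \<in> carrier R; b \<in> carrier R; x \<in> carrier M\<rbrakk> \<Longrightarrow>
        (a \<oplus> b) \<odot>\<^bsub>M\<^esub> x = a \<odot>\<^bsub>M\<^esub> x \<oplus>\<^bsub>M\<^esub> b \<odot>\<^bsub>M\<^esub> x"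
    and smult_r_distr:
      "\<lbrakk>a \<in> carrier R; x \<in> carrier M; y \<in> carrier M\<rbrakk> \<Longrightarrow>
        a \<odot>\<^bsub>M\<^esub> (x \<oplus>\<^bsub>M\<^esub> y) = a \<odot>\<^bsub>M\<^esub> x \<oplus>\<^bsub>M\<^esub> a \<odot>\<^bsub>M\<^esub> y"
    and smult_assoc:
      "\<lbrakk>a \<in> carrier R; b \<in> carrier R; x \<in> carrier M\<rbrakk> \<Longrightarrow>
        (a \<otimes> b) \<odot>\<^bsub>M\<^esub> x = a \<odot>\<^bsub>M\<^esub> (b \<odot>\<^bsub>M\<^esub> x)"
    and smult_one:
      "x \<in> carrier M \<Longrightarrow> \<one> \<odot>\<^bsub>M\<^esub> x = x"

definition opposite :: "('r, 'x) ring_scheme \<Rightarrow> ('r, 'x) ring_scheme" where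
  "opposite R = R\<lparr>monoid.mult := \<lambda>x y. y \<otimes>\<^bsub>R\<^esub> x\<rparr>"

text \<open>For a right module \<open>M\<close>, the term \<open>r \<odot>\<^bsub>M\<^esub> m\<close> stands for the product \<open>m r\<close>.\<close>

definition right_module :: "('r, 'x) ring_scheme \<Rightarrow> ('r, 'm, 'y) module_scheme \<Rightarrow> bool" where
  "right_module R M \<longleftrightarrow> left_module (opposite R) M"

definition module_hom ::
  "('r, 'x) ring_scheme \<Rightarrow> ('r, 'm, 'y) module_scheme \<Rightarrow> ('r, 'n, 'z) module_scheme \<Rightarrow> ('m \<Rightarrow> 'n) set"
  where "module_hom R M N =
    {h \<in> hom (add_monoid M) (add_monoid N).
      \<forall>r\<in>carrier R. \<forall>m\<in>carrier M. h (r \<odot>\<^bsub>M\<^esub> m) = r \<odot>\<^bsub>N\<^esub> h m}"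

definition with_smult :: "('m, 'x) ring_scheme \<Rightarrow> ('r \<Rightarrow> 'm \<Rightarrow> 'm) \<Rightarrow> ('r, 'm) module" where
  "with_smult M f = \<lparr>carrier = carrier M, monoid.mult = monoid.mult M, one = one M,
     ring.zero = ring.zero M, ring.add = ring.add M, smult = f\<rparr>"

text \<open>
  A ring as a left and as a right module over itself; the same records serve as modules over
  any subring.
\<close>

definition left_reg :: "('r, 'x) ring_scheme \<Rightarrow> ('r, 'r) module" where
  "left_reg R = with_smult R (\<lambda>r x. r \<otimes>\<^bsub>R\<^esub> x)"

definition right_reg :: "('r, 'x) ring_scheme \<Rightarrow> ('r, 'r) module" where
  "right_reg R = with_smult R (\<lambda>r x. x \<otimes>\<^bsub>R\<^esub> r)"

definition exact_at ::
  "('l, 'x) ring_scheme \<Rightarrow> ('m, 'y) ring_scheme \<Rightarrow> ('n, 'z) ring_scheme \<Rightarrow> ('l \<Rightarrow> 'm) \<Rightarrow> ('m \<Rightarrow> 'n) \<Rightarrow> bool"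
  where "exact_at L M N f g \<longleftrightarrow> f ` carrier L = a_kernel M N g"

definition direct_summand ::
  "('r, 'x) ring_scheme \<Rightarrow> ('r, 'm) module \<Rightarrow> 'm set \<Rightarrow> bool" where
  "direct_summand R M S \<longleftrightarrow> submodule S R M \<and>
    (\<exists>Q. submodule Q R M \<and> S \<inter> Q = {\<zero>\<^bsub>M\<^esub>} \<and> S <+>\<^bsub>M\<^esub> Q = carrier M)"

text \<open>
  HOL cannot quantify over types inside a formula, so the types carrying the test modules
  are parameters of the definitions.
\<close>

definition projective_left ::
  "'m itself \<Rightarrow> 'n itself \<Rightarrow> ('r, 'x) ring_scheme \<Rightarrow> ('r, 'q) module \<Rightarrow> bool" where
  "projective_left _ _ R Q \<longleftrightarrow> left_module R Q \<and>
    (\<forall>(M :: ('r, 'm) module) (N :: ('r, 'n) module) \<pi> f.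
       left_module R M \<and> left_module R N \<and>
       \<pi> \<in> module_hom R M N \<and> \<pi> ` carrier M = carrier N \<and> f \<in> module_hom R Q N \<longrightarrow>
       (\<exists>g\<in>module_hom R Q M. \<forall>q\<in>carrier Q. \<pi> (g q) = f q))"

definition projective_right ::
  "'m itself \<Rightarrow> 'n itself \<Rightarrow> ('r, 'x) ring_scheme \<Rightarrow> ('r, 'q) module \<Rightarrow> bool" where
  "projective_right tm tn R Q \<longleftrightarrow> projective_left tm tn (opposite R) Q"


section \<open>Tensor products\<close>

text \<open>
  The tensor product of a right \<open>R\<close>-module \<open>M\<close> and a left \<open>R\<close>-module \<open>N\<close> is the free abelian
  group on \<open>M \<times> N\<close> modulo the usual relations; its elements are cosets.
\<close>

type_synonym ('m, 'n) tensor = "('m \<times> 'n \<Rightarrow>\<^sub>0 int) set"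

definition tensor_free ::
  "('r, 'm, 'y) module_scheme \<Rightarrow> ('r, 'n, 'z) module_scheme \<Rightarrow> ('m \<times> 'n \<Rightarrow>\<^sub>0 int) monoid" where
  "tensor_free M N = free_Abelian_group (carrier M \<times> carrier N)"

definition tensor_relators ::
  "('r, 'x) ring_scheme \<Rightarrow> ('r, 'm, 'y) module_scheme \<Rightarrow> ('r, 'n, 'z) module_scheme \<Rightarrow>
   ('m \<times> 'n \<Rightarrow>\<^sub>0 int) set" where
  "tensor_relators R M N =
     {frag_of (m \<oplus>\<^bsub>M\<^esub> m', n) - frag_of (m, n) - frag_of (m', n) | m m' n.
        m \<in> carrier M \<and> m' \<in> carrier M \<and> n \<in> carrier N} \<union>
     {frag_of (m, n \<oplus>\<^bsub>N\<^esub> n') - frag_of (m, n) - frag_of (m, n') | m n n'.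
        m \<in> carrier M \<and> n \<in> carrier N \<and> n' \<in> carrier N} \<union>
     {frag_of (r \<odot>\<^bsub>M\<^esub> m, n) - frag_of (m, r \<odot>\<^bsub>N\<^esub> n) | r m n.
        r \<in> carrier R \<and> m \<in> carrier M \<and> n \<in> carrier N}"

definition tensor_null ::
  "('r, 'x) ring_scheme \<Rightarrow> ('r, 'm, 'y) module_scheme \<Rightarrow> ('r, 'n, 'z) module_scheme \<Rightarrow> ('m, 'n) tensor"
  where "tensor_null R M N = generate (tensor_free M N) (tensor_relators R M N)"

definition tensor_group ::
  "('r, 'x) ring_scheme \<Rightarrow> ('r, 'm, 'y) module_scheme \<Rightarrow> ('r, 'n, 'z) module_scheme \<Rightarrow>
   ('m, 'n) tensor ring" where
  "tensor_group R M N =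
     (let Q = tensor_free M N Mod tensor_null R M N
      in \<lparr>carrier = carrier Q, monoid.mult = undefined, one = undefined,
          ring.zero = one Q, ring.add = monoid.mult Q\<rparr>)"

definition pure_tensor ::
  "('r, 'x) ring_scheme \<Rightarrow> ('r, 'm, 'y) module_scheme \<Rightarrow> ('r, 'n, 'z) module_scheme \<Rightarrow>
   'm \<Rightarrow> 'n \<Rightarrow> ('m, 'n) tensor" where
  "pure_tensor R M N m n = tensor_null R M N #>\<^bsub>tensor_free M N\<^esub> frag_of (m, n)"

text \<open>
  The additive map into \<open>A\<close> determined by \<open>m \<otimes> n \<mapsto> f m n\<close>.  It is evaluated on a representative;
  for a balanced biadditive \<open>f\<close>, the only case in which it is used, the choice does not matter.
\<close>

definition tensor_lift ::
  "('a, 'x) ring_scheme \<Rightarrow> ('m \<Rightarrow> 'n \<Rightarrow> 'a) \<Rightarrow> ('m, 'n) tensor \<Rightarrow> 'a" where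
  "tensor_lift A f t =
     (let z = (SOME z. z \<in> t)
      in finsum A (\<lambda>(m, n). add_pow A (Poly_Mapping.lookup z (m, n)) (f m n)) (Poly_Mapping.keys z))"

text \<open>The map \<open>f \<otimes> g\<close>; the arguments \<open>M\<close>, \<open>N\<close> are the factors of its \<^emph>\<open>codomain\<close>.\<close>

definition tensor_map ::
  "('r, 'x) ring_scheme \<Rightarrow> ('r, 'm, 'y) module_scheme \<Rightarrow> ('r, 'n, 'z) module_scheme \<Rightarrow>
   ('a \<Rightarrow> 'm) \<Rightarrow> ('b \<Rightarrow> 'n) \<Rightarrow> ('a, 'b) tensor \<Rightarrow> ('m, 'n) tensor" where
  "tensor_map R M N f g =
     tensor_lift (tensor_group R M N) (\<lambda>a b. pure_tensor R M N (f a) (g b))"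

definition tensor_space ::
  "('k, 'x) ring_scheme \<Rightarrow> ('k, 'v, 'y) module_scheme \<Rightarrow> ('k, 'w, 'z) module_scheme \<Rightarrow>
   ('k, ('v, 'w) tensor) module" where
  "tensor_space K V W =
     with_smult (tensor_group K V W) (\<lambda>a. tensor_map K V W (\<lambda>v. a \<odot>\<^bsub>V\<^esub> v) id)"

definition assoc_right ::
  "('k, 'x) ring_scheme \<Rightarrow> ('k, 'u, 'y) module_scheme \<Rightarrow> ('k, 'v, 'z) module_scheme \<Rightarrow>
   ('k, 'w, 't) module_scheme \<Rightarrow> (('u, 'v) tensor, 'w) tensor \<Rightarrow> ('u, ('v, 'w) tensor) tensor" where
  "assoc_right K U V W =
     (let VW = tensor_space K V W; A = tensor_space K U VW
      in tensor_lift A (\<lambda>t w.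
           tensor_lift A (\<lambda>u v. pure_tensor K U VW u (pure_tensor K V W v w)) t))"

definition assoc_left ::
  "('k, 'x) ring_scheme \<Rightarrow> ('k, 'u, 'y) module_scheme \<Rightarrow> ('k, 'v, 'z) module_scheme \<Rightarrow>
   ('k, 'w, 't) module_scheme \<Rightarrow> ('u, ('v, 'w) tensor) tensor \<Rightarrow> (('u, 'v) tensor, 'w) tensor" where
  "assoc_left K U V W =
     (let UV = tensor_space K U V; A = tensor_space K UV W
      in tensor_lift A (\<lambda>u t.
           tensor_lift A (\<lambda>v w. pure_tensor K UV W (pure_tensor K U V u v) w) t))"

text \<open>
  The definition by exactness, applied to the tensor functors from right (respectively left)
  \<open>R\<close>-modules to abelian groups.
\<close>

definition faithfully_flat_left ::
  "'l itself \<Rightarrow> 'm itself \<Rightarrow> 'n itself \<Rightarrow> ('r, 'x) ring_scheme \<Rightarrow> ('r, 'q) module \<Rightarrow> bool" where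
  "faithfully_flat_left _ _ _ R Q \<longleftrightarrow> left_module R Q \<and>
    (\<forall>(L :: ('r, 'l) module) (M :: ('r, 'm) module) (N :: ('r, 'n) module) f g.
       right_module R L \<and> right_module R M \<and> right_module R N \<and>
       f \<in> module_hom R L M \<and> g \<in> module_hom R M N \<longrightarrow>
       (exact_at L M N f g \<longleftrightarrow>
        exact_at (tensor_group R L Q) (tensor_group R M Q) (tensor_group R N Q)
          (tensor_map R M Q f id) (tensor_map R N Q g id)))"

definition faithfully_flat_right ::
  "'l itself \<Rightarrow> 'm itself \<Rightarrow> 'n itself \<Rightarrow> ('r, 'x) ring_scheme \<Rightarrow> ('r, 'q) module \<Rightarrow> bool" where
  "faithfully_flat_right _ _ _ R Q \<longleftrightarrow> right_module R Q \<and>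
    (\<forall>(L :: ('r, 'l) module) (M :: ('r, 'm) module) (N :: ('r, 'n) module) f g.
       left_module R L \<and> left_module R M \<and> left_module R N \<and>
       f \<in> module_hom R L M \<and> g \<in> module_hom R M N \<longrightarrow>
       (exact_at L M N f g \<longleftrightarrow>
        exact_at (tensor_group R Q L) (tensor_group R Q M) (tensor_group R Q N)
          (tensor_map R Q M id f) (tensor_map R Q N id g)))"


section \<open>Algebras, coalgebras and comodules over a field\<close>

definition assoc_algebra :: "('k, 'x) ring_scheme \<Rightarrow> ('k, 'a, 'y) module_scheme \<Rightarrow> bool" where
  "assoc_algebra K A \<longleftrightarrow> module K A \<and> ring A \<and>
    (\<forall>a\<in>carrier K. \<forall>x\<in>carrier A. \<forall>y\<in>carrier A.
       a \<odot>\<^bsub>A\<^esub> (x \<otimes>\<^bsub>A\<^esub> y) = (a \<odot>\<^bsub>A\<^esub> x) \<otimes>\<^bsub>A\<^esub> y \<and>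
       a \<odot>\<^bsub>A\<^esub> (x \<otimes>\<^bsub>A\<^esub> y) = x \<otimes>\<^bsub>A\<^esub> (a \<odot>\<^bsub>A\<^esub> y))"

record ('k, 'c) coalgebra = "('k, 'c) module" +
  comult :: "'c \<Rightarrow> ('c, 'c) tensor"
  counit :: "'c \<Rightarrow> 'k"

definition is_coalgebra :: "'k ring \<Rightarrow> ('k, 'c) coalgebra \<Rightarrow> bool" where
  "is_coalgebra K C \<longleftrightarrow> module K C \<and>
    comult C \<in> module_hom K C (tensor_space K C C) \<and>
    counit C \<in> module_hom K C (left_reg K) \<and>
    (\<forall>c\<in>carrier C.
       assoc_right K C C C (tensor_map K (tensor_space K C C) C (comult C) id (comult C c)) =
         tensor_map K C (tensor_space K C C) id (comult C) (comult C c) \<and>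
       tensor_lift C (\<lambda>x y. counit C x \<odot>\<^bsub>C\<^esub> y) (comult C c) = c \<and>
       tensor_lift C (\<lambda>x y. counit C y \<odot>\<^bsub>C\<^esub> x) (comult C c) = c)"

definition group_like :: "'k ring \<Rightarrow> ('k, 'c) coalgebra \<Rightarrow> 'c \<Rightarrow> bool" where
  "group_like K C e \<longleftrightarrow>
     e \<in> carrier C \<and> comult C e = pure_tensor K C C e e \<and> counit C e = \<one>\<^bsub>K\<^esub>"

definition right_comodule ::
  "'k ring \<Rightarrow> ('k, 'c) coalgebra \<Rightarrow> ('k, 'v) module \<Rightarrow> ('v \<Rightarrow> ('v, 'c) tensor) \<Rightarrow> bool" where
  "right_comodule K C V \<rho> \<longleftrightarrow> module K V \<and>
    \<rho> \<in> module_hom K V (tensor_space K V C) \<and>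
    (\<forall>v\<in>carrier V.
       assoc_right K V C C (tensor_map K (tensor_space K V C) C \<rho> id (\<rho> v)) =
         tensor_map K V (tensor_space K C C) id (comult C) (\<rho> v) \<and>
       tensor_lift V (\<lambda>x c. counit C c \<odot>\<^bsub>V\<^esub> x) (\<rho> v) = v)"

definition left_comodule ::
  "'k ring \<Rightarrow> ('k, 'c) coalgebra \<Rightarrow> ('k, 'w) module \<Rightarrow> ('w \<Rightarrow> ('c, 'w) tensor) \<Rightarrow> bool" where
  "left_comodule K C W \<rho> \<longleftrightarrow> module K W \<and>
    \<rho> \<in> module_hom K W (tensor_space K C W) \<and>
    (\<forall>w\<in>carrier W.
       assoc_right K C C W (tensor_map K (tensor_space K C C) W (comult C) id (\<rho> w)) =
         tensor_map K C (tensor_space K C W) id \<rho> (\<rho> w) \<and>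
       tensor_lift W (\<lambda>c x. counit C c \<odot>\<^bsub>W\<^esub> x) (\<rho> w) = w)"

definition right_comodule_hom ::
  "'k ring \<Rightarrow> ('k, 'c) coalgebra \<Rightarrow> ('k, 'v) module \<Rightarrow> ('v \<Rightarrow> ('v, 'c) tensor) \<Rightarrow>
   ('k, 'w) module \<Rightarrow> ('w \<Rightarrow> ('w, 'c) tensor) \<Rightarrow> ('v \<Rightarrow> 'w) set" where
  "right_comodule_hom K C V \<rho> W \<sigma> =
     {f \<in> module_hom K V W. \<forall>v\<in>carrier V. \<sigma> (f v) = tensor_map K W C f id (\<rho> v)}"

definition left_comodule_hom ::
  "'k ring \<Rightarrow> ('k, 'c) coalgebra \<Rightarrow> ('k, 'v) module \<Rightarrow> ('v \<Rightarrow> ('c, 'v) tensor) \<Rightarrow>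
   ('k, 'w) module \<Rightarrow> ('w \<Rightarrow> ('c, 'w) tensor) \<Rightarrow> ('v \<Rightarrow> 'w) set" where
  "left_comodule_hom K C V \<rho> W \<sigma> =
     {f \<in> module_hom K V W. \<forall>v\<in>carrier V. \<sigma> (f v) = tensor_map K C W id f (\<rho> v)}"

definition cotensor ::
  "'k ring \<Rightarrow> ('k, 'c) coalgebra \<Rightarrow> ('k, 'v) module \<Rightarrow> ('v \<Rightarrow> ('v, 'c) tensor) \<Rightarrow>
   ('k, 'w) module \<Rightarrow> ('w \<Rightarrow> ('c, 'w) tensor) \<Rightarrow> ('k, ('v, 'w) tensor) module" where
  "cotensor K C V \<rho> W \<sigma> = (tensor_space K V W)\<lparr>carrier :=
     {t \<in> carrier (tensor_space K V W).
        tensor_map K V (tensor_space K C W) id \<sigma> t =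
        assoc_right K V C W (tensor_map K (tensor_space K V C) W \<rho> id t)}\<rparr>"

definition coflat_right ::
  "'l itself \<Rightarrow> 'm itself \<Rightarrow> 'n itself \<Rightarrow> 'k ring \<Rightarrow> ('k, 'c) coalgebra \<Rightarrow>
   ('k, 'v) module \<Rightarrow> ('v \<Rightarrow> ('v, 'c) tensor) \<Rightarrow> bool" where
  "coflat_right _ _ _ K C V \<rho> \<longleftrightarrow> right_comodule K C V \<rho> \<and>
    (\<forall>(L :: ('k, 'l) module) \<sigma>\<^sub>L (M :: ('k, 'm) module) \<sigma>\<^sub>M (N :: ('k, 'n) module) \<sigma>\<^sub>N f g.
       left_comodule K C L \<sigma>\<^sub>L \<and> left_comodule K C M \<sigma>\<^sub>M \<and> left_comodule K C N \<sigma>\<^sub>N \<and>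
       f \<in> left_comodule_hom K C L \<sigma>\<^sub>L M \<sigma>\<^sub>M \<and> g \<in> left_comodule_hom K C M \<sigma>\<^sub>M N \<sigma>\<^sub>N \<and>
       exact_at L M N f g \<longrightarrow>
       exact_at (cotensor K C V \<rho> L \<sigma>\<^sub>L) (cotensor K C V \<rho> M \<sigma>\<^sub>M) (cotensor K C V \<rho> N \<sigma>\<^sub>N)
         (tensor_map K V M id f) (tensor_map K V N id g))"

definition coflat_left ::
  "'l itself \<Rightarrow> 'm itself \<Rightarrow> 'n itself \<Rightarrow> 'k ring \<Rightarrow> ('k, 'c) coalgebra \<Rightarrow>
   ('k, 'w) module \<Rightarrow> ('w \<Rightarrow> ('c, 'w) tensor) \<Rightarrow> bool" where
  "coflat_left _ _ _ K C W \<sigma> \<longleftrightarrow> left_comodule K C W \<sigma> \<and>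
    (\<forall>(L :: ('k, 'l) module) \<rho>\<^sub>L (M :: ('k, 'm) module) \<rho>\<^sub>M (N :: ('k, 'n) module) \<rho>\<^sub>N f g.
       right_comodule K C L \<rho>\<^sub>L \<and> right_comodule K C M \<rho>\<^sub>M \<and> right_comodule K C N \<rho>\<^sub>N \<and>
       f \<in> right_comodule_hom K C L \<rho>\<^sub>L M \<rho>\<^sub>M \<and> g \<in> right_comodule_hom K C M \<rho>\<^sub>M N \<rho>\<^sub>N \<and>
       exact_at L M N f g \<longrightarrow>
       exact_at (cotensor K C L \<rho>\<^sub>L W \<sigma>) (cotensor K C M \<rho>\<^sub>M W \<sigma>) (cotensor K C N \<rho>\<^sub>N W \<sigma>)
         (tensor_map K M W f id) (tensor_map K N W g id))"


section \<open>Principal extensions\<close>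

text \<open>The vector space underlying a left module over the algebra \<open>A\<close>: \<open>a m = (a 1) m\<close>.\<close>

definition scalars :: "('k, 'a) module \<Rightarrow> ('a, 'm) module \<Rightarrow> ('k, 'm) module" where
  "scalars A M = with_smult M (\<lambda>a m. (a \<odot>\<^bsub>A\<^esub> \<one>\<^bsub>A\<^esub>) \<odot>\<^bsub>M\<^esub> m)"

text \<open>Left \<open>A\<close>-modules that are right \<open>C\<close>-comodules with \<open>A\<close>-linear coaction.\<close>

definition module_comodule ::
  "'k ring \<Rightarrow> ('k, 'c) coalgebra \<Rightarrow> ('k, 'a) module \<Rightarrow> ('a, 'm) module \<Rightarrow>
   ('m \<Rightarrow> ('m, 'c) tensor) \<Rightarrow> bool" where
  "module_comodule K C A M \<rho> \<longleftrightarrow> left_module A M \<and> right_comodule K C (scalars A M) \<rho> \<and>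
    (\<forall>b\<in>carrier A. \<forall>m\<in>carrier M.
       \<rho> (b \<odot>\<^bsub>M\<^esub> m) = tensor_map K (scalars A M) C (\<lambda>x. b \<odot>\<^bsub>M\<^esub> x) id (\<rho> m))"

definition module_comodule_hom ::
  "'k ring \<Rightarrow> ('k, 'c) coalgebra \<Rightarrow> ('k, 'a) module \<Rightarrow> ('a, 'm) module \<Rightarrow>
   ('m \<Rightarrow> ('m, 'c) tensor) \<Rightarrow> ('a, 'n) module \<Rightarrow> ('n \<Rightarrow> ('n, 'c) tensor) \<Rightarrow> ('m \<Rightarrow> 'n) set" where
  "module_comodule_hom K C A M \<rho> N \<sigma> =
     module_hom A M N \<inter> right_comodule_hom K C (scalars A M) \<rho> (scalars A N) \<sigma>"

definition equivariantly_projective ::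
  "'m itself \<Rightarrow> 'n itself \<Rightarrow> 'k ring \<Rightarrow> ('k, 'c) coalgebra \<Rightarrow> ('k, 'a) module \<Rightarrow>
   ('a, 'q) module \<Rightarrow> ('q \<Rightarrow> ('q, 'c) tensor) \<Rightarrow> bool" where
  "equivariantly_projective _ _ K C A Q \<Delta> \<longleftrightarrow>
    (\<forall>(M :: ('a, 'm) module) \<rho> (N :: ('a, 'n) module) \<sigma> \<pi> f.
       module_comodule K C A M \<rho> \<and> module_comodule K C A N \<sigma> \<and>
       \<pi> \<in> module_comodule_hom K C A M \<rho> N \<sigma> \<and> \<pi> ` carrier M = carrier N \<and>
       (\<exists>j\<in>right_comodule_hom K C (scalars A N) \<sigma> (scalars A M) \<rho>.
          \<forall>n\<in>carrier N. \<pi> (j n) = n) \<and>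
       f \<in> module_comodule_hom K C A Q \<Delta> N \<sigma> \<longrightarrow>
       (\<exists>g\<in>module_comodule_hom K C A Q \<Delta> M \<rho>. \<forall>q\<in>carrier Q. \<pi> (g q) = f q))"

definition coinvariants ::
  "'k ring \<Rightarrow> ('k, 'c) coalgebra \<Rightarrow> ('k, 'p) module \<Rightarrow> ('p \<Rightarrow> ('p, 'c) tensor) \<Rightarrow> 'p set" where
  "coinvariants K C P \<Delta> = {b \<in> carrier P. \<forall>p\<in>carrier P.
     \<Delta> (b \<otimes>\<^bsub>P\<^esub> p) = tensor_map K P C (\<lambda>x. b \<otimes>\<^bsub>P\<^esub> x) id (\<Delta> p)}"

definition base ::
  "'k ring \<Rightarrow> ('k, 'c) coalgebra \<Rightarrow> ('k, 'p) module \<Rightarrow> ('p \<Rightarrow> ('p, 'c) tensor) \<Rightarrow> ('k, 'p) module" where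
  "base K C P \<Delta> = P\<lparr>carrier := coinvariants K C P \<Delta>\<rparr>"

definition tensor_over_base ::
  "'k ring \<Rightarrow> ('k, 'c) coalgebra \<Rightarrow> ('k, 'p) module \<Rightarrow> ('p \<Rightarrow> ('p, 'c) tensor) \<Rightarrow> ('p, 'p) tensor ring" where
  "tensor_over_base K C P \<Delta> = tensor_group (base K C P \<Delta>) (right_reg P) (left_reg P)"

definition can ::
  "'k ring \<Rightarrow> ('k, 'c) coalgebra \<Rightarrow> ('k, 'p) module \<Rightarrow> ('p \<Rightarrow> ('p, 'c) tensor) \<Rightarrow>
   ('p, 'p) tensor \<Rightarrow> ('p, 'c) tensor" where
  "can K C P \<Delta> = tensor_lift (tensor_space K P C)
     (\<lambda>p p'. tensor_map K P C (\<lambda>x. p \<otimes>\<^bsub>P\<^esub> x) id (\<Delta> p'))"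

definition can_inv ::
  "'k ring \<Rightarrow> ('k, 'c) coalgebra \<Rightarrow> ('k, 'p) module \<Rightarrow> ('p \<Rightarrow> ('p, 'c) tensor) \<Rightarrow>
   ('p, 'c) tensor \<Rightarrow> ('p, 'p) tensor" where
  "can_inv K C P \<Delta> = inv_into (carrier (tensor_over_base K C P \<Delta>)) (can K C P \<Delta>)"

definition entwining ::
  "'k ring \<Rightarrow> ('k, 'c) coalgebra \<Rightarrow> ('k, 'p) module \<Rightarrow> ('p \<Rightarrow> ('p, 'c) tensor) \<Rightarrow>
   ('c, 'p) tensor \<Rightarrow> ('p, 'c) tensor" where
  "entwining K C P \<Delta> = tensor_lift (tensor_space K P C) (\<lambda>c p. can K C P \<Delta>
     (tensor_map (base K C P \<Delta>) (right_reg P) (left_reg P) id (\<lambda>y. y \<otimes>\<^bsub>P\<^esub> p)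
       (can_inv K C P \<Delta> (pure_tensor K P C \<one>\<^bsub>P\<^esub> c))))"

definition left_coaction ::
  "'k ring \<Rightarrow> ('k, 'c) coalgebra \<Rightarrow> ('k, 'p) module \<Rightarrow> ('p \<Rightarrow> ('p, 'c) tensor) \<Rightarrow> 'c \<Rightarrow>
   'p \<Rightarrow> ('c, 'p) tensor" where
  "left_coaction K C P \<Delta> e p =
     inv_into (carrier (tensor_space K C P)) (entwining K C P \<Delta>) (pure_tensor K P C p e)"

definition extension ::
  "'k ring \<Rightarrow> ('k, 'c) coalgebra \<Rightarrow> ('k, 'p) module \<Rightarrow> ('p \<Rightarrow> ('p, 'c) tensor) \<Rightarrow> bool" where
  "extension K C P \<Delta> \<longleftrightarrow> assoc_algebra K P \<and> right_comodule K C P \<Delta>"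

text \<open>
  The group-like element \<open>e\<close> is a parameter because the left coaction refers to it.

  Equivariant projectivity is tested on modules \<open>M\<close> carried by subsets of the type of elements
  of \<open>P \<otimes> P\<close> and modules \<open>N\<close> carried by subsets of the type of \<open>P\<close>.  Writing \<open>B\<close> for the base,
  these include \<open>M = B \<otimes> P\<close> and \<open>N = P\<close>, and this restriction is equivalent to the condition for
  all modules: the multiplication \<open>B \<otimes> P \<rightarrow> P\<close> is split as a comodule map by \<open>p \<mapsto> 1 \<otimes> p\<close>, so the
  identity of \<open>P\<close> lifts to a section \<open>s\<close>; given arbitrary \<open>\<pi>\<close> with comodule splitting \<open>j\<close> and
  arbitrary \<open>f\<close>, the composite of \<open>s\<close> with \<open>b \<otimes> p \<mapsto> b j (f p)\<close> is the required \<open>g\<close>.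
\<close>

definition principal_extension ::
  "'k ring \<Rightarrow> ('k, 'c) coalgebra \<Rightarrow> ('k, 'p) module \<Rightarrow> ('p \<Rightarrow> ('p, 'c) tensor) \<Rightarrow> 'c \<Rightarrow> bool" where
  "principal_extension K C P \<Delta> e \<longleftrightarrow> extension K C P \<Delta> \<and>
    bij_betw (can K C P \<Delta>) (carrier (tensor_over_base K C P \<Delta>)) (carrier (tensor_space K P C)) \<and>
    bij_betw (entwining K C P \<Delta>) (carrier (tensor_space K C P)) (carrier (tensor_space K P C)) \<and>
    group_like K C e \<and>
    (\<forall>p\<in>carrier P. \<Delta> p = entwining K C P \<Delta> (pure_tensor K C P e p)) \<and>
    equivariantly_projective TYPE(('p, 'p) tensor) TYPE('p) K C (base K C P \<Delta>) (left_reg P) \<Delta>"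

definition base_tensor ::
  "'k ring \<Rightarrow> ('k, 'c) coalgebra \<Rightarrow> ('k, 'p) module \<Rightarrow> ('p \<Rightarrow> ('p, 'c) tensor) \<Rightarrow>
   ('k, ('p, 'p) tensor) module" where
  "base_tensor K C P \<Delta> = tensor_space K (base K C P \<Delta>) P"

definition base_tensor_left ::
  "'k ring \<Rightarrow> ('k, 'c) coalgebra \<Rightarrow> ('k, 'p) module \<Rightarrow> ('p \<Rightarrow> ('p, 'c) tensor) \<Rightarrow>
   ('p, ('p, 'p) tensor) module" where
  "base_tensor_left K C P \<Delta> = with_smult (base_tensor K C P \<Delta>)
     (\<lambda>b. tensor_map K (base K C P \<Delta>) P (\<lambda>x. b \<otimes>\<^bsub>P\<^esub> x) id)"

definition base_tensor_coaction ::
  "'k ring \<Rightarrow> ('k, 'c) coalgebra \<Rightarrow> ('k, 'p) module \<Rightarrow> ('p \<Rightarrow> ('p, 'c) tensor) \<Rightarrow>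
   ('p, 'p) tensor \<Rightarrow> (('p, 'p) tensor, 'c) tensor" where
  "base_tensor_coaction K C P \<Delta> t = assoc_left K (base K C P \<Delta>) P C
     (tensor_map K (base K C P \<Delta>) (tensor_space K P C) id \<Delta> t)"

definition strong_connection ::
  "'k ring \<Rightarrow> ('k, 'c) coalgebra \<Rightarrow> ('k, 'p) module \<Rightarrow> ('p \<Rightarrow> ('p, 'c) tensor) \<Rightarrow>
   ('p \<Rightarrow> ('p, 'p) tensor) \<Rightarrow> bool" where
  "strong_connection K C P \<Delta> s \<longleftrightarrow>
    s \<in> module_hom (base K C P \<Delta>) (left_reg P) (base_tensor_left K C P \<Delta>) \<and>
    s \<in> right_comodule_hom K C P \<Delta> (base_tensor K C P \<Delta>) (base_tensor_coaction K C P \<Delta>) \<and>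
    (\<forall>p\<in>carrier P. tensor_lift P (\<lambda>b p'. b \<otimes>\<^bsub>P\<^esub> p') (s p) = p) \<and>
    s \<one>\<^bsub>P\<^esub> = pure_tensor K (base K C P \<Delta>) P \<one>\<^bsub>P\<^esub> \<one>\<^bsub>P\<^esub>"

end

theory Submission
  imports Defs
begin

text \<open>
  Equivariant projectivity enters once: the multiplication \<open>B \<otimes> P \<rightarrow> P\<close> is split as a comodule map by
  \<open>p \<mapsto> 1 \<otimes> p\<close>, so the identity of \<open>P\<close> lifts to a left \<open>B\<close>-linear right \<open>C\<close>-colinear section
  \<open>s(p) = s'(p) \<otimes> s''(p)\<close> (\<open>colinear_splitting_exists\<close>).  All five assertions follow from explicit
  formulas in \<open>s\<close>.  Coactions are written \<open>\<Delta>(p) = p\<^sub>0 \<otimes> p\<^sub>1\<close> on the right and \<open>p\<^sub>- \<otimes> p\<^sub>0\<close> on the left.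

  Over a field, a module \<open>Q\<close> with an \<open>R\<close>-linear section of \<open>R \<otimes> Q \<rightarrow> Q\<close> is projective, because a map
  out of \<open>Q\<close> is lifted linearly first and then averaged along the section; and \<open>L \<otimes>\<^sub>R Q\<close> is a natural
  retract of \<open>L \<otimes> Q\<close>, so that \<open>Q\<close> is flat.  If moreover \<open>R\<close> is a retract of \<open>Q\<close>, every \<open>L\<close> is a
  natural retract of \<open>L \<otimes>\<^sub>R Q\<close>, so that \<open>Q\<close> is faithfully flat.  Dually, a comodule whose coaction has a
  colinear left inverse is coflat.  It remains to produce such data on both sides.

  Since \<open>(x, y) \<mapsto> x s(y)\<close> is balanced over \<open>B\<close>, composing it with the inverse of the canonical map gives a
  linear map \<open>\<kappa>: P \<otimes> C \<rightarrow> P \<otimes> P\<close>, hence \<open>c \<mapsto> \<kappa>(1 \<otimes> c) = c' \<otimes> c''\<close> with \<open>c' c'' = \<epsilon>(c)\<close>, a lift of the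
  translation map to \<open>P \<otimes> P\<close>.  It is colinear on both sides (\<open>translation_right_colinear\<close>,
  \<open>translation_left_colinear\<close>).  The section on the right is \<open>p \<mapsto> p\<^sub>-' \<otimes> p\<^sub>-'' p\<^sub>0\<close>; colinearity puts its
  values into \<open>P \<otimes> B\<close>, and likewise \<open>s(1)\<close> into \<open>B \<otimes> B\<close>.

  Membership in such subspaces is expressed through a linear projection \<open>r\<close> of \<open>P\<close> onto \<open>B\<close>.  As
  \<open>b \<in> B\<close> is equivalent to \<open>\<Delta>(b) = b \<otimes> e\<close>, it can be chosen with \<open>p - r(p) = u(\<Delta>(p)) - u(p \<otimes> e)\<close> for a
  linear \<open>u\<close>; therefore \<open>r\<close> may be inserted into any expression that does not distinguish \<open>\<Delta>(p)\<close> from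
  \<open>p \<otimes> e\<close> (\<open>lift_projection\<close>).  With \<open>r\<close> one obtains retractions of \<open>P\<close> onto \<open>B\<close>, namely
  \<open>q \<mapsto> s'(q) r(s''(q))\<close> and its analogue on the right, and colinear left inverses of the two
  coactions: \<open>p \<otimes> c \<mapsto> r(x) y\<close>, where \<open>x \<otimes> y\<close> stands for \<open>\<kappa>(p \<otimes> c)\<close>, and \<open>c \<otimes> p \<mapsto> c' r(c'' p)\<close>.

  The first of these, at \<open>p = 1\<close>, is a colinear map \<open>j: C \<rightarrow> P\<close> with \<open>j(e) = 1\<close>.  It makes
  \<open>\<theta>(q) = r(q\<^sub>0) \<otimes> j(q\<^sub>1) + 1 \<otimes> (q - r(q\<^sub>0) j(q\<^sub>1))\<close> a colinear section of the multiplication with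
  \<open>\<theta>(b) = b \<otimes> 1\<close> for \<open>b \<in> B\<close>.  Then \<open>p \<mapsto> s'(p) \<theta>(s''(p))\<close> is again \<open>B\<close>-linear, and since \<open>s(1) \<in> B \<otimes> B\<close> it
  takes the value \<open>1 \<otimes> 1\<close> at \<open>1\<close>: it is a strong connection.
\<close>

section \<open>The universal property of the tensor product\<close>

text \<open>
  The common part of left modules, right modules and vector spaces: an abelian group closed under
  scalars, so that one construction of the tensor product serves them all.
\<close>

definition smult_group :: "('r, 'x) ring_scheme \<Rightarrow> ('r, 'm, 'y) module_scheme \<Rightarrow> bool" where
  "smult_group R M \<longleftrightarrow> abelian_group M \<and> (\<forall>r\<in>carrier R. \<forall>m\<in>carrier M. r \<odot>\<^bsub>M\<^esub> m \<in> carrier M)"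

definition add_hom :: "('a, 'x) ring_scheme \<Rightarrow> ('b, 'y) ring_scheme \<Rightarrow> ('a \<Rightarrow> 'b) set" where
  "add_hom A B = hom (add_monoid A) (add_monoid B)"

definition balanced ::
  "('r, 'x) ring_scheme \<Rightarrow> ('r, 'm, 'y) module_scheme \<Rightarrow> ('r, 'n, 'z) module_scheme \<Rightarrow>
   ('a, 'w) ring_scheme \<Rightarrow> ('m \<Rightarrow> 'n \<Rightarrow> 'a) \<Rightarrow> bool" where
  "balanced R M N A f \<longleftrightarrow>
     (\<forall>m\<in>carrier M. f m \<in> add_hom N A) \<and>
     (\<forall>n\<in>carrier N. (\<lambda>m. f m n) \<in> add_hom M A) \<and>
     (\<forall>r\<in>carrier R. \<forall>m\<in>carrier M. \<forall>n\<in>carrier N. f (r \<odot>\<^bsub>M\<^esub> m) n = f m (r \<odot>\<^bsub>N\<^esub> n))"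

lemma add_homI:
  assumes "\<And>x. x \<in> carrier A \<Longrightarrow> f x \<in> carrier B"
    and "\<And>x y. \<lbrakk>x \<in> carrier A; y \<in> carrier A\<rbrakk> \<Longrightarrow> f (x \<oplus>\<^bsub>A\<^esub> y) = f x \<oplus>\<^bsub>B\<^esub> f y"
  shows "f \<in> add_hom A B"
  using assms by (auto simp: add_hom_def intro: homI)

lemma add_hom_closed: "\<lbrakk>f \<in> add_hom A B; x \<in> carrier A\<rbrakk> \<Longrightarrow> f x \<in> carrier B"
  by (auto simp: add_hom_def hom_def)

lemma add_hom_add:
  "\<lbrakk>f \<in> add_hom A B; x \<in> carrier A; y \<in> carrier A\<rbrakk> \<Longrightarrow> f (x \<oplus>\<^bsub>A\<^esub> y) = f x \<oplus>\<^bsub>B\<^esub> f y"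
  by (auto simp: add_hom_def hom_def)

lemma balanced_smult:
  "\<lbrakk>balanced R M N A f; r \<in> carrier R; m \<in> carrier M; n \<in> carrier N\<rbrakk> \<Longrightarrow> f (r \<odot>\<^bsub>M\<^esub> m) n = f m (r \<odot>\<^bsub>N\<^esub> n)"
  by (simp add: balanced_def)

lemma balanced_closed:
  "\<lbrakk>balanced R M N A f; m \<in> carrier M; n \<in> carrier N\<rbrakk> \<Longrightarrow> f m n \<in> carrier A"
  by (auto simp: balanced_def intro: add_hom_closed)

lemma balancedI:
  assumes "\<And>m n. \<lbrakk>m \<in> carrier M; n \<in> carrier N\<rbrakk> \<Longrightarrow> f m n \<in> carrier A"
    and "\<And>m m' n. \<lbrakk>m \<in> carrier M; m' \<in> carrier M; n \<in> carrier N\<rbrakk> \<Longrightarrow>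
      f (m \<oplus>\<^bsub>M\<^esub> m') n = f m n \<oplus>\<^bsub>A\<^esub> f m' n"
    and "\<And>m n n'. \<lbrakk>m \<in> carrier M; n \<in> carrier N; n' \<in> carrier N\<rbrakk> \<Longrightarrow>
      f m (n \<oplus>\<^bsub>N\<^esub> n') = f m n \<oplus>\<^bsub>A\<^esub> f m n'"
    and "\<And>r m n. \<lbrakk>r \<in> carrier R; m \<in> carrier M; n \<in> carrier N\<rbrakk> \<Longrightarrow>
      f (r \<odot>\<^bsub>M\<^esub> m) n = f m (r \<odot>\<^bsub>N\<^esub> n)"
  shows "balanced R M N A f"
  using assms by (simp add: balanced_def add_homI)

lemma balanced_add:
  assumes "balanced R M N A f"
  shows "\<lbrakk>m \<in> carrier M; m' \<in> carrier M; n \<in> carrier N\<rbrakk> \<Longrightarrow> f (m \<oplus>\<^bsub>M\<^esub> m') n = f m n \<oplus>\<^bsub>A\<^esub> f m' n"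
    and "\<lbrakk>m \<in> carrier M; n \<in> carrier N; n' \<in> carrier N\<rbrakk> \<Longrightarrow> f m (n \<oplus>\<^bsub>N\<^esub> n') = f m n \<oplus>\<^bsub>A\<^esub> f m n'"
  using assms add_hom_add[of "\<lambda>m. f m n" M A m m'] add_hom_add[of "f m" N A n n']
  by (auto simp: balanced_def)

lemma add_hom_group_hom:
  "\<lbrakk>abelian_group A; abelian_group B; f \<in> add_hom A B\<rbrakk> \<Longrightarrow> group_hom (add_monoid A) (add_monoid B) f"
  by (simp add: add_hom_def abelian_group.a_group group_hom_axioms_def group_hom_def)

lemma add_hom_zero:
  "\<lbrakk>abelian_group A; abelian_group B; f \<in> add_hom A B\<rbrakk> \<Longrightarrow> f \<zero>\<^bsub>A\<^esub> = \<zero>\<^bsub>B\<^esub>"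
  using group_hom.hom_one[OF add_hom_group_hom] by fastforce

lemma add_hom_minus:
  assumes "abelian_group A" "abelian_group B" "f \<in> add_hom A B" "x \<in> carrier A"
  shows "f (\<ominus>\<^bsub>A\<^esub> x) = \<ominus>\<^bsub>B\<^esub> f x"
  using group_hom.hom_inv[OF add_hom_group_hom[OF assms(1-3)]] assms(4) by (simp add: a_inv_def)

locale tensor_factors =
  fixes R :: "('r, 'x) ring_scheme" and M :: "('r, 'm, 'y) module_scheme"
    and N :: "('r, 'n, 'z) module_scheme"
  assumes smult_group_left: "smult_group R M" and smult_group_right: "smult_group R N"
begin

lemma abelian_factors: "abelian_group M" "abelian_group N"
  using smult_group_left smult_group_right by (auto simp: smult_group_def)

lemma closed_factors:
  "r \<in> carrier R \<Longrightarrow> m \<in> carrier M \<Longrightarrow> r \<odot>\<^bsub>M\<^esub> m \<in> carrier M"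
  "r \<in> carrier R \<Longrightarrow> n \<in> carrier N \<Longrightarrow> r \<odot>\<^bsub>N\<^esub> n \<in> carrier N"
  "m \<in> carrier M \<Longrightarrow> m' \<in> carrier M \<Longrightarrow> m \<oplus>\<^bsub>M\<^esub> m' \<in> carrier M"
  "n \<in> carrier N \<Longrightarrow> n' \<in> carrier N \<Longrightarrow> n \<oplus>\<^bsub>N\<^esub> n' \<in> carrier N"
  using smult_group_left smult_group_right
  by (auto simp: smult_group_def abelian_group_def abelian_monoid.a_closed)

lemma comm_group_tensor_free: "comm_group (tensor_free M N)"
  by (simp add: tensor_free_def abelian_free_Abelian_group)

lemma carrier_tensor_free: "carrier (tensor_free M N) = {z. Poly_Mapping.keys z \<subseteq> carrier M \<times> carrier N}"
  by (simp add: tensor_free_def free_Abelian_group_def)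

lemma ops_tensor_free: "x \<otimes>\<^bsub>tensor_free M N\<^esub> y = x + y" "\<one>\<^bsub>tensor_free M N\<^esub> = 0"
  by (simp_all add: tensor_free_def)

lemma frag_of_tensor_free: "m \<in> carrier M \<Longrightarrow> n \<in> carrier N \<Longrightarrow> frag_of (m, n) \<in> carrier (tensor_free M N)"
  by (simp add: tensor_free_def)

lemma tensor_free_diff:
  "x \<in> carrier (tensor_free M N) \<Longrightarrow> y \<in> carrier (tensor_free M N) \<Longrightarrow> x - y \<in> carrier (tensor_free M N)"
  by (simp add: carrier_tensor_free) (meson Un_least keys_diff order.trans)

lemma tensor_relators_closed: "tensor_relators R M N \<subseteq> carrier (tensor_free M N)"
  unfolding tensor_relators_def
  by (auto intro!: tensor_free_diff frag_of_tensor_free closed_factors simp del: carrier_free_Abelian_group_iff)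

lemma subgroup_tensor_null: "subgroup (tensor_null R M N) (tensor_free M N)"
  unfolding tensor_null_def
  using comm_group_tensor_free tensor_relators_closed
  by (intro group.generate_is_subgroup) (auto simp: comm_group_def)

lemma normal_tensor_null: "tensor_null R M N \<lhd> tensor_free M N"
  using comm_group.subgroup_imp_normal[OF comm_group_tensor_free subgroup_tensor_null] .

abbreviation coset where "coset z \<equiv> tensor_null R M N #>\<^bsub>tensor_free M N\<^esub> z"

lemma carrier_tensor_group: "carrier (tensor_group R M N) = coset ` carrier (tensor_free M N)"
  by (simp add: tensor_group_def Let_def carrier_FactGroup)

lemma zero_tensor_group: "\<zero>\<^bsub>tensor_group R M N\<^esub> = coset 0"
proof -
  interpret T: comm_group "tensor_free M N" by (rule comm_group_tensor_free)
  have "coset \<one>\<^bsub>tensor_free M N\<^esub> = tensor_null R M N"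
    using subgroup.subset[OF subgroup_tensor_null] by (rule T.coset_mult_one)
  then show ?thesis by (simp add: tensor_group_def Let_def ops_tensor_free)
qed

lemma add_tensor_group:
  assumes "x \<in> carrier (tensor_free M N)" "y \<in> carrier (tensor_free M N)"
  shows "coset x \<oplus>\<^bsub>tensor_group R M N\<^esub> coset y = coset (x + y)"
  using normal.rcos_sum[OF normal_tensor_null assms]
  by (simp add: tensor_group_def Let_def ops_tensor_free)

lemma abelian_tensor_group: "abelian_group (tensor_group R M N)"
proof (rule comm_group_abelian_groupI)
  have "comm_group (tensor_free M N Mod tensor_null R M N)"
    using comm_group.abelian_FactGroup[OF comm_group_tensor_free subgroup_tensor_null] .
  moreover have "add_monoid (tensor_group R M N) = tensor_free M N Mod tensor_null R M N"
    by (simp add: tensor_group_def Let_def)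
  ultimately show "comm_group (add_monoid (tensor_group R M N))" by simp
qed

lemma coset_eqI:
  assumes "x \<in> carrier (tensor_free M N)" "y \<in> carrier (tensor_free M N)" "x - y \<in> tensor_null R M N"
  shows "coset x = coset y"
proof -
  interpret T: comm_group "tensor_free M N" by (rule comm_group_tensor_free)
  have "x \<in> coset y"
    unfolding r_coset_def using assms(3) by (auto simp: ops_tensor_free intro!: bexI[of _ "x - y"])
  then show ?thesis using T.repr_independence[OF _ assms(2) subgroup_tensor_null] by simp
qed

lemma relator_null: "x \<in> tensor_relators R M N \<Longrightarrow> x \<in> tensor_null R M N"
  unfolding tensor_null_def by (rule generate.incl)

lemma pure_closed: "m \<in> carrier M \<Longrightarrow> n \<in> carrier N \<Longrightarrow> pure_tensor R M N m n \<in> carrier (tensor_group R M N)"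
  unfolding pure_tensor_def carrier_tensor_group by (rule imageI) (rule frag_of_tensor_free)

lemma balanced_pure: "balanced R M N (tensor_group R M N) (pure_tensor R M N)"
proof -
  have add: "frag_of (x :: 'm \<times> 'n) - frag_of y - frag_of z \<in> tensor_null R M N \<Longrightarrow>
      x \<in> carrier M \<times> carrier N \<Longrightarrow> y \<in> carrier M \<times> carrier N \<Longrightarrow> z \<in> carrier M \<times> carrier N \<Longrightarrow>
      coset (frag_of x) = coset (frag_of y) \<oplus>\<^bsub>tensor_group R M N\<^esub> coset (frag_of z)" for x y z
  proof -
    assume null: "frag_of x - frag_of y - frag_of z \<in> tensor_null R M N"
      and "x \<in> carrier M \<times> carrier N" "y \<in> carrier M \<times> carrier N" "z \<in> carrier M \<times> carrier N"
    then have free: "frag_of x \<in> carrier (tensor_free M N)" "frag_of y \<in> carrier (tensor_free M N)"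
        "frag_of z \<in> carrier (tensor_free M N)"
      using frag_of_tensor_free by (cases x; cases y; cases z; auto)+
    then have "frag_of y + frag_of z \<in> carrier (tensor_free M N)"
      using comm_groupE(1)[OF comm_group_tensor_free, of "frag_of y" "frag_of z"] by (simp add: ops_tensor_free)
    then show "coset (frag_of x) = coset (frag_of y) \<oplus>\<^bsub>tensor_group R M N\<^esub> coset (frag_of z)"
      using coset_eqI[OF free(1)] null free(2,3) by (simp add: add_tensor_group diff_diff_eq)
  qed
  show ?thesis
    unfolding balanced_def
  proof (intro conjI ballI add_homI)
    fix m n n' assume "m \<in> carrier M" "n \<in> carrier N" "n' \<in> carrier N"
    then show "pure_tensor R M N m (n \<oplus>\<^bsub>N\<^esub> n') =
        pure_tensor R M N m n \<oplus>\<^bsub>tensor_group R M N\<^esub> pure_tensor R M N m n'"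
      unfolding pure_tensor_def
      by (intro add relator_null) (auto simp: tensor_relators_def intro: closed_factors)
  next
    fix m m' n assume "n \<in> carrier N" "m \<in> carrier M" "m' \<in> carrier M"
    then show "pure_tensor R M N (m \<oplus>\<^bsub>M\<^esub> m') n =
        pure_tensor R M N m n \<oplus>\<^bsub>tensor_group R M N\<^esub> pure_tensor R M N m' n"
      unfolding pure_tensor_def
      by (intro add relator_null) (auto simp: tensor_relators_def intro: closed_factors)
  next
    fix r m n assume "r \<in> carrier R" "m \<in> carrier M" "n \<in> carrier N"
    then show "pure_tensor R M N (r \<odot>\<^bsub>M\<^esub> m) n = pure_tensor R M N m (r \<odot>\<^bsub>N\<^esub> n)"
      unfolding pure_tensor_def
      by (intro coset_eqI relator_null frag_of_tensor_free)
        (auto simp: tensor_relators_def intro: closed_factors)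
  qed (simp_all add: pure_closed)
qed

text \<open>The pure tensors generate the group: the free abelian group is generated by its basis.\<close>

lemma tensor_induct [consumes 1, case_names zero pure diff]:
  assumes "t \<in> carrier (tensor_group R M N)"
    and zero: "Q \<zero>\<^bsub>tensor_group R M N\<^esub>"
    and pure: "\<And>m n. \<lbrakk>m \<in> carrier M; n \<in> carrier N\<rbrakk> \<Longrightarrow> Q (pure_tensor R M N m n)"
    and diff: "\<And>x y. \<lbrakk>x \<in> carrier (tensor_group R M N); y \<in> carrier (tensor_group R M N); Q x; Q y\<rbrakk>
      \<Longrightarrow> Q (x \<ominus>\<^bsub>tensor_group R M N\<^esub> y)"
  shows "Q t"
proof -
  interpret T: comm_group "tensor_free M N" by (rule comm_group_tensor_free)
  interpret A: abelian_group "tensor_group R M N" by (rule abelian_tensor_group)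
  obtain z where z: "Poly_Mapping.keys z \<subseteq> carrier M \<times> carrier N" "t = coset z"
    using assms(1) by (auto simp: carrier_tensor_group carrier_tensor_free)
  have "Q (coset z)"
  proof (rule free_Abelian_group_induct[OF z(1), of "\<lambda>z. Q (coset z)"])
    show "Q (coset 0)" using zero by (simp add: zero_tensor_group)
  next
    fix x y
    assume xy: "Poly_Mapping.keys x \<subseteq> carrier M \<times> carrier N" "Poly_Mapping.keys y \<subseteq> carrier M \<times> carrier N"
      and Q: "Q (coset x)" "Q (coset y)"
    then have free: "x \<in> carrier (tensor_free M N)" "y \<in> carrier (tensor_free M N)"
      by (auto simp: carrier_tensor_free)
    then have "coset x = coset (x - y) \<oplus>\<^bsub>tensor_group R M N\<^esub> coset y"
      using tensor_free_diff by (simp add: add_tensor_group)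
    moreover have "coset (x - y) \<in> carrier (tensor_group R M N)" "coset y \<in> carrier (tensor_group R M N)"
        "coset x \<in> carrier (tensor_group R M N)"
      using free tensor_free_diff by (auto simp: carrier_tensor_group)
    ultimately have "coset (x - y) = coset x \<ominus>\<^bsub>tensor_group R M N\<^esub> coset y"
      by (metis A.minus_eq A.add.inv_solve_right)
    with Q diff free show "Q (coset (x - y))" by (auto simp: carrier_tensor_group)
  next
    fix a assume "a \<in> carrier M \<times> carrier N"
    then show "Q (coset (frag_of a))" using pure by (cases a) (auto simp: pure_tensor_def)
  qed
  with z(2) show ?thesis by simp
qed

lemma tensor_hom_ext:
  assumes "abelian_group A" "F \<in> add_hom (tensor_group R M N) A" "G \<in> add_hom (tensor_group R M N) A"
    and "\<And>m n. \<lbrakk>m \<in> carrier M; n \<in> carrier N\<rbrakk> \<Longrightarrow> F (pure_tensor R M N m n) = G (pure_tensor R M N m n)"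
    and "t \<in> carrier (tensor_group R M N)"
  shows "F t = G t"
  using assms(5)
proof (induction rule: tensor_induct)
  case zero
  then show ?case using assms(1-3) abelian_tensor_group by (simp add: add_hom_zero)
next
  case (pure m n) then show ?case by (rule assms(4))
next
  case (diff x y)
  then show ?case
    using assms(1-3) abelian_tensor_group
    by (simp add: a_minus_def add_hom_add add_hom_minus abelian_group.a_inv_closed)
qed

text \<open>
  The sum in \<open>tensor_lift\<close> is the homomorphism of the free group that extends \<open>f\<close>; being balanced,
  \<open>f\<close> kills the relators, so that the value does not depend on the representative.
\<close>

lemma tensor_lift_coset:
  assumes "abelian_group A" "balanced R M N A f"
  obtains h where "h \<in> hom (tensor_free M N) (add_monoid A)"
    "\<And>m n. \<lbrakk>m \<in> carrier M; n \<in> carrier N\<rbrakk> \<Longrightarrow> h (frag_of (m, n)) = f m n"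
    "\<And>z. z \<in> carrier (tensor_free M N) \<Longrightarrow> tensor_lift A f (coset z) = h z"
proof -
  interpret A: abelian_group A by fact
  interpret T: comm_group "tensor_free M N" by (rule comm_group_tensor_free)
  have f_closed: "f m n \<in> carrier A" if "m \<in> carrier M" "n \<in> carrier N" for m n
    using assms(2) that by (auto simp: balanced_def dest: add_hom_closed)
  have "(\<lambda>(m, n). f m n) ` (carrier M \<times> carrier N) \<subseteq> carrier (add_monoid A)"
    using f_closed by auto
  then obtain h where h: "h \<in> hom (tensor_free M N) (add_monoid A)"
    and h_frag: "\<And>x. x \<in> carrier M \<times> carrier N \<Longrightarrow> h (frag_of x) = (\<lambda>(m, n). f m n) x"
    unfolding tensor_free_def by (rule comm_group.free_Abelian_group_universal[OF A.a_comm_group]) blast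
  interpret h: group_hom "tensor_free M N" "add_monoid A" h
    using h A.a_group T.is_group by (simp add: group_hom_def group_hom_axioms_def)
  have cmul: "h (frag_cmul k (frag_of x)) = add_pow A k ((\<lambda>(m, n). f m n) x)"
    "frag_cmul k (frag_of x) \<in> carrier (tensor_free M N)"
    if "x \<in> carrier M \<times> carrier N" for k x
  proof -
    have "frag_of x \<in> carrier (tensor_free M N)" using that by (simp add: tensor_free_def)
    moreover from this have "frag_of x [^]\<^bsub>tensor_free M N\<^esub> k = frag_cmul k (frag_of x)"
      by (simp add: tensor_free_def)
    ultimately show "h (frag_cmul k (frag_of x)) = add_pow A k ((\<lambda>(m, n). f m n) x)"
      "frag_cmul k (frag_of x) \<in> carrier (tensor_free M N)"
      using h.hom_int_pow[of "frag_of x" k] T.int_pow_closed[of "frag_of x" k] h_frag[OF that]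
      by (simp_all add: add_pow_def)
  qed
  have sum: "h (\<Sum>x\<in>I. frag_cmul (c x) (frag_of x)) = (\<Oplus>\<^bsub>A\<^esub>x\<in>I. add_pow A (c x) ((\<lambda>(m, n). f m n) x)) \<and>
      (\<Sum>x\<in>I. frag_cmul (c x) (frag_of x)) \<in> carrier (tensor_free M N)"
    if "finite I" "I \<subseteq> carrier M \<times> carrier N" for I c
    using that
  proof (induction I rule: finite_induct)
    case empty
    then show ?case using h.hom_one by (simp add: ops_tensor_free carrier_tensor_free)
  next
    case (insert x I)
    then have "(\<lambda>x. add_pow A (c x) ((\<lambda>(m, n). f m n) x)) \<in> I \<rightarrow> carrier A"
        "add_pow A (c x) ((\<lambda>(m, n). f m n) x) \<in> carrier A"
      using f_closed by (auto intro!: A.add.int_pow_closed)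
    moreover have "x \<in> carrier M \<times> carrier N" using insert by auto
    ultimately show ?case
      using insert cmul[of x "c x"] h.hom_mult[of "frag_cmul (c x) (frag_of x)"]
        T.m_closed[of "frag_cmul (c x) (frag_of x)"]
      by (simp add: ops_tensor_free)
  qed
  have finsum: "finsum A (\<lambda>(m, n). add_pow A (Poly_Mapping.lookup z (m, n)) (f m n)) (Poly_Mapping.keys z) = h z"
    if "z \<in> carrier (tensor_free M N)" for z
  proof -
    have "h z = h (\<Sum>x\<in>Poly_Mapping.keys z. frag_cmul (Poly_Mapping.lookup z x) (frag_of x))"
      by (subst (1) frag_expansion[of z]) (simp add: frag_extend_def)
    then show ?thesis
      using sum[of "Poly_Mapping.keys z" "Poly_Mapping.lookup z"] that
      by (simp add: carrier_tensor_free split_def)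
  qed
  have kills: "h x = \<zero>\<^bsub>A\<^esub>" if "x \<in> tensor_relators R M N" for x
  proof -
    have diff: "h (x - y) = h x \<ominus>\<^bsub>A\<^esub> h y" if "x \<in> carrier (tensor_free M N)" "y \<in> carrier (tensor_free M N)" for x y
    proof -
      have "h x = h (x - y) \<oplus>\<^bsub>A\<^esub> h y"
        using h.hom_mult[of "x - y" y] that tensor_free_diff by (simp add: ops_tensor_free)
      then show ?thesis
        using h.hom_closed that tensor_free_diff
        by (simp add: A.minus_eq A.a_assoc A.r_neg)
    qed
    have diff2: "h (frag_of p - frag_of q - frag_of r) = \<zero>\<^bsub>A\<^esub>"
      if "p \<in> carrier M \<times> carrier N" "q \<in> carrier M \<times> carrier N" "r \<in> carrier M \<times> carrier N"
        "(\<lambda>(m, n). f m n) p = (\<lambda>(m, n). f m n) q \<oplus>\<^bsub>A\<^esub> (\<lambda>(m, n). f m n) r" for p q r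
    proof -
      have free: "frag_of p \<in> carrier (tensor_free M N)" "frag_of q \<in> carrier (tensor_free M N)"
          "frag_of r \<in> carrier (tensor_free M N)"
        using that by (auto simp: tensor_free_def keys_frag_of)
      have "h (frag_of p - frag_of q - frag_of r) = h (frag_of p) \<ominus>\<^bsub>A\<^esub> h (frag_of q) \<ominus>\<^bsub>A\<^esub> h (frag_of r)"
        using free tensor_free_diff by (simp add: diff)
      also have "\<dots> = (h (frag_of q) \<oplus>\<^bsub>A\<^esub> h (frag_of r)) \<ominus>\<^bsub>A\<^esub> h (frag_of q) \<ominus>\<^bsub>A\<^esub> h (frag_of r)"
        using that h_frag by simp
      also have "\<dots> = \<zero>\<^bsub>A\<^esub>"
      proof -
        have "h (frag_of q) \<in> carrier A" "h (frag_of r) \<in> carrier A" using free h.hom_closed by auto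
        then show ?thesis
          by (simp add: A.minus_eq A.a_comm[of "h (frag_of q)" "h (frag_of r)"] A.a_assoc A.r_neg)
      qed
      finally show ?thesis .
    qed
    have diff1: "h (frag_of p - frag_of q) = \<zero>\<^bsub>A\<^esub>"
      if "p \<in> carrier M \<times> carrier N" "q \<in> carrier M \<times> carrier N"
        "(\<lambda>(m, n). f m n) p = (\<lambda>(m, n). f m n) q" for p q
    proof -
      have "frag_of p \<in> carrier (tensor_free M N)" "frag_of q \<in> carrier (tensor_free M N)"
        using that by (auto simp: tensor_free_def keys_frag_of)
      then have "h (frag_of p - frag_of q) = h (frag_of q) \<ominus>\<^bsub>A\<^esub> h (frag_of q)" "h (frag_of q) \<in> carrier A"
        using that h_frag f_closed by (auto simp: diff)
      then show ?thesis by (simp add: A.minus_eq A.r_neg)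
    qed
    show ?thesis
      using that unfolding tensor_relators_def
    proof (elim UnE CollectE exE conjE)
      fix m m' n assume "x = frag_of (m \<oplus>\<^bsub>M\<^esub> m', n) - frag_of (m, n) - frag_of (m', n)"
        "m \<in> carrier M" "m' \<in> carrier M" "n \<in> carrier N"
      then show ?thesis
        using assms(2) closed_factors by (auto intro!: diff2 simp: balanced_add)
    next
      fix m n n' assume "x = frag_of (m, n \<oplus>\<^bsub>N\<^esub> n') - frag_of (m, n) - frag_of (m, n')"
        "m \<in> carrier M" "n \<in> carrier N" "n' \<in> carrier N"
      then show ?thesis
        using assms(2) closed_factors by (auto intro!: diff2 simp: balanced_add)
    next
      fix r m n assume "x = frag_of (r \<odot>\<^bsub>M\<^esub> m, n) - frag_of (m, r \<odot>\<^bsub>N\<^esub> n)"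
        "r \<in> carrier R" "m \<in> carrier M" "n \<in> carrier N"
      then show ?thesis
        using assms(2) closed_factors by (auto intro!: diff1 simp: balanced_def)
    qed
  qed
  have null: "h x = \<zero>\<^bsub>A\<^esub>" if "x \<in> tensor_null R M N" for x
  proof -
    have "generate (tensor_free M N) (tensor_relators R M N) \<subseteq> kernel (tensor_free M N) (add_monoid A) h"
      using tensor_relators_closed kills h.subgroup_kernel
      by (intro T.generate_subgroup_incl) (auto simp: kernel_def)
    then show ?thesis using that by (auto simp: tensor_null_def kernel_def)
  qed
  have "tensor_lift A f (coset z) = h z" if z: "z \<in> carrier (tensor_free M N)" for z
  proof -
    define y where "y = (SOME y. y \<in> coset z)"
    have "z \<in> coset z" using T.rcos_self[OF z subgroup_tensor_null] .
    then have "y \<in> coset z" unfolding y_def by (rule someI)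
    then obtain x where x: "x \<in> tensor_null R M N" "y = x + z"
      by (auto simp: r_coset_def ops_tensor_free)
    then have "x \<in> carrier (tensor_free M N)" using subgroup.subset[OF subgroup_tensor_null] by auto
    then have "y \<in> carrier (tensor_free M N)" "h y = h z"
      using x z h.hom_mult[of x z] T.m_closed[of x z] null h.hom_closed[OF z] by (simp_all add: ops_tensor_free)
    then show ?thesis
      unfolding tensor_lift_def Let_def y_def[symmetric] using finsum by simp
  qed
  with that[OF h] h_frag show ?thesis by auto
qed

lemma tensor_lift_hom:
  assumes "abelian_group A" "balanced R M N A f"
  shows "tensor_lift A f \<in> add_hom (tensor_group R M N) A"
proof -
  obtain h where h: "h \<in> hom (tensor_free M N) (add_monoid A)"
    "\<And>z. z \<in> carrier (tensor_free M N) \<Longrightarrow> tensor_lift A f (coset z) = h z"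
    using tensor_lift_coset[OF assms] by metis
  interpret T: comm_group "tensor_free M N" by (rule comm_group_tensor_free)
  show ?thesis
    using h T.m_closed
    by (intro add_homI) (auto simp: carrier_tensor_group add_tensor_group hom_def ops_tensor_free Pi_def)
qed

lemma tensor_lift_pure:
  assumes "abelian_group A" "balanced R M N A f" "m \<in> carrier M" "n \<in> carrier N"
  shows "tensor_lift A f (pure_tensor R M N m n) = f m n"
  using tensor_lift_coset[OF assms(1,2)] frag_of_tensor_free[OF assms(3,4)] assms(3,4)
  unfolding pure_tensor_def by metis

lemma tensor_lift_unique:
  assumes "abelian_group A" "balanced R M N A f" "F \<in> add_hom (tensor_group R M N) A"
    and "\<And>m n. \<lbrakk>m \<in> carrier M; n \<in> carrier N\<rbrakk> \<Longrightarrow> F (pure_tensor R M N m n) = f m n"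
    and "t \<in> carrier (tensor_group R M N)"
  shows "tensor_lift A f t = F t"
  using tensor_hom_ext[OF assms(1) tensor_lift_hom[OF assms(1,2)] assms(3) _ assms(5)]
  by (simp add: tensor_lift_pure[OF assms(1,2)] assms(4))

lemma add_hom_tensor_lift:
  assumes "abelian_group A" "abelian_group B" "balanced R M N A f" "h \<in> add_hom A B"
    and "t \<in> carrier (tensor_group R M N)"
  shows "h (tensor_lift A f t) = tensor_lift B (\<lambda>m n. h (f m n)) t"
proof (rule tensor_lift_unique[OF assms(2) _ _ _ assms(5), symmetric])
  show "balanced R M N B (\<lambda>m n. h (f m n))"
    using assms(4) by (intro balancedI)
      (simp_all add: balanced_closed[OF assms(3)] balanced_add[OF assms(3)] balanced_smult[OF assms(3)]
        add_hom_closed add_hom_add)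
  show "(\<lambda>t. h (tensor_lift A f t)) \<in> add_hom (tensor_group R M N) B"
    using assms(4) tensor_lift_hom[OF assms(1,3)]
    by (intro add_homI) (simp_all add: add_hom_closed add_hom_add)
qed (simp add: tensor_lift_pure[OF assms(1,3)])

lemma balanced_cong:
  assumes "balanced R M N A f" "\<And>m n. \<lbrakk>m \<in> carrier M; n \<in> carrier N\<rbrakk> \<Longrightarrow> f m n = g m n"
  shows "balanced R M N A g"
  using balanced_closed[OF assms(1)] balanced_add[OF assms(1)] balanced_smult[OF assms(1)] closed_factors
  by (intro balancedI) (simp_all add: assms(2)[symmetric])

lemma tensor_lift_cong:
  assumes "abelian_group A" "balanced R M N A f"
    and "\<And>m n. \<lbrakk>m \<in> carrier M; n \<in> carrier N\<rbrakk> \<Longrightarrow> f m n = g m n"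
    and "t \<in> carrier (tensor_group R M N)"
  shows "tensor_lift A f t = tensor_lift A g t"
proof (rule tensor_lift_unique[OF assms(1,2) _ _ assms(4)])
  note g = balanced_cong[OF assms(2,3)]
  show "tensor_lift A g \<in> add_hom (tensor_group R M N) A"
    by (rule tensor_lift_hom[OF assms(1) g])
  show "tensor_lift A g (pure_tensor R M N m n) = f m n" if "m \<in> carrier M" "n \<in> carrier N" for m n
    using tensor_lift_pure[OF assms(1) g that] assms(3)[OF that] by simp
qed

end

lemma module_hom_add_hom: "f \<in> module_hom R M N \<Longrightarrow> f \<in> add_hom M N"
  by (simp add: module_hom_def add_hom_def)

lemma module_hom_smult:
  "\<lbrakk>f \<in> module_hom R M N; r \<in> carrier R; m \<in> carrier M\<rbrakk> \<Longrightarrow> f (r \<odot>\<^bsub>M\<^esub> m) = r \<odot>\<^bsub>N\<^esub> f m"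
  by (simp add: module_hom_def)

lemma module_homI:
  assumes "\<And>x. x \<in> carrier V \<Longrightarrow> f x \<in> carrier W"
    and "\<And>x y. \<lbrakk>x \<in> carrier V; y \<in> carrier V\<rbrakk> \<Longrightarrow> f (x \<oplus>\<^bsub>V\<^esub> y) = f x \<oplus>\<^bsub>W\<^esub> f y"
    and "\<And>a x. \<lbrakk>a \<in> carrier R; x \<in> carrier V\<rbrakk> \<Longrightarrow> f (a \<odot>\<^bsub>V\<^esub> x) = a \<odot>\<^bsub>W\<^esub> f x"
  shows "f \<in> module_hom R V W"
  using assms by (auto simp: module_hom_def intro: homI)

lemma id_module_hom [simp]: "id \<in> module_hom R M M"
  by (rule module_homI) auto

lemma balanced_tensor_map:
  assumes "tensor_factors R M N" "tensor_factors R A B" "f \<in> module_hom R A M" "g \<in> module_hom R B N"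
  shows "balanced R A B (tensor_group R M N) (\<lambda>a b. pure_tensor R M N (f a) (g b))"
proof -
  note f = module_hom_add_hom[OF assms(3)] and g = module_hom_add_hom[OF assms(4)]
  note pure = tensor_factors.balanced_pure[OF assms(1)]
  show ?thesis
    using add_hom_closed[OF f] add_hom_closed[OF g]
    by (intro balancedI) (simp_all add: balanced_closed[OF pure] balanced_add[OF pure] balanced_smult[OF pure]
        add_hom_add[OF f] add_hom_add[OF g] module_hom_smult[OF assms(3)] module_hom_smult[OF assms(4)])
qed

lemma tensor_map_hom:
  assumes "tensor_factors R M N" "tensor_factors R A B" "f \<in> module_hom R A M" "g \<in> module_hom R B N"
  shows "tensor_map R M N f g \<in> add_hom (tensor_group R A B) (tensor_group R M N)"
  unfolding tensor_map_def
  by (rule tensor_factors.tensor_lift_hom[OF assms(2) tensor_factors.abelian_tensor_group[OF assms(1)]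
        balanced_tensor_map[OF assms]])

lemma tensor_map_pure_tensor:
  assumes "tensor_factors R M N" "tensor_factors R A B" "f \<in> module_hom R A M" "g \<in> module_hom R B N"
    and "a \<in> carrier A" "b \<in> carrier B"
  shows "tensor_map R M N f g (pure_tensor R A B a b) = pure_tensor R M N (f a) (g b)"
  unfolding tensor_map_def
  by (rule tensor_factors.tensor_lift_pure[OF assms(2) tensor_factors.abelian_tensor_group[OF assms(1)]
        balanced_tensor_map[OF assms(1-4)] assms(5,6)])

section \<open>Linear and bilinear maps over the ground field\<close>

locale ground_field = K?: field K for K :: "'k ring" (structure)
begin

abbreviation lin :: "('k, 'v, 'y) module_scheme \<Rightarrow> ('k, 'w, 'z) module_scheme \<Rightarrow> ('v \<Rightarrow> 'w) set" where
  "lin V W \<equiv> module_hom K V W"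

abbreviation tensor_product (infixr "\<boxtimes>" 72) where
  "V \<boxtimes> W \<equiv> tensor_space K V W"

abbreviation pure where "pure V W \<equiv> pure_tensor K V W"

definition bilinear where
  "bilinear V W E f \<longleftrightarrow> (\<forall>v\<in>carrier V. f v \<in> lin W E) \<and> (\<forall>w\<in>carrier W. (\<lambda>v. f v w) \<in> lin V E)"

definition trilinear where
  "trilinear U V W E f \<longleftrightarrow> (\<forall>u\<in>carrier U. bilinear V W E (f u)) \<and>
     (\<forall>v\<in>carrier V. \<forall>w\<in>carrier W. (\<lambda>u. f u v w) \<in> lin U E)"

named_theorems linear_intros

lemma bilinearI [linear_intros]:
  assumes "\<And>v. v \<in> carrier V \<Longrightarrow> (\<lambda>w. f v w) \<in> lin W E"
    and "\<And>w. w \<in> carrier W \<Longrightarrow> (\<lambda>v. f v w) \<in> lin V E"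
  shows "bilinear V W E f"
  using assms by (simp add: bilinear_def)

lemma trilinearI [linear_intros]:
  assumes "\<And>u v. \<lbrakk>u \<in> carrier U; v \<in> carrier V\<rbrakk> \<Longrightarrow> (\<lambda>w. f u v w) \<in> lin W E"
    and "\<And>u w. \<lbrakk>u \<in> carrier U; w \<in> carrier W\<rbrakk> \<Longrightarrow> (\<lambda>v. f u v w) \<in> lin V E"
    and "\<And>v w. \<lbrakk>v \<in> carrier V; w \<in> carrier W\<rbrakk> \<Longrightarrow> (\<lambda>u. f u v w) \<in> lin U E"
  shows "trilinear U V W E f"
  using assms by (simp add: trilinear_def bilinear_def)

lemma bilinearD:
  "bilinear V W E f \<Longrightarrow> v \<in> carrier V \<Longrightarrow> f v \<in> lin W E"
  "bilinear V W E f \<Longrightarrow> w \<in> carrier W \<Longrightarrow> (\<lambda>v. f v w) \<in> lin V E"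
  by (auto simp: bilinear_def)

lemma trilinearD:
  "trilinear U V W E f \<Longrightarrow> u \<in> carrier U \<Longrightarrow> bilinear V W E (f u)"
  "trilinear U V W E f \<Longrightarrow> w \<in> carrier W \<Longrightarrow> bilinear U V E (\<lambda>u v. f u v w)"
  "trilinear U V W E f \<Longrightarrow> v \<in> carrier V \<Longrightarrow> bilinear U W E (\<lambda>u w. f u v w)"
  by (auto simp: trilinear_def bilinear_def)

lemma bilinear_add:
  assumes "bilinear V W E f"
  shows "\<lbrakk>v \<in> carrier V; v' \<in> carrier V; w \<in> carrier W\<rbrakk> \<Longrightarrow> f (v \<oplus>\<^bsub>V\<^esub> v') w = f v w \<oplus>\<^bsub>E\<^esub> f v' w"
    and "\<lbrakk>v \<in> carrier V; w \<in> carrier W; w' \<in> carrier W\<rbrakk> \<Longrightarrow> f v (w \<oplus>\<^bsub>W\<^esub> w') = f v w \<oplus>\<^bsub>E\<^esub> f v w'"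
  using bilinearD[OF assms] by (auto simp: module_hom_def hom_def)

lemma bilinear_smult:
  assumes "bilinear V W E f" "a \<in> carrier K" "v \<in> carrier V" "w \<in> carrier W"
  shows "f (a \<odot>\<^bsub>V\<^esub> v) w = a \<odot>\<^bsub>E\<^esub> f v w" "f v (a \<odot>\<^bsub>W\<^esub> w) = a \<odot>\<^bsub>E\<^esub> f v w"
  using bilinearD[OF assms(1)] assms(2-) by (auto simp: module_hom_def)

lemma linI:
  assumes "\<And>x. x \<in> carrier V \<Longrightarrow> f x \<in> carrier W"
    and "\<And>x y. \<lbrakk>x \<in> carrier V; y \<in> carrier V\<rbrakk> \<Longrightarrow> f (x \<oplus>\<^bsub>V\<^esub> y) = f x \<oplus>\<^bsub>W\<^esub> f y"
    and "\<And>a x. \<lbrakk>a \<in> carrier K; x \<in> carrier V\<rbrakk> \<Longrightarrow> f (a \<odot>\<^bsub>V\<^esub> x) = a \<odot>\<^bsub>W\<^esub> f x"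
  shows "f \<in> lin V W"
  using assms by (auto simp: module_hom_def intro: homI)

lemma lin_add_hom: "f \<in> lin V W \<Longrightarrow> f \<in> add_hom V W"
  by (simp add: module_hom_def add_hom_def)

lemma lin_closed: "f \<in> lin V W \<Longrightarrow> x \<in> carrier V \<Longrightarrow> f x \<in> carrier W"
  by (auto simp: module_hom_def hom_def)

lemma lin_add: "f \<in> lin V W \<Longrightarrow> x \<in> carrier V \<Longrightarrow> y \<in> carrier V \<Longrightarrow> f (x \<oplus>\<^bsub>V\<^esub> y) = f x \<oplus>\<^bsub>W\<^esub> f y"
  by (auto simp: module_hom_def hom_def)

lemma lin_smult: "f \<in> lin V W \<Longrightarrow> a \<in> carrier K \<Longrightarrow> x \<in> carrier V \<Longrightarrow> f (a \<odot>\<^bsub>V\<^esub> x) = a \<odot>\<^bsub>W\<^esub> f x"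
  by (auto simp: module_hom_def)

lemma module_abelian: "module K V \<Longrightarrow> abelian_group V"
  by (simp add: module_def)

lemma module_smult_group: "module K V \<Longrightarrow> smult_group K V"
  by (simp add: smult_group_def module_abelian module.smult_closed)

lemma lin_zero: "\<lbrakk>module K V; module K W; f \<in> lin V W\<rbrakk> \<Longrightarrow> f \<zero>\<^bsub>V\<^esub> = \<zero>\<^bsub>W\<^esub>"
  by (simp add: add_hom_zero lin_add_hom module_abelian)

lemma lin_minus: "\<lbrakk>module K V; module K W; f \<in> lin V W; x \<in> carrier V\<rbrakk> \<Longrightarrow> f (\<ominus>\<^bsub>V\<^esub> x) = \<ominus>\<^bsub>W\<^esub> f x"
  by (simp add: add_hom_minus lin_add_hom module_abelian)

lemma lin_diff:
  "\<lbrakk>module K V; module K W; f \<in> lin V W; x \<in> carrier V; y \<in> carrier V\<rbrakk> \<Longrightarrow>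
    f (x \<ominus>\<^bsub>V\<^esub> y) = f x \<ominus>\<^bsub>W\<^esub> f y"
  by (simp add: a_minus_def lin_add lin_minus module_abelian abelian_group.a_inv_closed)

lemma bilinear_closed: "bilinear V W E f \<Longrightarrow> v \<in> carrier V \<Longrightarrow> w \<in> carrier W \<Longrightarrow> f v w \<in> carrier E"
  by (auto simp: bilinear_def intro: lin_closed)

lemma lin_ident [linear_intros]: "(\<lambda>x. x) \<in> lin V V" by (rule linI) auto

lemma lin_compose: "f \<in> lin V W \<Longrightarrow> g \<in> lin U V \<Longrightarrow> (\<lambda>u. f (g u)) \<in> lin U W"
  by (rule linI) (simp_all add: lin_closed lin_add lin_smult)

lemma lin_smult_const [linear_intros]:
  assumes "module K E" "a \<in> carrier K" "f \<in> lin U E"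
  shows "(\<lambda>u. a \<odot>\<^bsub>E\<^esub> f u) \<in> lin U E"
proof -
  interpret E: module K E by fact
  show ?thesis
    using assms(2,3)
    by (intro linI) (auto simp: lin_closed lin_add lin_smult E.smult_r_distr E.smult_assoc1[symmetric] K.m_comm)
qed

lemma lin_smult_scalar [linear_intros]:
  assumes "module K E" "f \<in> lin U (left_reg K)" "x \<in> carrier E"
  shows "(\<lambda>u. f u \<odot>\<^bsub>E\<^esub> x) \<in> lin U E"
proof -
  interpret E: module K E by fact
  have [simp]: "f u \<in> carrier K" if "u \<in> carrier U" for u
    using lin_closed[OF assms(2) that] by (simp add: left_reg_def with_smult_def)
  show ?thesis
    using assms(2,3) lin_add[OF assms(2)] lin_smult[OF assms(2)]
    by (intro linI) (auto simp: E.smult_l_distr E.smult_assoc1 left_reg_def with_smult_def)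
qed

lemma lin_sum [linear_intros]:
  assumes "module K E" "f \<in> lin U E" "g \<in> lin U E"
  shows "(\<lambda>u. f u \<oplus>\<^bsub>E\<^esub> g u) \<in> lin U E"
proof -
  interpret E: module K E by fact
  show ?thesis
    using assms(2,3)
    by (intro linI) (auto simp: lin_closed lin_add lin_smult E.smult_r_distr E.a_ac)
qed

lemma lin_uminus [linear_intros]:
  assumes "module K E" "f \<in> lin U E"
  shows "(\<lambda>u. \<ominus>\<^bsub>E\<^esub> f u) \<in> lin U E"
proof -
  interpret E: module K E by fact
  show ?thesis
    using assms(2)
    by (intro linI) (auto simp: lin_closed lin_add lin_smult E.smult_r_minus E.minus_add)
qed

lemma lin_difference [linear_intros]:
  assumes "module K E" "f \<in> lin U E" "g \<in> lin U E"
  shows "(\<lambda>u. f u \<ominus>\<^bsub>E\<^esub> g u) \<in> lin U E"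
  unfolding a_minus_def using assms by (intro lin_sum lin_uminus)

subsection \<open>Bilinear maps on tensor products\<close>

lemma tensor_factors_modules: "module K V \<Longrightarrow> module K W \<Longrightarrow> tensor_factors K V W"
  by (simp add: tensor_factors_def module_smult_group)

lemma bilinear_balanced: "bilinear V W E f \<Longrightarrow> balanced K V W E f"
  using lin_smult[OF bilinearD(1), of V W E f] lin_smult[OF bilinearD(2), of V W E f]
  by (simp add: balanced_def bilinear_def lin_add_hom)

lemma tensor_space_simps [simp]:
  "carrier (V \<boxtimes> W) = carrier (tensor_group K V W)"
  "ring.add (V \<boxtimes> W) = ring.add (tensor_group K V W)"
  "ring.zero (V \<boxtimes> W) = ring.zero (tensor_group K V W)"
  by (simp_all add: tensor_space_def with_smult_def)

end

text \<open>
  The record of the target carries a multiplication or a scalar action that differs between the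
  various module structures on one group; \<open>tensor_lift\<close> sees the additive group only.
\<close>

lemma tensor_lift_target_cong:
  assumes "carrier A = carrier B" "ring.add A = ring.add B" "ring.zero A = ring.zero B"
  shows "tensor_lift A = tensor_lift B"
proof -
  show ?thesis
    unfolding tensor_lift_def finsum_def finprod_def add_pow_def int_pow_def nat_pow_def m_inv_def
      monoid_record_simps assms ..
qed

context ground_field
begin

lemma tensor_lift_tensor_group: "tensor_lift (tensor_group K V W) = tensor_lift (V \<boxtimes> W)"
  by (rule tensor_lift_target_cong) simp_all

lemma lin_add_hom_tensor: "F \<in> lin (V \<boxtimes> W) E \<Longrightarrow> F \<in> add_hom (tensor_group K V W) E"
  by (rule add_homI) (auto simp: lin_closed lin_add[of F "V \<boxtimes> W", simplified])

lemma tensor_map_lift: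
  "tensor_map K V W f g = tensor_lift (V \<boxtimes> W) (\<lambda>a b. pure V W (f a) (g b))"
  by (simp add: tensor_map_def tensor_lift_tensor_group)

lemma smult_tensor:
  "a \<odot>\<^bsub>V \<boxtimes> W\<^esub> t = tensor_lift (tensor_group K V W) (\<lambda>v w. pure V W (a \<odot>\<^bsub>V\<^esub> v) w) t"
  by (simp add: tensor_space_def with_smult_def tensor_map_def)

context
  fixes V :: "('k, 'v, 'y) module_scheme" and W :: "('k, 'w, 'z) module_scheme"
  assumes V: "module K V" and W: "module K W"
begin

interpretation T: tensor_factors K V W using V W by (rule tensor_factors_modules)
interpretation V: module K V by (rule V)
interpretation W: module K W by (rule W)
interpretation TG: abelian_group "tensor_group K V W" by (rule T.abelian_tensor_group)

lemma balanced_smult_pure: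
  assumes "a \<in> carrier K"
  shows "balanced K V W (tensor_group K V W) (\<lambda>v w. pure V W (a \<odot>\<^bsub>V\<^esub> v) w)"
proof (rule balancedI)
  note pure = balanced_smult[OF T.balanced_pure]
  fix r m n assume "r \<in> carrier K" "m \<in> carrier V" "n \<in> carrier W"
  then show "pure V W (a \<odot>\<^bsub>V\<^esub> (r \<odot>\<^bsub>V\<^esub> m)) n = pure V W (a \<odot>\<^bsub>V\<^esub> m) (r \<odot>\<^bsub>W\<^esub> n)"
    using assms pure by (metis V.smult_assoc1 V.smult_closed K.m_comm)
qed (use assms in \<open>simp_all add: T.pure_closed balanced_add[OF T.balanced_pure] V.smult_r_distr\<close>)

lemma smult_pure:
  "\<lbrakk>a \<in> carrier K; v \<in> carrier V; w \<in> carrier W\<rbrakk> \<Longrightarrow> a \<odot>\<^bsub>V \<boxtimes> W\<^esub> pure V W v w = pure V W (a \<odot>\<^bsub>V\<^esub> v) w"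
  by (simp add: smult_tensor T.tensor_lift_pure balanced_smult_pure T.abelian_tensor_group)

lemma smult_tensor_hom: "a \<in> carrier K \<Longrightarrow> (\<lambda>t. a \<odot>\<^bsub>V \<boxtimes> W\<^esub> t) \<in> add_hom (tensor_group K V W) (tensor_group K V W)"
  unfolding smult_tensor by (intro T.tensor_lift_hom T.abelian_tensor_group balanced_smult_pure)

lemma pure_closed [simp, intro]: "v \<in> carrier V \<Longrightarrow> w \<in> carrier W \<Longrightarrow> pure V W v w \<in> carrier (tensor_group K V W)"
  by (rule T.pure_closed)

lemma module_tensor [simp, intro]: "module K (V \<boxtimes> W)"
proof (rule moduleI)
  show "cring K" by (rule K.is_cring)
  show "abelian_group (V \<boxtimes> W)"
  proof (rule abelian_groupI)
    fix x assume "x \<in> carrier (V \<boxtimes> W)"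
    then show "\<exists>y\<in>carrier (V \<boxtimes> W). y \<oplus>\<^bsub>V \<boxtimes> W\<^esub> x = \<zero>\<^bsub>V \<boxtimes> W\<^esub>"
      using TG.l_neg TG.a_inv_closed by (intro bexI[of _ "\<ominus>\<^bsub>tensor_group K V W\<^esub> x"]) simp_all
  qed (simp_all add: TG.a_ac)
  note pure_add = balanced_add[OF T.balanced_pure]
  note smult = add_hom_closed[OF smult_tensor_hom] add_hom_add[OF smult_tensor_hom]
  show "\<one> \<odot>\<^bsub>V \<boxtimes> W\<^esub> x = x" if "x \<in> carrier (V \<boxtimes> W)" for x
    by (rule T.tensor_hom_ext[OF T.abelian_tensor_group])
      (use smult that in \<open>simp_all add: add_homI smult_pure\<close>)
  fix a b x y assume ab: "a \<in> carrier K" "b \<in> carrier K"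
  assume "x \<in> carrier (V \<boxtimes> W)" "y \<in> carrier (V \<boxtimes> W)"
  then have xy: "x \<in> carrier (tensor_group K V W)" "y \<in> carrier (tensor_group K V W)" by simp_all
  show "a \<odot>\<^bsub>V \<boxtimes> W\<^esub> x \<in> carrier (V \<boxtimes> W)" using smult ab xy by simp
  show "a \<odot>\<^bsub>V \<boxtimes> W\<^esub> (x \<oplus>\<^bsub>V \<boxtimes> W\<^esub> y) = a \<odot>\<^bsub>V \<boxtimes> W\<^esub> x \<oplus>\<^bsub>V \<boxtimes> W\<^esub> a \<odot>\<^bsub>V \<boxtimes> W\<^esub> y"
    using smult ab xy by simp
  have "(a \<oplus> b) \<odot>\<^bsub>V \<boxtimes> W\<^esub> x = a \<odot>\<^bsub>V \<boxtimes> W\<^esub> x \<oplus>\<^bsub>tensor_group K V W\<^esub> b \<odot>\<^bsub>V \<boxtimes> W\<^esub> x"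
    by (rule T.tensor_hom_ext[OF T.abelian_tensor_group _ _ _ xy(1)])
      (use ab smult in \<open>simp_all add: add_homI smult_pure V.smult_l_distr pure_add TG.a_ac\<close>)
  then show "(a \<oplus> b) \<odot>\<^bsub>V \<boxtimes> W\<^esub> x = a \<odot>\<^bsub>V \<boxtimes> W\<^esub> x \<oplus>\<^bsub>V \<boxtimes> W\<^esub> b \<odot>\<^bsub>V \<boxtimes> W\<^esub> x" by simp
  show "(a \<otimes> b) \<odot>\<^bsub>V \<boxtimes> W\<^esub> x = a \<odot>\<^bsub>V \<boxtimes> W\<^esub> (b \<odot>\<^bsub>V \<boxtimes> W\<^esub> x)"
    by (rule T.tensor_hom_ext[OF T.abelian_tensor_group _ _ _ xy(1)])
      (use ab smult in \<open>simp_all add: add_homI smult_pure V.smult_assoc1\<close>)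
qed

lemma bilinear_pure: "bilinear V W (V \<boxtimes> W) (pure V W)"
proof -
  have smult: "pure V W v (a \<odot>\<^bsub>W\<^esub> w) = a \<odot>\<^bsub>V \<boxtimes> W\<^esub> pure V W v w"
    if "a \<in> carrier K" "v \<in> carrier V" "w \<in> carrier W" for a v w
    using that balanced_smult[OF T.balanced_pure that] by (simp add: smult_pure)
  show ?thesis
    by (intro bilinearI linI) (simp_all add: smult balanced_add[OF T.balanced_pure] smult_pure)
qed

lemma tensor_lin_ext:
  assumes "module K E" "F \<in> lin (V \<boxtimes> W) E" "G \<in> lin (V \<boxtimes> W) E"
    and "\<And>v w. \<lbrakk>v \<in> carrier V; w \<in> carrier W\<rbrakk> \<Longrightarrow> F (pure V W v w) = G (pure V W v w)"
    and "t \<in> carrier (V \<boxtimes> W)"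
  shows "F t = G t"
  by (rule T.tensor_hom_ext[OF module_abelian[OF assms(1)] lin_add_hom_tensor[OF assms(2)]
        lin_add_hom_tensor[OF assms(3)] assms(4)]) (use assms(5) in simp_all)

context
  fixes E :: "('k, 'a, 'x) module_scheme" and f
  assumes E: "module K E" and f: "bilinear V W E f"
begin

interpretation E: module K E by (rule E)

lemma lift_pure: "v \<in> carrier V \<Longrightarrow> w \<in> carrier W \<Longrightarrow> tensor_lift E f (pure V W v w) = f v w"
  by (rule T.tensor_lift_pure[OF E.abelian_group_axioms bilinear_balanced[OF f]])

lemma lift_lin: "tensor_lift E f \<in> lin (V \<boxtimes> W) E"
proof -
  have hom: "tensor_lift E f \<in> add_hom (tensor_group K V W) E"
    by (rule T.tensor_lift_hom[OF E.abelian_group_axioms bilinear_balanced[OF f]])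
  note simps = add_hom_closed[OF hom] add_hom_add[OF hom]
    add_hom_closed[OF smult_tensor_hom] add_hom_add[OF smult_tensor_hom]
  have smult: "tensor_lift E f (a \<odot>\<^bsub>V \<boxtimes> W\<^esub> t) = a \<odot>\<^bsub>E\<^esub> tensor_lift E f t"
    if a: "a \<in> carrier K" and t: "t \<in> carrier (tensor_group K V W)" for a t
  proof (rule T.tensor_hom_ext[OF E.abelian_group_axioms _ _ _ t])
    show "(\<lambda>t. tensor_lift E f (a \<odot>\<^bsub>V \<boxtimes> W\<^esub> t)) \<in> add_hom (tensor_group K V W) E"
      using a by (intro add_homI) (simp_all add: simps)
    show "(\<lambda>t. a \<odot>\<^bsub>E\<^esub> tensor_lift E f t) \<in> add_hom (tensor_group K V W) E"
      using a by (intro add_homI) (simp_all add: simps E.smult_r_distr)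
    fix v w assume "v \<in> carrier V" "w \<in> carrier W"
    then show "tensor_lift E f (a \<odot>\<^bsub>V \<boxtimes> W\<^esub> pure V W v w) = a \<odot>\<^bsub>E\<^esub> tensor_lift E f (pure V W v w)"
      using a by (simp add: smult_pure lift_pure bilinear_smult[OF f])
  qed
  show ?thesis
    by (rule linI) (simp_all add: simps smult)
qed

lemma lift_closed: "t \<in> carrier (V \<boxtimes> W) \<Longrightarrow> tensor_lift E f t \<in> carrier E"
  by (rule lin_closed[OF lift_lin])

lemma lift_unique:
  assumes "F \<in> lin (V \<boxtimes> W) E" "\<And>v w. v \<in> carrier V \<Longrightarrow> w \<in> carrier W \<Longrightarrow> F (pure V W v w) = f v w"
    and "t \<in> carrier (V \<boxtimes> W)"
  shows "tensor_lift E f t = F t"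
  by (rule tensor_lin_ext[OF E lift_lin assms(1)]) (use assms in \<open>simp_all add: lift_pure\<close>)

lemma hom_lift:
  assumes "module K Y" "h \<in> lin E Y" "t \<in> carrier (V \<boxtimes> W)"
  shows "h (tensor_lift E f t) = tensor_lift Y (\<lambda>v w. h (f v w)) t"
proof -
  interpret Y: module K Y by fact
  have hf: "bilinear V W Y (\<lambda>v w. h (f v w))"
    using f assms(2) by (auto simp: bilinear_def intro: lin_compose)
  interpret T': tensor_factors K V W ..
  have lin: "tensor_lift Y (\<lambda>v w. h (f v w)) \<in> add_hom (tensor_group K V W) Y"
    by (rule T.tensor_lift_hom[OF Y.abelian_group_axioms bilinear_balanced[OF hf]])
  show ?thesis
  proof (rule T.tensor_hom_ext[OF Y.abelian_group_axioms _ lin])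
    show "(\<lambda>t. h (tensor_lift E f t)) \<in> add_hom (tensor_group K V W) Y"
      using lin_add_hom_tensor[OF lin_compose[OF assms(2) lift_lin]] .
    show "t \<in> carrier (tensor_group K V W)" using assms(3) by simp
    fix v w assume "v \<in> carrier V" "w \<in> carrier W"
    then show "h (tensor_lift E f (pure V W v w)) = tensor_lift Y (\<lambda>v w. h (f v w)) (pure V W v w)"
      by (simp add: lift_pure T.tensor_lift_pure[OF Y.abelian_group_axioms bilinear_balanced[OF hf]])
  qed
qed

lemma lift_cong:
  assumes "\<And>v w. \<lbrakk>v \<in> carrier V; w \<in> carrier W\<rbrakk> \<Longrightarrow> f v w = g v w" and "t \<in> carrier (V \<boxtimes> W)"
  shows "tensor_lift E f t = tensor_lift E g t"
proof -
  have "bilinear V W E g"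
    by (intro bilinearI linI)
      (simp_all add: assms(1)[symmetric] bilinear_closed[OF f] bilinear_add[OF f] bilinear_smult[OF f])
  then have bal: "balanced K V W E g" by (rule bilinear_balanced)
  show ?thesis
    by (rule T.tensor_hom_ext[OF E.abelian_group_axioms lin_add_hom_tensor[OF lift_lin]
          T.tensor_lift_hom[OF E.abelian_group_axioms bal]])
      (use assms in \<open>simp_all add: lift_pure T.tensor_lift_pure[OF E.abelian_group_axioms bal]\<close>)
qed

end

lemma lift_pure_id: "t \<in> carrier (V \<boxtimes> W) \<Longrightarrow> tensor_lift (V \<boxtimes> W) (pure V W) t = t"
  by (rule lift_unique[OF module_tensor bilinear_pure lin_ident]) auto

end

lemma lin_lift_arg [linear_intros]:
  assumes "module K V" "module K W" "module K E" "bilinear V W E f" "t \<in> lin U (V \<boxtimes> W)"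
  shows "(\<lambda>u. tensor_lift E f (t u)) \<in> lin U E"
  using lin_compose[OF lift_lin[OF assms(1-4)] assms(5)] .

lemma lift_add_fun:
  assumes "module K V" "module K W" "module K E" "bilinear V W E f" "bilinear V W E g" "t \<in> carrier (V \<boxtimes> W)"
  shows "tensor_lift E (\<lambda>v w. f v w \<oplus>\<^bsub>E\<^esub> g v w) t = tensor_lift E f t \<oplus>\<^bsub>E\<^esub> tensor_lift E g t"
proof (rule lift_unique)
  show "bilinear V W E (\<lambda>v w. f v w \<oplus>\<^bsub>E\<^esub> g v w)"
    using assms by (intro bilinearI lin_sum) (auto dest: bilinearD)
  show "(\<lambda>t. tensor_lift E f t \<oplus>\<^bsub>E\<^esub> tensor_lift E g t) \<in> lin (V \<boxtimes> W) E"
    using assms by (intro lin_sum lift_lin)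
qed (use assms in \<open>auto simp: lift_pure\<close>)

lemma lift_smult_fun:
  assumes "module K V" "module K W" "module K E" "bilinear V W E f" "a \<in> carrier K" "t \<in> carrier (V \<boxtimes> W)"
  shows "tensor_lift E (\<lambda>v w. a \<odot>\<^bsub>E\<^esub> f v w) t = a \<odot>\<^bsub>E\<^esub> tensor_lift E f t"
  using hom_lift[OF assms(1-4,3) lin_smult_const[OF assms(3,5) lin_ident] assms(6)] by simp

lemma lin_lift_fun [linear_intros]:
  assumes "module K V" "module K W" "module K E" "t \<in> carrier (V \<boxtimes> W)" "module K U"
    and lin: "\<And>v w. \<lbrakk>v \<in> carrier V; w \<in> carrier W\<rbrakk> \<Longrightarrow> (\<lambda>u. f u v w) \<in> lin U E"
    and bil: "\<And>u. u \<in> carrier U \<Longrightarrow> bilinear V W E (f u)"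
  shows "(\<lambda>u. tensor_lift E (f u) t) \<in> lin U E"
proof (rule linI)
  interpret U: module K U by fact
  note mods = assms(1-3)
  fix u assume u: "u \<in> carrier U"
  then show "tensor_lift E (f u) t \<in> carrier E" using lift_closed mods bil assms(4) by blast
  { fix u' assume u': "u' \<in> carrier U"
    have "tensor_lift E (f (u \<oplus>\<^bsub>U\<^esub> u')) t = tensor_lift E (\<lambda>v w. f u v w \<oplus>\<^bsub>E\<^esub> f u' v w) t"
      using u u' assms by (intro lift_cong[of V W]) (auto simp: lin_add[OF lin])
    then show "tensor_lift E (f (u \<oplus>\<^bsub>U\<^esub> u')) t = tensor_lift E (f u) t \<oplus>\<^bsub>E\<^esub> tensor_lift E (f u') t"
      using u u' assms lift_add_fun[OF mods] by simp }
  fix a assume a: "a \<in> carrier K"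
  have "tensor_lift E (f (a \<odot>\<^bsub>U\<^esub> u)) t = tensor_lift E (\<lambda>v w. a \<odot>\<^bsub>E\<^esub> f u v w) t"
    using u a assms by (intro lift_cong[of V W]) (auto simp: lin_smult[OF lin])
  then show "tensor_lift E (f (a \<odot>\<^bsub>U\<^esub> u)) t = a \<odot>\<^bsub>E\<^esub> tensor_lift E (f u) t"
    using u a assms lift_smult_fun[OF mods] by simp
qed

lemma lin_pure_left [linear_intros]:
  assumes "module K V" "module K W" "f \<in> lin U V" "w \<in> carrier W"
  shows "(\<lambda>u. pure V W (f u) w) \<in> lin U (V \<boxtimes> W)"
  using lin_compose[OF bilinearD(2)[OF bilinear_pure[OF assms(1,2)] assms(4)] assms(3)] .

lemma lin_pure_right [linear_intros]:
  assumes "module K V" "module K W" "f \<in> lin U W" "v \<in> carrier V"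
  shows "(\<lambda>u. pure V W v (f u)) \<in> lin U (V \<boxtimes> W)"
  using lin_compose[OF bilinearD(1)[OF bilinear_pure[OF assms(1,2)] assms(4)] assms(3)] .

lemma bilinear_pure_maps:
  assumes "module K V" "module K W" "f \<in> lin A V" "g \<in> lin B W"
  shows "bilinear A B (V \<boxtimes> W) (\<lambda>a b. pure V W (f a) (g b))"
  using assms by (intro bilinearI lin_pure_left lin_pure_right) (auto simp: lin_closed)

lemma bilinear_compose:
  assumes "bilinear V W E F" "f \<in> lin A V" "g \<in> lin B W"
  shows "bilinear A B E (\<lambda>a b. F (f a) (g b))"
proof (rule bilinearI)
  fix a assume "a \<in> carrier A"
  then show "(\<lambda>b. F (f a) (g b)) \<in> lin B E"
    using assms by (intro lin_compose[OF bilinearD(1)[OF assms(1)]]) (auto intro: lin_closed)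
next
  fix b assume "b \<in> carrier B"
  then show "(\<lambda>a. F (f a) (g b)) \<in> lin A E"
    using lin_compose[OF bilinearD(2)[OF assms(1)] assms(2)] assms(3) by (auto intro: lin_closed)
qed

lemma tensor_map_lin:
  assumes "module K V" "module K W" "module K A" "module K B" "f \<in> lin A V" "g \<in> lin B W"
  shows "tensor_map K V W f g \<in> lin (A \<boxtimes> B) (V \<boxtimes> W)"
  unfolding tensor_map_lift using assms by (intro lift_lin module_tensor bilinear_pure_maps)

lemma tensor_map_pure:
  assumes "module K V" "module K W" "module K A" "module K B" "f \<in> lin A V" "g \<in> lin B W"
    "a \<in> carrier A" "b \<in> carrier B"
  shows "tensor_map K V W f g (pure A B a b) = pure V W (f a) (g b)"
  unfolding tensor_map_lift using assms by (simp add: lift_pure bilinear_pure_maps)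

lemma lift_tensor_map:
  assumes "module K V" "module K W" "module K A" "module K B" "module K E"
    "f \<in> lin A V" "g \<in> lin B W" "bilinear V W E F" "t \<in> carrier (A \<boxtimes> B)"
  shows "tensor_lift E F (tensor_map K V W f g t) = tensor_lift E (\<lambda>a b. F (f a) (g b)) t"
proof (rule lift_unique[where F = "\<lambda>t. tensor_lift E F (tensor_map K V W f g t)", symmetric])
  show "bilinear A B E (\<lambda>a b. F (f a) (g b))" by (rule bilinear_compose[OF assms(8,6,7)])
  show "(\<lambda>t. tensor_lift E F (tensor_map K V W f g t)) \<in> lin (A \<boxtimes> B) E"
    by (rule lin_compose[OF lift_lin[OF assms(1,2,5,8)] tensor_map_lin[OF assms(1-4,6,7)]])
qed (use assms in \<open>simp_all add: tensor_map_pure lift_pure lin_closed\<close>)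

lemma lift_lift:
  assumes "module K V" "module K W" "module K A" "module K B" "module K E"
    "bilinear A B (V \<boxtimes> W) g" "bilinear V W E F" "t \<in> carrier (A \<boxtimes> B)"
  shows "tensor_lift E F (tensor_lift (V \<boxtimes> W) g t) = tensor_lift E (\<lambda>a b. tensor_lift E F (g a b)) t"
  using assms by (intro hom_lift lift_lin) auto

text \<open>Both sides are biadditive in the two tensors and agree on pure tensors.\<close>

lemma lift_swap:
  assumes "module K V" "module K W" "module K A" "module K B" "module K E"
    and "\<And>v w. \<lbrakk>v \<in> carrier V; w \<in> carrier W\<rbrakk> \<Longrightarrow> bilinear A B E (f v w)"
    and "\<And>a b. \<lbrakk>a \<in> carrier A; b \<in> carrier B\<rbrakk> \<Longrightarrow> bilinear V W E (\<lambda>v w. f v w a b)"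
    and "t \<in> carrier (V \<boxtimes> W)" "t' \<in> carrier (A \<boxtimes> B)"
  shows "tensor_lift E (\<lambda>v w. tensor_lift E (\<lambda>a b. f v w a b) t') t =
    tensor_lift E (\<lambda>a b. tensor_lift E (\<lambda>v w. f v w a b) t) t'"
proof (rule lift_unique[where F = "\<lambda>t. tensor_lift E (\<lambda>a b. tensor_lift E (\<lambda>v w. f v w a b) t) t'"])
  note lin = bilinearD[OF assms(6)] bilinearD[OF assms(7)]
  show "bilinear V W E (\<lambda>v w. tensor_lift E (f v w) t')"
    using assms(1-5,9) by (intro bilinearI lin_lift_fun) (assumption | rule lin assms(6))+
  show "(\<lambda>t. tensor_lift E (\<lambda>a b. tensor_lift E (\<lambda>v w. f v w a b) t) t') \<in> lin (V \<boxtimes> W) E"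
    using assms(1-5,9) by (intro lin_lift_fun bilinearI) (assumption | rule lin assms(7) lift_lin module_tensor)+
  fix v w assume "v \<in> carrier V" "w \<in> carrier W"
  then show "tensor_lift E (\<lambda>a b. tensor_lift E (\<lambda>v w. f v w a b) (pure V W v w)) t' = tensor_lift E (f v w) t'"
    using assms by (intro lift_cong[of A B, symmetric]) (auto simp: lift_pure)
qed (use assms in auto)

declare tensor_space_simps [simp del]

lemma pure_in_tensor [simp, intro]:
  "\<lbrakk>module K V; module K W; v \<in> carrier V; w \<in> carrier W\<rbrakk> \<Longrightarrow> pure V W v w \<in> carrier (V \<boxtimes> W)"
  by (simp add: tensor_space_simps)

declare lin_ident [simp]

lemma id_lin [simp]: "id \<in> lin V V" by (rule linI) auto

lemma bilinear_lift_right: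
  assumes "module K U" "module K V" "module K W" "module K E" "trilinear U V W E F"
  shows "bilinear U (V \<boxtimes> W) E (\<lambda>u t. tensor_lift E (F u) t)"
proof (intro bilinearI)
  fix u assume "u \<in> carrier U"
  then show "(\<lambda>t. tensor_lift E (F u) t) \<in> lin (V \<boxtimes> W) E"
    using lift_lin[OF assms(2-4) trilinearD(1)[OF assms(5)]] by simp
next
  fix t assume t: "t \<in> carrier (V \<boxtimes> W)"
  show "(\<lambda>u. tensor_lift E (F u) t) \<in> lin U E"
    using bilinearD(2)[OF trilinearD(2)[OF assms(5)]]
    by (intro lin_lift_fun[OF assms(2-4) t assms(1)] trilinearD(1)[OF assms(5)])
qed

lemma bilinear_lift_left:
  assumes "module K U" "module K V" "module K W" "module K E" "trilinear U V W E F"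
  shows "bilinear (U \<boxtimes> V) W E (\<lambda>t w. tensor_lift E (\<lambda>u v. F u v w) t)"
proof (intro bilinearI)
  fix w assume "w \<in> carrier W"
  then show "(\<lambda>t. tensor_lift E (\<lambda>u v. F u v w) t) \<in> lin (U \<boxtimes> V) E"
    using lift_lin[OF assms(1,2,4) trilinearD(2)[OF assms(5)]] by simp
next
  fix t assume t: "t \<in> carrier (U \<boxtimes> V)"
  show "(\<lambda>w. tensor_lift E (\<lambda>u v. F u v w) t) \<in> lin W E"
    using bilinearD(1)[OF trilinearD(1)[OF assms(5)]]
    by (intro lin_lift_fun[OF assms(1,2,4) t assms(3)] trilinearD(2)[OF assms(5)])
qed

lemma trilinear_pure:
  assumes "module K U" "module K V" "module K W"
  shows "trilinear U V W (U \<boxtimes> V \<boxtimes> W) (\<lambda>u v w. pure U (V \<boxtimes> W) u (pure V W v w))"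
  using assms by (intro trilinearI linear_intros) auto

lemma assoc_right_lift:
  "assoc_right K U V W = tensor_lift (U \<boxtimes> V \<boxtimes> W)
     (\<lambda>t w. tensor_lift (U \<boxtimes> V \<boxtimes> W) (\<lambda>u v. pure U (V \<boxtimes> W) u (pure V W v w)) t)"
  by (simp add: assoc_right_def Let_def)

lemma assoc_right_tensor_map:
  assumes "module K U" "module K V" "module K W" "module K A" "\<rho> \<in> lin A (U \<boxtimes> V)" "t \<in> carrier (A \<boxtimes> W)"
  shows "assoc_right K U V W (tensor_map K (U \<boxtimes> V) W \<rho> id t) = tensor_lift (U \<boxtimes> V \<boxtimes> W)
     (\<lambda>a w. tensor_lift (U \<boxtimes> V \<boxtimes> W) (\<lambda>u v. pure U (V \<boxtimes> W) u (pure V W v w)) (\<rho> a)) t"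
  unfolding assoc_right_lift
  using lift_tensor_map[OF module_tensor[OF assms(1,2)] assms(3,4,3) _ assms(5) id_lin
      bilinear_lift_left[OF assms(1-3) _ trilinear_pure[OF assms(1-3)]] assms(6)] assms(1-3)
  by simp

lemma tensor_map_right_lift:
  assumes "module K U" "module K V" "module K W" "module K B" "\<delta> \<in> lin B (V \<boxtimes> W)" "t \<in> carrier (U \<boxtimes> B)"
  shows "tensor_map K U (V \<boxtimes> W) id \<delta> t = tensor_lift (U \<boxtimes> V \<boxtimes> W)
     (\<lambda>u b. tensor_lift (U \<boxtimes> V \<boxtimes> W) (\<lambda>v w. pure U (V \<boxtimes> W) u (pure V W v w)) (\<delta> b)) t"
  unfolding tensor_map_lift
proof (rule lift_cong[of U B])
  show "bilinear U B (U \<boxtimes> V \<boxtimes> W) (\<lambda>a b. pure U (V \<boxtimes> W) (id a) (\<delta> b))"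
    using assms by (intro bilinear_pure_maps id_lin) auto
  fix u b assume ub: "u \<in> carrier U" "b \<in> carrier B"
  then have b: "\<delta> b \<in> carrier (V \<boxtimes> W)" using assms(5) by (auto intro: lin_closed)
  have "pure U (V \<boxtimes> W) u (tensor_lift (V \<boxtimes> W) (pure V W) (\<delta> b)) =
      tensor_lift (U \<boxtimes> V \<boxtimes> W) (\<lambda>v w. pure U (V \<boxtimes> W) u (pure V W v w)) (\<delta> b)"
    using assms ub b by (intro hom_lift bilinear_pure linear_intros) auto
  then show "pure U (V \<boxtimes> W) (id u) (\<delta> b) =
      tensor_lift (U \<boxtimes> V \<boxtimes> W) (\<lambda>v w. pure U (V \<boxtimes> W) u (pure V W v w)) (\<delta> b)"
    using assms b by (simp add: lift_pure_id)
qed (use assms in auto)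

text \<open>
  Sweedler calculus: an identity in a threefold tensor product may be tested against an arbitrary
  trilinear map, in which case both of its sides are iterated lifts.
\<close>

lemma lift_lift_right:
  assumes "module K U" "module K V" "module K W" "module K B" "module K E"
    "\<delta> \<in> lin B (V \<boxtimes> W)" "t \<in> carrier (U \<boxtimes> B)" "trilinear U V W E F"
  shows "tensor_lift E (\<lambda>u s. tensor_lift E (F u) s) (tensor_map K U (V \<boxtimes> W) id \<delta> t) =
    tensor_lift E (\<lambda>u b. tensor_lift E (\<lambda>v w. F u v w) (\<delta> b)) t"
  using lift_tensor_map[OF assms(1) module_tensor[OF assms(2,3)] assms(1,4,5) id_lin assms(6)
      bilinear_lift_right[OF assms(1-3,5,8)] assms(7)] by simp

lemma lift_assoc_right:
  assumes "module K U" "module K V" "module K W" "module K A" "module K E"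
    "\<rho> \<in> lin A (U \<boxtimes> V)" "t \<in> carrier (A \<boxtimes> W)" "trilinear U V W E F"
  shows "tensor_lift E (\<lambda>u s. tensor_lift E (F u) s) (assoc_right K U V W (tensor_map K (U \<boxtimes> V) W \<rho> id t)) =
    tensor_lift E (\<lambda>a w. tensor_lift E (\<lambda>u v. F u v w) (\<rho> a)) t"
proof -
  let ?T = "U \<boxtimes> V \<boxtimes> W"
  let ?h = "\<lambda>s. tensor_lift E (\<lambda>u s. tensor_lift E (F u) s) s"
  note m = assms(1-5)
  have T: "module K ?T" using m by auto
  have h: "?h \<in> lin ?T E"
    by (rule lift_lin[OF m(1) module_tensor[OF m(2,3)] m(5) bilinear_lift_right[OF m(1-3,5) assms(8)]])
  have bil: "bilinear A W ?T (\<lambda>a w. tensor_lift ?T (\<lambda>u v. pure U (V \<boxtimes> W) u (pure V W v w)) (\<rho> a))"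
    using bilinear_compose[OF bilinear_lift_left[OF m(1-3) T trilinear_pure[OF m(1-3)]] assms(6) lin_ident] .
  have "?h (assoc_right K U V W (tensor_map K (U \<boxtimes> V) W \<rho> id t)) =
      tensor_lift E (\<lambda>a w. ?h (tensor_lift ?T (\<lambda>u v. pure U (V \<boxtimes> W) u (pure V W v w)) (\<rho> a))) t"
    unfolding assoc_right_tensor_map[OF m(1-4) assms(6,7)] by (rule hom_lift[OF m(4,3) T bil m(5) h assms(7)])
  also have "\<dots> = tensor_lift E (\<lambda>a w. tensor_lift E (\<lambda>u v. F u v w) (\<rho> a)) t"
  proof (rule lift_cong[OF m(4,3,5) _ _ assms(7)])
    show "bilinear A W E (\<lambda>a w. ?h (tensor_lift ?T (\<lambda>u v. pure U (V \<boxtimes> W) u (pure V W v w)) (\<rho> a)))"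
      using lin_compose[OF h bilinearD(1)[OF bil]] lin_compose[OF h bilinearD(2)[OF bil]] by (intro bilinearI)
    fix a w assume aw: "a \<in> carrier A" "w \<in> carrier W"
    then have a: "\<rho> a \<in> carrier (U \<boxtimes> V)" using assms(6) by (auto intro: lin_closed)
    have bil': "bilinear U V ?T (\<lambda>u v. pure U (V \<boxtimes> W) u (pure V W v w))"
      using trilinearD(2)[OF trilinear_pure[OF m(1-3)] aw(2)] .
    have "?h (tensor_lift ?T (\<lambda>u v. pure U (V \<boxtimes> W) u (pure V W v w)) (\<rho> a)) =
        tensor_lift E (\<lambda>u v. ?h (pure U (V \<boxtimes> W) u (pure V W v w))) (\<rho> a)"
      by (rule hom_lift[OF m(1,2) T bil' m(5) h a])
    also have "\<dots> = tensor_lift E (\<lambda>u v. F u v w) (\<rho> a)"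
    proof (rule lift_cong[OF m(1,2,5) trilinearD(2)[OF assms(8) aw(2)] _ a, symmetric])
      fix u v assume uv: "u \<in> carrier U" "v \<in> carrier V"
      then show "F u v w = ?h (pure U (V \<boxtimes> W) u (pure V W v w))"
        using m aw by (simp add: lift_pure[OF m(1) module_tensor[OF m(2,3)] m(5) bilinear_lift_right[OF m(1-3,5) assms(8)]]
          lift_pure[OF m(2,3,5) trilinearD(1)[OF assms(8)]])
    qed
    finally show "?h (tensor_lift ?T (\<lambda>u v. pure U (V \<boxtimes> W) u (pure V W v w)) (\<rho> a)) =
        tensor_lift E (\<lambda>u v. F u v w) (\<rho> a)" .
  qed
  finally show ?thesis .
qed

end

section \<open>Exactness\<close>

lemma exact_at_iff:
  "exact_at L M N f g \<longleftrightarrow> f ` carrier L = {x \<in> carrier M. g x = \<zero>\<^bsub>N\<^esub>}"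
  by (simp add: exact_at_def a_kernel_def')

text \<open>Diagram chase: exactness descends along a commutative retraction of three-term sequences.\<close>

lemma exact_at_retract:
  assumes exact: "exact_at L' M' N' f' g'"
    and maps: "f \<in> carrier L \<rightarrow> carrier M"
    and zero: "i\<^sub>N \<zero>\<^bsub>N\<^esub> = \<zero>\<^bsub>N'\<^esub>" "p\<^sub>N \<zero>\<^bsub>N'\<^esub> = \<zero>\<^bsub>N\<^esub>"
    and i: "i\<^sub>L \<in> carrier L \<rightarrow> carrier L'" "i\<^sub>M \<in> carrier M \<rightarrow> carrier M'"
    and p: "p\<^sub>L \<in> carrier L' \<rightarrow> carrier L"
    and retract: "\<And>x. x \<in> carrier M \<Longrightarrow> p\<^sub>M (i\<^sub>M x) = x" "\<And>x. x \<in> carrier N \<Longrightarrow> p\<^sub>N (i\<^sub>N x) = x"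
    and g: "g \<in> carrier M \<rightarrow> carrier N"
    and nat: "\<And>x. x \<in> carrier L \<Longrightarrow> i\<^sub>M (f x) = f' (i\<^sub>L x)" "\<And>x. x \<in> carrier M \<Longrightarrow> i\<^sub>N (g x) = g' (i\<^sub>M x)"
      "\<And>x. x \<in> carrier L' \<Longrightarrow> p\<^sub>M (f' x) = f (p\<^sub>L x)"
  shows "exact_at L M N f g"
proof -
  have ex: "f' ` carrier L' = {x \<in> carrier M'. g' x = \<zero>\<^bsub>N'\<^esub>}"
    using exact by (simp add: exact_at_iff)
  show ?thesis
    unfolding exact_at_iff
  proof (intro equalityI subsetI)
    fix y assume "y \<in> f ` carrier L"
    then obtain x where x: "x \<in> carrier L" "y = f x" by auto
    then have y: "y \<in> carrier M" using maps by auto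
    have "i\<^sub>N (g y) = g' (f' (i\<^sub>L x))" using nat x y by simp
    also have "\<dots> = \<zero>\<^bsub>N'\<^esub>" using ex i x by blast
    finally have "g y = \<zero>\<^bsub>N\<^esub>" using retract(2)[of "g y"] g y zero by (auto simp: Pi_iff)
    with y show "y \<in> {x \<in> carrier M. g x = \<zero>\<^bsub>N\<^esub>}" by simp
  next
    fix y assume "y \<in> {x \<in> carrier M. g x = \<zero>\<^bsub>N\<^esub>}"
    then have y: "y \<in> carrier M" "g y = \<zero>\<^bsub>N\<^esub>" by auto
    then have "i\<^sub>M y \<in> f' ` carrier L'"
      unfolding ex using nat(2)[OF y(1)] zero i by auto
    then obtain x where x: "x \<in> carrier L'" "i\<^sub>M y = f' x" by auto
    then have "y = f (p\<^sub>L x)" using retract(1)[OF y(1)] nat(3)[of x] by simp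
    then show "y \<in> f ` carrier L" using x p by auto
  qed
qed

context ground_field
begin

subsection \<open>Vector spaces\<close>

lemma submodule_kernel:
  assumes "module K V" "module K W" "T \<in> lin V W"
  shows "submodule {v \<in> carrier V. T v = \<zero>\<^bsub>W\<^esub>} K V"
proof -
  interpret V: module K V by fact
  interpret W: module K W by fact
  show ?thesis
    using assms
    by (intro V.submoduleI) (auto simp: lin_zero lin_minus[OF assms] lin_add[OF assms(3)] lin_smult[OF assms(3)])
qed

lemma submodule_image:
  assumes "module K V" "module K W" "T \<in> lin V W"
  shows "submodule (T ` carrier V) K W"
proof -
  interpret V: module K V by fact
  interpret W: module K W by fact
  show ?thesis
    using assms
    by (intro W.submoduleI)
      (auto simp: image_iff lin_closed simp flip: lin_zero[OF assms] lin_minus[OF assms] lin_add[OF assms(3)] lin_smult[OF assms(3)])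
qed

text \<open>
  By Zorn's lemma there is a maximal \<open>Q\<close> meeting \<open>S\<close> trivially; a vector \<open>v\<close> outside \<open>S + Q\<close> could be
  adjoined to \<open>Q\<close>, since scalars are invertible.
\<close>

lemma complement_exists:
  assumes "module K V" "submodule S K V"
  obtains Q where "submodule Q K V" "S \<inter> Q = {\<zero>\<^bsub>V\<^esub>}"
    "\<And>v. v \<in> carrier V \<Longrightarrow> \<exists>s\<in>S. \<exists>q\<in>Q. v = s \<oplus>\<^bsub>V\<^esub> q"
proof -
  interpret V: module K V by fact
  note S = V.submoduleE[OF assms(2)]
  have S0: "\<zero>\<^bsub>V\<^esub> \<in> S" using S(1,2,3,5) V.r_neg by (metis all_not_in_conv subsetD)
  let ?Q = "{Q. submodule Q K V \<and> S \<inter> Q = {\<zero>\<^bsub>V\<^esub>}}"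
  have zero_in: "\<zero>\<^bsub>V\<^esub> \<in> Q" if "submodule Q K V" for Q
    using V.submoduleE[OF that] V.r_neg by (metis all_not_in_conv subsetD)
  have "submodule {\<zero>\<^bsub>V\<^esub>} K V" by (intro V.submoduleI) auto
  then have ne: "?Q \<noteq> {}" using S0 by auto
  have "\<exists>M\<in>?Q. \<forall>Y\<in>?Q. M \<subseteq> Y \<longrightarrow> Y = M"
  proof (rule subset_Zorn_nonempty[OF ne])
    fix \<C> assume \<C>: "\<C> \<noteq> {}" "subset.chain ?Q \<C>"
    then have mem: "submodule Y K V" "S \<inter> Y = {\<zero>\<^bsub>V\<^esub>}" if "Y \<in> \<C>" for Y
      using that by (auto simp: subset.chain_def)
    have "submodule (\<Union>\<C>) K V"
    proof (rule V.submoduleI)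
      show "\<Union>\<C> \<subseteq> carrier V" using V.submoduleE(1)[OF mem(1)] by blast
      show "\<zero>\<^bsub>V\<^esub> \<in> \<Union>\<C>" using \<C>(1) zero_in mem by blast
      show "\<ominus>\<^bsub>V\<^esub> a \<in> \<Union>\<C>" if "a \<in> \<Union>\<C>" for a using that V.submoduleE(3)[OF mem(1)] by blast
      show "a \<odot>\<^bsub>V\<^esub> x \<in> \<Union>\<C>" if "a \<in> carrier K" "x \<in> \<Union>\<C>" for a x
        using that V.submoduleE(4)[OF mem(1)] by blast
      show "a \<oplus>\<^bsub>V\<^esub> b \<in> \<Union>\<C>" if ab: "a \<in> \<Union>\<C>" "b \<in> \<Union>\<C>" for a b
      proof -
        obtain A B where AB: "A \<in> \<C>" "a \<in> A" "B \<in> \<C>" "b \<in> B" using ab by auto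
        then consider "A \<subseteq> B" | "B \<subseteq> A" using \<C>(2) by (auto simp: subset.chain_def)
        then show ?thesis
          using AB V.submoduleE(5)[OF mem(1)] by (cases; meson UnionI subsetD)
      qed
    qed
    moreover have "S \<inter> \<Union>\<C> = {\<zero>\<^bsub>V\<^esub>}" using mem(2) \<C>(1) by blast
    ultimately show "\<Union>\<C> \<in> ?Q" by simp
  qed
  then obtain Q where Q: "submodule Q K V" "S \<inter> Q = {\<zero>\<^bsub>V\<^esub>}"
    and max: "\<And>Y. submodule Y K V \<Longrightarrow> S \<inter> Y = {\<zero>\<^bsub>V\<^esub>} \<Longrightarrow> Q \<subseteq> Y \<Longrightarrow> Y = Q"
    by auto
  note Qm = V.submoduleE[OF Q(1)]
  have Q0: "\<zero>\<^bsub>V\<^esub> \<in> Q" using zero_in Q by auto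
  have "\<exists>s\<in>S. \<exists>q\<in>Q. v = s \<oplus>\<^bsub>V\<^esub> q" if v: "v \<in> carrier V" for v
  proof (rule ccontr)
    assume no: "\<not> ?thesis"
    \<comment> \<open>The span of \<open>Q\<close> and \<open>v\<close> contradicts maximality.\<close>
    let ?X = "{q \<oplus>\<^bsub>V\<^esub> a \<odot>\<^bsub>V\<^esub> v | q a. q \<in> Q \<and> a \<in> carrier K}"
    have q_in: "q \<in> carrier V" if "q \<in> Q" for q using that Qm(1) by auto
    have s_in: "s \<in> carrier V" if "s \<in> S" for s using that S(1) by auto
    have "submodule ?X K V"
    proof (rule V.submoduleI)
      show "?X \<subseteq> carrier V" using v q_in by auto
      show "\<zero>\<^bsub>V\<^esub> \<in> ?X" using Q0 v by (auto intro!: exI[of _ "\<zero>\<^bsub>V\<^esub>"] exI[of _ \<zero>])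
    next
      fix x assume "x \<in> ?X"
      then obtain q a where "x = q \<oplus>\<^bsub>V\<^esub> a \<odot>\<^bsub>V\<^esub> v" "q \<in> Q" "a \<in> carrier K" by auto
      moreover then have "\<ominus>\<^bsub>V\<^esub> x = (\<ominus>\<^bsub>V\<^esub> q) \<oplus>\<^bsub>V\<^esub> (\<ominus> a) \<odot>\<^bsub>V\<^esub> v"
        using v q_in by (simp add: V.minus_add V.smult_l_minus)
      ultimately show "\<ominus>\<^bsub>V\<^esub> x \<in> ?X" using Qm(3) by blast
    next
      fix x y assume "x \<in> ?X" "y \<in> ?X"
      then obtain q a q' a' where *: "x = q \<oplus>\<^bsub>V\<^esub> a \<odot>\<^bsub>V\<^esub> v" "q \<in> Q" "a \<in> carrier K"
        "y = q' \<oplus>\<^bsub>V\<^esub> a' \<odot>\<^bsub>V\<^esub> v" "q' \<in> Q" "a' \<in> carrier K" by auto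
      then have "x \<oplus>\<^bsub>V\<^esub> y = (q \<oplus>\<^bsub>V\<^esub> q') \<oplus>\<^bsub>V\<^esub> (a \<oplus> a') \<odot>\<^bsub>V\<^esub> v"
        using v q_in by (simp add: V.smult_l_distr V.a_ac)
      then show "x \<oplus>\<^bsub>V\<^esub> y \<in> ?X" using * Qm(5) by blast
    next
      fix c x assume c: "c \<in> carrier K" and "x \<in> ?X"
      then obtain q a where *: "x = q \<oplus>\<^bsub>V\<^esub> a \<odot>\<^bsub>V\<^esub> v" "q \<in> Q" "a \<in> carrier K" by auto
      then have "c \<odot>\<^bsub>V\<^esub> x = c \<odot>\<^bsub>V\<^esub> q \<oplus>\<^bsub>V\<^esub> (c \<otimes> a) \<odot>\<^bsub>V\<^esub> v"
        using c v q_in by (simp add: V.smult_r_distr V.smult_assoc1)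
      then show "c \<odot>\<^bsub>V\<^esub> x \<in> ?X" using * c Qm(4) by blast
    qed
    moreover have "S \<inter> ?X = {\<zero>\<^bsub>V\<^esub>}"
    proof (intro equalityI subsetI)
      fix x assume "x \<in> S \<inter> ?X"
      then obtain q a where x: "x \<in> S" "x = q \<oplus>\<^bsub>V\<^esub> a \<odot>\<^bsub>V\<^esub> v" "q \<in> Q" "a \<in> carrier K" by auto
      have "a = \<zero>"
      proof (rule ccontr)
        assume "a \<noteq> \<zero>"
        then have a: "inv a \<in> carrier K" "inv a \<otimes> a = \<one>" using x(4) field_Units by auto
        have eq: "a \<odot>\<^bsub>V\<^esub> v = x \<oplus>\<^bsub>V\<^esub> \<ominus>\<^bsub>V\<^esub> q"
          using x(2-4) v q_in by (simp add: V.a_comm[of q "a \<odot>\<^bsub>V\<^esub> v"] V.a_assoc V.r_neg)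
        then have "inv a \<odot>\<^bsub>V\<^esub> (a \<odot>\<^bsub>V\<^esub> v) = inv a \<odot>\<^bsub>V\<^esub> x \<oplus>\<^bsub>V\<^esub> inv a \<odot>\<^bsub>V\<^esub> (\<ominus>\<^bsub>V\<^esub> q)"
          unfolding eq using V.smult_r_distr[of "inv a" x "\<ominus>\<^bsub>V\<^esub> q"] a(1) x(1,3) s_in q_in by simp
        then have "v = inv a \<odot>\<^bsub>V\<^esub> x \<oplus>\<^bsub>V\<^esub> inv a \<odot>\<^bsub>V\<^esub> (\<ominus>\<^bsub>V\<^esub> q)"
          using a v x(4) by (simp flip: V.smult_assoc1)
        then show False using no x a Qm(3,4) S(4) by blast
      qed
      then have "x = q" using x v q_in by simp
      then show "x \<in> {\<zero>\<^bsub>V\<^esub>}" using x Q(2) by auto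
    next
      fix x assume "x \<in> {\<zero>\<^bsub>V\<^esub>}"
      moreover have "\<zero>\<^bsub>V\<^esub> = \<zero>\<^bsub>V\<^esub> \<oplus>\<^bsub>V\<^esub> \<zero> \<odot>\<^bsub>V\<^esub> v" using v by simp
      ultimately show "x \<in> S \<inter> ?X" using S0 Q0 K.zero_closed by blast
    qed
    moreover have "Q \<subseteq> ?X"
    proof
      fix q assume "q \<in> Q"
      moreover then have "q = q \<oplus>\<^bsub>V\<^esub> \<zero> \<odot>\<^bsub>V\<^esub> v" using v q_in by simp
      ultimately show "q \<in> ?X" using K.zero_closed by blast
    qed
    ultimately have "?X = Q" by (rule max)
    moreover have "v = \<zero>\<^bsub>V\<^esub> \<oplus>\<^bsub>V\<^esub> \<one> \<odot>\<^bsub>V\<^esub> v" using v by simp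
    then have "v \<in> ?X" using Q0 K.one_closed by blast
    ultimately have "v \<in> Q" by simp
    moreover have "v = \<zero>\<^bsub>V\<^esub> \<oplus>\<^bsub>V\<^esub> v" using v by simp
    ultimately show False using no S0 by blast
  qed
  with Q show thesis by (rule that)
qed

text \<open>
  Choose complements \<open>Q\<close> of the kernel and \<open>D\<close> of the image: \<open>u\<close> inverts the isomorphism from \<open>Q\<close> onto the
  image and kills \<open>D\<close>.  This one statement yields projections onto kernels, sections of surjections
  and the exactness of tensoring with a vector space.
\<close>

lemma generalised_inverse:
  assumes "module K V" "module K W" "T \<in> lin V W"
  obtains u where "u \<in> lin W V" "\<And>v. v \<in> carrier V \<Longrightarrow> T (u (T v)) = T v"
proof -
  interpret V: module K V by fact
  interpret W: module K W by fact
  note T = lin_closed[OF assms(3)] lin_add[OF assms(3)] lin_smult[OF assms(3)] lin_minus[OF assms] lin_zero[OF assms]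
  obtain Q where Q: "submodule Q K V" "{v \<in> carrier V. T v = \<zero>\<^bsub>W\<^esub>} \<inter> Q = {\<zero>\<^bsub>V\<^esub>}"
    and Q_span: "\<And>v. v \<in> carrier V \<Longrightarrow> \<exists>s\<in>{v \<in> carrier V. T v = \<zero>\<^bsub>W\<^esub>}. \<exists>q\<in>Q. v = s \<oplus>\<^bsub>V\<^esub> q"
    using complement_exists[OF assms(1) submodule_kernel[OF assms]] by blast
  obtain D where D: "submodule D K W" "T ` carrier V \<inter> D = {\<zero>\<^bsub>W\<^esub>}"
    and D_span: "\<And>w. w \<in> carrier W \<Longrightarrow> \<exists>s\<in>T ` carrier V. \<exists>d\<in>D. w = s \<oplus>\<^bsub>W\<^esub> d"
    using complement_exists[OF assms(2) submodule_image[OF assms]] by blast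
  note Qm = V.submoduleE[OF Q(1)] and Dm = W.submoduleE[OF D(1)]
  have Q_in: "q \<in> carrier V" if "q \<in> Q" for q using that Qm(1) by auto
  have D_in: "d \<in> carrier W" if "d \<in> D" for d using that Dm(1) by auto
  have D0: "\<zero>\<^bsub>W\<^esub> \<in> D" using D(2) by blast
  have ex: "\<exists>q\<in>Q. \<exists>d\<in>D. w = T q \<oplus>\<^bsub>W\<^esub> d" if w: "w \<in> carrier W" for w
  proof -
    obtain v d where "v \<in> carrier V" "d \<in> D" "w = T v \<oplus>\<^bsub>W\<^esub> d" using D_span[OF w] by auto
    moreover then obtain s q where "s \<in> carrier V" "T s = \<zero>\<^bsub>W\<^esub>" "q \<in> Q" "v = s \<oplus>\<^bsub>V\<^esub> q"
      using Q_span by blast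
    ultimately show ?thesis using Q_in by (intro bexI[of _ q] bexI[of _ d]) (auto simp: T)
  qed
  have unique: "q = q'"
    if "q \<in> Q" "q' \<in> Q" "d \<in> D" "d' \<in> D" "T q \<oplus>\<^bsub>W\<^esub> d = T q' \<oplus>\<^bsub>W\<^esub> d'" for q q' d d'
  proof -
    note in_carrier = that(1,2)[THEN Q_in] that(3,4)[THEN D_in]
    let ?q = "q \<oplus>\<^bsub>V\<^esub> \<ominus>\<^bsub>V\<^esub> q'"
    have "T ?q = T q \<oplus>\<^bsub>W\<^esub> d \<oplus>\<^bsub>W\<^esub> \<ominus>\<^bsub>W\<^esub> d \<oplus>\<^bsub>W\<^esub> \<ominus>\<^bsub>W\<^esub> T q'"
      using in_carrier by (simp add: T W.a_assoc W.r_neg)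
    also have "\<dots> = T q' \<oplus>\<^bsub>W\<^esub> d' \<oplus>\<^bsub>W\<^esub> \<ominus>\<^bsub>W\<^esub> d \<oplus>\<^bsub>W\<^esub> \<ominus>\<^bsub>W\<^esub> T q'"
      using that(5) by simp
    also have "\<dots> = (d' \<oplus>\<^bsub>W\<^esub> \<ominus>\<^bsub>W\<^esub> d) \<oplus>\<^bsub>W\<^esub> (T q' \<oplus>\<^bsub>W\<^esub> \<ominus>\<^bsub>W\<^esub> T q')"
      using in_carrier T(1) by (simp add: W.a_ac del: W.r_neg)
    also have "\<dots> = d' \<oplus>\<^bsub>W\<^esub> \<ominus>\<^bsub>W\<^esub> d"
      using in_carrier T(1) by (simp add: W.r_neg)
    finally have "T ?q = d' \<oplus>\<^bsub>W\<^esub> \<ominus>\<^bsub>W\<^esub> d" .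
    moreover have "d' \<oplus>\<^bsub>W\<^esub> \<ominus>\<^bsub>W\<^esub> d \<in> D" using Dm(3,5) that by simp
    moreover have "?q \<in> Q" using Qm(3,5) that by simp
    ultimately have "T ?q = \<zero>\<^bsub>W\<^esub>" using D(2) Q_in by (metis IntI image_eqI singletonD)
    then have "?q = \<zero>\<^bsub>V\<^esub>" using Q(2) \<open>?q \<in> Q\<close> Q_in by blast
    then show ?thesis using in_carrier by (metis V.minus_equality V.minus_minus V.a_inv_closed)
  qed
  define u where "u w = (THE q. q \<in> Q \<and> (\<exists>d\<in>D. w = T q \<oplus>\<^bsub>W\<^esub> d))" for w
  have u_eq: "u (T q \<oplus>\<^bsub>W\<^esub> d) = q" if "q \<in> Q" "d \<in> D" for q d
    unfolding u_def using that unique by (intro the_equality) blast+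
  have u_obtain: "\<exists>q\<in>Q. \<exists>d\<in>D. w = T q \<oplus>\<^bsub>W\<^esub> d \<and> u w = q" if "w \<in> carrier W" for w
    using ex[OF that] u_eq by blast
  have "u \<in> lin W V"
  proof (rule linI)
    fix w assume w: "w \<in> carrier W"
    then obtain q d where q: "q \<in> Q" "d \<in> D" "w = T q \<oplus>\<^bsub>W\<^esub> d" "u w = q" using u_obtain by blast
    then show "u w \<in> carrier V" using Q_in by simp
    { fix w' assume "w' \<in> carrier W"
      then obtain q' d' where q': "q' \<in> Q" "d' \<in> D" "w' = T q' \<oplus>\<^bsub>W\<^esub> d'" "u w' = q'" using u_obtain by blast
      have "w \<oplus>\<^bsub>W\<^esub> w' = T (q \<oplus>\<^bsub>V\<^esub> q') \<oplus>\<^bsub>W\<^esub> (d \<oplus>\<^bsub>W\<^esub> d')"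
        using q q' Q_in D_in by (simp add: T W.a_ac)
      then show "u (w \<oplus>\<^bsub>W\<^esub> w') = u w \<oplus>\<^bsub>V\<^esub> u w'"
        using q q' Qm(5) Dm(5) by (simp add: u_eq) }
    fix a assume a: "a \<in> carrier K"
    have "a \<odot>\<^bsub>W\<^esub> w = T (a \<odot>\<^bsub>V\<^esub> q) \<oplus>\<^bsub>W\<^esub> a \<odot>\<^bsub>W\<^esub> d"
      using q a Q_in D_in by (simp add: T W.smult_r_distr)
    then show "u (a \<odot>\<^bsub>W\<^esub> w) = a \<odot>\<^bsub>V\<^esub> u w"
      using q a Qm(4) Dm(4) by (simp add: u_eq)
  qed
  moreover have "T (u (T v)) = T v" if v: "v \<in> carrier V" for v
  proof -
    obtain s q where "s \<in> carrier V" "T s = \<zero>\<^bsub>W\<^esub>" "q \<in> Q" "v = s \<oplus>\<^bsub>V\<^esub> q"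
      using Q_span[OF v] by blast
    then have q: "q \<in> Q" "T v = T q \<oplus>\<^bsub>W\<^esub> \<zero>\<^bsub>W\<^esub>" using Q_in by (auto simp: T)
    show ?thesis using q u_eq[OF q(1) D0] Q_in T by simp
  qed
  ultimately show thesis by (rule that)
qed

lemma linear_section:
  assumes "module K V" "module K W" "T \<in> lin V W" "T ` carrier V = carrier W"
  obtains u where "u \<in> lin W V" "\<And>w. w \<in> carrier W \<Longrightarrow> T (u w) = w"
  using generalised_inverse[OF assms(1-3)] assms(4) by (metis imageE)

end

lemma exact_at_split:
  assumes "abelian_group M" "abelian_group N" "f \<in> add_hom L M" "g \<in> add_hom M N" "u \<in> add_hom N M"
    and "p \<in> carrier M \<rightarrow> carrier L"
    and zero: "\<And>x. x \<in> carrier L \<Longrightarrow> g (f x) = \<zero>\<^bsub>N\<^esub>"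
    and split: "\<And>x. x \<in> carrier M \<Longrightarrow> f (p x) \<oplus>\<^bsub>M\<^esub> u (g x) = x"
  shows "exact_at L M N f g"
proof -
  interpret M: abelian_group M by fact
  have "x \<in> f ` carrier L" if "x \<in> carrier M" "g x = \<zero>\<^bsub>N\<^esub>" for x
  proof -
    have "p x \<in> carrier L" using assms(6) that by auto
    moreover have "f (p x) = x"
      using split[OF that(1)] that(2) add_hom_zero[OF assms(2,1,5)] add_hom_closed[OF assms(3) \<open>p x \<in> carrier L\<close>] by simp
    ultimately show ?thesis by force
  qed
  then show ?thesis
    using assms(3) zero by (auto simp: exact_at_iff intro: add_hom_closed)
qed

context ground_field
begin

text \<open>
  Exactness over a field is equational: with the maps \<open>p\<close> and \<open>u\<close>, a contracting homotopy at \<open>M\<close>, it is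
  preserved by every additive functor.
\<close>

lemma exact_at_splitting:
  assumes "module K L" "module K M" "module K N" "f \<in> lin L M" "g \<in> lin M N" "exact_at L M N f g"
  obtains p u where "p \<in> lin M L" "u \<in> lin N M" "\<And>x. x \<in> carrier L \<Longrightarrow> g (f x) = \<zero>\<^bsub>N\<^esub>"
    "\<And>x. x \<in> carrier M \<Longrightarrow> f (p x) \<oplus>\<^bsub>M\<^esub> u (g x) = x"
proof -
  interpret M: module K M by fact
  interpret N: module K N by fact
  obtain u where u: "u \<in> lin N M" "\<And>x. x \<in> carrier M \<Longrightarrow> g (u (g x)) = g x"
    using generalised_inverse[OF assms(2,3,5)] by blast
  obtain w where w: "w \<in> lin M L" "\<And>x. x \<in> carrier L \<Longrightarrow> f (w (f x)) = f x"
    using generalised_inverse[OF assms(1,2,4)] by blast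
  have ug: "(\<lambda>x. u (g x)) \<in> lin M M" by (rule lin_compose[OF u(1) assms(5)])
  have h: "(\<lambda>x. x \<ominus>\<^bsub>M\<^esub> u (g x)) \<in> lin M M"
    using assms(2) ug by (intro lin_difference) simp_all
  have zero: "g (f x) = \<zero>\<^bsub>N\<^esub>" if "x \<in> carrier L" for x
    using assms(6) that by (auto simp: exact_at_iff)
  have "f (w (x \<ominus>\<^bsub>M\<^esub> u (g x))) \<oplus>\<^bsub>M\<^esub> u (g x) = x" if x: "x \<in> carrier M" for x
  proof -
    have cl: "u (g x) \<in> carrier M" "g x \<in> carrier N" using x lin_closed[OF ug] lin_closed[OF assms(5)] by auto
    have "g (x \<ominus>\<^bsub>M\<^esub> u (g x)) = \<zero>\<^bsub>N\<^esub>"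
      using x cl by (simp add: lin_diff[OF assms(2,3,5)] u(2) N.minus_eq N.r_neg)
    then have "x \<ominus>\<^bsub>M\<^esub> u (g x) \<in> f ` carrier L"
      using assms(6) x cl by (auto simp: exact_at_iff)
    then have "f (w (x \<ominus>\<^bsub>M\<^esub> u (g x))) = x \<ominus>\<^bsub>M\<^esub> u (g x)" using w(2) by auto
    then show ?thesis using x cl by (simp add: M.minus_eq M.a_assoc M.l_neg)
  qed
  then show thesis using that[OF lin_compose[OF w(1) h] u(1) zero] by simp
qed

lemma exact_at_tensor_space:
  "exact_at (tensor_group K V L) (tensor_group K V' M) (tensor_group K V'' N) f g \<longleftrightarrow>
    exact_at (V \<boxtimes> L) (V' \<boxtimes> M) (V'' \<boxtimes> N) f g"
  by (simp add: exact_at_iff tensor_space_simps)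

text \<open>
  The identities of a contracting homotopy hold on a tensor product once they hold on pure tensors.
  The two tensor factors are treated alike, so that tensoring on either side is an instance.
\<close>

lemma exact_at_tensor_maps:
  assumes mods: "module K L" "module K L'" "module K M" "module K M'" "module K N" "module K N'"
    and lin: "f \<in> lin L M" "f' \<in> lin L' M'" "g \<in> lin M N" "g' \<in> lin M' N'"
      "p \<in> lin M L" "p' \<in> lin M' L'" "u \<in> lin N M" "u' \<in> lin N' M'"
    and zero: "\<And>x y. x \<in> carrier L \<Longrightarrow> y \<in> carrier L' \<Longrightarrow> pure N N' (g (f x)) (g' (f' y)) = \<zero>\<^bsub>N \<boxtimes> N'\<^esub>"
    and split: "\<And>x y. x \<in> carrier M \<Longrightarrow> y \<in> carrier M' \<Longrightarrow>
       pure M M' (f (p x)) (f' (p' y)) \<oplus>\<^bsub>M \<boxtimes> M'\<^esub> pure M M' (u (g x)) (u' (g' y)) = pure M M' x y"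
  shows "exact_at (L \<boxtimes> L') (M \<boxtimes> M') (N \<boxtimes> N') (tensor_map K M M' f f') (tensor_map K N N' g g')"
proof (rule exact_at_split[where p = "tensor_map K L L' p p'" and u = "tensor_map K M M' u u'"])
  note F = tensor_map_lin[OF mods(3,4,1,2) lin(1,2)] and G = tensor_map_lin[OF mods(5,6,3,4) lin(3,4)]
    and Q = tensor_map_lin[OF mods(1,2,3,4) lin(5,6)] and U = tensor_map_lin[OF mods(3,4,5,6) lin(7,8)]
  note tp = tensor_map_pure[OF mods(3,4,1,2) lin(1,2)] tensor_map_pure[OF mods(5,6,3,4) lin(3,4)]
    tensor_map_pure[OF mods(1,2,3,4) lin(5,6)] tensor_map_pure[OF mods(3,4,5,6) lin(7,8)]
  note cl = lin[THEN lin_closed]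
  note T = module_tensor[OF mods(1,2)] module_tensor[OF mods(3,4)] module_tensor[OF mods(5,6)]
  show "abelian_group (M \<boxtimes> M')" "abelian_group (N \<boxtimes> N')" using T by (auto intro: module_abelian)
  show "tensor_map K M M' f f' \<in> add_hom (L \<boxtimes> L') (M \<boxtimes> M')" "tensor_map K N N' g g' \<in> add_hom (M \<boxtimes> M') (N \<boxtimes> N')"
    "tensor_map K M M' u u' \<in> add_hom (N \<boxtimes> N') (M \<boxtimes> M')"
    using F G U by (auto intro: lin_add_hom)
  show "tensor_map K L L' p p' \<in> carrier (M \<boxtimes> M') \<rightarrow> carrier (L \<boxtimes> L')" using Q by (auto intro: lin_closed)
  interpret NN: module K "N \<boxtimes> N'" by (rule T)
  fix t assume "t \<in> carrier (L \<boxtimes> L')"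
  then show "tensor_map K N N' g g' (tensor_map K M M' f f' t) = \<zero>\<^bsub>N \<boxtimes> N'\<^esub>"
  proof (rule tensor_lin_ext[OF mods(1,2) T(3) lin_compose[OF G F], rotated 2])
    show "(\<lambda>t. \<zero>\<^bsub>N \<boxtimes> N'\<^esub>) \<in> lin (L \<boxtimes> L') (N \<boxtimes> N')" by (rule linI) auto
  qed (simp add: tp cl zero)
next
  note F = tensor_map_lin[OF mods(3,4,1,2) lin(1,2)] and G = tensor_map_lin[OF mods(5,6,3,4) lin(3,4)]
    and Q = tensor_map_lin[OF mods(1,2,3,4) lin(5,6)] and U = tensor_map_lin[OF mods(3,4,5,6) lin(7,8)]
  note tp = tensor_map_pure[OF mods(3,4,1,2) lin(1,2)] tensor_map_pure[OF mods(5,6,3,4) lin(3,4)]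
    tensor_map_pure[OF mods(1,2,3,4) lin(5,6)] tensor_map_pure[OF mods(3,4,5,6) lin(7,8)]
  note cl = lin[THEN lin_closed]
  note T = module_tensor[OF mods(3,4)]
  fix t assume "t \<in> carrier (M \<boxtimes> M')"
  then show "tensor_map K M M' f f' (tensor_map K L L' p p' t) \<oplus>\<^bsub>M \<boxtimes> M'\<^esub> tensor_map K M M' u u' (tensor_map K N N' g g' t) = t"
    by (rule tensor_lin_ext[OF mods(3,4) T lin_sum[OF T lin_compose[OF F Q] lin_compose[OF U G]] lin_ident, rotated])
      (simp add: tp cl split)
qed

lemma pure_zero:
  assumes "module K V" "module K W"
  shows "w \<in> carrier W \<Longrightarrow> pure V W \<zero>\<^bsub>V\<^esub> w = \<zero>\<^bsub>V \<boxtimes> W\<^esub>" "v \<in> carrier V \<Longrightarrow> pure V W v \<zero>\<^bsub>W\<^esub> = \<zero>\<^bsub>V \<boxtimes> W\<^esub>"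
  using lin_zero[OF assms(1) module_tensor[OF assms] bilinearD(2)[OF bilinear_pure[OF assms]]]
    lin_zero[OF assms(2) module_tensor[OF assms] bilinearD(1)[OF bilinear_pure[OF assms]]] by auto

lemma exact_tensor_left:
  assumes "module K V" "module K L" "module K M" "module K N" "f \<in> lin L M" "g \<in> lin M N" "exact_at L M N f g"
  shows "exact_at (V \<boxtimes> L) (V \<boxtimes> M) (V \<boxtimes> N) (tensor_map K V M id f) (tensor_map K V N id g)"
proof -
  obtain p u where pu: "p \<in> lin M L" "u \<in> lin N M" "\<And>x. x \<in> carrier L \<Longrightarrow> g (f x) = \<zero>\<^bsub>N\<^esub>"
    "\<And>x. x \<in> carrier M \<Longrightarrow> f (p x) \<oplus>\<^bsub>M\<^esub> u (g x) = x"
    using exact_at_splitting[OF assms(2-)] by blast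
  have "f (p y) \<in> carrier M" "u (g y) \<in> carrier M" if "y \<in> carrier M" for y
    using that lin_closed[OF lin_compose[OF assms(5) pu(1)]] lin_closed[OF lin_compose[OF pu(2) assms(6)]] by auto
  then show ?thesis
    using assms pu
    by (intro exact_at_tensor_maps[where p = id and p' = p and u = id and u' = u])
      (auto simp: pure_zero pu(4) simp flip: bilinear_add(2)[OF bilinear_pure])
qed

lemma exact_tensor_right:
  assumes "module K V" "module K L" "module K M" "module K N" "f \<in> lin L M" "g \<in> lin M N" "exact_at L M N f g"
  shows "exact_at (L \<boxtimes> V) (M \<boxtimes> V) (N \<boxtimes> V) (tensor_map K M V f id) (tensor_map K N V g id)"
proof -
  obtain p u where pu: "p \<in> lin M L" "u \<in> lin N M" "\<And>x. x \<in> carrier L \<Longrightarrow> g (f x) = \<zero>\<^bsub>N\<^esub>"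
    "\<And>x. x \<in> carrier M \<Longrightarrow> f (p x) \<oplus>\<^bsub>M\<^esub> u (g x) = x"
    using exact_at_splitting[OF assms(2-)] by blast
  have "f (p y) \<in> carrier M" "u (g y) \<in> carrier M" if "y \<in> carrier M" for y
    using that lin_closed[OF lin_compose[OF assms(5) pu(1)]] lin_closed[OF lin_compose[OF pu(2) assms(6)]] by auto
  then show ?thesis
    using assms pu
    by (intro exact_at_tensor_maps[where p = p and p' = id and u = u and u' = id])
      (auto simp: pure_zero pu(4) simp flip: bilinear_add(1)[OF bilinear_pure])
qed

end

section \<open>Modules that are projective relative to the ground field\<close>

lemma opposite_simps [simp]:
  "carrier (opposite R) = carrier R" "ring.add (opposite R) = ring.add R" "ring.zero (opposite R) = ring.zero R"
  "one (opposite R) = one R" "monoid.mult (opposite R) x y = y \<otimes>\<^bsub>R\<^esub> x"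
  by (simp_all add: opposite_def)

lemma smult_opposite [simp]: "smult (opposite R) = smult R"
  by (simp add: opposite_def)

lemma opposite_opposite [simp]: "opposite (opposite R) = R"
  by (simp add: opposite_def)

lemma ring_opposite:
  assumes "ring R"
  shows "ring (opposite R)"
proof -
  interpret R: ring R by fact
  have "abelian_group (opposite R)"
  proof (rule abelian_groupI)
    show "\<exists>y\<in>carrier (opposite R). y \<oplus>\<^bsub>opposite R\<^esub> x = \<zero>\<^bsub>opposite R\<^esub>" if "x \<in> carrier (opposite R)" for x
      using that R.l_neg R.a_inv_closed by (intro bexI[of _ "\<ominus>\<^bsub>R\<^esub> x"]) simp_all
  qed (simp_all add: R.a_ac)
  moreover have "monoid (opposite R)" by (rule monoidI) (simp_all add: R.m_assoc)
  ultimately show ?thesis by (rule ringI) (simp_all add: R.l_distr R.r_distr)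
qed

lemma module_hom_opposite [simp]: "module_hom (opposite R) = module_hom R"
  by (intro ext) (simp add: module_hom_def)

lemma tensor_group_opposite [simp]: "tensor_group (opposite R) = tensor_group R"
  by (intro ext) (simp add: tensor_group_def tensor_null_def tensor_relators_def)

lemma tensor_map_opposite [simp]: "tensor_map (opposite R) = tensor_map R"
  by (intro ext) (simp add: tensor_map_def pure_tensor_def tensor_null_def tensor_relators_def)

lemma scalars_simps [simp]:
  "carrier (scalars A M) = carrier M" "ring.add (scalars A M) = ring.add M" "ring.zero (scalars A M) = ring.zero M"
  "a \<odot>\<^bsub>scalars A M\<^esub> m = (a \<odot>\<^bsub>A\<^esub> \<one>\<^bsub>A\<^esub>) \<odot>\<^bsub>M\<^esub> m"
  by (simp_all add: scalars_def with_smult_def)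

text \<open>
  Statements about right modules are obtained from those about left modules over the opposite
  algebra.
\<close>

lemma assoc_algebra_opposite: "assoc_algebra K A \<Longrightarrow> assoc_algebra K (opposite A)"
proof -
  assume A: "assoc_algebra K A"
  then interpret A: module K A by (simp add: assoc_algebra_def)
  have ring: "ring (opposite A)" using A by (intro ring_opposite) (simp add: assoc_algebra_def)
  then have "module K (opposite A)"
    using ring.is_abelian_group[OF ring]
    by (intro moduleI) (simp_all add: A.is_cring A.smult_l_distr A.smult_r_distr A.smult_assoc1)
  moreover have "a \<odot>\<^bsub>A\<^esub> (y \<otimes>\<^bsub>A\<^esub> x) = (a \<odot>\<^bsub>A\<^esub> y) \<otimes>\<^bsub>A\<^esub> x" "a \<odot>\<^bsub>A\<^esub> (y \<otimes>\<^bsub>A\<^esub> x) = y \<otimes>\<^bsub>A\<^esub> (a \<odot>\<^bsub>A\<^esub> x)"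
    if "a \<in> carrier K" "x \<in> carrier A" "y \<in> carrier A" for a x y
    using A that unfolding assoc_algebra_def by metis+
  ultimately show ?thesis
    unfolding assoc_algebra_def opposite_simps smult_opposite using ring by blast
qed

lemma assoc_algebra_scalar:
  assumes "assoc_algebra K A" "a \<in> carrier K" "x \<in> carrier A"
  shows "(a \<odot>\<^bsub>A\<^esub> \<one>\<^bsub>A\<^esub>) \<otimes>\<^bsub>A\<^esub> x = a \<odot>\<^bsub>A\<^esub> x" "x \<otimes>\<^bsub>A\<^esub> (a \<odot>\<^bsub>A\<^esub> \<one>\<^bsub>A\<^esub>) = a \<odot>\<^bsub>A\<^esub> x"
    "a \<odot>\<^bsub>A\<^esub> \<one>\<^bsub>A\<^esub> \<in> carrier A"
proof -
  interpret M: module K A using assms(1) by (simp add: assoc_algebra_def)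
  interpret A: ring A using assms(1) by (simp add: assoc_algebra_def)
  have alg: "a \<odot>\<^bsub>A\<^esub> (x \<otimes>\<^bsub>A\<^esub> y) = (a \<odot>\<^bsub>A\<^esub> x) \<otimes>\<^bsub>A\<^esub> y" "a \<odot>\<^bsub>A\<^esub> (x \<otimes>\<^bsub>A\<^esub> y) = x \<otimes>\<^bsub>A\<^esub> (a \<odot>\<^bsub>A\<^esub> y)"
    if "x \<in> carrier A" "y \<in> carrier A" for x y
    using assms(1,2) that unfolding assoc_algebra_def by blast+
  have "a \<odot>\<^bsub>A\<^esub> (\<one>\<^bsub>A\<^esub> \<otimes>\<^bsub>A\<^esub> x) = (a \<odot>\<^bsub>A\<^esub> \<one>\<^bsub>A\<^esub>) \<otimes>\<^bsub>A\<^esub> x" "a \<odot>\<^bsub>A\<^esub> (x \<otimes>\<^bsub>A\<^esub> \<one>\<^bsub>A\<^esub>) = x \<otimes>\<^bsub>A\<^esub> (a \<odot>\<^bsub>A\<^esub> \<one>\<^bsub>A\<^esub>)"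
    using alg(1)[of "\<one>\<^bsub>A\<^esub>" x] alg(2)[of x "\<one>\<^bsub>A\<^esub>"] assms(3) A.one_closed by metis+
  then show "(a \<odot>\<^bsub>A\<^esub> \<one>\<^bsub>A\<^esub>) \<otimes>\<^bsub>A\<^esub> x = a \<odot>\<^bsub>A\<^esub> x" "x \<otimes>\<^bsub>A\<^esub> (a \<odot>\<^bsub>A\<^esub> \<one>\<^bsub>A\<^esub>) = a \<odot>\<^bsub>A\<^esub> x"
    using assms(3) by (metis A.l_one, metis A.r_one)
  show "a \<odot>\<^bsub>A\<^esub> \<one>\<^bsub>A\<^esub> \<in> carrier A" using assms by simp
qed

lemma left_moduleD:
  assumes "left_module R M"
  shows "ring R" "abelian_group M"
    and "\<And>a x. \<lbrakk>a \<in> carrier R; x \<in> carrier M\<rbrakk> \<Longrightarrow> a \<odot>\<^bsub>M\<^esub> x \<in> carrier M"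
    and "\<And>a b x. \<lbrakk>a \<in> carrier R; b \<in> carrier R; x \<in> carrier M\<rbrakk> \<Longrightarrow>
      (a \<oplus>\<^bsub>R\<^esub> b) \<odot>\<^bsub>M\<^esub> x = a \<odot>\<^bsub>M\<^esub> x \<oplus>\<^bsub>M\<^esub> b \<odot>\<^bsub>M\<^esub> x"
    and "\<And>a x y. \<lbrakk>a \<in> carrier R; x \<in> carrier M; y \<in> carrier M\<rbrakk> \<Longrightarrow>
      a \<odot>\<^bsub>M\<^esub> (x \<oplus>\<^bsub>M\<^esub> y) = a \<odot>\<^bsub>M\<^esub> x \<oplus>\<^bsub>M\<^esub> a \<odot>\<^bsub>M\<^esub> y"
    and "\<And>a b x. \<lbrakk>a \<in> carrier R; b \<in> carrier R; x \<in> carrier M\<rbrakk> \<Longrightarrow>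
      (a \<otimes>\<^bsub>R\<^esub> b) \<odot>\<^bsub>M\<^esub> x = a \<odot>\<^bsub>M\<^esub> (b \<odot>\<^bsub>M\<^esub> x)"
    and "\<And>x. x \<in> carrier M \<Longrightarrow> \<one>\<^bsub>R\<^esub> \<odot>\<^bsub>M\<^esub> x = x"
proof -
  interpret left_module R M by fact
  show "ring R" "abelian_group M" ..
qed (fact left_module.smult_closed[OF assms] left_module.smult_l_distr[OF assms] left_module.smult_r_distr[OF assms]
  left_module.smult_assoc[OF assms] left_module.smult_one[OF assms])+

lemma left_module_smult_group: "left_module R M \<Longrightarrow> smult_group R M"
  by (simp add: smult_group_def left_moduleD)

lemma right_module_smult_group: "right_module R M \<Longrightarrow> smult_group R M"
  using left_module_smult_group[of "opposite R" M] by (simp add: right_module_def smult_group_def)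

context ground_field
begin

lemma bilinear_hom:
  assumes "bilinear V W E f" "h \<in> lin E E'"
  shows "bilinear V W E' (\<lambda>v w. h (f v w))"
  using lin_compose[OF assms(2) bilinearD(1)[OF assms(1)]] lin_compose[OF assms(2) bilinearD(2)[OF assms(1)]]
  by (rule bilinearI)

lemma algebraD:
  assumes "assoc_algebra K A"
  shows "module K A" "ring A"
    and "\<And>a x y. \<lbrakk>a \<in> carrier K; x \<in> carrier A; y \<in> carrier A\<rbrakk> \<Longrightarrow> (a \<odot>\<^bsub>A\<^esub> x) \<otimes>\<^bsub>A\<^esub> y = a \<odot>\<^bsub>A\<^esub> (x \<otimes>\<^bsub>A\<^esub> y)"
    and "\<And>a x y. \<lbrakk>a \<in> carrier K; x \<in> carrier A; y \<in> carrier A\<rbrakk> \<Longrightarrow> x \<otimes>\<^bsub>A\<^esub> (a \<odot>\<^bsub>A\<^esub> y) = a \<odot>\<^bsub>A\<^esub> (x \<otimes>\<^bsub>A\<^esub> y)"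
  using assms unfolding assoc_algebra_def by metis+

lemma module_scalars:
  assumes "assoc_algebra K A" "left_module A M"
  shows "module K (scalars A M)"
proof (rule moduleI)
  interpret M: abelian_group M by (rule left_moduleD[OF assms(2)])
  interpret A: module K A by (rule algebraD[OF assms(1)])
  note A = assoc_algebra_scalar[OF assms(1)] and mod = left_moduleD[OF assms(2)]
  show "cring K" by (rule K.is_cring)
  show "abelian_group (scalars A M)"
  proof (rule abelian_groupI)
    show "\<exists>y\<in>carrier (scalars A M). y \<oplus>\<^bsub>scalars A M\<^esub> x = \<zero>\<^bsub>scalars A M\<^esub>" if "x \<in> carrier (scalars A M)" for x
      using that M.l_neg M.a_inv_closed by (intro bexI[of _ "\<ominus>\<^bsub>M\<^esub> x"]) simp_all
  qed (simp_all add: M.a_ac)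
  fix a b x y assume "a \<in> carrier K" "b \<in> carrier K" "x \<in> carrier (scalars A M)"
  then have *: "a \<in> carrier K" "b \<in> carrier K" "x \<in> carrier M" "a \<odot>\<^bsub>A\<^esub> \<one>\<^bsub>A\<^esub> \<in> carrier A" "b \<odot>\<^bsub>A\<^esub> \<one>\<^bsub>A\<^esub> \<in> carrier A"
    "\<one>\<^bsub>A\<^esub> \<in> carrier A"
    using ring.ring_simprules(6)[OF algebraD(2)[OF assms(1)]] by simp_all
  show "a \<odot>\<^bsub>scalars A M\<^esub> x \<in> carrier (scalars A M)" using * mod by simp
  show "(a \<oplus> b) \<odot>\<^bsub>scalars A M\<^esub> x = a \<odot>\<^bsub>scalars A M\<^esub> x \<oplus>\<^bsub>scalars A M\<^esub> b \<odot>\<^bsub>scalars A M\<^esub> x"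
    using * mod by (simp add: A.smult_l_distr)
  have "(a \<otimes> b) \<odot>\<^bsub>A\<^esub> \<one>\<^bsub>A\<^esub> = (a \<odot>\<^bsub>A\<^esub> \<one>\<^bsub>A\<^esub>) \<otimes>\<^bsub>A\<^esub> (b \<odot>\<^bsub>A\<^esub> \<one>\<^bsub>A\<^esub>)" using * A(1)[of a "b \<odot>\<^bsub>A\<^esub> \<one>\<^bsub>A\<^esub>"] by (simp add: A.smult_assoc1)
  then show "(a \<otimes> b) \<odot>\<^bsub>scalars A M\<^esub> x = a \<odot>\<^bsub>scalars A M\<^esub> (b \<odot>\<^bsub>scalars A M\<^esub> x)"
    using * mod by simp
  { assume "y \<in> carrier (scalars A M)"
    then show "a \<odot>\<^bsub>scalars A M\<^esub> (x \<oplus>\<^bsub>scalars A M\<^esub> y) = a \<odot>\<^bsub>scalars A M\<^esub> x \<oplus>\<^bsub>scalars A M\<^esub> a \<odot>\<^bsub>scalars A M\<^esub> y"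
      using * mod by simp }
next
  interpret A: module K A by (rule algebraD[OF assms(1)])
  show "\<one> \<odot>\<^bsub>scalars A M\<^esub> x = x" if "x \<in> carrier (scalars A M)" for x
    using that left_moduleD[OF assms(2)] ring.ring_simprules(6)[OF algebraD(2)[OF assms(1)]] by simp
qed

lemma module_hom_scalars:
  assumes "assoc_algebra K A" "f \<in> module_hom A M N"
  shows "f \<in> lin (scalars A M) (scalars A N)"
  using assms assoc_algebra_scalar(3)[OF assms(1)] ring.ring_simprules(6)[OF algebraD(2)[OF assms(1)]]
    module_hom_add_hom[OF assms(2)]
  by (intro linI) (auto simp: module_hom_smult add_hom_closed add_hom_add)

lemma bilinear_action:
  assumes "assoc_algebra K A" "left_module A M" "h \<in> lin V (scalars A M)"
  shows "bilinear A V (scalars A M) (\<lambda>r x. r \<odot>\<^bsub>M\<^esub> h x)"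
proof -
  interpret A: module K A by (rule algebraD[OF assms(1)])
  have one: "\<one>\<^bsub>A\<^esub> \<in> carrier A" using ring.ring_simprules(6)[OF algebraD(2)[OF assms(1)]] .
  have comm: "r \<odot>\<^bsub>M\<^esub> ((a \<odot>\<^bsub>A\<^esub> \<one>\<^bsub>A\<^esub>) \<odot>\<^bsub>M\<^esub> x) = (a \<odot>\<^bsub>A\<^esub> \<one>\<^bsub>A\<^esub>) \<odot>\<^bsub>M\<^esub> (r \<odot>\<^bsub>M\<^esub> x)"
    if "r \<in> carrier A" "a \<in> carrier K" "x \<in> carrier M" for r a x
    using that assoc_algebra_scalar[OF assms(1) that(2,1)] left_moduleD(6)[OF assms(2)] by (metis)
  have scal: "(a \<odot>\<^bsub>A\<^esub> r) \<odot>\<^bsub>M\<^esub> x = (a \<odot>\<^bsub>A\<^esub> \<one>\<^bsub>A\<^esub>) \<odot>\<^bsub>M\<^esub> (r \<odot>\<^bsub>M\<^esub> x)"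
    if "r \<in> carrier A" "a \<in> carrier K" "x \<in> carrier M" for r a x
    using that assoc_algebra_scalar[OF assms(1) that(2,1)] left_moduleD(6)[OF assms(2)] by metis
  have h: "h x \<in> carrier M" if "x \<in> carrier V" for x using lin_closed[OF assms(3) that] by simp
  note mod = left_moduleD[OF assms(2)]
  show ?thesis
    using lin_add[OF assms(3)] lin_smult[OF assms(3)]
    by (intro bilinearI linI) (simp_all add: mod h comm scal)
qed

lemma tensor_lift_scalars: "tensor_lift (scalars A M) = tensor_lift M"
  by (rule tensor_lift_target_cong) simp_all

end

text \<open>
  A module \<open>Q\<close> with an \<open>R\<close>-linear section \<open>s\<close> of the action \<open>R \<otimes> Q \<rightarrow> Q\<close>.  The vector space
  underlying \<open>Q\<close> is a separate parameter \<open>V\<close>, because it usually carries a record of its own that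
  differs from \<open>scalars R Q\<close>.
\<close>

locale relatively_projective = ground_field K for K :: "'k ring" (structure) +
  fixes R :: "('k, 'r) module" and Q :: "('r, 'q) module" and V :: "('k, 'q) module"
    and s :: "'q \<Rightarrow> ('r, 'q) tensor"
  assumes algebra: "assoc_algebra K R" and Q: "left_module R Q" and V: "module K V"
    and V_simps [simp]: "carrier V = carrier Q" "ring.add V = ring.add Q" "ring.zero V = ring.zero Q"
    and V_smult: "\<And>a x. \<lbrakk>a \<in> carrier K; x \<in> carrier Q\<rbrakk> \<Longrightarrow> a \<odot>\<^bsub>V\<^esub> x = (a \<odot>\<^bsub>R\<^esub> \<one>\<^bsub>R\<^esub>) \<odot>\<^bsub>Q\<^esub> x"
    and s_closed: "\<And>q. q \<in> carrier Q \<Longrightarrow> s q \<in> carrier (R \<boxtimes> V)"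
    and s_add: "\<And>x y. \<lbrakk>x \<in> carrier Q; y \<in> carrier Q\<rbrakk> \<Longrightarrow> s (x \<oplus>\<^bsub>Q\<^esub> y) = s x \<oplus>\<^bsub>R \<boxtimes> V\<^esub> s y"
    and s_smult: "\<And>r q. \<lbrakk>r \<in> carrier R; q \<in> carrier Q\<rbrakk> \<Longrightarrow>
      s (r \<odot>\<^bsub>Q\<^esub> q) = tensor_map K R V (\<lambda>x. r \<otimes>\<^bsub>R\<^esub> x) id (s q)"
    and s_split: "\<And>q. q \<in> carrier Q \<Longrightarrow> tensor_lift Q (\<lambda>r x. r \<odot>\<^bsub>Q\<^esub> x) (s q) = q"
begin

lemma R: "module K R" by (rule algebraD[OF algebra])

lemma mult_lin: "r \<in> carrier R \<Longrightarrow> (\<lambda>x. r \<otimes>\<^bsub>R\<^esub> x) \<in> lin R R"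
  using algebraD[OF algebra] by (intro linI) (auto simp: ring.ring_simprules)

lemma scalars_lin: "h \<in> lin V W \<longleftrightarrow> h \<in> lin (scalars R Q) W"
  by (simp add: module_hom_def V_smult)

text \<open>Averaging a linear map \<open>h\<close> along the section, \<open>q \<mapsto> s'(q) h(s''(q))\<close>, makes it \<open>R\<close>-linear.\<close>

lemma lift_smult_hom:
  assumes "left_module R M" "h \<in> lin V (scalars R M)"
  shows "(\<lambda>q. tensor_lift M (\<lambda>r x. r \<odot>\<^bsub>M\<^esub> h x) (s q)) \<in> module_hom R Q M"
proof -
  let ?f = "\<lambda>r x. r \<odot>\<^bsub>M\<^esub> h x"
  note M = module_scalars[OF algebra assms(1)] and bil = bilinear_action[OF algebra assms]
  note lift = lift_lin[OF R V M bil, unfolded tensor_lift_scalars]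
  show ?thesis
  proof (rule module_homI)
    fix r q assume r: "r \<in> carrier R" and q: "q \<in> carrier Q"
    have h: "h x \<in> carrier M" if "x \<in> carrier Q" for x using lin_closed[OF assms(2)] that by simp
    have smult: "(\<lambda>x. r \<odot>\<^bsub>M\<^esub> x) \<in> lin (scalars R M) (scalars R M)"
      using bilinearD(1)[OF bilinear_action[OF algebra assms(1) lin_ident] r] .
    have "tensor_lift (scalars R M) ?f (s (r \<odot>\<^bsub>Q\<^esub> q)) = tensor_lift (scalars R M) (\<lambda>x y. ?f (r \<otimes>\<^bsub>R\<^esub> x) (id y)) (s q)"
      unfolding s_smult[OF r q] by (rule lift_tensor_map[OF R V R V M mult_lin[OF r] id_lin bil s_closed[OF q]])
    also have "\<dots> = tensor_lift (scalars R M) (\<lambda>x y. r \<odot>\<^bsub>M\<^esub> ?f x y) (s q)"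
      using r h
      by (intro lift_cong[OF R V M bilinear_compose[OF bil mult_lin[OF r] id_lin] _ s_closed[OF q]])
        (simp add: left_moduleD(6)[OF assms(1)])
    also have "\<dots> = r \<odot>\<^bsub>M\<^esub> tensor_lift (scalars R M) ?f (s q)"
      by (rule hom_lift[OF R V M bil M smult s_closed[OF q], symmetric])
    finally show "tensor_lift M ?f (s (r \<odot>\<^bsub>Q\<^esub> q)) = r \<odot>\<^bsub>M\<^esub> tensor_lift M ?f (s q)"
      by (simp add: tensor_lift_scalars)
  qed (use lin_closed[OF lift] lin_add[OF lift] in \<open>simp_all add: s_closed s_add\<close>)
qed

text \<open>Averaging a linear section of \<open>\<pi>\<close> composed with \<open>f\<close> gives the required lift.\<close>

theorem projective: "projective_left TYPE('m) TYPE('n) R Q"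
  unfolding projective_left_def
proof (intro conjI allI impI Q)
  fix M :: "('r, 'm) module" and N :: "('r, 'n) module" and \<pi> f
  assume "left_module R M \<and> left_module R N \<and> \<pi> \<in> module_hom R M N \<and> \<pi> ` carrier M = carrier N \<and> f \<in> module_hom R Q N"
  then have M: "left_module R M" and N: "left_module R N" and \<pi>: "\<pi> \<in> module_hom R M N" "\<pi> ` carrier M = carrier N"
    and f: "f \<in> module_hom R Q N" by auto
  note MK = module_scalars[OF algebra M] and NK = module_scalars[OF algebra N]
  note \<pi>K = module_hom_scalars[OF algebra \<pi>(1)]
  have fK: "f \<in> lin V (scalars R N)" using module_hom_scalars[OF algebra f] scalars_lin by blast
  obtain j where j: "j \<in> lin (scalars R N) (scalars R M)" "\<And>y. y \<in> carrier N \<Longrightarrow> \<pi> (j y) = y"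
    using linear_section[OF MK NK \<pi>K] \<pi>(2) by auto
  have jf: "(\<lambda>x. j (f x)) \<in> lin V (scalars R M)" by (rule lin_compose[OF j(1) fK])
  let ?g = "\<lambda>q. tensor_lift M (\<lambda>r x. r \<odot>\<^bsub>M\<^esub> j (f x)) (s q)"
  have "\<pi> (?g q) = f q" if q: "q \<in> carrier Q" for q
  proof -
    have cl: "f x \<in> carrier N" "j (f x) \<in> carrier M" if "x \<in> carrier Q" for x
      using that lin_closed[OF fK] lin_closed[OF jf] by simp_all
    have "\<pi> (tensor_lift (scalars R M) (\<lambda>r x. r \<odot>\<^bsub>M\<^esub> j (f x)) (s q)) =
        tensor_lift (scalars R N) (\<lambda>r x. \<pi> (r \<odot>\<^bsub>M\<^esub> j (f x))) (s q)"
      by (rule hom_lift[OF R V MK bilinear_action[OF algebra M jf] NK \<pi>K s_closed[OF q]])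
    also have "\<dots> = tensor_lift (scalars R N) (\<lambda>r x. f (r \<odot>\<^bsub>Q\<^esub> x)) (s q)"
      by (rule lift_cong[OF R V NK bilinear_hom[OF bilinear_action[OF algebra M jf] \<pi>K] _ s_closed[OF q]])
        (simp add: module_hom_smult[OF \<pi>(1)] module_hom_smult[OF f] cl j(2))
    also have "\<dots> = f (tensor_lift (scalars R Q) (\<lambda>r x. r \<odot>\<^bsub>Q\<^esub> x) (s q))"
      by (rule hom_lift[OF R V module_scalars[OF algebra Q] bilinear_action[OF algebra Q
            iffD2[OF scalars_lin lin_ident]] NK module_hom_scalars[OF algebra f] s_closed[OF q], symmetric])
    finally show ?thesis using s_split[OF q] by (simp add: tensor_lift_scalars)
  qed
  then show "\<exists>g\<in>module_hom R Q M. \<forall>q\<in>carrier Q. \<pi> (g q) = f q"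
    by (intro bexI[OF _ lift_smult_hom[OF M jf]] ballI)
qed

end

section \<open>Faithful flatness\<close>

lemma tensor_factors_swap: "tensor_factors R M N \<Longrightarrow> tensor_factors R N M"
  by (simp add: tensor_factors_def)

definition tensor_swap where
  "tensor_swap R M N = tensor_lift (tensor_group R N M) (\<lambda>m n. pure_tensor R N M n m)"

lemma balanced_swap:
  assumes "tensor_factors R M N"
  shows "balanced R M N (tensor_group R N M) (\<lambda>m n. pure_tensor R N M n m)"
proof -
  note pure = tensor_factors.balanced_pure[OF tensor_factors_swap[OF assms]]
  show ?thesis
    by (intro balancedI) (simp_all add: balanced_closed[OF pure] balanced_add[OF pure] balanced_smult[OF pure])
qed

lemma tensor_swap_hom:
  assumes "tensor_factors R M N"
  shows "tensor_swap R M N \<in> add_hom (tensor_group R M N) (tensor_group R N M)"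
  unfolding tensor_swap_def
  by (rule tensor_factors.tensor_lift_hom[OF assms
        tensor_factors.abelian_tensor_group[OF tensor_factors_swap[OF assms]] balanced_swap[OF assms]])

lemma tensor_swap_pure:
  assumes "tensor_factors R M N" "m \<in> carrier M" "n \<in> carrier N"
  shows "tensor_swap R M N (pure_tensor R M N m n) = pure_tensor R N M n m"
  unfolding tensor_swap_def
  by (rule tensor_factors.tensor_lift_pure[OF assms(1)
        tensor_factors.abelian_tensor_group[OF tensor_factors_swap[OF assms(1)]] balanced_swap[OF assms(1)] assms(2,3)])

lemma add_hom_compose: "\<lbrakk>g \<in> add_hom B C; f \<in> add_hom A B\<rbrakk> \<Longrightarrow> (\<lambda>x. g (f x)) \<in> add_hom A C"
  by (intro add_homI) (simp_all add: add_hom_closed add_hom_add)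

lemma add_hom_ident: "(\<lambda>x. x) \<in> add_hom A A"
  by (rule add_homI) auto

lemma tensor_swap_swap:
  assumes MN: "tensor_factors R M N" and t: "t \<in> carrier (tensor_group R M N)"
  shows "tensor_swap R N M (tensor_swap R M N t) = t"
proof -
  note NM = tensor_factors_swap[OF MN]
  show ?thesis
    by (rule tensor_factors.tensor_hom_ext[OF MN tensor_factors.abelian_tensor_group[OF MN]
          add_hom_compose[OF tensor_swap_hom[OF NM] tensor_swap_hom[OF MN]] add_hom_ident _ t])
      (simp add: tensor_swap_pure MN NM)
qed

lemma tensor_swap_tensor_map:
  assumes MN: "tensor_factors R M N" and AB: "tensor_factors R A B"
    and f: "f \<in> module_hom R A M" and g: "g \<in> module_hom R B N" and t: "t \<in> carrier (tensor_group R A B)"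
  shows "tensor_swap R M N (tensor_map R M N f g t) = tensor_map R N M g f (tensor_swap R A B t)"
proof -
  note NM = tensor_factors_swap[OF MN] and BA = tensor_factors_swap[OF AB]
  show ?thesis
    by (rule tensor_factors.tensor_hom_ext[OF AB tensor_factors.abelian_tensor_group[OF NM]
          add_hom_compose[OF tensor_swap_hom[OF MN] tensor_map_hom[OF MN AB f g]]
          add_hom_compose[OF tensor_map_hom[OF NM BA g f] tensor_swap_hom[OF AB]] _ t])
      (simp add: tensor_swap_pure tensor_map_pure_tensor MN NM AB BA f g
        add_hom_closed[OF module_hom_add_hom[OF f]] add_hom_closed[OF module_hom_add_hom[OF g]])
qed

lemma exact_at_swap:
  assumes L: "tensor_factors R L L'" and M: "tensor_factors R M M'" and N: "tensor_factors R N N'"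
    and f: "f \<in> module_hom R L M" "f' \<in> module_hom R L' M'" and g: "g \<in> module_hom R M N" "g' \<in> module_hom R M' N'"
    and exact: "exact_at (tensor_group R L L') (tensor_group R M M') (tensor_group R N N')
      (tensor_map R M M' f f') (tensor_map R N N' g g')"
  shows "exact_at (tensor_group R L' L) (tensor_group R M' M) (tensor_group R N' N)
      (tensor_map R M' M f' f) (tensor_map R N' N g' g)"
proof -
  note L' = tensor_factors_swap[OF L] and M' = tensor_factors_swap[OF M] and N' = tensor_factors_swap[OF N]
  note hom = tensor_map_hom[OF M' L' f(2,1)] tensor_map_hom[OF N' M' g(2,1)]
  show ?thesis
    by (rule exact_at_retract[OF exact, where i\<^sub>L = "tensor_swap R L' L" and i\<^sub>M = "tensor_swap R M' M"
          and i\<^sub>N = "tensor_swap R N' N" and p\<^sub>L = "tensor_swap R L L'" and p\<^sub>M = "tensor_swap R M M'"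
          and p\<^sub>N = "tensor_swap R N N'"])
      (use L M N L' M' N' f g hom in \<open>auto intro: add_hom_closed tensor_swap_hom
        simp: tensor_swap_swap tensor_swap_tensor_map add_hom_zero[OF tensor_factors.abelian_tensor_group
          tensor_factors.abelian_tensor_group tensor_swap_hom]\<close>)
qed

text \<open>Exchanging the tensor factors identifies the two functors.\<close>

lemma faithfully_flat_right_opposite:
  assumes "faithfully_flat_left TYPE('l) TYPE('m) TYPE('n) (opposite R) Q"
  shows "faithfully_flat_right TYPE('l) TYPE('m) TYPE('n) R Q"
  unfolding faithfully_flat_right_def
proof (intro conjI allI impI)
  have Q: "left_module (opposite R) Q" using assms by (simp add: faithfully_flat_left_def)
  then show Q': "right_module R Q" by (simp add: right_module_def)
  fix L :: "('a, 'l) module" and M :: "('a, 'm) module" and N :: "('a, 'n) module" and f g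
  assume "left_module R L \<and> left_module R M \<and> left_module R N \<and> f \<in> module_hom R L M \<and> g \<in> module_hom R M N"
  then have mods: "left_module R L" "left_module R M" "left_module R N"
    and hom: "f \<in> module_hom R L M" "g \<in> module_hom R M N" by auto
  have "exact_at L M N f g \<longleftrightarrow> exact_at (tensor_group R L Q) (tensor_group R M Q) (tensor_group R N Q)
      (tensor_map R M Q f id) (tensor_map R N Q g id)"
    using assms mods hom by (simp add: faithfully_flat_left_def right_module_def)
  also have "\<dots> \<longleftrightarrow> exact_at (tensor_group R Q L) (tensor_group R Q M) (tensor_group R Q N)
      (tensor_map R Q M id f) (tensor_map R Q N id g)"
  proof -
    have tf: "tensor_factors R L Q" "tensor_factors R M Q" "tensor_factors R N Q"
      using mods right_module_smult_group[OF Q'] by (auto simp: tensor_factors_def left_module_smult_group)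
    show ?thesis
      using exact_at_swap[OF tf hom(1) id_module_hom hom(2) id_module_hom]
        exact_at_swap[OF tf[THEN tensor_factors_swap] id_module_hom hom(1) id_module_hom hom(2)] by blast
  qed
  finally show "exact_at L M N f g \<longleftrightarrow> exact_at (tensor_group R Q L) (tensor_group R Q M) (tensor_group R Q N)
      (tensor_map R Q M id f) (tensor_map R Q N id g)" .
qed

context ground_field
begin

lemma lin_opposite [simp]: "lin (opposite A) W = lin A W"
  by (simp add: module_hom_def)

end

context relatively_projective
begin

context
  fixes L :: "('r, 'l) module"
  assumes L: "right_module R L"
begin

abbreviation (input) "LK \<equiv> scalars (opposite R) L"

text \<open>
  \<open>l \<otimes> q \<mapsto> l s'(q) \<otimes> s''(q)\<close> embeds \<open>L \<otimes>\<^sub>R Q\<close> naturally into \<open>L \<otimes> Q\<close>; the projection of the larger tensor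
  product onto the smaller one is a left inverse.
\<close>

definition tensor_embed where
  "tensor_embed = tensor_lift (scalars (opposite R) L \<boxtimes> V)
     (\<lambda>l q. tensor_lift (scalars (opposite R) L \<boxtimes> V) (\<lambda>r x. pure (scalars (opposite R) L) V (r \<odot>\<^bsub>L\<^esub> l) x) (s q))"

definition tensor_project where
  "tensor_project = tensor_lift (tensor_group R L Q) (pure_tensor R L Q)"

lemma left_module_opposite: "left_module (opposite R) L"
  using L by (simp add: right_module_def)

lemma LK: "module K LK"
  by (rule module_scalars[OF assoc_algebra_opposite[OF algebra] left_module_opposite])

lemma tensor_factors_RLQ: "tensor_factors R L Q"
  using right_module_smult_group[OF L] left_module_smult_group[OF Q] by (simp add: tensor_factors_def)

lemma trilinear_embed: "trilinear LK R V (LK \<boxtimes> V) (\<lambda>l r x. pure LK V (r \<odot>\<^bsub>L\<^esub> l) x)"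
proof -
  note act = bilinear_action[OF assoc_algebra_opposite[OF algebra] left_module_opposite lin_ident]
  have "r \<odot>\<^bsub>L\<^esub> l \<in> carrier LK" if "r \<in> carrier R" "l \<in> carrier LK" for r l
    using bilinear_closed[OF act, of r l] that by simp
  then show ?thesis
    using bilinearD[OF act]
    by (intro trilinearI lin_pure_left[OF LK V] lin_pure_right[OF LK V]) auto
qed

text \<open>\<open>R\<close>-linearity of the section says that \<open>l s'(r q) \<otimes> s''(r q) = (l r) s'(q) \<otimes> s''(q)\<close>.\<close>

lemma balanced_embed:
  "balanced R L Q (LK \<boxtimes> V) (\<lambda>l q. tensor_lift (LK \<boxtimes> V) (\<lambda>r x. pure LK V (r \<odot>\<^bsub>L\<^esub> l) x) (s q))"
proof (rule balancedI)
  note tri = trilinear_embed and T = module_tensor[OF LK V]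
  note lift = lift_lin[OF R V T trilinearD(1)[OF tri]]
  fix l assume "l \<in> carrier L"
  then have l: "l \<in> carrier LK" by simp
  { fix q assume q: "q \<in> carrier Q"
    show "tensor_lift (LK \<boxtimes> V) (\<lambda>r x. pure LK V (r \<odot>\<^bsub>L\<^esub> l) x) (s q) \<in> carrier (LK \<boxtimes> V)"
      by (rule lin_closed[OF lift[OF l] s_closed[OF q]])
    { fix q' assume q': "q' \<in> carrier Q"
      show "tensor_lift (LK \<boxtimes> V) (\<lambda>r x. pure LK V (r \<odot>\<^bsub>L\<^esub> l) x) (s (q \<oplus>\<^bsub>Q\<^esub> q')) =
          tensor_lift (LK \<boxtimes> V) (\<lambda>r x. pure LK V (r \<odot>\<^bsub>L\<^esub> l) x) (s q) \<oplus>\<^bsub>LK \<boxtimes> V\<^esub>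
          tensor_lift (LK \<boxtimes> V) (\<lambda>r x. pure LK V (r \<odot>\<^bsub>L\<^esub> l) x) (s q')"
        unfolding s_add[OF q q'] by (rule lin_add[OF lift[OF l] s_closed[OF q] s_closed[OF q']]) }
    { fix l' assume "l' \<in> carrier L"
      then have l': "l' \<in> carrier LK" by simp
      have "(\<lambda>l. tensor_lift (LK \<boxtimes> V) (\<lambda>r x. pure LK V (r \<odot>\<^bsub>L\<^esub> l) x) (s q)) \<in> lin LK (LK \<boxtimes> V)"
        by (rule bilinearD(2)[OF bilinear_lift_right[OF LK R V T tri] s_closed[OF q]])
      from lin_add[OF this l l']
      show "tensor_lift (LK \<boxtimes> V) (\<lambda>r x. pure LK V (r \<odot>\<^bsub>L\<^esub> (l \<oplus>\<^bsub>L\<^esub> l')) x) (s q) =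
          tensor_lift (LK \<boxtimes> V) (\<lambda>r x. pure LK V (r \<odot>\<^bsub>L\<^esub> l) x) (s q) \<oplus>\<^bsub>LK \<boxtimes> V\<^esub>
          tensor_lift (LK \<boxtimes> V) (\<lambda>r x. pure LK V (r \<odot>\<^bsub>L\<^esub> l') x) (s q)" by simp }
    fix r' assume r': "r' \<in> carrier R"
    have rl: "r' \<odot>\<^bsub>L\<^esub> l \<in> carrier LK" using r' l left_moduleD(3)[OF left_module_opposite] by simp
    have "tensor_lift (LK \<boxtimes> V) (\<lambda>r x. pure LK V (r \<odot>\<^bsub>L\<^esub> l) x) (s (r' \<odot>\<^bsub>Q\<^esub> q)) =
        tensor_lift (LK \<boxtimes> V) (\<lambda>r x. pure LK V ((r' \<otimes>\<^bsub>R\<^esub> r) \<odot>\<^bsub>L\<^esub> l) (id x)) (s q)"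
      unfolding s_smult[OF r' q]
      by (rule lift_tensor_map[OF R V R V T mult_lin[OF r'] id_lin trilinearD(1)[OF tri l] s_closed[OF q]])
    also have "\<dots> = tensor_lift (LK \<boxtimes> V) (\<lambda>r x. pure LK V (r \<odot>\<^bsub>L\<^esub> (r' \<odot>\<^bsub>L\<^esub> l)) x) (s q)"
      using r' l left_moduleD(6)[OF left_module_opposite]
      by (intro lift_cong[OF R V T trilinearD(1)[OF tri rl] _ s_closed[OF q], symmetric]) simp
    finally show "tensor_lift (LK \<boxtimes> V) (\<lambda>r x. pure LK V (r \<odot>\<^bsub>L\<^esub> (r' \<odot>\<^bsub>L\<^esub> l)) x) (s q) =
        tensor_lift (LK \<boxtimes> V) (\<lambda>r x. pure LK V (r \<odot>\<^bsub>L\<^esub> l) x) (s (r' \<odot>\<^bsub>Q\<^esub> q))" ..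
  }
qed

lemma tensor_embed_hom: "tensor_embed \<in> add_hom (tensor_group R L Q) (LK \<boxtimes> V)"
  unfolding tensor_embed_def
  by (rule tensor_factors.tensor_lift_hom[OF tensor_factors_RLQ module_abelian[OF module_tensor[OF LK V]] balanced_embed])

lemma tensor_embed_closed: "t \<in> carrier (tensor_group R L Q) \<Longrightarrow> tensor_embed t \<in> carrier (tensor_group K LK V)"
  using add_hom_closed[OF tensor_embed_hom] by (simp add: tensor_space_simps)

lemma tensor_embed_pure:
  "\<lbrakk>l \<in> carrier L; q \<in> carrier Q\<rbrakk> \<Longrightarrow> tensor_embed (pure_tensor R L Q l q) =
    tensor_lift (LK \<boxtimes> V) (\<lambda>r x. pure LK V (r \<odot>\<^bsub>L\<^esub> l) x) (s q)"
  unfolding tensor_embed_def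
  by (rule tensor_factors.tensor_lift_pure[OF tensor_factors_RLQ module_abelian[OF module_tensor[OF LK V]] balanced_embed])

lemma balanced_project: "balanced K LK V (tensor_group R L Q) (pure_tensor R L Q)"
proof -
  note pure = tensor_factors.balanced_pure[OF tensor_factors_RLQ]
    and scalar = assoc_algebra_scalar(3)[OF algebra _ ring.ring_simprules(6)[OF algebraD(2)[OF algebra]]]
  show ?thesis
    by (intro balancedI)
      (simp_all add: balanced_closed[OF pure] balanced_add[OF pure] balanced_smult[OF pure] V_smult scalar)
qed

lemma tensor_project_hom: "tensor_project \<in> add_hom (tensor_group K LK V) (tensor_group R L Q)"
  unfolding tensor_project_def
  by (rule tensor_factors.tensor_lift_hom[OF tensor_factors_modules[OF LK V]
      tensor_factors.abelian_tensor_group[OF tensor_factors_RLQ] balanced_project])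

lemma tensor_project_pure:
  "\<lbrakk>l \<in> carrier L; q \<in> carrier Q\<rbrakk> \<Longrightarrow> tensor_project (pure LK V l q) = pure_tensor R L Q l q"
  unfolding tensor_project_def
  by (rule tensor_factors.tensor_lift_pure[OF tensor_factors_modules[OF LK V]
      tensor_factors.abelian_tensor_group[OF tensor_factors_RLQ] balanced_project]) simp_all

text \<open>In \<open>L \<otimes>\<^sub>R Q\<close> one has \<open>l s'(q) \<otimes> s''(q) = l \<otimes> s'(q) s''(q) = l \<otimes> q\<close>.\<close>

lemma tensor_project_embed:
  assumes "t \<in> carrier (tensor_group R L Q)"
  shows "tensor_project (tensor_embed t) = t"
proof (rule tensor_factors.tensor_hom_ext[OF tensor_factors_RLQ _ _ add_hom_ident _ assms])
  note T = module_tensor[OF LK V] and RLQ = tensor_factors_RLQ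
  note abel = tensor_factors.abelian_tensor_group[OF RLQ] and RV = tensor_factors_modules[OF R V]
  note opp = left_moduleD[OF left_module_opposite]
  show "abelian_group (tensor_group R L Q)" by (rule abel)
  have hom: "tensor_project \<in> add_hom (LK \<boxtimes> V) (tensor_group R L Q)"
    by (intro add_homI)
      (simp_all add: tensor_space_simps add_hom_closed[OF tensor_project_hom] add_hom_add[OF tensor_project_hom])
  then show "(\<lambda>t. tensor_project (tensor_embed t)) \<in> add_hom (tensor_group R L Q) (tensor_group R L Q)"
    by (rule add_hom_compose[OF _ tensor_embed_hom])
  fix l q assume l: "l \<in> carrier L" and q: "q \<in> carrier Q"
  have sq: "s q \<in> carrier (tensor_group K R V)" using s_closed[OF q] by (simp add: tensor_space_simps)
  have lK: "l \<in> carrier LK" using l by simp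
  note bal = bilinear_balanced[OF trilinearD(1)[OF trilinear_embed lK]]
  note pure = tensor_factors.balanced_pure[OF RLQ]
  have act: "balanced K R V Q (\<lambda>r x. r \<odot>\<^bsub>Q\<^esub> x)"
  proof -
    note b = bilinear_balanced[OF bilinear_action[OF algebra Q iffD2[OF scalars_lin lin_ident]]]
    show ?thesis
      using balanced_closed[OF b] balanced_add[OF b] balanced_smult[OF b] by (intro balancedI) simp_all
  qed
  have hom_l: "pure_tensor R L Q l \<in> add_hom Q (tensor_group R L Q)"
    using pure l by (simp add: balanced_def)
  have "tensor_project (tensor_embed (pure_tensor R L Q l q)) =
      tensor_lift (tensor_group R L Q) (\<lambda>r x. tensor_project (pure LK V (r \<odot>\<^bsub>L\<^esub> l) x)) (s q)"
    unfolding tensor_embed_pure[OF l q]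
    by (rule tensor_factors.add_hom_tensor_lift[OF RV module_abelian[OF T] abel bal hom sq])
  also have "\<dots> = tensor_lift (tensor_group R L Q) (\<lambda>r x. pure_tensor R L Q l (r \<odot>\<^bsub>Q\<^esub> x)) (s q)"
  proof (rule tensor_factors.tensor_lift_cong[OF RV abel _ _ sq, symmetric])
    show "balanced K R V (tensor_group R L Q) (\<lambda>r x. pure_tensor R L Q l (r \<odot>\<^bsub>Q\<^esub> x))"
      using add_hom_closed[OF hom_l] add_hom_add[OF hom_l]
      by (intro balancedI) (simp_all add: left_moduleD[OF Q] balanced_smult[OF act])
    fix r x assume "r \<in> carrier R" "x \<in> carrier V"
    then show "pure_tensor R L Q l (r \<odot>\<^bsub>Q\<^esub> x) = tensor_project (pure LK V (r \<odot>\<^bsub>L\<^esub> l) x)"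
      using l opp by (simp add: tensor_project_pure balanced_smult[OF pure])
  qed
  also have "\<dots> = pure_tensor R L Q l (tensor_lift Q (\<lambda>r x. r \<odot>\<^bsub>Q\<^esub> x) (s q))"
    by (rule tensor_factors.add_hom_tensor_lift[OF RV left_moduleD(2)[OF Q] abel act hom_l sq, symmetric])
  finally show "tensor_project (tensor_embed (pure_tensor R L Q l q)) = pure_tensor R L Q l q"
    by (simp add: s_split[OF q])
qed

end

lemma tensor_embed_natural:
  fixes L :: "('r, 'l) module" and M :: "('r, 'm) module"
  assumes L: "right_module R L" and M: "right_module R M" and f: "f \<in> module_hom R L M"
    and t: "t \<in> carrier (tensor_group R L Q)"
  shows "tensor_embed M (tensor_map R M Q f id t) =
    tensor_map K (scalars (opposite R) M) V f id (tensor_embed L t)"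
proof -
  let ?L = "scalars (opposite R) L" and ?M = "scalars (opposite R) M"
  note T = module_tensor[OF LK[OF L] V] and T' = module_tensor[OF LK[OF M] V]
  have fK: "f \<in> lin ?L ?M" using module_hom_scalars[OF assoc_algebra_opposite[OF algebra], of f L M] f by simp
  note F = tensor_map_lin[OF LK[OF M] V LK[OF L] V fK id_lin]
  show ?thesis
  proof (rule tensor_factors.tensor_hom_ext[OF tensor_factors_RLQ[OF L] module_abelian[OF T'] _ _ _ t])
    show "(\<lambda>t. tensor_embed M (tensor_map R M Q f id t)) \<in> add_hom (tensor_group R L Q) (?M \<boxtimes> V)"
      by (rule add_hom_compose[OF tensor_embed_hom[OF M]
            tensor_map_hom[OF tensor_factors_RLQ[OF M] tensor_factors_RLQ[OF L] f id_module_hom]])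
    show "(\<lambda>t. tensor_map K ?M V f id (tensor_embed L t)) \<in> add_hom (tensor_group R L Q) (?M \<boxtimes> V)"
      by (rule add_hom_compose[OF lin_add_hom[OF F] tensor_embed_hom[OF L]])
    fix l q assume l: "l \<in> carrier L" and q: "q \<in> carrier Q"
    have fl: "f l \<in> carrier M" using add_hom_closed[OF module_hom_add_hom[OF f] l] .
    have rl: "r \<odot>\<^bsub>L\<^esub> l \<in> carrier L" if "r \<in> carrier R" for r
      using left_moduleD(3)[OF left_module_opposite[OF L]] that l by simp
    have lL: "l \<in> carrier ?L" and lM: "f l \<in> carrier ?M" using l fl by simp_all
    have "tensor_map K ?M V f id (tensor_embed L (pure_tensor R L Q l q)) =
        tensor_lift (?M \<boxtimes> V) (\<lambda>r x. tensor_map K ?M V f id (pure ?L V (r \<odot>\<^bsub>L\<^esub> l) x)) (s q)"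
      unfolding tensor_embed_pure[OF L l q]
      by (rule hom_lift[OF R V T trilinearD(1)[OF trilinear_embed[OF L] lL] T' F s_closed[OF q]])
    also have "\<dots> = tensor_lift (?M \<boxtimes> V) (\<lambda>r x. pure ?M V (r \<odot>\<^bsub>M\<^esub> f l) x) (s q)"
      using l rl
      by (intro lift_cong[OF R V T' trilinearD(1)[OF trilinear_embed[OF M] lM] _ s_closed[OF q], symmetric])
        (simp add: tensor_map_pure[OF LK[OF M] V LK[OF L] V fK id_lin] module_hom_smult[OF f])
    also have "\<dots> = tensor_embed M (tensor_map R M Q f id (pure_tensor R L Q l q))"
      using l q fl
      by (simp add: tensor_map_pure_tensor[OF tensor_factors_RLQ[OF M] tensor_factors_RLQ[OF L] f id_module_hom]
          tensor_embed_pure[OF M])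
    finally show "tensor_embed M (tensor_map R M Q f id (pure_tensor R L Q l q)) =
        tensor_map K ?M V f id (tensor_embed L (pure_tensor R L Q l q))" ..
  qed
qed

lemma tensor_project_natural:
  fixes L :: "('r, 'l) module" and M :: "('r, 'm) module"
  assumes L: "right_module R L" and M: "right_module R M" and f: "f \<in> module_hom R L M"
    and t: "t \<in> carrier (tensor_group K (scalars (opposite R) L) V)"
  shows "tensor_project M (tensor_map K (scalars (opposite R) M) V f id t) =
    tensor_map R M Q f id (tensor_project L t)"
proof -
  let ?L = "scalars (opposite R) L" and ?M = "scalars (opposite R) M"
  have fK: "f \<in> lin ?L ?M" using module_hom_scalars[OF assoc_algebra_opposite[OF algebra], of f L M] f by simp
  note KL = tensor_factors_modules[OF LK[OF L] V] and KM = tensor_factors_modules[OF LK[OF M] V]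
  note RL = tensor_factors_RLQ[OF L] and RM = tensor_factors_RLQ[OF M]
  show ?thesis
    by (rule tensor_factors.tensor_hom_ext[OF KL tensor_factors.abelian_tensor_group[OF RM]
          add_hom_compose[OF tensor_project_hom[OF M] tensor_map_hom[OF KM KL fK id_module_hom]]
          add_hom_compose[OF tensor_map_hom[OF RM RL f id_module_hom] tensor_project_hom[OF L]] _ t])
      (simp add: tensor_map_pure_tensor[OF KM KL fK id_module_hom] tensor_map_pure_tensor[OF RM RL f id_module_hom]
        tensor_project_pure[OF L] tensor_project_pure[OF M] add_hom_closed[OF module_hom_add_hom[OF f]])
qed

text \<open>\<open>L \<otimes>\<^sub>R Q\<close> is a natural retract of \<open>L \<otimes> Q\<close>, and tensoring with a vector space is exact.\<close>

lemma flat: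
  fixes L :: "('r, 'l) module" and M :: "('r, 'm) module" and N :: "('r, 'n) module"
  assumes L: "right_module R L" and M: "right_module R M" and N: "right_module R N"
    and f: "f \<in> module_hom R L M" and g: "g \<in> module_hom R M N" and exact: "exact_at L M N f g"
  shows "exact_at (tensor_group R L Q) (tensor_group R M Q) (tensor_group R N Q)
    (tensor_map R M Q f id) (tensor_map R N Q g id)"
proof -
  let ?L = "scalars (opposite R) L" and ?M = "scalars (opposite R) M" and ?N = "scalars (opposite R) N"
  note RL = tensor_factors_RLQ[OF L] and RM = tensor_factors_RLQ[OF M] and RN = tensor_factors_RLQ[OF N]
  have fK: "f \<in> lin ?L ?M" and gK: "g \<in> lin ?M ?N"
    using module_hom_scalars[OF assoc_algebra_opposite[OF algebra], of f L M]
      module_hom_scalars[OF assoc_algebra_opposite[OF algebra], of g M N] f g by simp_all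
  have exactK: "exact_at ?L ?M ?N f g" using exact by (simp add: exact_at_iff)
  have zero: "tensor_embed N \<zero>\<^bsub>tensor_group R N Q\<^esub> = \<zero>\<^bsub>tensor_group K ?N V\<^esub>"
    using add_hom_zero[OF tensor_factors.abelian_tensor_group[OF RN] module_abelian[OF module_tensor[OF LK[OF N] V]]
        tensor_embed_hom[OF N]] by (simp add: tensor_space_simps)
  have zero': "tensor_project N \<zero>\<^bsub>tensor_group K ?N V\<^esub> = \<zero>\<^bsub>tensor_group R N Q\<^esub>"
    by (rule add_hom_zero[OF tensor_factors.abelian_tensor_group[OF tensor_factors_modules[OF LK[OF N] V]]
          tensor_factors.abelian_tensor_group[OF RN] tensor_project_hom[OF N]])
  have "exact_at (tensor_group K ?L V) (tensor_group K ?M V) (tensor_group K ?N V)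
      (tensor_map K ?M V f id) (tensor_map K ?N V g id)"
    unfolding exact_at_tensor_space
    by (rule exact_tensor_right[OF V LK[OF L] LK[OF M] LK[OF N] fK gK exactK])
  then show ?thesis
    by (rule exact_at_retract[where i\<^sub>L = "tensor_embed L" and i\<^sub>M = "tensor_embed M" and i\<^sub>N = "tensor_embed N"
          and p\<^sub>L = "tensor_project L" and p\<^sub>M = "tensor_project M" and p\<^sub>N = "tensor_project N"])
      (use zero zero' add_hom_closed[OF tensor_map_hom[OF RM RL f id_module_hom]]
        add_hom_closed[OF tensor_map_hom[OF RN RM g id_module_hom]] add_hom_closed[OF tensor_project_hom[OF L]]
       in \<open>simp_all add: L M N f g tensor_embed_closed tensor_project_embed tensor_embed_natural tensor_project_natural\<close>)
qed

end

text \<open>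
  If an \<open>R\<close>-linear \<open>\<rho>: Q \<rightarrow> R\<close> takes the value \<open>1\<close> at \<open>u\<close>, then \<open>l \<mapsto> l \<otimes> u\<close> and \<open>l \<otimes> q \<mapsto> l \<rho>(q)\<close> exhibit
  each \<open>L\<close> as a natural retract of \<open>L \<otimes>\<^sub>R Q\<close>, which makes tensoring with \<open>Q\<close> reflect exactness.
\<close>

locale relatively_projective_retraction = relatively_projective K R Q V s
  for K :: "'k ring" (structure) and R :: "('k, 'r) module" and Q :: "('r, 'q) module" and V s +
  fixes \<rho> :: "'q \<Rightarrow> 'r" and u :: 'q
  assumes \<rho>: "\<rho> \<in> module_hom R Q (left_reg R)" and u: "u \<in> carrier Q" and \<rho>_u: "\<rho> u = \<one>\<^bsub>R\<^esub>"
begin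

lemma \<rho>_simps:
  "x \<in> carrier Q \<Longrightarrow> \<rho> x \<in> carrier R"
  "x \<in> carrier Q \<Longrightarrow> y \<in> carrier Q \<Longrightarrow> \<rho> (x \<oplus>\<^bsub>Q\<^esub> y) = \<rho> x \<oplus>\<^bsub>R\<^esub> \<rho> y"
  "r \<in> carrier R \<Longrightarrow> x \<in> carrier Q \<Longrightarrow> \<rho> (r \<odot>\<^bsub>Q\<^esub> x) = r \<otimes>\<^bsub>R\<^esub> \<rho> x"
  using add_hom_closed[OF module_hom_add_hom[OF \<rho>]] add_hom_add[OF module_hom_add_hom[OF \<rho>]] module_hom_smult[OF \<rho>]
  by (simp_all add: left_reg_def with_smult_def)

lemma balanced_retraction:
  fixes L :: "('r, 'l) module"
  assumes L: "right_module R L"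
  shows "balanced R L Q L (\<lambda>l q. \<rho> q \<odot>\<^bsub>L\<^esub> l)"
  using left_moduleD[OF left_module_opposite[OF L]] by (intro balancedI) (simp_all add: \<rho>_simps)

lemma retraction_natural:
  fixes L :: "('r, 'l) module" and M :: "('r, 'm) module"
  assumes L: "right_module R L" and M: "right_module R M" and f: "f \<in> module_hom R L M"
    and t: "t \<in> carrier (tensor_group R L Q)"
  shows "tensor_lift M (\<lambda>l q. \<rho> q \<odot>\<^bsub>M\<^esub> l) (tensor_map R M Q f id t) = f (tensor_lift L (\<lambda>l q. \<rho> q \<odot>\<^bsub>L\<^esub> l) t)"
proof -
  note RL = tensor_factors_RLQ[OF L] and RM = tensor_factors_RLQ[OF M]
  note L' = left_moduleD(2)[OF left_module_opposite[OF L]] and M' = left_moduleD(2)[OF left_module_opposite[OF M]]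
  show ?thesis
    by (rule tensor_factors.tensor_hom_ext[OF RL M'
          add_hom_compose[OF tensor_factors.tensor_lift_hom[OF RM M' balanced_retraction[OF M]]
            tensor_map_hom[OF RM RL f id_module_hom]]
          add_hom_compose[OF module_hom_add_hom[OF f] tensor_factors.tensor_lift_hom[OF RL L' balanced_retraction[OF L]]] _ t])
      (simp add: tensor_map_pure_tensor[OF RM RL f id_module_hom] add_hom_closed[OF module_hom_add_hom[OF f]]
        tensor_factors.tensor_lift_pure[OF RM M' balanced_retraction[OF M]]
        tensor_factors.tensor_lift_pure[OF RL L' balanced_retraction[OF L]] module_hom_smult[OF f] \<rho>_simps)
qed

lemma retraction_unit:
  fixes L :: "('r, 'l) module"
  assumes L: "right_module R L" and l: "l \<in> carrier L"
  shows "tensor_lift L (\<lambda>l q. \<rho> q \<odot>\<^bsub>L\<^esub> l) (pure_tensor R L Q l u) = l"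
  using tensor_factors.tensor_lift_pure[OF tensor_factors_RLQ[OF L] _ balanced_retraction[OF L] l u]
    left_moduleD[OF left_module_opposite[OF L]] l \<rho>_u by simp

lemma faithful:
  fixes L :: "('r, 'l) module" and M :: "('r, 'm) module" and N :: "('r, 'n) module"
  assumes L: "right_module R L" and M: "right_module R M" and N: "right_module R N"
    and f: "f \<in> module_hom R L M" and g: "g \<in> module_hom R M N"
    and exact: "exact_at (tensor_group R L Q) (tensor_group R M Q) (tensor_group R N Q)
      (tensor_map R M Q f id) (tensor_map R N Q g id)"
  shows "exact_at L M N f g"
proof -
  note RL = tensor_factors_RLQ[OF L] and RM = tensor_factors_RLQ[OF M] and RN = tensor_factors_RLQ[OF N]
  note L' = left_moduleD(2)[OF left_module_opposite[OF L]] and M' = left_moduleD(2)[OF left_module_opposite[OF M]]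
    and N' = left_moduleD(2)[OF left_module_opposite[OF N]]
  have zero: "pure_tensor R N Q \<zero>\<^bsub>N\<^esub> u = \<zero>\<^bsub>tensor_group R N Q\<^esub>"
    using tensor_factors.balanced_pure[OF RN] u
    by (intro add_hom_zero[OF N' tensor_factors.abelian_tensor_group[OF RN]]) (simp add: balanced_def)
  have zero': "tensor_lift N (\<lambda>l q. \<rho> q \<odot>\<^bsub>N\<^esub> l) \<zero>\<^bsub>tensor_group R N Q\<^esub> = \<zero>\<^bsub>N\<^esub>"
    by (rule add_hom_zero[OF tensor_factors.abelian_tensor_group[OF RN] N'
          tensor_factors.tensor_lift_hom[OF RN N' balanced_retraction[OF N]]])
  note hom = add_hom_closed[OF module_hom_add_hom[OF f]] add_hom_closed[OF module_hom_add_hom[OF g]]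
  show ?thesis
    by (rule exact_at_retract[OF exact, where i\<^sub>L = "\<lambda>l. pure_tensor R L Q l u" and i\<^sub>M = "\<lambda>l. pure_tensor R M Q l u"
          and i\<^sub>N = "\<lambda>l. pure_tensor R N Q l u" and p\<^sub>L = "tensor_lift L (\<lambda>l q. \<rho> q \<odot>\<^bsub>L\<^esub> l)"
          and p\<^sub>M = "tensor_lift M (\<lambda>l q. \<rho> q \<odot>\<^bsub>M\<^esub> l)" and p\<^sub>N = "tensor_lift N (\<lambda>l q. \<rho> q \<odot>\<^bsub>N\<^esub> l)"])
      (use u hom in \<open>simp_all add: zero zero' retraction_unit L M N f g retraction_natural
        tensor_map_pure_tensor[OF RM RL f id_module_hom] tensor_map_pure_tensor[OF RN RM g id_module_hom]
        tensor_factors.pure_closed[OF RL] tensor_factors.pure_closed[OF RM]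
        add_hom_closed[OF tensor_factors.tensor_lift_hom[OF RL L' balanced_retraction[OF L]]]\<close>)
qed

theorem faithfully_flat: "faithfully_flat_left TYPE('l) TYPE('m) TYPE('n) R Q"
  unfolding faithfully_flat_left_def using Q flat faithful by blast

end

text \<open>
  The complement is the kernel of \<open>\<rho>\<close>.  The last two assumptions replace module axioms, so that the
  lemma applies to left and to right modules.
\<close>

lemma direct_summand_retraction:
  assumes "abelian_group M" "submodule S R M" "\<rho> \<in> module_hom R M M"
    and "\<And>x. x \<in> carrier M \<Longrightarrow> \<rho> x \<in> S" "\<And>x. x \<in> S \<Longrightarrow> \<rho> x = x"
    and "\<And>r. r \<in> carrier R \<Longrightarrow> r \<odot>\<^bsub>M\<^esub> \<zero>\<^bsub>M\<^esub> = \<zero>\<^bsub>M\<^esub>"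
    and "\<And>r x. \<lbrakk>r \<in> carrier R; x \<in> carrier M\<rbrakk> \<Longrightarrow> r \<odot>\<^bsub>M\<^esub> x \<in> carrier M"
  shows "direct_summand R M S"
proof -
  interpret M: abelian_group M by fact
  let ?Q = "{x \<in> carrier M. \<rho> x = \<zero>\<^bsub>M\<^esub>}"
  note hom = module_hom_add_hom[OF assms(3)]
  note simps = add_hom_closed[OF hom] add_hom_add[OF hom] add_hom_minus[OF assms(1,1) hom] add_hom_zero[OF assms(1,1) hom]
  interpret S: submodule S R M by fact
  have S: "S \<subseteq> carrier M" "\<zero>\<^bsub>M\<^esub> \<in> S" using S.subset S.one_closed by auto
  have "submodule ?Q R M"
    using assms(6,7)
    by (intro submodule.intro subgroup.intro submodule_axioms.intro)
      (auto simp: simps module_hom_smult[OF assms(3)] a_inv_def[symmetric])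
  moreover have "S \<inter> ?Q = {\<zero>\<^bsub>M\<^esub>}"
    using S(2) assms(5)[OF S(2)] assms(5) by fastforce
  moreover have "S <+>\<^bsub>M\<^esub> ?Q = carrier M"
  proof (intro equalityI subsetI)
    fix x assume "x \<in> S <+>\<^bsub>M\<^esub> ?Q"
    then show "x \<in> carrier M" using S by (auto simp: set_add_def set_mult_def)
  next
    fix x assume x: "x \<in> carrier M"
    let ?q = "x \<ominus>\<^bsub>M\<^esub> \<rho> x"
    have "\<rho> (\<rho> x) = \<rho> x" using assms(4,5) x by simp
    then have "?q \<in> ?Q" using x by (simp add: simps a_minus_def M.r_neg)
    moreover have "x = \<rho> x \<oplus>\<^bsub>M\<^esub> ?q" using x simps(1)[OF x] by (simp add: a_minus_def M.a_lcomm M.r_neg)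
    ultimately show "x \<in> S <+>\<^bsub>M\<^esub> ?Q"
      using assms(4)[OF x] unfolding set_add_def set_mult_def by auto
  qed
  ultimately show ?thesis unfolding direct_summand_def using assms(2) by blast
qed

section \<open>Coflatness of relatively injective comodules\<close>

context ground_field
begin

lemma bilinear_app_right: "bilinear V W E g \<Longrightarrow> v \<in> carrier V \<Longrightarrow> f \<in> lin U W \<Longrightarrow> (\<lambda>u. g v (f u)) \<in> lin U E"
  by (rule lin_compose[OF bilinearD(1)])

lemma bilinear_app_left: "bilinear V W E g \<Longrightarrow> w \<in> carrier W \<Longrightarrow> f \<in> lin U V \<Longrightarrow> (\<lambda>u. g (f u) w) \<in> lin U E"
  by (rule lin_compose[OF bilinearD(2)])

text \<open>
  The two iterated lifts of Sweedler calculus: \<open>F v w\<^sub>(\<^sub>0\<^sub>) w\<^sub>(\<^sub>1\<^sub>)\<close> and \<open>F v\<^sub>(\<^sub>0\<^sub>) v\<^sub>(\<^sub>1\<^sub>) w\<close>, summed over a tensor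
  with entries \<open>v \<otimes> w\<close>, where \<open>\<tau>\<close> expands the second and \<open>\<rho>\<close> the first factor.
\<close>

definition expand_right where
  "expand_right E F \<tau> t = tensor_lift E (\<lambda>v w. tensor_lift E (F v) (\<tau> w)) t"

definition expand_left where
  "expand_left E F \<rho> t = tensor_lift E (\<lambda>v w. tensor_lift E (\<lambda>x y. F x y w) (\<rho> v)) t"

abbreviation "pure3 U V W \<equiv> \<lambda>u v w. pure U (V \<boxtimes> W) u (pure V W v w)"

context
  fixes U :: "('k, 'u, 'x1) module_scheme" and V :: "('k, 'v, 'x2) module_scheme"
    and W :: "('k, 'w, 'x3) module_scheme" and B :: "('k, 'b, 'x4) module_scheme"
    and E :: "('k, 'e, 'x5) module_scheme"
  assumes mods: "module K U" "module K V" "module K W" "module K B" "module K E"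
begin

lemma bilinear_expand_right:
  "\<lbrakk>trilinear U V W E F; \<tau> \<in> lin B (V \<boxtimes> W)\<rbrakk> \<Longrightarrow> bilinear U B E (\<lambda>v w. tensor_lift E (F v) (\<tau> w))"
  by (rule bilinear_compose[OF bilinear_lift_right[OF mods(1-3,5)] lin_ident])

lemma bilinear_expand_left:
  "\<lbrakk>trilinear U V W E F; \<rho> \<in> lin B (U \<boxtimes> V)\<rbrakk> \<Longrightarrow>
    bilinear B W E (\<lambda>v w. tensor_lift E (\<lambda>x y. F x y w) (\<rho> v))"
  by (rule bilinear_compose[OF bilinear_lift_left[OF mods(1-3,5)] _ lin_ident])

lemma expand_right_lin:
  "\<lbrakk>trilinear U V W E F; \<tau> \<in> lin B (V \<boxtimes> W)\<rbrakk> \<Longrightarrow> expand_right E F \<tau> \<in> lin (U \<boxtimes> B) E"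
  unfolding expand_right_def by (rule lift_lin[OF mods(1,4,5) bilinear_expand_right])

lemma expand_left_lin:
  "\<lbrakk>trilinear U V W E F; \<rho> \<in> lin B (U \<boxtimes> V)\<rbrakk> \<Longrightarrow> expand_left E F \<rho> \<in> lin (B \<boxtimes> W) E"
  unfolding expand_left_def by (rule lift_lin[OF mods(4,3,5) bilinear_expand_left])

lemma expand_right_pure:
  "\<lbrakk>trilinear U V W E F; \<tau> \<in> lin B (V \<boxtimes> W); u \<in> carrier U; b \<in> carrier B\<rbrakk> \<Longrightarrow>
    expand_right E F \<tau> (pure U B u b) = tensor_lift E (F u) (\<tau> b)"
  unfolding expand_right_def by (rule lift_pure[OF mods(1,4,5) bilinear_expand_right])

lemma expand_left_pure:
  "\<lbrakk>trilinear U V W E F; \<rho> \<in> lin B (U \<boxtimes> V); b \<in> carrier B; w \<in> carrier W\<rbrakk> \<Longrightarrow>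
    expand_left E F \<rho> (pure B W b w) = tensor_lift E (\<lambda>x y. F x y w) (\<rho> b)"
  unfolding expand_left_def by (rule lift_pure[OF mods(4,3,5) bilinear_expand_left])

text \<open>
  An equation between the two ways of expanding tensors holds as soon as it holds for the
  universal trilinear map.
\<close>

lemma expand_eq:
  fixes A :: "('k, 'a, 'x6) module_scheme"
  assumes A: "module K A" and \<tau>: "\<tau> \<in> lin B (V \<boxtimes> W)" and \<rho>: "\<rho> \<in> lin A (U \<boxtimes> V)"
    and t: "t \<in> carrier (U \<boxtimes> B)" "t' \<in> carrier (A \<boxtimes> W)" and F: "trilinear U V W E F"
    and eq: "tensor_map K U (V \<boxtimes> W) id \<tau> t = assoc_right K U V W (tensor_map K (U \<boxtimes> V) W \<rho> id t')"
  shows "expand_right E F \<tau> t = expand_left E F \<rho> t'"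
  unfolding expand_right_def expand_left_def
  using lift_lift_right[OF mods \<tau> t(1) F] lift_assoc_right[OF mods(1-3) A mods(5) \<rho> t(2) F] eq by simp

end

text \<open>The identity is tested against the universal trilinear map.\<close>

lemma expand_eqI:
  assumes "module K U" "module K V" "module K W" "module K B" "module K A"
    and \<tau>: "\<tau> \<in> lin B (V \<boxtimes> W)" and \<rho>: "\<rho> \<in> lin A (U \<boxtimes> V)"
    and t: "t \<in> carrier (U \<boxtimes> B)" "t' \<in> carrier (A \<boxtimes> W)"
    and eq: "expand_right (U \<boxtimes> V \<boxtimes> W) (pure3 U V W) \<tau> t = expand_left (U \<boxtimes> V \<boxtimes> W) (pure3 U V W) \<rho> t'"
  shows "tensor_map K U (V \<boxtimes> W) id \<tau> t = assoc_right K U V W (tensor_map K (U \<boxtimes> V) W \<rho> id t')"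
  using eq unfolding tensor_map_right_lift[OF assms(1-4) \<tau> t(1)] assoc_right_tensor_map[OF assms(1-3,5) \<rho> t(2)]
    expand_right_def expand_left_def .

lemma hom_expand_right:
  assumes "module K U" "module K V" "module K W" "module K B" "module K E" "module K E'"
    "trilinear U V W E F" "\<tau> \<in> lin B (V \<boxtimes> W)" "h \<in> lin E E'" "t \<in> carrier (U \<boxtimes> B)"
  shows "h (expand_right E F \<tau> t) = expand_right E' (\<lambda>x y z. h (F x y z)) \<tau> t"
proof -
  note bil = bilinear_expand_right[OF assms(1-5,7,8)]
  show ?thesis
    unfolding expand_right_def hom_lift[OF assms(1,4,5) bil assms(6,9,10)]
  proof (rule lift_cong[OF assms(1,4,6) bilinear_hom[OF bil assms(9)] _ assms(10)])
    fix v w assume v: "v \<in> carrier U" and w: "w \<in> carrier B"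
    show "h (tensor_lift E (F v) (\<tau> w)) = tensor_lift E' (\<lambda>y z. h (F v y z)) (\<tau> w)"
      by (rule hom_lift[OF assms(2,3,5) trilinearD(1)[OF assms(7) v] assms(6,9) lin_closed[OF assms(8) w]])
  qed
qed

lemma hom_expand_left:
  assumes "module K U" "module K V" "module K W" "module K B" "module K E" "module K E'"
    "trilinear U V W E F" "\<rho> \<in> lin B (U \<boxtimes> V)" "h \<in> lin E E'" "t \<in> carrier (B \<boxtimes> W)"
  shows "h (expand_left E F \<rho> t) = expand_left E' (\<lambda>x y z. h (F x y z)) \<rho> t"
proof -
  note bil = bilinear_expand_left[OF assms(1-5,7,8)]
  show ?thesis
    unfolding expand_left_def hom_lift[OF assms(4,3,5) bil assms(6,9,10)]
  proof (rule lift_cong[OF assms(4,3,6) bilinear_hom[OF bil assms(9)] _ assms(10)])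
    fix v w assume v: "v \<in> carrier B" and w: "w \<in> carrier W"
    show "h (tensor_lift E (\<lambda>x y. F x y w) (\<rho> v)) = tensor_lift E' (\<lambda>x y. h (F x y w)) (\<rho> v)"
      by (rule hom_lift[OF assms(1,2,5) trilinearD(2)[OF assms(7) w] assms(6,9) lin_closed[OF assms(8) v]])
  qed
qed

lemma coalgebraD:
  assumes "is_coalgebra K C"
  shows "module K C" "comult C \<in> lin C (C \<boxtimes> C)" "counit C \<in> lin C (left_reg K)"
    and "c \<in> carrier C \<Longrightarrow> tensor_lift C (\<lambda>x y. counit C x \<odot>\<^bsub>C\<^esub> y) (comult C c) = c"
    and "c \<in> carrier C \<Longrightarrow> tensor_lift C (\<lambda>x y. counit C y \<odot>\<^bsub>C\<^esub> x) (comult C c) = c"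
  using assms by (auto simp: is_coalgebra_def)

lemma right_comoduleD:
  assumes "right_comodule K C V \<rho>"
  shows "module K V" "\<rho> \<in> lin V (V \<boxtimes> C)"
    and "v \<in> carrier V \<Longrightarrow> tensor_lift V (\<lambda>x c. counit C c \<odot>\<^bsub>V\<^esub> x) (\<rho> v) = v"
  using assms by (auto simp: right_comodule_def)

lemma left_comoduleD:
  assumes "left_comodule K C W \<tau>"
  shows "module K W" "\<tau> \<in> lin W (C \<boxtimes> W)"
    and "w \<in> carrier W \<Longrightarrow> tensor_lift W (\<lambda>c x. counit C c \<odot>\<^bsub>W\<^esub> x) (\<tau> w) = w"
  using assms by (auto simp: left_comodule_def)

lemma right_comodule_coassoc:
  assumes C: "is_coalgebra K C" and V: "right_comodule K C V \<rho>" and v: "v \<in> carrier V" and E: "module K E"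
    and F: "trilinear V C C E F"
  shows "expand_right E F (comult C) (\<rho> v) = expand_left E F \<rho> (\<rho> v)"
proof -
  note m = coalgebraD(1)[OF C] and \<Delta> = coalgebraD(2)[OF C] and mV = right_comoduleD(1)[OF V]
    and \<rho> = right_comoduleD(2)[OF V]
  show ?thesis
    using V v by (intro expand_eq[OF mV m m m E mV \<Delta> \<rho> lin_closed[OF \<rho> v] lin_closed[OF \<rho> v] F])
      (simp add: right_comodule_def)
qed

lemma left_comodule_coassoc:
  assumes C: "is_coalgebra K C" and W: "left_comodule K C W \<tau>" and w: "w \<in> carrier W" and E: "module K E"
    and F: "trilinear C C W E F"
  shows "expand_right E F \<tau> (\<tau> w) = expand_left E F (comult C) (\<tau> w)"
proof -
  note m = coalgebraD(1)[OF C] and \<Delta> = coalgebraD(2)[OF C] and mW = left_comoduleD(1)[OF W]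
    and \<tau> = left_comoduleD(2)[OF W]
  show ?thesis
    using W w by (intro expand_eq[OF m m mW mW E m \<tau> \<Delta> lin_closed[OF \<tau> w] lin_closed[OF \<tau> w] F])
      (simp add: left_comodule_def)
qed

subsection \<open>Cotensor products\<close>

lemma cotensor_simps:
  "t \<in> carrier (cotensor K C V \<rho> W \<tau>) \<Longrightarrow> t \<in> carrier (V \<boxtimes> W)"
  "\<zero>\<^bsub>cotensor K C V \<rho> W \<tau>\<^esub> = \<zero>\<^bsub>V \<boxtimes> W\<^esub>"
  by (simp_all add: cotensor_def)

context
  fixes C :: "('k, 'c) coalgebra" and V :: "('k, 'v) module" and W :: "('k, 'w) module" and \<rho> \<tau>
  assumes C: "is_coalgebra K C" and V: "right_comodule K C V \<rho>" and W: "left_comodule K C W \<tau>"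
begin

lemma cotensor_expand:
  assumes "t \<in> carrier (cotensor K C V \<rho> W \<tau>)" "module K E" "trilinear V C W E F"
  shows "expand_right E F \<tau> t = expand_left E F \<rho> t"
  using assms(1)
  by (intro expand_eq[OF right_comoduleD(1)[OF V] coalgebraD(1)[OF C] left_comoduleD(1)[OF W]
      left_comoduleD(1)[OF W] assms(2) right_comoduleD(1)[OF V] left_comoduleD(2)[OF W] right_comoduleD(2)[OF V]
      cotensor_simps(1)[OF assms(1)] cotensor_simps(1)[OF assms(1)] assms(3)])
    (simp add: cotensor_def)

lemma cotensorI:
  assumes "t \<in> carrier (V \<boxtimes> W)"
    and "expand_right (V \<boxtimes> C \<boxtimes> W) (pure3 V C W) \<tau> t = expand_left (V \<boxtimes> C \<boxtimes> W) (pure3 V C W) \<rho> t"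
  shows "t \<in> carrier (cotensor K C V \<rho> W \<tau>)"
  using assms expand_eqI[OF right_comoduleD(1)[OF V] coalgebraD(1)[OF C] left_comoduleD(1)[OF W]
      left_comoduleD(1)[OF W] right_comoduleD(1)[OF V] left_comoduleD(2)[OF W] right_comoduleD(2)[OF V]
      assms(1) assms(1)]
  by (simp add: cotensor_def)

end

end

text \<open>
  A comodule whose coaction has a colinear left inverse \<open>\<gamma>\<close> is a direct summand of a cofree comodule,
  and cotensoring with a cofree comodule is tensoring over the ground field.
\<close>

locale relatively_injective_right = ground_field K for K :: "'k ring" (structure) +
  fixes C :: "('k, 'c) coalgebra" and V :: "('k, 'v) module" and \<rho> and \<gamma>
  assumes C: "is_coalgebra K C" and V: "right_comodule K C V \<rho>" and \<gamma>: "bilinear V C V \<gamma>"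
    and \<gamma>_split: "\<And>v. v \<in> carrier V \<Longrightarrow> tensor_lift V \<gamma> (\<rho> v) = v"
    and \<gamma>_colinear: "\<And>v c. \<lbrakk>v \<in> carrier V; c \<in> carrier C\<rbrakk> \<Longrightarrow>
      \<rho> (\<gamma> v c) = tensor_lift (V \<boxtimes> C) (\<lambda>x y. pure V C (\<gamma> v x) y) (comult C c)"
begin

lemmas mC = coalgebraD(1)[OF C] and mV = right_comoduleD(1)[OF V] and \<rho> = right_comoduleD(2)[OF V]
  and \<Delta> = coalgebraD(2)[OF C]

lemma trilinear_\<gamma>: "module K W \<Longrightarrow> trilinear V C W (V \<boxtimes> W) (\<lambda>v c w. pure V W (\<gamma> v c) w)"
  by (intro trilinearI lin_pure_left[OF mV] lin_pure_right[OF mV] bilinear_app_left[OF \<gamma>] bilinear_app_right[OF \<gamma>])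
    (auto simp: bilinear_closed[OF \<gamma>])

text \<open>
  The map \<open>v \<otimes> w \<mapsto> \<gamma>(v \<otimes> w\<^sub>-) \<otimes> w\<^sub>0\<close> projects \<open>V \<otimes> W\<close> onto the cotensor product: its values are cotensors
  because \<open>\<gamma>\<close> is colinear, and it fixes cotensors because \<open>\<gamma>\<close> splits the coaction.
\<close>

lemma project_closed:
  assumes W: "left_comodule K C W \<tau>" and t: "t \<in> carrier (V \<boxtimes> W)"
  shows "expand_right (V \<boxtimes> W) (\<lambda>v c w. pure V W (\<gamma> v c) w) \<tau> t \<in> carrier (cotensor K C V \<rho> W \<tau>)"
proof -
  let ?T = "V \<boxtimes> C \<boxtimes> W" and ?p = "expand_right (V \<boxtimes> W) (\<lambda>v c w. pure V W (\<gamma> v c) w) \<tau>"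
  note mW = left_comoduleD(1)[OF W] and \<tau> = left_comoduleD(2)[OF W]
  note T = module_tensor[OF mV module_tensor[OF mC mW]] and VW = module_tensor[OF mV mW]
  note tri = trilinear_\<gamma>[OF mW] and tri3 = trilinear_pure[OF mV mC mW]
  have p: "?p \<in> lin (V \<boxtimes> W) (V \<boxtimes> W)" by (rule expand_right_lin[OF mV mC mW mW VW tri \<tau>])
  have L: "expand_right ?T (pure3 V C W) \<tau> \<in> lin (V \<boxtimes> W) ?T"
    by (rule expand_right_lin[OF mV mC mW mW T tri3 \<tau>])
  have R: "expand_left ?T (pure3 V C W) \<rho> \<in> lin (V \<boxtimes> W) ?T"
    by (rule expand_left_lin[OF mV mC mW mV T tri3 \<rho>])
  have "expand_right ?T (pure3 V C W) \<tau> (?p t) = expand_left ?T (pure3 V C W) \<rho> (?p t)"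
  proof (rule tensor_lin_ext[OF mV mW T lin_compose[OF L p] lin_compose[OF R p] _ t])
    fix v w assume v: "v \<in> carrier V" and w: "w \<in> carrier W"
    have tri': "trilinear C C W ?T (\<lambda>c c' x. pure V (C \<boxtimes> W) (\<gamma> v c) (pure C W c' x))"
      using mV mC mW v
      by (intro trilinearI linear_intros bilinear_app_right[OF \<gamma>]) (auto simp: bilinear_closed[OF \<gamma>])
    note \<tau>w = lin_closed[OF \<tau> w] and bil = trilinearD(1)[OF tri v]
    have "expand_right ?T (pure3 V C W) \<tau> (?p (pure V W v w)) =
        tensor_lift ?T (\<lambda>c x. expand_right ?T (pure3 V C W) \<tau> (pure V W (\<gamma> v c) x)) (\<tau> w)"
      unfolding expand_right_pure[OF mV mC mW mW VW tri \<tau> v w] by (rule hom_lift[OF mC mW VW bil T L \<tau>w])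
    also have "\<dots> = expand_right ?T (\<lambda>c c' x. pure V (C \<boxtimes> W) (\<gamma> v c) (pure C W c' x)) \<tau> (\<tau> w)"
      unfolding expand_right_def[of _ _ _ "\<tau> w"]
      by (rule lift_cong[OF mC mW T bilinear_expand_right[OF mC mC mW mW T tri' \<tau>] _ \<tau>w, symmetric])
        (simp add: expand_right_pure[OF mV mC mW mW T tri3 \<tau>] bilinear_closed[OF \<gamma> v])
    also have "\<dots> = expand_left ?T (\<lambda>c c' x. pure V (C \<boxtimes> W) (\<gamma> v c) (pure C W c' x)) (comult C) (\<tau> w)"
      by (rule left_comodule_coassoc[OF C W w T tri'])
    also have "\<dots> = tensor_lift ?T (\<lambda>c x. expand_left ?T (pure3 V C W) \<rho> (pure V W (\<gamma> v c) x)) (\<tau> w)"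
      unfolding expand_left_def[of _ _ _ "\<tau> w"]
    proof (rule lift_cong[OF mC mW T bilinear_expand_left[OF mC mC mW mC T tri' \<Delta>] _ \<tau>w])
      fix c x assume c: "c \<in> carrier C" and x: "x \<in> carrier W"
      have \<gamma>v: "bilinear C C (V \<boxtimes> C) (\<lambda>c c'. pure V C (\<gamma> v c) c')"
        using mV mC v
        by (intro linear_intros bilinear_app_right[OF \<gamma>]) (auto simp: bilinear_closed[OF \<gamma>])
      note bx = trilinearD(2)[OF tri3 x]
      have "expand_left ?T (pure3 V C W) \<rho> (pure V W (\<gamma> v c) x) =
          tensor_lift ?T (\<lambda>v' c'. pure3 V C W v' c' x) (\<rho> (\<gamma> v c))"
        by (rule expand_left_pure[OF mV mC mW mV T tri3 \<rho> bilinear_closed[OF \<gamma> v c] x])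
      also have "\<dots> = tensor_lift ?T (\<lambda>c c'. tensor_lift ?T (\<lambda>v' c'. pure3 V C W v' c' x) (pure V C (\<gamma> v c) c')) (comult C c)"
        unfolding \<gamma>_colinear[OF v c] by (rule lift_lift[OF mV mC mC mC T \<gamma>v bx lin_closed[OF \<Delta> c]])
      also have "\<dots> = tensor_lift ?T (\<lambda>c c'. pure3 V C W (\<gamma> v c) c' x) (comult C c)"
        by (rule lift_cong[OF mC mC T trilinearD(2)[OF tri' x] _ lin_closed[OF \<Delta> c], symmetric])
          (simp add: lift_pure[OF mV mC T bx] bilinear_closed[OF \<gamma> v])
      finally show "tensor_lift ?T (\<lambda>c c'. pure3 V C W (\<gamma> v c) c' x) (comult C c) =
          expand_left ?T (pure3 V C W) \<rho> (pure V W (\<gamma> v c) x)" ..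
    qed
    also have "\<dots> = expand_left ?T (pure3 V C W) \<rho> (?p (pure V W v w))"
      unfolding expand_right_pure[OF mV mC mW mW VW tri \<tau> v w]
      by (rule hom_lift[OF mC mW VW bil T R \<tau>w, symmetric])
    finally show "expand_right ?T (pure3 V C W) \<tau> (?p (pure V W v w)) =
        expand_left ?T (pure3 V C W) \<rho> (?p (pure V W v w))" .
  qed
  then show ?thesis by (rule cotensorI[OF C V W lin_closed[OF p t]])
qed

lemma project_cotensor:
  assumes W: "left_comodule K C W \<tau>" and t: "t \<in> carrier (cotensor K C V \<rho> W \<tau>)"
  shows "expand_right (V \<boxtimes> W) (\<lambda>v c w. pure V W (\<gamma> v c) w) \<tau> t = t"
proof -
  note mW = left_comoduleD(1)[OF W] and tV = cotensor_simps(1)[OF t]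
  note VW = module_tensor[OF mV mW] and tri = trilinear_\<gamma>[OF mW]
  have "expand_right (V \<boxtimes> W) (\<lambda>v c w. pure V W (\<gamma> v c) w) \<tau> t =
      expand_left (V \<boxtimes> W) (\<lambda>v c w. pure V W (\<gamma> v c) w) \<rho> t"
    by (rule cotensor_expand[OF C V W t VW tri])
  also have "\<dots> = tensor_lift (V \<boxtimes> W) (pure V W) t"
    unfolding expand_left_def
  proof (rule lift_cong[OF mV mW VW bilinear_pure[OF mV mW] _ tV, symmetric])
    fix v w assume v: "v \<in> carrier V" and w: "w \<in> carrier W"
    have "pure V W (tensor_lift V \<gamma> (\<rho> v)) w = tensor_lift (V \<boxtimes> W) (\<lambda>x y. pure V W (\<gamma> x y) w) (\<rho> v)"
      by (rule hom_lift[OF mV mC mV \<gamma> VW lin_pure_left[OF mV mW lin_ident w] lin_closed[OF \<rho> v]])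
    then show "pure V W v w = tensor_lift (V \<boxtimes> W) (\<lambda>x y. pure V W (\<gamma> x y) w) (\<rho> v)"
      by (simp add: \<gamma>_split[OF v])
  qed
  finally show ?thesis by (simp add: lift_pure_id[OF mV mW tV])
qed

lemma expand_comodule_hom:
  assumes L: "left_comodule K C L \<tau>\<^sub>L" and M: "left_comodule K C M \<tau>\<^sub>M"
    and f: "f \<in> left_comodule_hom K C L \<tau>\<^sub>L M \<tau>\<^sub>M" and E: "module K E" and F: "trilinear V C M E F"
    and t: "t \<in> carrier (V \<boxtimes> L)"
  shows "expand_right E F \<tau>\<^sub>M (tensor_map K V M id f t) = expand_right E (\<lambda>v c x. F v c (f x)) \<tau>\<^sub>L t"
proof -
  note mL = left_comoduleD(1)[OF L] and mM = left_comoduleD(1)[OF M]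
  have fl: "f \<in> lin L M" and fc: "\<And>l. l \<in> carrier L \<Longrightarrow> \<tau>\<^sub>M (f l) = tensor_map K C M id f (\<tau>\<^sub>L l)"
    using f by (auto simp: left_comodule_hom_def)
  note \<tau>L = left_comoduleD(2)[OF L] and \<tau>M = left_comoduleD(2)[OF M]
  note bil = bilinear_expand_right[OF mV mC mM mM E F \<tau>M]
  show ?thesis
    unfolding expand_right_def lift_tensor_map[OF mV mM mV mL E id_lin fl bil t]
  proof (rule lift_cong[OF mV mL E bilinear_compose[OF bil id_lin fl] _ t])
    fix v l assume v: "v \<in> carrier V" and l: "l \<in> carrier L"
    show "tensor_lift E (F (id v)) (\<tau>\<^sub>M (f l)) = tensor_lift E (\<lambda>c x. F v c (f x)) (\<tau>\<^sub>L l)"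
      unfolding fc[OF l]
      using lift_tensor_map[OF mC mM mC mL E id_lin fl trilinearD(1)[OF F v] lin_closed[OF \<tau>L l]] by simp
  qed
qed

lemma trilinear_comodule_hom:
  assumes "f \<in> lin L M" "trilinear V C M E F"
  shows "trilinear V C L E (\<lambda>v c x. F v c (f x))"
  using lin_compose[OF bilinearD(1)[OF trilinearD(1)[OF assms(2)]] assms(1)]
    bilinearD(2)[OF trilinearD(1)[OF assms(2)]] bilinearD(2)[OF trilinearD(2)[OF assms(2)]] lin_closed[OF assms(1)]
  by (intro trilinearI) auto

lemma cotensor_map_closed:
  assumes L: "left_comodule K C L \<tau>\<^sub>L" and M: "left_comodule K C M \<tau>\<^sub>M"
    and f: "f \<in> left_comodule_hom K C L \<tau>\<^sub>L M \<tau>\<^sub>M" and t: "t \<in> carrier (cotensor K C V \<rho> L \<tau>\<^sub>L)"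
  shows "tensor_map K V M id f t \<in> carrier (cotensor K C V \<rho> M \<tau>\<^sub>M)"
proof (rule cotensorI[OF C V M])
  let ?T = "V \<boxtimes> C \<boxtimes> M"
  note mL = left_comoduleD(1)[OF L] and mM = left_comoduleD(1)[OF M] and tV = cotensor_simps(1)[OF t]
  have fl: "f \<in> lin L M" using f by (auto simp: left_comodule_hom_def)
  note T = module_tensor[OF mV module_tensor[OF mC mM]] and tri3 = trilinear_pure[OF mV mC mM]
  show "tensor_map K V M id f t \<in> carrier (V \<boxtimes> M)"
    by (rule lin_closed[OF tensor_map_lin[OF mV mM mV mL id_lin fl] tV])
  have "expand_right ?T (pure3 V C M) \<tau>\<^sub>M (tensor_map K V M id f t) =
      expand_right ?T (\<lambda>v c x. pure3 V C M v c (f x)) \<tau>\<^sub>L t"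
    by (rule expand_comodule_hom[OF L M f T tri3 tV])
  also have "\<dots> = expand_left ?T (\<lambda>v c x. pure3 V C M v c (f x)) \<rho> t"
    by (rule cotensor_expand[OF C V L t T trilinear_comodule_hom[OF fl tri3]])
  also have "\<dots> = expand_left ?T (pure3 V C M) \<rho> (tensor_map K V M id f t)"
    unfolding expand_left_def
    using lift_tensor_map[OF mV mM mV mL T id_lin fl bilinear_expand_left[OF mV mC mM mV T tri3 \<rho>] tV] by simp
  finally show "expand_right ?T (pure3 V C M) \<tau>\<^sub>M (tensor_map K V M id f t) =
    expand_left ?T (pure3 V C M) \<rho> (tensor_map K V M id f t)" .
qed

text \<open>
  The projection is natural, so the cotensor products form a retract of the sequence of tensor
  products over the ground field, which is exact.
\<close>

theorem coflat: "coflat_right TYPE('l) TYPE('m) TYPE('n) K C V \<rho>"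
  unfolding coflat_right_def
proof (intro conjI allI impI V)
  fix L :: "('k, 'l) module" and \<tau>\<^sub>L and M :: "('k, 'm) module" and \<tau>\<^sub>M and N :: "('k, 'n) module" and \<tau>\<^sub>N f g
  assume "left_comodule K C L \<tau>\<^sub>L \<and> left_comodule K C M \<tau>\<^sub>M \<and> left_comodule K C N \<tau>\<^sub>N \<and>
       f \<in> left_comodule_hom K C L \<tau>\<^sub>L M \<tau>\<^sub>M \<and> g \<in> left_comodule_hom K C M \<tau>\<^sub>M N \<tau>\<^sub>N \<and> exact_at L M N f g"
  then have L: "left_comodule K C L \<tau>\<^sub>L" and M: "left_comodule K C M \<tau>\<^sub>M" and N: "left_comodule K C N \<tau>\<^sub>N"
    and f: "f \<in> left_comodule_hom K C L \<tau>\<^sub>L M \<tau>\<^sub>M" and g: "g \<in> left_comodule_hom K C M \<tau>\<^sub>M N \<tau>\<^sub>N"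
    and exact: "exact_at L M N f g" by auto
  have fl: "f \<in> lin L M" and gl: "g \<in> lin M N" using f g by (auto simp: left_comodule_hom_def)
  note mL = left_comoduleD(1)[OF L] and mM = left_comoduleD(1)[OF M] and mN = left_comoduleD(1)[OF N]
  let ?p = "\<lambda>W \<tau>. expand_right (V \<boxtimes> W) (\<lambda>v c w. pure V W (\<gamma> v c) w) \<tau>"
  have nat: "?p M \<tau>\<^sub>M (tensor_map K V M id f t) = tensor_map K V M id f (?p L \<tau>\<^sub>L t)" if t: "t \<in> carrier (V \<boxtimes> L)" for t
  proof -
    note F = tensor_map_lin[OF mV mM mV mL id_lin fl] and \<tau>L = left_comoduleD(2)[OF L]
    have "?p M \<tau>\<^sub>M (tensor_map K V M id f t) = expand_right (V \<boxtimes> M) (\<lambda>v c x. pure V M (\<gamma> v c) (f x)) \<tau>\<^sub>L t"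
      by (rule expand_comodule_hom[OF L M f module_tensor[OF mV mM] trilinear_\<gamma>[OF mM] t])
    also have "\<dots> = expand_right (V \<boxtimes> M) (\<lambda>v c x. tensor_map K V M id f (pure V L (\<gamma> v c) x)) \<tau>\<^sub>L t"
      unfolding expand_right_def
    proof (rule lift_cong[OF mV mL module_tensor[OF mV mM] bilinear_expand_right[OF mV mC mL mL module_tensor[OF mV mM]
            trilinear_comodule_hom[OF fl trilinear_\<gamma>[OF mM]] \<tau>L] _ t])
      fix v l assume v: "v \<in> carrier V" and l: "l \<in> carrier L"
      show "tensor_lift (V \<boxtimes> M) (\<lambda>c x. pure V M (\<gamma> v c) (f x)) (\<tau>\<^sub>L l) =
          tensor_lift (V \<boxtimes> M) (\<lambda>c x. tensor_map K V M id f (pure V L (\<gamma> v c) x)) (\<tau>\<^sub>L l)"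
        by (rule lift_cong[OF mC mL module_tensor[OF mV mM] trilinearD(1)[OF trilinear_comodule_hom[OF fl trilinear_\<gamma>[OF mM]] v]
              _ lin_closed[OF \<tau>L l]])
          (simp add: tensor_map_pure[OF mV mM mV mL id_lin fl] bilinear_closed[OF \<gamma> v])
    qed
    also have "\<dots> = tensor_map K V M id f (?p L \<tau>\<^sub>L t)"
      by (rule hom_expand_right[OF mV mC mL mL module_tensor[OF mV mL] module_tensor[OF mV mM] trilinear_\<gamma>[OF mL]
            \<tau>L F t, symmetric])
    finally show ?thesis .
  qed
  note p = expand_right_lin[OF mV mC mN mN module_tensor[OF mV mN] trilinear_\<gamma>[OF mN] left_comoduleD(2)[OF N]]
  have zero: "?p N \<tau>\<^sub>N \<zero>\<^bsub>V \<boxtimes> N\<^esub> = \<zero>\<^bsub>V \<boxtimes> N\<^esub>"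
    by (rule lin_zero[OF module_tensor[OF mV mN] module_tensor[OF mV mN] p])
  show "exact_at (cotensor K C V \<rho> L \<tau>\<^sub>L) (cotensor K C V \<rho> M \<tau>\<^sub>M) (cotensor K C V \<rho> N \<tau>\<^sub>N)
      (tensor_map K V M id f) (tensor_map K V N id g)"
    by (rule exact_at_retract[OF exact_tensor_left[OF mV mL mM mN fl gl exact], where i\<^sub>L = "\<lambda>x. x" and i\<^sub>M = "\<lambda>x. x"
          and i\<^sub>N = "\<lambda>x. x" and p\<^sub>L = "?p L \<tau>\<^sub>L" and p\<^sub>M = "?p M \<tau>\<^sub>M" and p\<^sub>N = "?p N \<tau>\<^sub>N"])
      (auto simp: cotensor_simps zero nat project_cotensor[OF M] project_cotensor[OF N]
        intro: cotensor_map_closed[OF L M f] cotensor_map_closed[OF M N g] project_closed[OF L])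
qed

end

text \<open>The mirror image of the preceding argument; the projection is \<open>v \<otimes> w \<mapsto> v\<^sub>0 \<otimes> \<gamma>(v\<^sub>1 \<otimes> w)\<close>.\<close>

locale relatively_injective_left = ground_field K for K :: "'k ring" (structure) +
  fixes C :: "('k, 'c) coalgebra" and W :: "('k, 'w) module" and \<tau> and \<gamma>
  assumes C: "is_coalgebra K C" and W: "left_comodule K C W \<tau>" and \<gamma>: "bilinear C W W \<gamma>"
    and \<gamma>_split: "\<And>w. w \<in> carrier W \<Longrightarrow> tensor_lift W \<gamma> (\<tau> w) = w"
    and \<gamma>_colinear: "\<And>c w. \<lbrakk>c \<in> carrier C; w \<in> carrier W\<rbrakk> \<Longrightarrow>
      \<tau> (\<gamma> c w) = tensor_lift (C \<boxtimes> W) (\<lambda>x y. pure C W x (\<gamma> y w)) (comult C c)"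
begin

lemmas mC = coalgebraD(1)[OF C] and mW = left_comoduleD(1)[OF W] and \<tau> = left_comoduleD(2)[OF W]
  and \<Delta> = coalgebraD(2)[OF C]

lemma trilinear_\<gamma>: "module K V \<Longrightarrow> trilinear V C W (V \<boxtimes> W) (\<lambda>v c w. pure V W v (\<gamma> c w))"
  by (intro trilinearI lin_pure_left[OF _ mW] lin_pure_right[OF _ mW] bilinear_app_left[OF \<gamma>] bilinear_app_right[OF \<gamma>])
    (auto simp: bilinear_closed[OF \<gamma>])

lemma project_closed:
  assumes V: "right_comodule K C V \<rho>" and t: "t \<in> carrier (V \<boxtimes> W)"
  shows "expand_left (V \<boxtimes> W) (\<lambda>v c w. pure V W v (\<gamma> c w)) \<rho> t \<in> carrier (cotensor K C V \<rho> W \<tau>)"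
proof -
  let ?T = "V \<boxtimes> C \<boxtimes> W" and ?p = "expand_left (V \<boxtimes> W) (\<lambda>v c w. pure V W v (\<gamma> c w)) \<rho>"
  note mV = right_comoduleD(1)[OF V] and \<rho> = right_comoduleD(2)[OF V]
  note T = module_tensor[OF mV module_tensor[OF mC mW]] and VW = module_tensor[OF mV mW]
  note tri = trilinear_\<gamma>[OF mV] and tri3 = trilinear_pure[OF mV mC mW]
  have p: "?p \<in> lin (V \<boxtimes> W) (V \<boxtimes> W)" by (rule expand_left_lin[OF mV mC mW mV VW tri \<rho>])
  have L: "expand_right ?T (pure3 V C W) \<tau> \<in> lin (V \<boxtimes> W) ?T"
    by (rule expand_right_lin[OF mV mC mW mW T tri3 \<tau>])
  have R: "expand_left ?T (pure3 V C W) \<rho> \<in> lin (V \<boxtimes> W) ?T"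
    by (rule expand_left_lin[OF mV mC mW mV T tri3 \<rho>])
  have "expand_right ?T (pure3 V C W) \<tau> (?p t) = expand_left ?T (pure3 V C W) \<rho> (?p t)"
  proof (rule tensor_lin_ext[OF mV mW T lin_compose[OF L p] lin_compose[OF R p] _ t])
    fix v w assume v: "v \<in> carrier V" and w: "w \<in> carrier W"
    have tri': "trilinear V C C ?T (\<lambda>x c c'. pure V (C \<boxtimes> W) x (pure C W c (\<gamma> c' w)))"
      using mV mC mW w
      by (intro trilinearI linear_intros bilinear_app_left[OF \<gamma>]) (auto simp: bilinear_closed[OF \<gamma>])
    note \<rho>v = lin_closed[OF \<rho> v] and bil = trilinearD(2)[OF tri w]
    have "expand_left ?T (pure3 V C W) \<rho> (?p (pure V W v w)) =
        tensor_lift ?T (\<lambda>x c. expand_left ?T (pure3 V C W) \<rho> (pure V W x (\<gamma> c w))) (\<rho> v)"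
      unfolding expand_left_pure[OF mV mC mW mV VW tri \<rho> v w] by (rule hom_lift[OF mV mC VW bil T R \<rho>v])
    also have "\<dots> = expand_left ?T (\<lambda>x c c'. pure V (C \<boxtimes> W) x (pure C W c (\<gamma> c' w))) \<rho> (\<rho> v)"
      unfolding expand_left_def[of _ _ _ "\<rho> v"]
      by (rule lift_cong[OF mV mC T bilinear_expand_left[OF mV mC mC mV T tri' \<rho>] _ \<rho>v, symmetric])
        (simp add: expand_left_pure[OF mV mC mW mV T tri3 \<rho>] bilinear_closed[OF \<gamma> _ w])
    also have "\<dots> = expand_right ?T (\<lambda>x c c'. pure V (C \<boxtimes> W) x (pure C W c (\<gamma> c' w))) (comult C) (\<rho> v)"
      by (rule right_comodule_coassoc[OF C V v T tri', symmetric])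
    also have "\<dots> = tensor_lift ?T (\<lambda>x c. expand_right ?T (pure3 V C W) \<tau> (pure V W x (\<gamma> c w))) (\<rho> v)"
      unfolding expand_right_def[of _ _ _ "\<rho> v"]
    proof (rule lift_cong[OF mV mC T bilinear_expand_right[OF mV mC mC mC T tri' \<Delta>] _ \<rho>v])
      fix x c assume x: "x \<in> carrier V" and c: "c \<in> carrier C"
      have \<gamma>w: "bilinear C C (C \<boxtimes> W) (\<lambda>c c'. pure C W c (\<gamma> c' w))"
        using mW mC w
        by (intro linear_intros bilinear_app_left[OF \<gamma>]) (auto simp: bilinear_closed[OF \<gamma>])
      note bx = trilinearD(1)[OF tri3 x]
      have "expand_right ?T (pure3 V C W) \<tau> (pure V W x (\<gamma> c w)) = tensor_lift ?T (pure3 V C W x) (\<tau> (\<gamma> c w))"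
        by (rule expand_right_pure[OF mV mC mW mW T tri3 \<tau> x bilinear_closed[OF \<gamma> c w]])
      also have "\<dots> = tensor_lift ?T (\<lambda>c c'. tensor_lift ?T (pure3 V C W x) (pure C W c (\<gamma> c' w))) (comult C c)"
        unfolding \<gamma>_colinear[OF c w] by (rule lift_lift[OF mC mW mC mC T \<gamma>w bx lin_closed[OF \<Delta> c]])
      also have "\<dots> = tensor_lift ?T (\<lambda>c c'. pure3 V C W x c (\<gamma> c' w)) (comult C c)"
        by (rule lift_cong[OF mC mC T trilinearD(1)[OF tri' x] _ lin_closed[OF \<Delta> c], symmetric])
          (simp add: lift_pure[OF mC mW T bx] bilinear_closed[OF \<gamma> _ w])
      finally show "tensor_lift ?T (\<lambda>c c'. pure3 V C W x c (\<gamma> c' w)) (comult C c) =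
          expand_right ?T (pure3 V C W) \<tau> (pure V W x (\<gamma> c w))" ..
    qed
    also have "\<dots> = expand_right ?T (pure3 V C W) \<tau> (?p (pure V W v w))"
      unfolding expand_left_pure[OF mV mC mW mV VW tri \<rho> v w]
      by (rule hom_lift[OF mV mC VW bil T L \<rho>v, symmetric])
    finally show "expand_right ?T (pure3 V C W) \<tau> (?p (pure V W v w)) =
        expand_left ?T (pure3 V C W) \<rho> (?p (pure V W v w))" ..
  qed
  then show ?thesis by (rule cotensorI[OF C V W lin_closed[OF p t]])
qed

lemma project_cotensor:
  assumes V: "right_comodule K C V \<rho>" and t: "t \<in> carrier (cotensor K C V \<rho> W \<tau>)"
  shows "expand_left (V \<boxtimes> W) (\<lambda>v c w. pure V W v (\<gamma> c w)) \<rho> t = t"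
proof -
  note mV = right_comoduleD(1)[OF V] and tV = cotensor_simps(1)[OF t]
  note VW = module_tensor[OF mV mW] and tri = trilinear_\<gamma>[OF mV]
  have "expand_left (V \<boxtimes> W) (\<lambda>v c w. pure V W v (\<gamma> c w)) \<rho> t =
      expand_right (V \<boxtimes> W) (\<lambda>v c w. pure V W v (\<gamma> c w)) \<tau> t"
    by (rule cotensor_expand[OF C V W t VW tri, symmetric])
  also have "\<dots> = tensor_lift (V \<boxtimes> W) (pure V W) t"
    unfolding expand_right_def
  proof (rule lift_cong[OF mV mW VW bilinear_pure[OF mV mW] _ tV, symmetric])
    fix v w assume v: "v \<in> carrier V" and w: "w \<in> carrier W"
    have "pure V W v (tensor_lift W \<gamma> (\<tau> w)) = tensor_lift (V \<boxtimes> W) (\<lambda>x y. pure V W v (\<gamma> x y)) (\<tau> w)"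
      by (rule hom_lift[OF mC mW mW \<gamma> VW lin_pure_right[OF mV mW lin_ident v] lin_closed[OF \<tau> w]])
    then show "pure V W v w = tensor_lift (V \<boxtimes> W) (\<lambda>x y. pure V W v (\<gamma> x y)) (\<tau> w)"
      by (simp add: \<gamma>_split[OF w])
  qed
  finally show ?thesis by (simp add: lift_pure_id[OF mV mW tV])
qed

lemma expand_comodule_hom:
  assumes L: "right_comodule K C L \<rho>\<^sub>L" and M: "right_comodule K C M \<rho>\<^sub>M"
    and f: "f \<in> right_comodule_hom K C L \<rho>\<^sub>L M \<rho>\<^sub>M" and E: "module K E" and F: "trilinear M C W E F"
    and t: "t \<in> carrier (L \<boxtimes> W)"
  shows "expand_left E F \<rho>\<^sub>M (tensor_map K M W f id t) = expand_left E (\<lambda>v c x. F (f v) c x) \<rho>\<^sub>L t"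
proof -
  note mL = right_comoduleD(1)[OF L] and mM = right_comoduleD(1)[OF M]
  have fl: "f \<in> lin L M" and fc: "\<And>l. l \<in> carrier L \<Longrightarrow> \<rho>\<^sub>M (f l) = tensor_map K M C f id (\<rho>\<^sub>L l)"
    using f by (auto simp: right_comodule_hom_def)
  note \<rho>L = right_comoduleD(2)[OF L] and \<rho>M = right_comoduleD(2)[OF M]
  note bil = bilinear_expand_left[OF mM mC mW mM E F \<rho>M]
  show ?thesis
    unfolding expand_left_def lift_tensor_map[OF mM mW mL mW E fl id_lin bil t]
  proof (rule lift_cong[OF mL mW E bilinear_compose[OF bil fl id_lin] _ t])
    fix l w assume l: "l \<in> carrier L" and w: "w \<in> carrier W"
    show "tensor_lift E (\<lambda>x y. F x y (id w)) (\<rho>\<^sub>M (f l)) = tensor_lift E (\<lambda>x y. F (f x) y w) (\<rho>\<^sub>L l)"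
      unfolding fc[OF l]
      using lift_tensor_map[OF mM mC mL mC E fl id_lin trilinearD(2)[OF F w] lin_closed[OF \<rho>L l]] by simp
  qed
qed

lemma trilinear_comodule_hom:
  assumes "f \<in> lin L M" "trilinear M C W E F"
  shows "trilinear L C W E (\<lambda>v c x. F (f v) c x)"
  using lin_compose[OF bilinearD(2)[OF trilinearD(2)[OF assms(2)]] assms(1)]
    bilinearD(1)[OF trilinearD(1)[OF assms(2)]] bilinearD(2)[OF trilinearD(1)[OF assms(2)]] lin_closed[OF assms(1)]
  by (intro trilinearI) auto

lemma cotensor_map_closed:
  assumes L: "right_comodule K C L \<rho>\<^sub>L" and M: "right_comodule K C M \<rho>\<^sub>M"
    and f: "f \<in> right_comodule_hom K C L \<rho>\<^sub>L M \<rho>\<^sub>M" and t: "t \<in> carrier (cotensor K C L \<rho>\<^sub>L W \<tau>)"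
  shows "tensor_map K M W f id t \<in> carrier (cotensor K C M \<rho>\<^sub>M W \<tau>)"
proof (rule cotensorI[OF C M W])
  let ?T = "M \<boxtimes> C \<boxtimes> W"
  note mL = right_comoduleD(1)[OF L] and mM = right_comoduleD(1)[OF M] and tV = cotensor_simps(1)[OF t]
  have fl: "f \<in> lin L M" using f by (auto simp: right_comodule_hom_def)
  note T = module_tensor[OF mM module_tensor[OF mC mW]] and tri3 = trilinear_pure[OF mM mC mW]
  show "tensor_map K M W f id t \<in> carrier (M \<boxtimes> W)"
    by (rule lin_closed[OF tensor_map_lin[OF mM mW mL mW fl id_lin] tV])
  have "expand_right ?T (pure3 M C W) \<tau> (tensor_map K M W f id t) =
      expand_right ?T (\<lambda>v c x. pure3 M C W (f v) c x) \<tau> t"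
    unfolding expand_right_def
    using lift_tensor_map[OF mM mW mL mW T fl id_lin bilinear_expand_right[OF mM mC mW mW T tri3 \<tau>] tV] by simp
  also have "\<dots> = expand_left ?T (\<lambda>v c x. pure3 M C W (f v) c x) \<rho>\<^sub>L t"
    by (rule cotensor_expand[OF C L W t T trilinear_comodule_hom[OF fl tri3]])
  also have "\<dots> = expand_left ?T (pure3 M C W) \<rho>\<^sub>M (tensor_map K M W f id t)"
    by (rule expand_comodule_hom[OF L M f T tri3 tV, symmetric])
  finally show "expand_right ?T (pure3 M C W) \<tau> (tensor_map K M W f id t) =
    expand_left ?T (pure3 M C W) \<rho>\<^sub>M (tensor_map K M W f id t)" .
qed

theorem coflat: "coflat_left TYPE('l) TYPE('m) TYPE('n) K C W \<tau>"
  unfolding coflat_left_def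
proof (intro conjI allI impI W)
  fix L :: "('k, 'l) module" and \<rho>\<^sub>L and M :: "('k, 'm) module" and \<rho>\<^sub>M and N :: "('k, 'n) module" and \<rho>\<^sub>N f g
  assume "right_comodule K C L \<rho>\<^sub>L \<and> right_comodule K C M \<rho>\<^sub>M \<and> right_comodule K C N \<rho>\<^sub>N \<and>
       f \<in> right_comodule_hom K C L \<rho>\<^sub>L M \<rho>\<^sub>M \<and> g \<in> right_comodule_hom K C M \<rho>\<^sub>M N \<rho>\<^sub>N \<and> exact_at L M N f g"
  then have L: "right_comodule K C L \<rho>\<^sub>L" and M: "right_comodule K C M \<rho>\<^sub>M" and N: "right_comodule K C N \<rho>\<^sub>N"
    and f: "f \<in> right_comodule_hom K C L \<rho>\<^sub>L M \<rho>\<^sub>M" and g: "g \<in> right_comodule_hom K C M \<rho>\<^sub>M N \<rho>\<^sub>N"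
    and exact: "exact_at L M N f g" by auto
  have fl: "f \<in> lin L M" and gl: "g \<in> lin M N" using f g by (auto simp: right_comodule_hom_def)
  note mL = right_comoduleD(1)[OF L] and mM = right_comoduleD(1)[OF M] and mN = right_comoduleD(1)[OF N]
  let ?p = "\<lambda>V \<rho>. expand_left (V \<boxtimes> W) (\<lambda>v c w. pure V W v (\<gamma> c w)) \<rho>"
  have nat: "?p M \<rho>\<^sub>M (tensor_map K M W f id t) = tensor_map K M W f id (?p L \<rho>\<^sub>L t)" if t: "t \<in> carrier (L \<boxtimes> W)" for t
  proof -
    note F = tensor_map_lin[OF mM mW mL mW fl id_lin] and \<rho>L = right_comoduleD(2)[OF L]
    note tri = trilinear_comodule_hom[OF fl trilinear_\<gamma>[OF mM]]
    have "?p M \<rho>\<^sub>M (tensor_map K M W f id t) = expand_left (M \<boxtimes> W) (\<lambda>v c x. pure M W (f v) (\<gamma> c x)) \<rho>\<^sub>L t"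
      by (rule expand_comodule_hom[OF L M f module_tensor[OF mM mW] trilinear_\<gamma>[OF mM] t])
    also have "\<dots> = expand_left (M \<boxtimes> W) (\<lambda>v c x. tensor_map K M W f id (pure L W v (\<gamma> c x))) \<rho>\<^sub>L t"
      unfolding expand_left_def
    proof (rule lift_cong[OF mL mW module_tensor[OF mM mW] bilinear_expand_left[OF mL mC mW mL module_tensor[OF mM mW]
            tri \<rho>L] _ t])
      fix l w assume l: "l \<in> carrier L" and w: "w \<in> carrier W"
      show "tensor_lift (M \<boxtimes> W) (\<lambda>v c. pure M W (f v) (\<gamma> c w)) (\<rho>\<^sub>L l) =
          tensor_lift (M \<boxtimes> W) (\<lambda>v c. tensor_map K M W f id (pure L W v (\<gamma> c w))) (\<rho>\<^sub>L l)"
        by (rule lift_cong[OF mL mC module_tensor[OF mM mW] trilinearD(2)[OF tri w] _ lin_closed[OF \<rho>L l]])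
          (simp add: tensor_map_pure[OF mM mW mL mW fl id_lin] bilinear_closed[OF \<gamma> _ w])
    qed
    also have "\<dots> = tensor_map K M W f id (?p L \<rho>\<^sub>L t)"
      by (rule hom_expand_left[OF mL mC mW mL module_tensor[OF mL mW] module_tensor[OF mM mW] trilinear_\<gamma>[OF mL]
            \<rho>L F t, symmetric])
    finally show ?thesis .
  qed
  note p = expand_left_lin[OF mN mC mW mN module_tensor[OF mN mW] trilinear_\<gamma>[OF mN] right_comoduleD(2)[OF N]]
  have zero: "?p N \<rho>\<^sub>N \<zero>\<^bsub>N \<boxtimes> W\<^esub> = \<zero>\<^bsub>N \<boxtimes> W\<^esub>"
    by (rule lin_zero[OF module_tensor[OF mN mW] module_tensor[OF mN mW] p])
  show "exact_at (cotensor K C L \<rho>\<^sub>L W \<tau>) (cotensor K C M \<rho>\<^sub>M W \<tau>) (cotensor K C N \<rho>\<^sub>N W \<tau>)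
      (tensor_map K M W f id) (tensor_map K N W g id)"
    by (rule exact_at_retract[OF exact_tensor_right[OF mW mL mM mN fl gl exact], where i\<^sub>L = "\<lambda>x. x" and i\<^sub>M = "\<lambda>x. x"
          and i\<^sub>N = "\<lambda>x. x" and p\<^sub>L = "?p L \<rho>\<^sub>L" and p\<^sub>M = "?p M \<rho>\<^sub>M" and p\<^sub>N = "?p N \<rho>\<^sub>N"])
      (auto simp: cotensor_simps zero nat project_cotensor[OF M] project_cotensor[OF N]
        intro: cotensor_map_closed[OF L M f] cotensor_map_closed[OF M N g] project_closed[OF L])
qed

end

section \<open>Equality of modules on their carriers\<close>

text \<open>
  The records \<open>scalars B (left_reg P)\<close> and \<open>P\<close> agree as vector spaces but differ in their multiplication and
  in the action of arguments outside the field; all notions for comodules respect this equality.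
\<close>

definition same_module ::
  "('k, 'x) ring_scheme \<Rightarrow> ('k, 'v, 'y) module_scheme \<Rightarrow> ('k, 'v, 'z) module_scheme \<Rightarrow> bool" where
  "same_module K V V' \<longleftrightarrow> carrier V = carrier V' \<and> ring.add V = ring.add V' \<and> ring.zero V = ring.zero V' \<and>
     (\<forall>a\<in>carrier K. \<forall>v\<in>carrier V. a \<odot>\<^bsub>V\<^esub> v = a \<odot>\<^bsub>V'\<^esub> v)"

lemma same_module_refl: "same_module K V V"
  by (simp add: same_module_def)

lemma same_module_sym: "same_module K V V' \<Longrightarrow> same_module K V' V"
  by (auto simp: same_module_def)

lemma tensor_null_cong:
  assumes "same_module K V V'" "same_module K W W'"
  shows "tensor_free V W = tensor_free V' W'" "tensor_null K V W = tensor_null K V' W'"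
proof -
  show free: "tensor_free V W = tensor_free V' W'" using assms by (simp add: tensor_free_def same_module_def)
  have "tensor_relators K V W = tensor_relators K V' W'"
    using assms unfolding tensor_relators_def same_module_def
    by (intro arg_cong2[where f = "(\<union>)"] Collect_cong refl) (metis | simp)+
  then show "tensor_null K V W = tensor_null K V' W'" by (simp add: tensor_null_def free)
qed

lemma tensor_group_cong:
  assumes "same_module K V V'" "same_module K W W'"
  shows "tensor_group K V W = tensor_group K V' W'" "pure_tensor K V W = pure_tensor K V' W'"
    "tensor_map K V W = tensor_map K V' W'"
proof -
  show group: "tensor_group K V W = tensor_group K V' W'"
    by (simp add: tensor_group_def tensor_null_cong[OF assms])
  show pure: "pure_tensor K V W = pure_tensor K V' W'"
    by (intro ext) (simp add: pure_tensor_def tensor_null_cong[OF assms])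
  show "tensor_map K V W = tensor_map K V' W'"
    by (intro ext) (simp add: tensor_map_def group pure)
qed

context ground_field
begin

lemma module_cong:
  assumes "same_module K V V'" "module K V"
  shows "module K V'"
proof -
  interpret V: module K V by fact
  have V': "carrier V' = carrier V" "ring.add V' = ring.add V" "ring.zero V' = ring.zero V"
    "\<And>a v. a \<in> carrier K \<Longrightarrow> v \<in> carrier V \<Longrightarrow> a \<odot>\<^bsub>V'\<^esub> v = a \<odot>\<^bsub>V\<^esub> v"
    using assms(1) by (auto simp: same_module_def)
  show ?thesis
  proof (rule moduleI)
    show "abelian_group V'"
    proof (rule abelian_groupI)
      show "\<exists>y\<in>carrier V'. y \<oplus>\<^bsub>V'\<^esub> x = \<zero>\<^bsub>V'\<^esub>" if "x \<in> carrier V'" for x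
        using that V.l_neg V.a_inv_closed by (intro bexI[of _ "\<ominus>\<^bsub>V\<^esub> x"]) (simp_all add: V')
    qed (simp_all add: V' V.a_ac)
  qed (simp_all add: K.is_cring V' V.smult_l_distr V.smult_r_distr V.smult_assoc1)
qed

lemma lin_cong: "same_module K V V' \<Longrightarrow> same_module K W W' \<Longrightarrow> lin V W \<subseteq> lin V' W'"
  by (auto simp: same_module_def module_hom_def hom_def Pi_iff)

lemma lin_cong_eq: "same_module K V V' \<Longrightarrow> same_module K W W' \<Longrightarrow> lin V W = lin V' W'"
  using lin_cong same_module_sym by (metis subset_antisym)

lemma tensor_space_cong:
  assumes V: "same_module K V V'" and W: "same_module K W W'" and "module K V" "module K W"
  shows "same_module K (V \<boxtimes> W) (V' \<boxtimes> W')"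
  unfolding same_module_def
proof (intro conjI ballI)
  note mods = module_cong[OF V assms(3)] module_cong[OF W assms(4)]
  fix a t assume a: "a \<in> carrier K" and t: "t \<in> carrier (V \<boxtimes> W)"
  have t': "t \<in> carrier (V' \<boxtimes> W')" using t by (simp add: tensor_space_simps tensor_group_cong[OF V W])
  have "a \<odot>\<^bsub>V \<boxtimes> W\<^esub> t = tensor_lift (tensor_group K V' W') (\<lambda>v w. pure V' W' (a \<odot>\<^bsub>V\<^esub> v) w) t"
    by (simp add: smult_tensor tensor_group_cong[OF V W])
  also have "\<dots> = tensor_lift (tensor_group K V' W') (\<lambda>v w. pure V' W' (a \<odot>\<^bsub>V'\<^esub> v) w) t"
    by (rule tensor_factors.tensor_lift_cong[OF tensor_factors_modules[OF mods]
          tensor_factors.abelian_tensor_group[OF tensor_factors_modules[OF mods]] balanced_smult_pure[OF mods a], symmetric])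
      (use V a t' in \<open>auto simp: same_module_def tensor_space_simps\<close>)
  finally show "a \<odot>\<^bsub>V \<boxtimes> W\<^esub> t = a \<odot>\<^bsub>V' \<boxtimes> W'\<^esub> t" by (simp add: smult_tensor)
qed (simp_all add: tensor_space_simps tensor_group_cong[OF V W])

lemma right_comodule_cong:
  assumes V: "same_module K V V'" and C: "is_coalgebra K C" and \<rho>: "right_comodule K C V \<rho>"
  shows "right_comodule K C V' \<rho>"
proof -
  note mV = right_comoduleD(1)[OF \<rho>] and mC = coalgebraD(1)[OF C]
  note VC = tensor_space_cong[OF V same_module_refl mV mC]
  note CC = same_module_refl[of K "C \<boxtimes> C"]
  have assoc: "assoc_right K V C C = assoc_right K V' C C"
    unfolding assoc_right_def Let_def tensor_lift_tensor_group[symmetric] tensor_group_cong[OF V CC] ..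
  have lift: "tensor_lift V (\<lambda>x c. counit C c \<odot>\<^bsub>V\<^esub> x) (\<rho> v) = tensor_lift V' (\<lambda>x c. counit C c \<odot>\<^bsub>V'\<^esub> x) (\<rho> v)"
    if v: "v \<in> carrier V" for v
  proof -
    have "tensor_lift V (\<lambda>x c. counit C c \<odot>\<^bsub>V\<^esub> x) (\<rho> v) = tensor_lift V (\<lambda>x c. counit C c \<odot>\<^bsub>V'\<^esub> x) (\<rho> v)"
    proof (rule lift_cong[OF mV mC mV _ _ lin_closed[OF right_comoduleD(2)[OF \<rho>] v]])
      show "bilinear V C V (\<lambda>x c. counit C c \<odot>\<^bsub>V\<^esub> x)"
        using mV lin_closed[OF coalgebraD(3)[OF C]] coalgebraD(3)[OF C]
        by (intro bilinearI lin_smult_const lin_smult_scalar lin_ident) (auto simp: left_reg_def with_smult_def)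
      show "counit C c \<odot>\<^bsub>V\<^esub> x = counit C c \<odot>\<^bsub>V'\<^esub> x" if "x \<in> carrier V" "c \<in> carrier C" for x c
        using V that lin_closed[OF coalgebraD(3)[OF C] that(2)]
        by (auto simp: same_module_def left_reg_def with_smult_def)
    qed
    moreover have "tensor_lift V (\<lambda>x c. counit C c \<odot>\<^bsub>V'\<^esub> x) (\<rho> v) = tensor_lift V' (\<lambda>x c. counit C c \<odot>\<^bsub>V'\<^esub> x) (\<rho> v)"
      using V by (subst tensor_lift_target_cong[of V V']) (auto simp: same_module_def)
    ultimately show ?thesis by simp
  qed
  have V': "carrier V' = carrier V" using V by (simp add: same_module_def)
  show ?thesis
    unfolding right_comodule_def V'
  proof (intro conjI ballI)
    show "module K V'" by (rule module_cong[OF V mV])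
    show "\<rho> \<in> lin V' (V' \<boxtimes> C)" using right_comoduleD(2)[OF \<rho>] lin_cong_eq[OF V VC] by simp
    fix v assume v: "v \<in> carrier V"
    show "tensor_lift V' (\<lambda>x c. counit C c \<odot>\<^bsub>V'\<^esub> x) (\<rho> v) = v"
      using right_comoduleD(3)[OF \<rho> v] lift[OF v] by simp
    show "assoc_right K V' C C (tensor_map K (V' \<boxtimes> C) C \<rho> id (\<rho> v)) = tensor_map K V' (C \<boxtimes> C) id (comult C) (\<rho> v)"
      unfolding assoc[symmetric] tensor_group_cong(3)[OF V CC, symmetric]
        tensor_group_cong(3)[OF VC same_module_refl, symmetric]
      using \<rho> v by (simp add: right_comodule_def)
  qed
qed

lemma right_comodule_hom_cong:
  assumes "same_module K V V'" "same_module K W W'"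
  shows "right_comodule_hom K C V \<rho> W \<tau> = right_comodule_hom K C V' \<rho> W' \<tau>"
  using assms(1)
  unfolding right_comodule_hom_def tensor_group_cong[OF assms(2) same_module_refl] lin_cong_eq[OF assms]
  by (auto simp: same_module_def)

lemmas lin_intros = lin_ident bilinearI trilinearI lin_pure_left lin_pure_right lin_sum lin_difference lin_smult_const

text \<open>
  Variants in which the premise on the tensor comes first: tried as introduction rules, they then
  read off the tensor factors from it.
\<close>

lemma lin_lift_arg' :
  assumes "t \<in> lin U (V \<boxtimes> W)" "module K V" "module K W" "module K E" "bilinear V W E f"
  shows "(\<lambda>u. tensor_lift E f (t u)) \<in> lin U E"
  using lin_lift_arg assms by blast

lemma lin_lift_fun':
  assumes "t \<in> carrier (V \<boxtimes> W)" "module K V" "module K W" "module K E" "module K U"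
    and "\<And>v w. \<lbrakk>v \<in> carrier V; w \<in> carrier W\<rbrakk> \<Longrightarrow> (\<lambda>u. f u v w) \<in> lin U E"
    and "\<And>u. u \<in> carrier U \<Longrightarrow> bilinear V W E (f u)"
  shows "(\<lambda>u. tensor_lift E (f u) t) \<in> lin U E"
  by (rule lin_lift_fun[OF assms(2-4,1,5-)])

end

section \<open>Principal extensions\<close>

locale principal = ground_field K for K :: "'k ring" (structure) +
  fixes C :: "('k, 'c) coalgebra" and P :: "('k, 'p) module" and \<Delta> :: "'p \<Rightarrow> ('p, 'c) tensor" and e :: 'c
  assumes C: "is_coalgebra K C" and principal: "principal_extension K C P \<Delta> e"
begin

lemma algebra_P: "assoc_algebra K P" and comodule_P: "right_comodule K C P \<Delta>" and group_like_e: "group_like K C e"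
  using principal by (auto simp: principal_extension_def extension_def)

lemmas mC [simp, intro] = coalgebraD(1)[OF C]
lemmas mP [simp, intro] = algebraD(1)[OF algebra_P]

sublocale P: ring P by (rule algebraD(2)[OF algebra_P])

lemma e [simp, intro]: "e \<in> carrier C" and comult_e: "comult C e = pure C C e e" and counit_e: "counit C e = \<one>"
  using group_like_e by (auto simp: group_like_def)

definition lmul :: "('k, 'w, 'z) module_scheme \<Rightarrow> 'p \<Rightarrow> ('p, 'w) tensor \<Rightarrow> ('p, 'w) tensor" where
  "lmul W x = tensor_map K P W (\<lambda>y. x \<otimes>\<^bsub>P\<^esub> y) id"

lemma lin_mult_right: "\<lbrakk>f \<in> lin U P; x \<in> carrier P\<rbrakk> \<Longrightarrow> (\<lambda>u. x \<otimes>\<^bsub>P\<^esub> f u) \<in> lin U P"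
  by (intro linI) (auto simp: lin_closed lin_add lin_smult P.r_distr algebraD(4)[OF algebra_P])

lemma lin_mult_left: "\<lbrakk>f \<in> lin U P; y \<in> carrier P\<rbrakk> \<Longrightarrow> (\<lambda>u. f u \<otimes>\<^bsub>P\<^esub> y) \<in> lin U P"
  by (intro linI) (auto simp: lin_closed lin_add lin_smult P.l_distr algebraD(3)[OF algebra_P])

lemma \<Delta>_lin: "\<Delta> \<in> lin P (P \<boxtimes> C)" by (rule right_comoduleD(2)[OF comodule_P])

lemma lin_\<Delta>: "f \<in> lin U P \<Longrightarrow> (\<lambda>u. \<Delta> (f u)) \<in> lin U (P \<boxtimes> C)" by (rule lin_compose[OF \<Delta>_lin])

lemma \<Delta>_closed [simp, intro]: "p \<in> carrier P \<Longrightarrow> \<Delta> p \<in> carrier (P \<boxtimes> C)" by (rule lin_closed[OF \<Delta>_lin])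

lemma comult_closed [simp, intro]: "c \<in> carrier C \<Longrightarrow> comult C c \<in> carrier (C \<boxtimes> C)"
  by (rule lin_closed[OF coalgebraD(2)[OF C]])

lemma lin_comult: "f \<in> lin U C \<Longrightarrow> (\<lambda>u. comult C (f u)) \<in> lin U (C \<boxtimes> C)"
  by (rule lin_compose[OF coalgebraD(2)[OF C]])

lemma mult_lin: "x \<in> carrier P \<Longrightarrow> (\<lambda>y. x \<otimes>\<^bsub>P\<^esub> y) \<in> lin P P" by (rule lin_mult_right[OF lin_ident])

lemma lmul_lin: "module K W \<Longrightarrow> x \<in> carrier P \<Longrightarrow> lmul W x \<in> lin (P \<boxtimes> W) (P \<boxtimes> W)"
  unfolding lmul_def by (intro tensor_map_lin mult_lin id_lin mP)

lemma lmul_pure [simp]: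
  "\<lbrakk>module K W; x \<in> carrier P; y \<in> carrier P; w \<in> carrier W\<rbrakk> \<Longrightarrow> lmul W x (pure P W y w) = pure P W (x \<otimes>\<^bsub>P\<^esub> y) w"
  unfolding lmul_def by (simp add: tensor_map_pure[OF mP _ mP _ mult_lin id_lin])

lemma lmul_closed [simp, intro]: "\<lbrakk>module K W; x \<in> carrier P; t \<in> carrier (P \<boxtimes> W)\<rbrakk> \<Longrightarrow> lmul W x t \<in> carrier (P \<boxtimes> W)"
  by (rule lin_closed[OF lmul_lin])

lemma lin_lmul_right: "\<lbrakk>f \<in> lin U (P \<boxtimes> W); module K W; x \<in> carrier P\<rbrakk> \<Longrightarrow> (\<lambda>u. lmul W x (f u)) \<in> lin U (P \<boxtimes> W)"
  by (rule lin_compose[OF lmul_lin])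

lemma lin_lmul_left:
  assumes "f \<in> lin U P" "module K U" "module K W" "t \<in> carrier (P \<boxtimes> W)"
  shows "(\<lambda>u. lmul W (f u) t) \<in> lin U (P \<boxtimes> W)"
  unfolding lmul_def tensor_map_lift id_apply
  using assms lin_closed[OF assms(1)]
  by (intro lin_lift_fun'[OF assms(4)] bilinearI lin_pure_left lin_pure_right lin_ident lin_mult_left lin_mult_right) auto

lemma lmul_mult:
  assumes "module K W" "x \<in> carrier P" "y \<in> carrier P" "t \<in> carrier (P \<boxtimes> W)"
  shows "lmul W (x \<otimes>\<^bsub>P\<^esub> y) t = lmul W x (lmul W y t)"
  by (rule tensor_lin_ext[OF mP assms(1) module_tensor[OF mP assms(1)] lmul_lin lin_compose[OF lmul_lin lmul_lin] _ assms(4)])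
    (use assms in \<open>simp_all add: P.m_assoc\<close>)

lemma lmul_one:
  assumes "module K W" "t \<in> carrier (P \<boxtimes> W)"
  shows "lmul W \<one>\<^bsub>P\<^esub> t = t"
  by (rule tensor_lin_ext[OF mP assms(1) module_tensor[OF mP assms(1)] lmul_lin lin_ident _ assms(2)])
    (use assms in simp_all)

lemma lmul_scalar:
  assumes "module K W" "a \<in> carrier K" "t \<in> carrier (P \<boxtimes> W)"
  shows "lmul W (a \<odot>\<^bsub>P\<^esub> \<one>\<^bsub>P\<^esub>) t = a \<odot>\<^bsub>P \<boxtimes> W\<^esub> t"
  using assms lin_smult[OF lin_lmul_left[OF lin_ident mP assms(1,3)] assms(2), of "\<one>\<^bsub>P\<^esub>"] by (simp add: lmul_one)

lemma lift_lmul: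
  assumes "t \<in> carrier (P \<boxtimes> W)" "module K W" "module K E" "x \<in> carrier P" "bilinear P W E F"
  shows "tensor_lift E F (lmul W x t) = tensor_lift E (\<lambda>y w. F (x \<otimes>\<^bsub>P\<^esub> y) w) t"
  unfolding lmul_def using lift_tensor_map[OF mP assms(2) mP assms(2,3) mult_lin[OF assms(4)] id_lin assms(5,1)] by simp

lemmas principal_intros = lin_intros lin_lift_arg' lin_lift_fun' lin_mult_right lin_mult_left lin_\<Delta> lin_comult
  lin_lmul_right lin_lmul_left

section \<open>The coinvariants\<close>

abbreviation B :: "('k, 'p) module" where "B \<equiv> base K C P \<Delta>"

lemma base_simps [simp]:
  "ring.add B = ring.add P" "ring.zero B = ring.zero P" "one B = one P" "monoid.mult B = monoid.mult P" "smult B = smult P"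
  by (simp_all add: base_def)

lemma carrier_base: "b \<in> carrier B \<longleftrightarrow> b \<in> carrier P \<and> (\<forall>p\<in>carrier P. \<Delta> (b \<otimes>\<^bsub>P\<^esub> p) = lmul C b (\<Delta> p))"
  by (simp add: base_def coinvariants_def lmul_def)

lemma base_subset [intro]: "b \<in> carrier B \<Longrightarrow> b \<in> carrier P"
  by (simp add: carrier_base)

lemma \<Delta>_base: "b \<in> carrier B \<Longrightarrow> p \<in> carrier P \<Longrightarrow> \<Delta> (b \<otimes>\<^bsub>P\<^esub> p) = lmul C b (\<Delta> p)"
  by (simp add: carrier_base)

lemma one_base [simp, intro]: "\<one>\<^bsub>P\<^esub> \<in> carrier B"
  by (simp add: carrier_base lmul_one)

lemma mult_base [simp, intro]: "a \<in> carrier B \<Longrightarrow> b \<in> carrier B \<Longrightarrow> a \<otimes>\<^bsub>P\<^esub> b \<in> carrier B"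
  by (simp add: carrier_base P.m_assoc lmul_mult)

lemma submodule_base: "submodule (carrier B) K P"
proof -
  interpret M: module K P by (rule mP)
  interpret T: module K "P \<boxtimes> C" by (rule module_tensor) auto
  have lin: "(\<lambda>b. \<Delta> (b \<otimes>\<^bsub>P\<^esub> p)) \<in> lin P (P \<boxtimes> C)" "(\<lambda>b. lmul C b (\<Delta> p)) \<in> lin P (P \<boxtimes> C)" if "p \<in> carrier P" for p
    using that by (auto intro!: lin_\<Delta> lin_mult_left lin_lmul_left)
  have T: "module K (P \<boxtimes> C)" by (rule T.module_axioms)
  show ?thesis
  proof (rule M.submoduleI)
    show "carrier B \<subseteq> carrier P" by auto
  qed (simp_all add: carrier_base lin_zero[OF mP T \<Delta>_lin] lin_zero[OF mP T lin(1)] lin_zero[OF mP T lin(2)] lin_minus[OF mP T lin(1)]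
      lin_minus[OF mP T lin(2)] lin_add[OF lin(1)] lin_add[OF lin(2)] lin_smult[OF lin(1)] lin_smult[OF lin(2)])
qed

declare base_subset [simp]

lemma mB [simp, intro]: "module K B"
  using submodule.submodule_is_module[OF submodule_base mP] by (simp add: base_def)

lemma algebra_B: "assoc_algebra K B"
proof -
  have "monoid B" by (rule monoidI) (simp_all add: P.m_assoc)
  then have "ring B" by (rule ringI[OF module_abelian[OF mB]]) (simp_all add: P.l_distr P.r_distr)
  then show ?thesis using algebraD(3,4)[OF algebra_P] by (simp add: assoc_algebra_def)
qed

lemma lin_base: "f \<in> lin U B \<Longrightarrow> f \<in> lin U P"
  by (auto simp: module_hom_def hom_def Pi_iff)

lemma lin_base_domain: "f \<in> lin P W \<Longrightarrow> f \<in> lin B W"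
  by (auto simp: module_hom_def hom_def Pi_iff)

end

lemma reg_simps [simp]:
  "carrier (left_reg R) = carrier R" "ring.add (left_reg R) = ring.add R" "ring.zero (left_reg R) = ring.zero R"
  "r \<odot>\<^bsub>left_reg R\<^esub> x = r \<otimes>\<^bsub>R\<^esub> x"
  "carrier (right_reg R) = carrier R" "ring.add (right_reg R) = ring.add R" "ring.zero (right_reg R) = ring.zero R"
  "r \<odot>\<^bsub>right_reg R\<^esub> x = x \<otimes>\<^bsub>R\<^esub> r"
  by (simp_all add: left_reg_def right_reg_def with_smult_def)

context principal
begin

section \<open>The canonical map and the entwining\<close>

abbreviation PBP where "PBP \<equiv> tensor_group B (right_reg P) (left_reg P)"
abbreviation pureB where "pureB \<equiv> pure_tensor B (right_reg P) (left_reg P)"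
abbreviation canP where "canP \<equiv> can K C P \<Delta>"
abbreviation canP_inv where "canP_inv \<equiv> can_inv K C P \<Delta>"

lemma mPC [simp, intro]: "module K (P \<boxtimes> C)" by (rule module_tensor) auto

lemma abelian_P: "abelian_group P" by (rule module_abelian[OF mP])

lemma abelian_reg: "abelian_group (left_reg P)" "abelian_group (right_reg P)"
proof -
  have *: "comm_group (add_monoid P)" using abelian_P by (rule abelian_group.a_comm_group)
  then show "abelian_group (left_reg P)" "abelian_group (right_reg P)"
    using P.l_neg P.a_inv_closed by (auto intro!: abelian_groupI simp: P.a_ac)
qed

lemma tensor_factors_PBP: "tensor_factors B (right_reg P) (left_reg P)"
  using abelian_reg by (simp add: tensor_factors_def smult_group_def)

sublocale PBP: tensor_factors B "right_reg P" "left_reg P" by (rule tensor_factors_PBP)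

lemma can_lift: "canP = tensor_lift (P \<boxtimes> C) (\<lambda>p q. lmul C p (\<Delta> q))"
  by (simp add: can_def lmul_def)

lemma balanced_can: "balanced B (right_reg P) (left_reg P) (P \<boxtimes> C) (\<lambda>p q. lmul C p (\<Delta> q))"
proof (rule balancedI)
  fix x y z assume *: "x \<in> carrier (right_reg P)" "y \<in> carrier (right_reg P)" "z \<in> carrier (left_reg P)"
  then show "lmul C (x \<oplus>\<^bsub>right_reg P\<^esub> y) (\<Delta> z) = lmul C x (\<Delta> z) \<oplus>\<^bsub>P \<boxtimes> C\<^esub> lmul C y (\<Delta> z)"
    using lin_add[OF lin_lmul_left[OF lin_ident mP mC], of "\<Delta> z" x y] by simp
next
  fix x y z assume "x \<in> carrier (right_reg P)" "y \<in> carrier (left_reg P)" "z \<in> carrier (left_reg P)"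
  then show "lmul C x (\<Delta> (y \<oplus>\<^bsub>left_reg P\<^esub> z)) = lmul C x (\<Delta> y) \<oplus>\<^bsub>P \<boxtimes> C\<^esub> lmul C x (\<Delta> z)"
    by (simp add: lin_add[OF \<Delta>_lin] lin_add[OF lmul_lin[OF mC]])
qed (auto simp: \<Delta>_base lmul_mult)

lemma can_hom: "canP \<in> add_hom PBP (P \<boxtimes> C)"
  unfolding can_lift by (rule PBP.tensor_lift_hom[OF module_abelian[OF mPC] balanced_can])

lemma can_pure: "\<lbrakk>x \<in> carrier P; y \<in> carrier P\<rbrakk> \<Longrightarrow> canP (pureB x y) = lmul C x (\<Delta> y)"
  unfolding can_lift by (rule PBP.tensor_lift_pure[OF module_abelian[OF mPC] balanced_can]) simp_all

lemma can_bij: "bij_betw canP (carrier PBP) (carrier (P \<boxtimes> C))"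
  using principal by (simp add: principal_extension_def tensor_over_base_def)

lemma can_inv_can: "t \<in> carrier PBP \<Longrightarrow> canP_inv (canP t) = t"
  unfolding can_inv_def tensor_over_base_def using can_bij by (intro inv_into_f_f) (auto simp: bij_betw_def)

lemma can_can_inv: "w \<in> carrier (P \<boxtimes> C) \<Longrightarrow> canP (canP_inv w) = w"
  unfolding can_inv_def tensor_over_base_def using can_bij by (intro f_inv_into_f) (auto simp: bij_betw_def)

lemma can_inv_closed: "w \<in> carrier (P \<boxtimes> C) \<Longrightarrow> canP_inv w \<in> carrier PBP"
  unfolding can_inv_def tensor_over_base_def using can_bij by (intro inv_into_into) (auto simp: bij_betw_def)

lemma can_inv_hom: "canP_inv \<in> add_hom (P \<boxtimes> C) PBP"
proof (rule add_homI)
  interpret A: abelian_group PBP by (rule PBP.abelian_tensor_group)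
  fix x y assume xy: "x \<in> carrier (P \<boxtimes> C)" "y \<in> carrier (P \<boxtimes> C)"
  have "canP (canP_inv x \<oplus>\<^bsub>PBP\<^esub> canP_inv y) = x \<oplus>\<^bsub>P \<boxtimes> C\<^esub> y"
    using xy by (simp add: add_hom_add[OF can_hom] can_inv_closed can_can_inv)
  then show "canP_inv (x \<oplus>\<^bsub>P \<boxtimes> C\<^esub> y) = canP_inv x \<oplus>\<^bsub>PBP\<^esub> canP_inv y"
    using can_inv_can[of "canP_inv x \<oplus>\<^bsub>PBP\<^esub> canP_inv y"] xy by (simp add: can_inv_closed)
qed (rule can_inv_closed)

lemma pureB_closed: "\<lbrakk>x \<in> carrier P; y \<in> carrier P\<rbrakk> \<Longrightarrow> pureB x y \<in> carrier PBP"
  by (rule PBP.pure_closed) simp_all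

lemma can_inv_pure: "\<lbrakk>x \<in> carrier P; y \<in> carrier P\<rbrakk> \<Longrightarrow> canP_inv (lmul C x (\<Delta> y)) = pureB x y"
  using can_inv_can[OF pureB_closed] can_pure by metis

text \<open>
  By surjectivity of the canonical map, \<open>P \<otimes> C\<close> is spanned by the elements \<open>x \<Delta>(y)\<close>.  Identities on
  \<open>P \<otimes> C\<close> are tested on these rather than on pure tensors.
\<close>

lemma can_ext:
  assumes A: "abelian_group A" and F: "F \<in> add_hom (P \<boxtimes> C) A" and G: "G \<in> add_hom (P \<boxtimes> C) A"
    and eq: "\<And>x y. \<lbrakk>x \<in> carrier P; y \<in> carrier P\<rbrakk> \<Longrightarrow> F (lmul C x (\<Delta> y)) = G (lmul C x (\<Delta> y))"
    and w: "w \<in> carrier (P \<boxtimes> C)"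
  shows "F w = G w"
proof -
  have "F (canP t) = G (canP t)" if t: "t \<in> carrier PBP" for t
    by (rule PBP.tensor_hom_ext[OF A add_hom_compose[OF F can_hom] add_hom_compose[OF G can_hom] _ t])
      (simp add: can_pure eq)
  from this[OF can_inv_closed[OF w]] show ?thesis by (simp add: can_can_inv w)
qed

lemma can_lin_ext:
  assumes "module K E" "F \<in> lin (P \<boxtimes> C) E" "G \<in> lin (P \<boxtimes> C) E"
    and "\<And>x y. \<lbrakk>x \<in> carrier P; y \<in> carrier P\<rbrakk> \<Longrightarrow> F (lmul C x (\<Delta> y)) = G (lmul C x (\<Delta> y))"
    and "w \<in> carrier (P \<boxtimes> C)"
  shows "F w = G w"
  by (rule can_ext[OF module_abelian[OF assms(1)] lin_add_hom[OF assms(2)] lin_add_hom[OF assms(3)] assms(4,5)])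

text \<open>
  Through the canonical map the right multiplication of \<open>P \<otimes>\<^sub>B P\<close> makes \<open>P \<otimes> C\<close> a \<open>P\<close>-bimodule and
  \<open>\<Delta>\<close> a right linear map; the entwining \<open>ent\<close> is \<open>c \<otimes> p \<mapsto> (1 \<otimes> c) p\<close>.
\<close>

definition ract :: "'p \<Rightarrow> ('p, 'c) tensor \<Rightarrow> ('p, 'c) tensor" where
  "ract q w = canP (tensor_map B (right_reg P) (left_reg P) id (\<lambda>y. y \<otimes>\<^bsub>P\<^esub> q) (canP_inv w))"

lemma right_mult_hom: "q \<in> carrier P \<Longrightarrow> (\<lambda>y. y \<otimes>\<^bsub>P\<^esub> q) \<in> module_hom B (left_reg P) (left_reg P)"
  by (rule module_homI) (simp_all add: P.l_distr P.m_assoc)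

lemma ract_add_hom:
  assumes "q \<in> carrier P"
  shows "ract q \<in> add_hom (P \<boxtimes> C) (P \<boxtimes> C)"
proof -
  have "(\<lambda>w. canP (tensor_map B (right_reg P) (left_reg P) id (\<lambda>y. y \<otimes>\<^bsub>P\<^esub> q) (canP_inv w))) \<in> add_hom (P \<boxtimes> C) (P \<boxtimes> C)"
    by (rule add_hom_compose[OF can_hom add_hom_compose[OF tensor_map_hom[OF tensor_factors_PBP tensor_factors_PBP
            id_module_hom right_mult_hom[OF assms]] can_inv_hom]])
  then show ?thesis by (simp add: ract_def[abs_def])
qed

lemma ract_lmul_\<Delta>:
  "\<lbrakk>x \<in> carrier P; y \<in> carrier P; q \<in> carrier P\<rbrakk> \<Longrightarrow> ract q (lmul C x (\<Delta> y)) = lmul C x (\<Delta> (y \<otimes>\<^bsub>P\<^esub> q))"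
  unfolding ract_def can_inv_pure
  by (subst tensor_map_pure_tensor[OF tensor_factors_PBP tensor_factors_PBP id_module_hom right_mult_hom])
    (simp_all add: can_pure)

lemma ract_lmul:
  assumes x: "x \<in> carrier P" and q: "q \<in> carrier P" and w: "w \<in> carrier (P \<boxtimes> C)"
  shows "ract q (lmul C x w) = lmul C x (ract q w)"
proof -
  note L = lin_add_hom[OF lmul_lin[OF mC x]] and R = ract_add_hom[OF q]
  show ?thesis
    by (rule can_ext[OF module_abelian[OF mPC] add_hom_compose[OF R L] add_hom_compose[OF L R] _ w])
      (simp add: x q ract_lmul_\<Delta> flip: lmul_mult)
qed

lemma ract_lin:
  assumes "q \<in> carrier P"
  shows "ract q \<in> lin (P \<boxtimes> C) (P \<boxtimes> C)"
proof (rule linI)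
  fix a w assume a: "a \<in> carrier K" and w: "w \<in> carrier (P \<boxtimes> C)"
  have "a \<odot>\<^bsub>P\<^esub> \<one>\<^bsub>P\<^esub> \<in> carrier P" using module.smult_closed[OF mP a] by simp
  then show "ract q (a \<odot>\<^bsub>P \<boxtimes> C\<^esub> w) = a \<odot>\<^bsub>P \<boxtimes> C\<^esub> ract q w"
    using ract_lmul[OF _ assms w] a w add_hom_closed[OF ract_add_hom[OF assms] w]
    by (simp flip: lmul_scalar)
qed (use ract_add_hom[OF assms] in \<open>auto simp: add_hom_closed add_hom_add\<close>)

lemma lin_ract_right: "\<lbrakk>f \<in> lin U (P \<boxtimes> C); q \<in> carrier P\<rbrakk> \<Longrightarrow> (\<lambda>u. ract q (f u)) \<in> lin U (P \<boxtimes> C)"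
  by (rule lin_compose[OF ract_lin])

lemma ract_closed [simp, intro]: "\<lbrakk>q \<in> carrier P; w \<in> carrier (P \<boxtimes> C)\<rbrakk> \<Longrightarrow> ract q w \<in> carrier (P \<boxtimes> C)"
  by (rule lin_closed[OF ract_lin])

lemma ract_lin_left:
  assumes w: "w \<in> carrier (P \<boxtimes> C)"
  shows "(\<lambda>q. ract q w) \<in> lin P (P \<boxtimes> C)"
proof (rule linI)
  fix q q' assume q: "q \<in> carrier P" "q' \<in> carrier P"
  have lin: "(\<lambda>w. ract q w \<oplus>\<^bsub>P \<boxtimes> C\<^esub> ract q' w) \<in> lin (P \<boxtimes> C) (P \<boxtimes> C)"
    using q by (intro lin_sum lin_ract_right lin_ident mPC)
  show "ract (q \<oplus>\<^bsub>P\<^esub> q') w = ract q w \<oplus>\<^bsub>P \<boxtimes> C\<^esub> ract q' w"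
    by (rule can_lin_ext[OF mPC ract_lin lin _ w])
      (use q in \<open>simp_all add: ract_lmul_\<Delta> P.r_distr lin_add[OF lin_\<Delta>[OF lin_ident]] lin_add[OF lmul_lin[OF mC]]\<close>)
next
  fix a q assume a: "a \<in> carrier K" and q: "q \<in> carrier P"
  have aq: "a \<odot>\<^bsub>P\<^esub> q \<in> carrier P" using module.smult_closed[OF mP a q] .
  have lin: "(\<lambda>w. a \<odot>\<^bsub>P \<boxtimes> C\<^esub> ract q w) \<in> lin (P \<boxtimes> C) (P \<boxtimes> C)"
    using a q by (intro lin_smult_const lin_ract_right lin_ident mPC)
  show "ract (a \<odot>\<^bsub>P\<^esub> q) w = a \<odot>\<^bsub>P \<boxtimes> C\<^esub> ract q w"
    by (rule can_lin_ext[OF mPC ract_lin[OF aq] lin _ w])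
      (use a q aq in \<open>simp_all add: ract_lmul_\<Delta> algebraD(4)[OF algebra_P] lin_smult[OF lin_\<Delta>[OF lin_ident]] lin_smult[OF lmul_lin[OF mC]]\<close>)
qed (use w in auto)

lemma lin_ract_left: "\<lbrakk>f \<in> lin U P; w \<in> carrier (P \<boxtimes> C)\<rbrakk> \<Longrightarrow> (\<lambda>u. ract (f u) w) \<in> lin U (P \<boxtimes> C)"
  by (rule lin_compose[OF ract_lin_left])

lemma ract_mult:
  assumes "p \<in> carrier P" "q \<in> carrier P" "w \<in> carrier (P \<boxtimes> C)"
  shows "ract (p \<otimes>\<^bsub>P\<^esub> q) w = ract q (ract p w)"
  by (rule can_lin_ext[OF mPC ract_lin lin_compose[OF ract_lin ract_lin] _ assms(3)])
    (use assms in \<open>simp_all add: ract_lmul_\<Delta> P.m_assoc\<close>)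

lemma ract_one: "w \<in> carrier (P \<boxtimes> C) \<Longrightarrow> ract \<one>\<^bsub>P\<^esub> w = w"
  by (rule can_lin_ext[OF mPC ract_lin lin_ident]) (simp_all add: ract_lmul_\<Delta>)

lemma \<Delta>_mult: "\<lbrakk>p \<in> carrier P; q \<in> carrier P\<rbrakk> \<Longrightarrow> \<Delta> (p \<otimes>\<^bsub>P\<^esub> q) = ract q (\<Delta> p)"
  using ract_lmul_\<Delta>[of "\<one>\<^bsub>P\<^esub>" p q] by (simp add: lmul_one)

definition ent :: "'c \<Rightarrow> 'p \<Rightarrow> ('p, 'c) tensor" where
  "ent c q = ract q (pure P C \<one>\<^bsub>P\<^esub> c)"

lemma ent_closed [simp, intro]: "\<lbrakk>c \<in> carrier C; q \<in> carrier P\<rbrakk> \<Longrightarrow> ent c q \<in> carrier (P \<boxtimes> C)"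
  by (simp add: ent_def)

lemma lin_ent_left: "\<lbrakk>f \<in> lin U C; q \<in> carrier P\<rbrakk> \<Longrightarrow> (\<lambda>u. ent (f u) q) \<in> lin U (P \<boxtimes> C)"
  unfolding ent_def by (intro lin_ract_right lin_pure_right) auto

lemma lin_ent_right: "\<lbrakk>f \<in> lin U P; c \<in> carrier C\<rbrakk> \<Longrightarrow> (\<lambda>u. ent c (f u)) \<in> lin U (P \<boxtimes> C)"
  unfolding ent_def by (intro lin_ract_left) auto

lemma bilinear_ent: "bilinear C P (P \<boxtimes> C) ent"
  by (intro bilinearI lin_ent_left lin_ent_right lin_ident)

lemma ract_pure: "\<lbrakk>x \<in> carrier P; c \<in> carrier C; q \<in> carrier P\<rbrakk> \<Longrightarrow> ract q (pure P C x c) = lmul C x (ent c q)"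
  unfolding ent_def by (simp flip: ract_lmul)

abbreviation \<psi> where "\<psi> \<equiv> entwining K C P \<Delta>"

lemma mCP [simp, intro]: "module K (C \<boxtimes> P)" by (rule module_tensor) auto

lemma \<psi>_lift: "\<psi> = tensor_lift (P \<boxtimes> C) ent"
  by (simp add: entwining_def ent_def[abs_def] ract_def)

lemma \<psi>_lin: "\<psi> \<in> lin (C \<boxtimes> P) (P \<boxtimes> C)"
  unfolding \<psi>_lift by (rule lift_lin[OF mC mP mPC bilinear_ent])

lemma \<psi>_pure: "\<lbrakk>c \<in> carrier C; q \<in> carrier P\<rbrakk> \<Longrightarrow> \<psi> (pure C P c q) = ent c q"
  unfolding \<psi>_lift by (rule lift_pure[OF mC mP mPC bilinear_ent])

lemma \<psi>_bij: "bij_betw \<psi> (carrier (C \<boxtimes> P)) (carrier (P \<boxtimes> C))"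
  using principal by (simp add: principal_extension_def)

definition \<chi> where "\<chi> = inv_into (carrier (C \<boxtimes> P)) \<psi>"

lemma \<chi>_\<psi>: "t \<in> carrier (C \<boxtimes> P) \<Longrightarrow> \<chi> (\<psi> t) = t"
  unfolding \<chi>_def using \<psi>_bij by (intro inv_into_f_f) (auto simp: bij_betw_def)

lemma \<psi>_\<chi>: "w \<in> carrier (P \<boxtimes> C) \<Longrightarrow> \<psi> (\<chi> w) = w"
  unfolding \<chi>_def using \<psi>_bij by (intro f_inv_into_f) (auto simp: bij_betw_def)

lemma \<chi>_closed [simp, intro]: "w \<in> carrier (P \<boxtimes> C) \<Longrightarrow> \<chi> w \<in> carrier (C \<boxtimes> P)"
  unfolding \<chi>_def using \<psi>_bij by (intro inv_into_into) (auto simp: bij_betw_def)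

lemma \<chi>_lin: "\<chi> \<in> lin (P \<boxtimes> C) (C \<boxtimes> P)"
proof (rule linI)
  interpret T: module K "C \<boxtimes> P" by (rule mCP)
  show "\<chi> (x \<oplus>\<^bsub>P \<boxtimes> C\<^esub> y) = \<chi> x \<oplus>\<^bsub>C \<boxtimes> P\<^esub> \<chi> y" if "x \<in> carrier (P \<boxtimes> C)" "y \<in> carrier (P \<boxtimes> C)" for x y
    using \<chi>_\<psi>[of "\<chi> x \<oplus>\<^bsub>C \<boxtimes> P\<^esub> \<chi> y"] that by (simp add: lin_add[OF \<psi>_lin] \<psi>_\<chi>)
  show "\<chi> (a \<odot>\<^bsub>P \<boxtimes> C\<^esub> x) = a \<odot>\<^bsub>C \<boxtimes> P\<^esub> \<chi> x" if "a \<in> carrier K" "x \<in> carrier (P \<boxtimes> C)" for a x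
    using \<chi>_\<psi>[of "a \<odot>\<^bsub>C \<boxtimes> P\<^esub> \<chi> x"] that by (simp add: lin_smult[OF \<psi>_lin] \<psi>_\<chi>)
qed auto

lemma lin_\<chi>: "f \<in> lin U (P \<boxtimes> C) \<Longrightarrow> (\<lambda>u. \<chi> (f u)) \<in> lin U (C \<boxtimes> P)"
  by (rule lin_compose[OF \<chi>_lin])

definition lco where "lco p = \<chi> (pure P C p e)"

lemma left_coaction_lco: "left_coaction K C P \<Delta> e = lco"
  by (intro ext) (simp add: left_coaction_def lco_def \<chi>_def)

lemma lin_lco: "f \<in> lin U P \<Longrightarrow> (\<lambda>u. lco (f u)) \<in> lin U (C \<boxtimes> P)"
  unfolding lco_def by (intro lin_\<chi> lin_pure_left) auto

lemma lco_lin: "lco \<in> lin P (C \<boxtimes> P)" using lin_lco[OF lin_ident] .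

lemma lco_closed [simp, intro]: "p \<in> carrier P \<Longrightarrow> lco p \<in> carrier (C \<boxtimes> P)" by (rule lin_closed[OF lco_lin])

lemma \<psi>_lco: "p \<in> carrier P \<Longrightarrow> \<psi> (lco p) = pure P C p e"
  by (simp add: lco_def \<psi>_\<chi>)

lemma \<Delta>_ent: "p \<in> carrier P \<Longrightarrow> \<Delta> p = ent e p"
  using principal by (simp add: principal_extension_def \<psi>_pure)

lemma \<Delta>_one: "\<Delta> \<one>\<^bsub>P\<^esub> = pure P C \<one>\<^bsub>P\<^esub> e"
  by (simp add: \<Delta>_ent ent_def ract_one)

text \<open>
  Because \<open>\<Delta>\<close> is right \<open>P\<close>-linear and \<open>(b \<otimes> e) p = b \<Delta>(p)\<close>, the defining condition on \<open>b\<close> need only be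
  tested at \<open>p = 1\<close>.
\<close>

lemma base_iff: "b \<in> carrier B \<longleftrightarrow> b \<in> carrier P \<and> \<Delta> b = pure P C b e"
proof (intro iffI conjI)
  assume b: "b \<in> carrier B"
  show "\<Delta> b = pure P C b e" using \<Delta>_base[OF b P.one_closed] b by (simp add: \<Delta>_one)
next
  assume b: "b \<in> carrier P \<and> \<Delta> b = pure P C b e"
  then have "\<Delta> (b \<otimes>\<^bsub>P\<^esub> p) = lmul C b (\<Delta> p)" if "p \<in> carrier P" for p
    using that by (simp add: \<Delta>_mult ract_pure \<Delta>_ent[symmetric])
  with b show "b \<in> carrier B" unfolding carrier_base by blast
qed auto

definition rmul where "rmul q = tensor_map K C P id (\<lambda>y. y \<otimes>\<^bsub>P\<^esub> q)"

lemma right_mult_lin: "q \<in> carrier P \<Longrightarrow> (\<lambda>y. y \<otimes>\<^bsub>P\<^esub> q) \<in> lin P P" by (rule lin_mult_left[OF lin_ident])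

lemma rmul_lin: "q \<in> carrier P \<Longrightarrow> rmul q \<in> lin (C \<boxtimes> P) (C \<boxtimes> P)"
  unfolding rmul_def by (intro tensor_map_lin right_mult_lin id_lin mP mC)

lemma rmul_closed [simp, intro]: "\<lbrakk>q \<in> carrier P; t \<in> carrier (C \<boxtimes> P)\<rbrakk> \<Longrightarrow> rmul q t \<in> carrier (C \<boxtimes> P)"
  by (rule lin_closed[OF rmul_lin])

lemma rmul_pure [simp]:
  "\<lbrakk>q \<in> carrier P; c \<in> carrier C; y \<in> carrier P\<rbrakk> \<Longrightarrow> rmul q (pure C P c y) = pure C P c (y \<otimes>\<^bsub>P\<^esub> q)"
  unfolding rmul_def by (simp add: tensor_map_pure[OF mC mP mC mP id_lin right_mult_lin])

lemma lift_rmul: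
  assumes "t \<in> carrier (C \<boxtimes> P)" "module K E" "q \<in> carrier P" "bilinear C P E F"
  shows "tensor_lift E F (rmul q t) = tensor_lift E (\<lambda>c y. F c (y \<otimes>\<^bsub>P\<^esub> q)) t"
  unfolding rmul_def
  using lift_tensor_map[OF mC mP mC mP assms(2) id_lin right_mult_lin[OF assms(3)] assms(4,1)] by simp

lemma \<psi>_rmul:
  assumes "q \<in> carrier P" "t \<in> carrier (C \<boxtimes> P)"
  shows "\<psi> (rmul q t) = ract q (\<psi> t)"
  by (rule tensor_lin_ext[OF mC mP mPC lin_compose[OF \<psi>_lin rmul_lin] lin_compose[OF ract_lin \<psi>_lin] _ assms(2)])
    (use assms in \<open>simp_all add: \<psi>_pure ent_def ract_mult\<close>)

text \<open>Both sides are mapped by \<open>\<psi>\<close> to \<open>(x \<otimes> e) y = x \<Delta>(y)\<close>.\<close>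

lemma \<chi>_lmul_\<Delta>:
  assumes "x \<in> carrier P" "y \<in> carrier P"
  shows "\<chi> (lmul C x (\<Delta> y)) = rmul y (lco x)"
  using \<chi>_\<psi>[of "rmul y (lco x)"] assms by (simp add: \<psi>_rmul \<psi>_lco ract_pure \<Delta>_ent[symmetric])

lemma lco_base: "\<lbrakk>p \<in> carrier P; b \<in> carrier B\<rbrakk> \<Longrightarrow> lco (p \<otimes>\<^bsub>P\<^esub> b) = rmul b (lco p)"
  using \<chi>_lmul_\<Delta>[of p b] base_iff[of b] by (simp add: lco_def)

lemma lco_one: "lco \<one>\<^bsub>P\<^esub> = pure C P e \<one>\<^bsub>P\<^esub>"
  using \<chi>_\<psi>[of "pure C P e \<one>\<^bsub>P\<^esub>"] by (simp add: \<psi>_pure \<Delta>_ent[symmetric] \<Delta>_one lco_def)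

lemmas entwining_intros = principal_intros lin_ract_left lin_ract_right lin_ent_left lin_ent_right lin_\<chi> lin_lco
  \<Delta>_closed comult_closed lmul_closed rmul_closed ract_closed ent_closed \<chi>_closed lco_closed pure_in_tensor

end

context ground_field
begin

lemma trilinear_app:
  assumes "trilinear U V W E F"
  shows "\<lbrakk>f \<in> lin A U; v \<in> carrier V; w \<in> carrier W\<rbrakk> \<Longrightarrow> (\<lambda>a. F (f a) v w) \<in> lin A E"
    and "\<lbrakk>g \<in> lin A V; u \<in> carrier U; w \<in> carrier W\<rbrakk> \<Longrightarrow> (\<lambda>a. F u (g a) w) \<in> lin A E"
    and "\<lbrakk>h \<in> lin A W; u \<in> carrier U; v \<in> carrier V\<rbrakk> \<Longrightarrow> (\<lambda>a. F u v (h a)) \<in> lin A E"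
  by (rule lin_compose[OF bilinearD(2)[OF trilinearD(2)[OF assms]]]; assumption)
    (rule lin_compose[OF bilinearD(1)[OF trilinearD(2)[OF assms]]] lin_compose[OF bilinearD(1)[OF trilinearD(1)[OF assms]]];
      assumption)+

end

context principal
begin

section \<open>The left comodule structure\<close>

lemma counit_closed [simp]: "c \<in> carrier C \<Longrightarrow> counit C c \<in> carrier K"
  using lin_closed[OF coalgebraD(3)[OF C]] by simp

lemma bilinear_counit: "module K W \<Longrightarrow> bilinear W C W (\<lambda>x c. counit C c \<odot>\<^bsub>W\<^esub> x)"
  using coalgebraD(3)[OF C] by (intro bilinearI lin_smult_const lin_smult_scalar lin_ident) auto

lemma bilinear_counit': "module K W \<Longrightarrow> bilinear C W W (\<lambda>c x. counit C c \<odot>\<^bsub>W\<^esub> x)"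
  using coalgebraD(3)[OF C] by (intro bilinearI lin_smult_const lin_smult_scalar lin_ident) auto

definition apply_counit where "apply_counit = tensor_lift P (\<lambda>x c. counit C c \<odot>\<^bsub>P\<^esub> x)"

lemma apply_counit_lin: "apply_counit \<in> lin (P \<boxtimes> C) P"
  unfolding apply_counit_def by (rule lift_lin[OF mP mC mP bilinear_counit[OF mP]])

lemma apply_counit_pure: "\<lbrakk>x \<in> carrier P; c \<in> carrier C\<rbrakk> \<Longrightarrow> apply_counit (pure P C x c) = counit C c \<odot>\<^bsub>P\<^esub> x"
  unfolding apply_counit_def by (rule lift_pure[OF mP mC mP bilinear_counit[OF mP]])

lemma apply_counit_\<Delta>: "p \<in> carrier P \<Longrightarrow> apply_counit (\<Delta> p) = p"
  unfolding apply_counit_def by (rule right_comoduleD(3)[OF comodule_P])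

lemma apply_counit_lmul:
  assumes "x \<in> carrier P" "w \<in> carrier (P \<boxtimes> C)"
  shows "apply_counit (lmul C x w) = x \<otimes>\<^bsub>P\<^esub> apply_counit w"
  by (rule tensor_lin_ext[OF mP mC mP lin_compose[OF apply_counit_lin lmul_lin[OF mC]]
        lin_mult_right[OF apply_counit_lin] _ assms(2)])
    (use assms in \<open>simp_all add: apply_counit_pure algebraD(4)[OF algebra_P]\<close>)

lemma apply_counit_ract:
  assumes "q \<in> carrier P" "w \<in> carrier (P \<boxtimes> C)"
  shows "apply_counit (ract q w) = apply_counit w \<otimes>\<^bsub>P\<^esub> q"
  by (rule can_lin_ext[OF mP lin_compose[OF apply_counit_lin ract_lin] lin_mult_left[OF apply_counit_lin] _ assms(2)])
    (use assms in \<open>simp_all add: ract_lmul_\<Delta> apply_counit_lmul apply_counit_\<Delta> P.m_assoc\<close>)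

lemma lco_counit:
  assumes "p \<in> carrier P"
  shows "tensor_lift P (\<lambda>c x. counit C c \<odot>\<^bsub>P\<^esub> x) (lco p) = p"
proof -
  have "tensor_lift P (\<lambda>c x. counit C c \<odot>\<^bsub>P\<^esub> x) (lco p) = apply_counit (\<psi> (lco p))"
  proof (rule lift_unique[OF mC mP mP bilinear_counit'[OF mP] lin_compose[OF apply_counit_lin \<psi>_lin]])
    fix c x assume "c \<in> carrier C" "x \<in> carrier P"
    then show "apply_counit (\<psi> (pure C P c x)) = counit C c \<odot>\<^bsub>P\<^esub> x"
      using algebraD(3)[OF algebra_P] by (simp add: \<psi>_pure ent_def apply_counit_ract apply_counit_pure)
  qed (use assms in auto)
  also have "\<dots> = p" using assms module.smult_one[OF mP] by (simp add: \<psi>_lco apply_counit_pure counit_e)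
  finally show ?thesis .
qed

lemma ract_expand:
  assumes "q \<in> carrier P" "w \<in> carrier (P \<boxtimes> C)"
  shows "ract q w = tensor_lift (P \<boxtimes> C) (\<lambda>x c. lmul C x (ent c q)) w"
proof (rule lift_unique[OF mP mC mPC _ ract_lin[OF assms(1)] _ assms(2), symmetric])
  show "bilinear P C (P \<boxtimes> C) (\<lambda>x c. lmul C x (ent c q))"
    using assms by (intro bilinearI lin_lmul_left lin_lmul_right lin_ent_left lin_ident) auto
qed (use assms in \<open>simp add: ract_pure\<close>)

lemma lift_lin_pure_mult:
  assumes h: "h \<in> lin (P \<boxtimes> C) E" and E: "module K E" and x: "x \<in> carrier P" and t: "t \<in> carrier (P \<boxtimes> C)"
  shows "tensor_lift E (\<lambda>u c. h (pure P C (x \<otimes>\<^bsub>P\<^esub> u) c)) t = h (lmul C x t)"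
proof (rule lift_unique[OF mP mC E _ lin_compose[OF h lmul_lin[OF mC x]] _ t])
  show "bilinear P C E (\<lambda>u c. h (pure P C (x \<otimes>\<^bsub>P\<^esub> u) c))"
    using x by (intro bilinearI lin_compose[OF h] lin_pure_left lin_pure_right lin_mult_right lin_ident) auto
qed (use x in simp)

lemma expand_right_lmul:
  assumes F: "trilinear P C C E F" and E: "module K E" and x: "x \<in> carrier P" and w: "w \<in> carrier (P \<boxtimes> C)"
  shows "expand_right E F (comult C) (lmul C x w) = expand_right E (\<lambda>u. F (x \<otimes>\<^bsub>P\<^esub> u)) (comult C) w"
  unfolding expand_right_def
  by (rule lift_lmul[OF w mC E x bilinear_expand_right[OF mP mC mC mC E F coalgebraD(2)[OF C]]])

lemma \<Delta>_coassoc: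
  assumes F: "trilinear P C C E F" and E: "module K E" and p: "p \<in> carrier P"
  shows "expand_right E F (comult C) (\<Delta> p) = expand_left E F \<Delta> (\<Delta> p)"
  by (rule right_comodule_coassoc[OF C comodule_P p E F])

lemma trilinear_mult_left:
  assumes F: "trilinear P V W E F" and x: "x \<in> carrier P"
  shows "trilinear P V W E (\<lambda>u. F (x \<otimes>\<^bsub>P\<^esub> u))"
  using x by (intro trilinearI trilinear_app[OF F] lin_mult_right lin_ident) auto

text \<open>
  The entwining respects the comultiplication.  On the spanning elements \<open>x \<Delta>(y)\<close> both sides are
  \<open>x \<Delta>(y p)\<close> expanded once more, by coassociativity of \<open>\<Delta>\<close>.
\<close>

lemma expand_right_ract:
  assumes F: "trilinear P C C E F" and E: "module K E" and p: "p \<in> carrier P" and w: "w \<in> carrier (P \<boxtimes> C)"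
  shows "expand_right E F (comult C) (ract p w) = expand_right E (\<lambda>x c d. tensor_lift E (\<lambda>q d'.
      tensor_lift E (\<lambda>q' c'. F q' c' d') (ract q (pure P C x c))) (ent d p)) (comult C) w"
proof -
  let ?M = "\<lambda>x c d. tensor_lift E (\<lambda>q d'. tensor_lift E (\<lambda>q' c'. F q' c' d') (ract q (pure P C x c))) (ent d p)"
  note F' = trilinear_app[OF F]
  note comult = coalgebraD(2)[OF C]
  have M: "trilinear P C C E ?M"
    using p E by - ((assumption | rule entwining_intros F' | simp)+)
  show ?thesis
  proof (rule can_lin_ext[OF E lin_compose[OF expand_right_lin[OF mP mC mC mC E F comult] ract_lin[OF p]]
        expand_right_lin[OF mP mC mC mC E M comult] _ w])
    fix x y assume x: "x \<in> carrier P" and y: "y \<in> carrier P"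
    note Fx = trilinear_mult_left[OF F x] and Mx = trilinear_mult_left[OF M x]
    let ?G = "\<lambda>u d. tensor_lift E (\<lambda>u' c'. F (x \<otimes>\<^bsub>P\<^esub> u') c' d) (\<Delta> u)"
    have G: "bilinear P C E ?G" by (rule bilinear_expand_left[OF mP mC mC mP E Fx \<Delta>_lin])
    have "expand_right E F (comult C) (ract p (lmul C x (\<Delta> y))) =
        expand_right E (\<lambda>u. F (x \<otimes>\<^bsub>P\<^esub> u)) (comult C) (\<Delta> (y \<otimes>\<^bsub>P\<^esub> p))"
      using x y p by (simp add: ract_lmul_\<Delta> expand_right_lmul[OF F E])
    also have "\<dots> = expand_left E (\<lambda>u. F (x \<otimes>\<^bsub>P\<^esub> u)) \<Delta> (\<Delta> (y \<otimes>\<^bsub>P\<^esub> p))"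
      using y p by (intro \<Delta>_coassoc[OF Fx E]) simp
    also have "\<dots> = tensor_lift E ?G (tensor_lift (P \<boxtimes> C) (\<lambda>u c. lmul C u (ent c p)) (\<Delta> y))"
      using y p by (simp add: expand_left_def \<Delta>_mult ract_expand)
    also have "\<dots> = tensor_lift E (\<lambda>u c. tensor_lift E ?G (lmul C u (ent c p))) (\<Delta> y)"
      using p y by (intro lift_lift[OF mP mC mP mC E _ G]) ((assumption | rule entwining_intros | simp)+)
    also have "\<dots> = tensor_lift E (\<lambda>u c. tensor_lift E (\<lambda>v d. ?M (x \<otimes>\<^bsub>P\<^esub> v) d c) (\<Delta> u)) (\<Delta> y)"
    proof (rule lift_cong[OF mP mC E bilinear_expand_left[OF mP mC mC mP E Mx \<Delta>_lin], symmetric])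
      fix u c assume u: "u \<in> carrier P" and c: "c \<in> carrier C"
      have "tensor_lift E (\<lambda>v d. ?M (x \<otimes>\<^bsub>P\<^esub> v) d c) (\<Delta> u) =
          tensor_lift E (\<lambda>q d'. tensor_lift E (\<lambda>v d. tensor_lift E (\<lambda>q' c'. F q' c' d') (ract q (pure P C (x \<otimes>\<^bsub>P\<^esub> v) d))) (\<Delta> u)) (ent c p)"
        using p x u c E by (intro lift_swap[OF mP mC mP mC E]) ((assumption | rule entwining_intros F' | simp)+)
      also have "\<dots> = tensor_lift E (\<lambda>q d. ?G (u \<otimes>\<^bsub>P\<^esub> q) d) (ent c p)"
      proof (rule lift_cong[OF mP mC E, symmetric])
        show "bilinear P C E (\<lambda>q d. ?G (u \<otimes>\<^bsub>P\<^esub> q) d)"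
          using x u E by - ((assumption | rule entwining_intros F' | simp)+)
        fix q d assume q: "q \<in> carrier P" and d: "d \<in> carrier C"
        have h: "(\<lambda>t. tensor_lift E (\<lambda>q' c'. F q' c' d) (ract q t)) \<in> lin (P \<boxtimes> C) E"
          by (rule lin_compose[OF lift_lin[OF mP mC E trilinearD(2)[OF F d]] ract_lin[OF q]])
        show "?G (u \<otimes>\<^bsub>P\<^esub> q) d =
            tensor_lift E (\<lambda>v c'. tensor_lift E (\<lambda>q' c'. F q' c' d) (ract q (pure P C (x \<otimes>\<^bsub>P\<^esub> v) c'))) (\<Delta> u)"
          unfolding lift_lin_pure_mult[OF h E x \<Delta>_closed[OF u]]
          using x u q d by (simp add: ract_lmul_\<Delta> lift_lmul[OF _ mC E _ trilinearD(2)[OF F d]])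
      qed (use c p in auto)
      also have "\<dots> = tensor_lift E ?G (lmul C u (ent c p))"
        using u c p by (simp add: lift_lmul[OF _ mC E _ G])
      finally show "tensor_lift E (\<lambda>v d. ?M (x \<otimes>\<^bsub>P\<^esub> v) d c) (\<Delta> u) = tensor_lift E ?G (lmul C u (ent c p))" .
    qed (use y in auto)
    also have "\<dots> = expand_right E (\<lambda>u. ?M (x \<otimes>\<^bsub>P\<^esub> u)) (comult C) (\<Delta> y)"
      using \<Delta>_coassoc[OF Mx E y] by (simp add: expand_left_def)
    also have "\<dots> = expand_right E ?M (comult C) (lmul C x (\<Delta> y))"
      using x y by (simp add: expand_right_lmul[OF M E])
    finally show "expand_right E F (comult C) (ract p (lmul C x (\<Delta> y))) = expand_right E ?M (comult C) (lmul C x (\<Delta> y))" .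
  qed
qed

lemma expand_right_ent:
  assumes F: "trilinear P C C E F" and E: "module K E" and p: "p \<in> carrier P" and c: "c \<in> carrier C"
  shows "expand_right E F (comult C) (ent c p) = tensor_lift E (\<lambda>c d. tensor_lift E (\<lambda>q d'.
      tensor_lift E (\<lambda>q' c'. F q' c' d') (ent c q)) (ent d p)) (comult C c)"
proof -
  let ?M = "\<lambda>x c d. tensor_lift E (\<lambda>q d'. tensor_lift E (\<lambda>q' c'. F q' c' d') (ract q (pure P C x c))) (ent d p)"
  note F' = trilinear_app[OF F]
  have M: "trilinear P C C E ?M"
    using p E by - ((assumption | rule entwining_intros F' | simp)+)
  show ?thesis
    using expand_right_ract[OF F E p, of "pure P C \<one>\<^bsub>P\<^esub> c"] c
      expand_right_pure[OF mP mC mC mC E M coalgebraD(2)[OF C] P.one_closed c]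
    by (simp add: ent_def)
qed

text \<open>
  Transporting the comultiplication of \<open>P \<otimes> C\<close> through \<open>\<psi>\<close>: by compatibility of the entwining with the
  comultiplication, expanding \<open>C\<close> in \<open>p\<^sub>- \<otimes> p\<^sub>0\<close> amounts to expanding \<open>e\<close> in \<open>p \<otimes> e\<close>, and \<open>e\<close> is group-like.
\<close>

lemma lco_coassoc:
  assumes G: "trilinear C C P E G" and E: "module K E" and p: "p \<in> carrier P"
  shows "expand_right E G lco (lco p) = expand_left E G (comult C) (lco p)"
proof -
  note G' = trilinear_app[OF G] and comult = coalgebraD(2)[OF C]
  \<comment> \<open>This is \<open>G\<close> evaluated after applying the inverse entwining to \<open>q \<otimes> c \<otimes> d\<close> twice, moving \<open>q\<close> to the end.\<close>
  let ?F = "\<lambda>q c d. tensor_lift E (\<lambda>c' u. tensor_lift E (G c') (\<chi> (pure P C u d))) (\<chi> (pure P C q c))"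
  have F: "trilinear P C C E ?F"
    using E by - ((assumption | rule entwining_intros G' | simp)+)
  have lin: "(\<lambda>t. expand_right E ?F (comult C) (\<psi> t)) \<in> lin (C \<boxtimes> P) E"
    by (rule lin_compose[OF expand_right_lin[OF mP mC mC mC E F comult] \<psi>_lin])
  have "expand_left E G (comult C) (lco p) = expand_right E ?F (comult C) (\<psi> (lco p))"
  proof (rule lift_unique[OF mC mP E bilinear_expand_left[OF mC mC mP mC E G comult] lin, folded expand_left_def])
    fix c q assume c: "c \<in> carrier C" and q: "q \<in> carrier P"
    have "expand_right E ?F (comult C) (\<psi> (pure C P c q)) = tensor_lift E (\<lambda>c d. tensor_lift E (\<lambda>q d'.
      tensor_lift E (\<lambda>q' c'. ?F q' c' d') (ent c q)) (ent d q)) (comult C c)"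
      using c q by (simp add: \<psi>_pure expand_right_ent[OF F E])
    also have "\<dots> = tensor_lift E (\<lambda>c d. G c d q) (comult C c)"
    proof (rule lift_cong[OF mC mC E trilinearD(2)[OF G q], symmetric])
      fix c d assume c: "c \<in> carrier C" and d: "d \<in> carrier C"
      have inner: "tensor_lift E (\<lambda>q' c'. ?F q' c' d') (ent c u) = tensor_lift E (G c) (\<chi> (pure P C u d'))"
        if u: "u \<in> carrier P" and d': "d' \<in> carrier C" for u d'
      proof -
        let ?h = "\<lambda>w. tensor_lift E (\<lambda>c' u. tensor_lift E (G c') (\<chi> (pure P C u d'))) (\<chi> w)"
        have bil: "bilinear C P E (\<lambda>c' u. tensor_lift E (G c') (\<chi> (pure P C u d')))"
          using E d' by - ((assumption | rule entwining_intros G' | simp)+)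
        have h: "?h \<in> lin (P \<boxtimes> C) E" by (rule lin_compose[OF lift_lin[OF mC mP E bil] \<chi>_lin])
        have "tensor_lift E (\<lambda>q' c'. ?h (pure P C q' c')) (ent c u) = ?h (ent c u)"
          by (rule lift_unique[OF mP mC E _ h])
            (use c u in \<open>auto intro!: bilinearI lin_compose[OF h] lin_pure_left lin_pure_right\<close>)
        also have "\<dots> = tensor_lift E (G c) (\<chi> (pure P C u d'))"
          using c u \<chi>_\<psi>[of "pure C P c u"] by (simp add: \<psi>_pure lift_pure[OF mC mP E bil])
        finally show ?thesis .
      qed
      let ?k = "\<lambda>w. tensor_lift E (G c) (\<chi> w)"
      have k: "?k \<in> lin (P \<boxtimes> C) E" by (rule lin_compose[OF lift_lin[OF mC mP E trilinearD(1)[OF G c]] \<chi>_lin])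
      have bk: "bilinear P C E (\<lambda>u d'. ?k (pure P C u d'))"
        by (intro bilinearI lin_compose[OF k] lin_pure_left lin_pure_right) auto
      have "G c d q = ?k (ent d q)"
        using c d q \<chi>_\<psi>[of "pure C P d q"] by (simp add: \<psi>_pure lift_pure[OF mC mP E trilinearD(1)[OF G c]])
      also have "\<dots> = tensor_lift E (\<lambda>u d'. ?k (pure P C u d')) (ent d q)"
        by (rule lift_unique[OF mP mC E bk k, symmetric]) (use d q in auto)
      also have "\<dots> = tensor_lift E (\<lambda>u d'. tensor_lift E (\<lambda>q' c'. ?F q' c' d') (ent c u)) (ent d q)"
        by (rule lift_cong[OF mP mC E bk]) (use d q inner in auto)
      finally show "G c d q = tensor_lift E (\<lambda>u d'. tensor_lift E (\<lambda>q' c'. ?F q' c' d') (ent c u)) (ent d q)" .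
    qed (use c in auto)
    finally show "expand_right E ?F (comult C) (\<psi> (pure C P c q)) = tensor_lift E (\<lambda>x y. G x y q) (comult C c)" .
  qed (use p in auto)
  also have "\<dots> = ?F p e e"
    using p expand_right_pure[OF mP mC mC mC E F comult p e] lift_pure[OF mC mC E trilinearD(1)[OF F p] e e]
    by (simp add: \<psi>_lco comult_e)
  also have "\<dots> = expand_right E G lco (lco p)" by (simp add: expand_right_def lco_def[abs_def])
  finally show ?thesis ..
qed

lemma left_comodule_P: "left_comodule K C P lco"
  unfolding left_comodule_def
proof (intro conjI ballI mP lco_lin lco_counit)
  fix p assume p: "p \<in> carrier P"
  show "assoc_right K C C P (tensor_map K (C \<boxtimes> C) P (comult C) id (lco p)) = tensor_map K C (C \<boxtimes> P) id lco (lco p)"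
    using p
    by (intro expand_eqI[symmetric, OF mC mC mP mP mC lco_lin coalgebraD(2)[OF C]]
        lco_coassoc[OF trilinear_pure[OF mC mC mP]]) auto
qed

section \<open>Existence of a colinear section\<close>

abbreviation BP where "BP \<equiv> B \<boxtimes> P"
abbreviation BP_left where "BP_left \<equiv> base_tensor_left K C P \<Delta>"
abbreviation BP_coact where "BP_coact \<equiv> base_tensor_coaction K C P \<Delta>"

lemma mBP [simp, intro]: "module K BP" by (rule module_tensor) auto
lemma mBPC [simp, intro]: "module K (BP \<boxtimes> C)" by (rule module_tensor) auto

lemma base_tensor_eq: "base_tensor K C P \<Delta> = BP" by (simp add: base_tensor_def)

lemma lin_mult_base: "\<lbrakk>f \<in> lin U B; b \<in> carrier B\<rbrakk> \<Longrightarrow> (\<lambda>u. b \<otimes>\<^bsub>P\<^esub> f u) \<in> lin U B"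
  by (intro linI) (auto simp: lin_closed lin_add[of f U B, simplified] lin_smult[of f U B, simplified]
      P.r_distr algebraD(4)[OF algebra_P])

definition bmul where "bmul b = tensor_map K B P (\<lambda>x. b \<otimes>\<^bsub>P\<^esub> x) id"

lemma bmul_lin: "b \<in> carrier B \<Longrightarrow> bmul b \<in> lin BP BP"
  unfolding bmul_def by (intro tensor_map_lin lin_mult_base lin_ident id_lin) auto

lemma bmul_closed [simp, intro]: "\<lbrakk>b \<in> carrier B; t \<in> carrier BP\<rbrakk> \<Longrightarrow> bmul b t \<in> carrier BP"
  by (rule lin_closed[OF bmul_lin])

lemma bmul_pure [simp]:
  "\<lbrakk>b \<in> carrier B; x \<in> carrier B; p \<in> carrier P\<rbrakk> \<Longrightarrow> bmul b (pure B P x p) = pure B P (b \<otimes>\<^bsub>P\<^esub> x) p"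
  unfolding bmul_def by (simp add: tensor_map_pure[OF mB mP mB mP lin_mult_base[OF lin_ident] id_lin])

lemma lift_bmul:
  assumes "t \<in> carrier BP" "module K E" "b \<in> carrier B" "bilinear B P E F"
  shows "tensor_lift E F (bmul b t) = tensor_lift E (\<lambda>x p. F (b \<otimes>\<^bsub>P\<^esub> x) p) t"
  unfolding bmul_def
  using lift_tensor_map[OF mB mP mB mP assms(2) lin_mult_base[OF lin_ident assms(3)] id_lin assms(4,1)] by simp

lemma BP_left_simps:
  "carrier BP_left = carrier BP" "ring.add BP_left = ring.add BP" "ring.zero BP_left = ring.zero BP"
  "b \<odot>\<^bsub>BP_left\<^esub> t = bmul b t"
  by (simp_all add: base_tensor_left_def with_smult_def base_tensor_eq bmul_def)

lemma bmul_lin_left: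
  assumes "t \<in> carrier BP"
  shows "(\<lambda>b. bmul b t) \<in> lin B BP"
proof -
  have "(\<lambda>b. b \<otimes>\<^bsub>P\<^esub> x) \<in> lin B B" if "x \<in> carrier B" for x
    using that by (intro linI) (auto simp: P.l_distr algebraD(3)[OF algebra_P])
  then show ?thesis
    unfolding bmul_def tensor_map_lift id_apply
    using assms by (intro lin_lift_fun'[OF assms] bilinearI lin_pure_left lin_pure_right lin_ident lin_mult_base) auto
qed

lemma left_module_BP: "left_module B BP_left"
proof -
  interpret T: module K BP by (rule mBP)
  have abel: "abelian_group BP_left"
  proof (rule abelian_groupI)
    show "\<exists>y\<in>carrier BP_left. y \<oplus>\<^bsub>BP_left\<^esub> x = \<zero>\<^bsub>BP_left\<^esub>" if "x \<in> carrier BP_left" for x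
      using that T.l_neg T.a_inv_closed by (intro bexI[of _ "\<ominus>\<^bsub>BP\<^esub> x"]) (simp_all add: BP_left_simps)
  qed (simp_all add: BP_left_simps T.a_ac)
  have mult: "bmul (a \<otimes>\<^bsub>P\<^esub> b) t = bmul a (bmul b t)" if "a \<in> carrier B" "b \<in> carrier B" "t \<in> carrier BP" for a b t
    by (rule tensor_lin_ext[OF mB mP mBP bmul_lin lin_compose[OF bmul_lin bmul_lin] _ that(3)])
      (use that in \<open>simp_all add: P.m_assoc\<close>)
  have one: "bmul \<one>\<^bsub>P\<^esub> t = t" if "t \<in> carrier BP" for t
    by (rule tensor_lin_ext[OF mB mP mBP bmul_lin lin_ident _ that]) simp_all
  show ?thesis
    using algebraD(2)[OF algebra_B] abel
    by (intro left_module.intro left_module_axioms.intro)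
      (simp_all add: BP_left_simps mult one lin_add[OF bmul_lin] lin_add[OF bmul_lin_left, simplified])
qed

lemma scalars_BP: "same_module K (scalars B BP_left) BP"
proof -
  have "bmul (a \<odot>\<^bsub>P\<^esub> \<one>\<^bsub>P\<^esub>) t = a \<odot>\<^bsub>BP\<^esub> t" if "a \<in> carrier K" "t \<in> carrier BP" for a t
    using lin_smult[OF bmul_lin_left[OF that(2)] that(1), of "\<one>\<^bsub>P\<^esub>"]
      left_moduleD(7)[OF left_module_BP, of t] that by (simp add: BP_left_simps)
  then show ?thesis by (simp add: same_module_def BP_left_simps)
qed

lemma scalars_P: "same_module K (scalars B (left_reg P)) P"
  using assoc_algebra_scalar(1)[OF algebra_P] by (simp add: same_module_def)

abbreviation "pureBPC \<equiv> \<lambda>b q c. pure BP C (pure B P b q) c"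

lemma trilinear_pureBPC: "trilinear B P C (BP \<boxtimes> C) pureBPC"
  by ((assumption | rule entwining_intros | simp)+)

lemma BP_coact_expand:
  assumes t: "t \<in> carrier BP"
  shows "BP_coact t = expand_right (BP \<boxtimes> C) pureBPC \<Delta> t"
proof -
  have "assoc_left K B P C = tensor_lift (BP \<boxtimes> C) (\<lambda>u t. tensor_lift (BP \<boxtimes> C) (pureBPC u) t)"
    by (simp add: assoc_left_def Let_def)
  then show ?thesis
    unfolding base_tensor_coaction_def expand_right_def
    using lift_lift_right[OF mB mP mC mP mBPC \<Delta>_lin t trilinear_pureBPC] by simp
qed

lemma expand_BP_coact_lin: "expand_right (BP \<boxtimes> C) pureBPC \<Delta> \<in> lin BP (BP \<boxtimes> C)"
  by (rule expand_right_lin[OF mB mP mC mP mBPC trilinear_pureBPC \<Delta>_lin])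

lemma BP_coact_lin: "BP_coact \<in> lin BP (BP \<boxtimes> C)"
  using lin_closed[OF expand_BP_coact_lin] lin_add[OF expand_BP_coact_lin] lin_smult[OF expand_BP_coact_lin]
    lin_add[OF lin_ident] module.smult_closed[OF mBP] abelian_monoid.a_closed[OF abelian_group.axioms(1)[OF module_abelian[OF mBP]]]
  by (intro linI) (simp_all add: BP_coact_expand)

lemma BP_coact_closed [simp, intro]: "t \<in> carrier BP \<Longrightarrow> BP_coact t \<in> carrier (BP \<boxtimes> C)"
  by (rule lin_closed[OF BP_coact_lin])

lemma BP_coact_pure:
  "\<lbrakk>b \<in> carrier B; p \<in> carrier P\<rbrakk> \<Longrightarrow> BP_coact (pure B P b p) = tensor_lift (BP \<boxtimes> C) (pureBPC b) (\<Delta> p)"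
  by (simp add: BP_coact_expand expand_right_pure[OF mB mP mC mP mBPC trilinear_pureBPC \<Delta>_lin])

text \<open>
  The coaction of \<open>B \<otimes> P\<close> is \<open>id \<otimes> \<Delta>\<close> up to reassociation, so evaluating a bilinear map on it is an
  expansion of the second factor.
\<close>

lemma lift_BP_coact:
  assumes E: "module K E" and F: "bilinear BP C E F" and t: "t \<in> carrier BP"
  shows "tensor_lift E F (BP_coact t) = expand_right E (\<lambda>b q c. F (pure B P b q) c) \<Delta> t"
  unfolding BP_coact_expand[OF t]
    hom_expand_right[OF mB mP mC mP mBPC E trilinear_pureBPC \<Delta>_lin lift_lin[OF mBP mC E F] t]
  unfolding expand_right_def
proof (rule lift_cong[OF mB mP E _ _ t])
  have F': "bilinear P C E (\<lambda>q c. F (pure B P b q) c)" if "b \<in> carrier B" for b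
    using that by (intro bilinearI bilinear_app_left[OF F] bilinear_app_right[OF F] lin_pure_right lin_ident) auto
  have eq: "tensor_lift E F (pure BP C (pure B P b q) c) = F (pure B P b q) c"
    if "b \<in> carrier B" "q \<in> carrier P" "c \<in> carrier C" for b q c
    using that by (intro lift_pure[OF mBP mC E F]) auto
  have h: "tensor_lift E F \<in> lin (BP \<boxtimes> C) E" by (rule lift_lin[OF mBP mC E F])
  show "bilinear B P E (\<lambda>v w. tensor_lift E (\<lambda>q c. tensor_lift E F (pure BP C (pure B P v q) c)) (\<Delta> w))"
    using E by - ((assumption | rule entwining_intros lin_compose[OF h] | simp)+)
  show "tensor_lift E (\<lambda>q c. tensor_lift E F (pure BP C (pure B P v q) c)) (\<Delta> w) =
      tensor_lift E (\<lambda>q c. F (pure B P v q) c) (\<Delta> w)" if "v \<in> carrier B" "w \<in> carrier P" for v w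
    using that eq by (intro lift_cong[OF mP mC E F', symmetric]) auto
qed

lemma right_comodule_BP: "right_comodule K C BP BP_coact"
  unfolding right_comodule_def
proof (intro conjI ballI mBP BP_coact_lin)
  note comult = coalgebraD(2)[OF C]
  let ?T = "BP \<boxtimes> C \<boxtimes> C"
  have T: "module K ?T" by (intro module_tensor) auto
  note tri = trilinear_pure[OF mBP mC mC]
  fix t assume t: "t \<in> carrier BP"
  have L: "(\<lambda>t. expand_right ?T (pure3 BP C C) (comult C) (BP_coact t)) \<in> lin BP ?T"
    by (rule lin_compose[OF expand_right_lin[OF mBP mC mC mC T tri comult] BP_coact_lin])
  have R: "(\<lambda>t. expand_left ?T (pure3 BP C C) BP_coact (BP_coact t)) \<in> lin BP ?T"
    by (rule lin_compose[OF expand_left_lin[OF mBP mC mC mBP T tri BP_coact_lin] BP_coact_lin])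
  have "expand_right ?T (pure3 BP C C) (comult C) (BP_coact t) = expand_left ?T (pure3 BP C C) BP_coact (BP_coact t)"
  proof (rule tensor_lin_ext[OF mB mP T L R _ t])
    fix b p assume b: "b \<in> carrier B" and p: "p \<in> carrier P"
    let ?F = "\<lambda>q c d. pure3 BP C C (pure B P b q) c d"
    have F: "trilinear P C C ?T ?F" using b by - ((assumption | rule entwining_intros | simp)+)
    have bp: "pure B P b p \<in> carrier BP" using b p by auto
    have 1: "bilinear BP C ?T (\<lambda>x c. tensor_lift ?T (pure3 BP C C x) (comult C c))"
      by (rule bilinear_expand_right[OF mBP mC mC mC T tri comult])
    have 2: "bilinear BP C ?T (\<lambda>x c. tensor_lift ?T (\<lambda>y d. pure3 BP C C y d c) (BP_coact x))"
      by (rule bilinear_expand_left[OF mBP mC mC mBP T tri BP_coact_lin])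
    have "expand_right ?T (pure3 BP C C) (comult C) (BP_coact (pure B P b p)) = expand_right ?T ?F (comult C) (\<Delta> p)"
      unfolding expand_right_def[of _ "pure3 BP C C"] lift_BP_coact[OF T 1 bp]
      using b p 1 by (subst expand_right_pure[OF mB mP mC mP T _ \<Delta>_lin])
        (auto simp: expand_right_def intro!: trilinearI bilinear_app_left[OF 1] bilinear_app_right[OF 1] lin_pure_left lin_pure_right)
    also have "\<dots> = expand_left ?T ?F \<Delta> (\<Delta> p)" by (rule \<Delta>_coassoc[OF F T p])
    also have "\<dots> = tensor_lift ?T (\<lambda>q c. tensor_lift ?T (\<lambda>y d. pure3 BP C C y d c) (BP_coact (pure B P b q))) (\<Delta> p)"
      unfolding expand_left_def
    proof (rule lift_cong[OF mP mC T bilinear_expand_left[OF mP mC mC mP T F \<Delta>_lin]])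
      fix q c assume q: "q \<in> carrier P" and c: "c \<in> carrier C"
      have bq: "pure B P b q \<in> carrier BP" using b q by auto
      note tc = trilinearD(2)[OF tri c]
      show "tensor_lift ?T (\<lambda>x y. ?F x y c) (\<Delta> q) = tensor_lift ?T (\<lambda>y d. pure3 BP C C y d c) (BP_coact (pure B P b q))"
        unfolding lift_BP_coact[OF T tc bq]
        using b q c by (subst expand_right_pure[OF mB mP mC mP T _ \<Delta>_lin])
          (auto intro!: trilinearI bilinear_app_left[OF tc] bilinear_app_right[OF tc] lin_pure_left lin_pure_right)
    qed (use p in auto)
    also have "\<dots> = expand_left ?T (pure3 BP C C) BP_coact (BP_coact (pure B P b p))"
      unfolding expand_left_def lift_BP_coact[OF T 2 bp]
      using b p by (subst expand_right_pure[OF mB mP mC mP T _ \<Delta>_lin])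
        (auto intro!: trilinearI bilinear_app_left[OF 2] bilinear_app_right[OF 2] lin_pure_left lin_pure_right)
    finally show "expand_right ?T (pure3 BP C C) (comult C) (BP_coact (pure B P b p)) =
        expand_left ?T (pure3 BP C C) BP_coact (BP_coact (pure B P b p))" .
  qed
  then show "assoc_right K BP C C (tensor_map K (BP \<boxtimes> C) C BP_coact id (BP_coact t)) =
      tensor_map K BP (C \<boxtimes> C) id (comult C) (BP_coact t)"
    using t by (intro expand_eqI[symmetric, OF mBP mC mC mC mBP comult BP_coact_lin]) auto
  have "(\<lambda>t. tensor_lift BP (\<lambda>x c. counit C c \<odot>\<^bsub>BP\<^esub> x) (BP_coact t)) \<in> lin BP BP"
    by (rule lin_compose[OF lift_lin[OF mBP mC mBP bilinear_counit[OF mBP]] BP_coact_lin])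
  then show "tensor_lift BP (\<lambda>x c. counit C c \<odot>\<^bsub>BP\<^esub> x) (BP_coact t) = t"
  proof (rule tensor_lin_ext[OF mB mP mBP _ lin_ident _ t])
    fix b p assume b: "b \<in> carrier B" and p: "p \<in> carrier P"
    note bil = bilinear_counit[OF mBP]
    have bp: "pure B P b p \<in> carrier BP" using b p by auto
    have "tensor_lift BP (\<lambda>x c. counit C c \<odot>\<^bsub>BP\<^esub> x) (BP_coact (pure B P b p)) =
        tensor_lift BP (\<lambda>q c. counit C c \<odot>\<^bsub>BP\<^esub> pure B P b q) (\<Delta> p)"
      unfolding lift_BP_coact[OF mBP bil bp]
      using b p by (subst expand_right_pure[OF mB mP mC mP mBP _ \<Delta>_lin])
        (auto intro!: trilinearI bilinear_app_left[OF bil] bilinear_app_right[OF bil] lin_pure_left lin_pure_right)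
    also have "\<dots> = tensor_lift BP (\<lambda>q c. pure B P b (counit C c \<odot>\<^bsub>P\<^esub> q)) (\<Delta> p)"
      using b p bilinear_smult(2)[OF bilinear_pure[OF mB mP]]
      by (intro lift_cong[OF mP mC mBP bilinear_compose[OF bil lin_pure_right[OF mB mP lin_ident b] lin_ident]]) auto
    also have "\<dots> = pure B P b (tensor_lift P (\<lambda>q c. counit C c \<odot>\<^bsub>P\<^esub> q) (\<Delta> p))"
      using b p by (intro hom_lift[OF mP mC mP bilinear_counit[OF mP] mBP lin_pure_right, symmetric]) auto
    finally show "tensor_lift BP (\<lambda>x c. counit C c \<odot>\<^bsub>BP\<^esub> x) (BP_coact (pure B P b p)) = pure B P b p"
      using p by (simp add: right_comoduleD(3)[OF comodule_P])
  qed
qed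

lemma lift_BP_coact_pure:
  assumes E: "module K E" and F: "bilinear BP C E F" and b: "b \<in> carrier B" and p: "p \<in> carrier P"
  shows "tensor_lift E F (BP_coact (pure B P b p)) = tensor_lift E (\<lambda>q c. F (pure B P b q) c) (\<Delta> p)"
proof -
  have bp: "pure B P b p \<in> carrier BP" using b p by auto
  show ?thesis
    unfolding lift_BP_coact[OF E F bp]
    using b p E by (subst expand_right_pure[OF mB mP mC mP E _ \<Delta>_lin])
      (auto intro!: trilinearI bilinear_app_left[OF F] bilinear_app_right[OF F] lin_pure_left lin_pure_right)
qed

lemma module_comodule_BP: "module_comodule K C B BP_left BP_coact"
  unfolding module_comodule_def
proof (intro conjI ballI left_module_BP)
  show "right_comodule K C (scalars B BP_left) BP_coact"
    by (rule right_comodule_cong[OF same_module_sym[OF scalars_BP] C right_comodule_BP])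
  fix b t assume b: "b \<in> carrier B" and "t \<in> carrier BP_left"
  then have t: "t \<in> carrier BP" by (simp add: BP_left_simps)
  note bm = bmul_lin[OF b]
  have "BP_coact (bmul b t) = tensor_map K BP C (bmul b) id (BP_coact t)"
  proof (rule tensor_lin_ext[OF mB mP mBPC lin_compose[OF BP_coact_lin bm]
        lin_compose[OF tensor_map_lin[OF mBP mC mBP mC bm id_lin] BP_coact_lin] _ t])
    fix x p assume x: "x \<in> carrier B" and p: "p \<in> carrier P"
    have "tensor_map K BP C (bmul b) id (BP_coact (pure B P x p)) =
        tensor_lift (BP \<boxtimes> C) (\<lambda>q c. pure BP C (bmul b (pure B P x q)) (id c)) (\<Delta> p)"
      unfolding tensor_map_lift
      using b x p by (intro lift_BP_coact_pure[OF mBPC bilinear_pure_maps[OF mBP mC bm id_lin]]) auto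
    also have "\<dots> = tensor_lift (BP \<boxtimes> C) (pureBPC (b \<otimes>\<^bsub>P\<^esub> x)) (\<Delta> p)"
      using b x p by (intro lift_cong[OF mP mC mBPC trilinearD(1)[OF trilinear_pureBPC], symmetric]) auto
    also have "\<dots> = BP_coact (bmul b (pure B P x p))"
      using b x p by (simp add: BP_coact_pure)
    finally show "BP_coact (bmul b (pure B P x p)) = tensor_map K BP C (bmul b) id (BP_coact (pure B P x p))" ..
  qed
  then show "BP_coact (b \<odot>\<^bsub>BP_left\<^esub> t) = tensor_map K (scalars B BP_left) C (\<lambda>x. b \<odot>\<^bsub>BP_left\<^esub> x) id (BP_coact t)"
    by (simp add: BP_left_simps tensor_group_cong(3)[OF scalars_BP same_module_refl])
qed

lemma left_module_P: "left_module B (left_reg P)"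
  using algebraD(2)[OF algebra_B] abelian_reg(1)
  by (intro left_module.intro left_module_axioms.intro) (simp_all add: P.l_distr P.r_distr P.m_assoc)

lemma module_comodule_P: "module_comodule K C B (left_reg P) \<Delta>"
  unfolding module_comodule_def
proof (intro conjI ballI left_module_P)
  show "right_comodule K C (scalars B (left_reg P)) \<Delta>"
    by (rule right_comodule_cong[OF same_module_sym[OF scalars_P] C comodule_P])
next
  have "smult (left_reg P) = monoid.mult P" by (simp add: left_reg_def with_smult_def)
  then show "\<Delta> (b \<odot>\<^bsub>left_reg P\<^esub> m) = tensor_map K (scalars B (left_reg P)) C (\<lambda>x. b \<odot>\<^bsub>left_reg P\<^esub> x) id (\<Delta> m)"
    if "b \<in> carrier B" "m \<in> carrier (left_reg P)" for b m
    using that by (simp add: tensor_group_cong(3)[OF scalars_P same_module_refl] \<Delta>_base lmul_def)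
qed

definition mult_BP where "mult_BP = tensor_lift P (\<lambda>b p. b \<otimes>\<^bsub>P\<^esub> p)"

lemma bilinear_mult_BP: "bilinear B P P (\<lambda>b p. b \<otimes>\<^bsub>P\<^esub> p)"
  by (intro bilinearI lin_mult_right lin_mult_left lin_ident lin_base_domain) auto

lemma mult_BP_lin: "mult_BP \<in> lin BP P"
  unfolding mult_BP_def by (rule lift_lin[OF mB mP mP bilinear_mult_BP])

lemma mult_BP_closed [simp, intro]: "t \<in> carrier BP \<Longrightarrow> mult_BP t \<in> carrier P"
  by (rule lin_closed[OF mult_BP_lin])

lemma mult_BP_pure [simp]: "\<lbrakk>b \<in> carrier B; p \<in> carrier P\<rbrakk> \<Longrightarrow> mult_BP (pure B P b p) = b \<otimes>\<^bsub>P\<^esub> p"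
  unfolding mult_BP_def by (rule lift_pure[OF mB mP mP bilinear_mult_BP])

lemma mult_BP_bmul:
  assumes "b \<in> carrier B" "t \<in> carrier BP"
  shows "mult_BP (bmul b t) = b \<otimes>\<^bsub>P\<^esub> mult_BP t"
  by (rule tensor_lin_ext[OF mB mP mP lin_compose[OF mult_BP_lin bmul_lin] lin_mult_right[OF mult_BP_lin] _ assms(2)])
    (use assms in \<open>simp_all add: P.m_assoc\<close>)

lemma \<Delta>_mult_BP:
  assumes t: "t \<in> carrier BP"
  shows "\<Delta> (mult_BP t) = tensor_map K P C mult_BP id (BP_coact t)"
proof (rule tensor_lin_ext[OF mB mP mPC lin_compose[OF \<Delta>_lin mult_BP_lin]
      lin_compose[OF tensor_map_lin[OF mP mC mBP mC mult_BP_lin id_lin] BP_coact_lin] _ t])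
  fix b p assume b: "b \<in> carrier B" and p: "p \<in> carrier P"
  have "tensor_map K P C mult_BP id (BP_coact (pure B P b p)) =
      tensor_lift (P \<boxtimes> C) (\<lambda>q c. pure P C (mult_BP (pure B P b q)) (id c)) (\<Delta> p)"
    unfolding tensor_map_lift
    using b p by (intro lift_BP_coact_pure[OF mPC bilinear_pure_maps[OF mP mC mult_BP_lin id_lin]]) auto
  also have "\<dots> = tensor_lift (P \<boxtimes> C) (\<lambda>q c. pure P C (b \<otimes>\<^bsub>P\<^esub> q) (id c)) (\<Delta> p)"
    using b p by (intro lift_cong[OF mP mC mPC bilinear_pure_maps[OF mP mC mult_lin[of b] id_lin], symmetric]) auto
  also have "\<dots> = \<Delta> (mult_BP (pure B P b p))"
    using b p by (simp add: \<Delta>_base lmul_def tensor_map_lift)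
  finally show "\<Delta> (mult_BP (pure B P b p)) = tensor_map K P C mult_BP id (BP_coact (pure B P b p))" ..
qed

definition colinear_splitting where
  "colinear_splitting s \<longleftrightarrow> s \<in> module_hom B (left_reg P) BP_left \<and> s \<in> right_comodule_hom K C P \<Delta> BP BP_coact \<and>
     (\<forall>p\<in>carrier P. mult_BP (s p) = p)"

text \<open>
  The multiplication \<open>B \<otimes> P \<rightarrow> P\<close> is split as a comodule map by \<open>p \<mapsto> 1 \<otimes> p\<close>; equivariant
  projectivity lifts the identity of \<open>P\<close> along it.
\<close>

lemma colinear_splitting_exists: "\<exists>s. colinear_splitting s"
proof -
  have hom_cong: "right_comodule_hom K C (scalars B BP_left) \<rho> (scalars B (left_reg P)) \<tau> = right_comodule_hom K C BP \<rho> P \<tau>"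
    "right_comodule_hom K C (scalars B (left_reg P)) \<tau> (scalars B BP_left) \<rho> = right_comodule_hom K C P \<tau> BP \<rho>"
    "right_comodule_hom K C (scalars B (left_reg P)) \<tau> (scalars B (left_reg P)) \<tau> = right_comodule_hom K C P \<tau> P \<tau>" for \<rho> \<tau>
    by (rule right_comodule_hom_cong[OF scalars_BP scalars_P] right_comodule_hom_cong[OF scalars_P scalars_BP]
        right_comodule_hom_cong[OF scalars_P scalars_P])+
  have "mult_BP \<in> module_hom B BP_left (left_reg P)"
    using lin_add[OF mult_BP_lin] by (intro module_homI) (simp_all add: BP_left_simps mult_BP_bmul)
  then have \<pi>: "mult_BP \<in> module_comodule_hom K C B BP_left BP_coact (left_reg P) \<Delta>"
    unfolding module_comodule_hom_def hom_cong
    using mult_BP_lin \<Delta>_mult_BP by (simp add: right_comodule_hom_def)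
  have "mult_BP (pure B P \<one>\<^bsub>P\<^esub> p) = p" if "p \<in> carrier P" for p using that by simp
  then have surj: "mult_BP ` carrier BP_left = carrier (left_reg P)"
    unfolding BP_left_simps reg_simps
  proof (intro equalityI subsetI)
    fix p assume p: "p \<in> carrier P"
    show "p \<in> mult_BP ` carrier BP"
      by (rule image_eqI[of _ _ "pure B P \<one>\<^bsub>P\<^esub> p"]) (use p in auto)
  qed auto
  have "(\<lambda>p. pure B P \<one>\<^bsub>P\<^esub> p) \<in> right_comodule_hom K C P \<Delta> BP BP_coact"
    unfolding right_comodule_hom_def
    by (auto intro!: lin_pure_right simp: BP_coact_pure tensor_map_lift)
  then have j: "\<exists>j\<in>right_comodule_hom K C (scalars B (left_reg P)) \<Delta> (scalars B BP_left) BP_coact.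
      \<forall>n\<in>carrier (left_reg P). mult_BP (j n) = n"
    unfolding hom_cong by (intro bexI[of _ "\<lambda>p. pure B P \<one>\<^bsub>P\<^esub> p"]) simp_all
  have "tensor_map K P C id id (\<Delta> p) = \<Delta> p" if "p \<in> carrier P" for p
    using that by (simp add: tensor_map_lift lift_pure_id)
  then have f: "(\<lambda>p. p) \<in> module_comodule_hom K C B (left_reg P) \<Delta> (left_reg P) \<Delta>"
    unfolding module_comodule_hom_def hom_cong
    by (auto simp: right_comodule_hom_def module_homI id_def[symmetric] id_module_hom)
  have "equivariantly_projective TYPE(('p, 'p) tensor) TYPE('p) K C B (left_reg P) \<Delta>"
    using principal by (simp add: principal_extension_def)
  then obtain s where s: "s \<in> module_comodule_hom K C B (left_reg P) \<Delta> BP_left BP_coact"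
    "\<forall>q\<in>carrier (left_reg P). mult_BP (s q) = q"
    unfolding equivariantly_projective_def
    using module_comodule_BP module_comodule_P \<pi> surj j f by blast
  then show ?thesis
    by (intro exI[of _ s]) (simp add: colinear_splitting_def module_comodule_hom_def hom_cong)
qed

end

section \<open>The lifted inverse of the canonical map\<close>

locale splitting = principal K C P \<Delta> e
  for K :: "'k ring" (structure) and C :: "('k, 'c) coalgebra" and P :: "('k, 'p) module" and \<Delta> e +
  fixes s :: "'p \<Rightarrow> ('p, 'p) tensor"
  assumes s: "colinear_splitting s"
begin

lemma s_lin: "s \<in> lin P BP"
  using s by (simp add: colinear_splitting_def right_comodule_hom_def)

lemma s_closed [simp, intro]: "p \<in> carrier P \<Longrightarrow> s p \<in> carrier BP" by (rule lin_closed[OF s_lin])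

lemma lin_s: "f \<in> lin U P \<Longrightarrow> (\<lambda>u. s (f u)) \<in> lin U BP" by (rule lin_compose[OF s_lin])

lemma s_base: "\<lbrakk>b \<in> carrier B; p \<in> carrier P\<rbrakk> \<Longrightarrow> s (b \<otimes>\<^bsub>P\<^esub> p) = bmul b (s p)"
  using s module_hom_smult[of s B "left_reg P" BP_left b p] by (simp add: colinear_splitting_def BP_left_simps)

lemma s_split: "p \<in> carrier P \<Longrightarrow> mult_BP (s p) = p"
  using s by (simp add: colinear_splitting_def)

text \<open>
  Colinearity in the form suited to Sweedler calculus:
  \<open>F(s'(p), s''(p)\<^sub>0, s''(p)\<^sub>1) = F(s'(p\<^sub>0), s''(p\<^sub>0), p\<^sub>1)\<close>.
\<close>

lemma s_colinear:
  assumes F: "trilinear B P C E F" and E: "module K E" and p: "p \<in> carrier P"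
  shows "expand_right E F \<Delta> (s p) = expand_left E F s (\<Delta> p)"
proof -
  let ?F = "\<lambda>t c. tensor_lift E (\<lambda>b q. F b q c) t"
  have bil: "bilinear BP C E ?F" by (rule bilinear_lift_left[OF mB mP mC E F])
  have "tensor_lift E ?F (BP_coact (s p)) = expand_right E (\<lambda>b q c. ?F (pure B P b q) c) \<Delta> (s p)"
    by (rule lift_BP_coact[OF E bil s_closed[OF p]])
  also have "\<dots> = expand_right E F \<Delta> (s p)"
    unfolding expand_right_def
  proof (rule lift_cong[OF mB mP E bilinear_expand_right[OF mB mP mC mP E F \<Delta>_lin] _ s_closed[OF p], symmetric])
    show "tensor_lift E (F v) (\<Delta> w) = tensor_lift E (\<lambda>q c. ?F (pure B P v q) c) (\<Delta> w)"
      if "v \<in> carrier B" "w \<in> carrier P" for v w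
      using that by (intro lift_cong[OF mP mC E trilinearD(1)[OF F]])
        (auto simp: lift_pure[OF mB mP E trilinearD(2)[OF F]])
  qed
  finally have 1: "tensor_lift E ?F (BP_coact (s p)) = expand_right E F \<Delta> (s p)" .
  have "BP_coact (s p) = tensor_map K BP C s id (\<Delta> p)"
    using s p by (simp add: colinear_splitting_def right_comodule_hom_def)
  then have "tensor_lift E ?F (BP_coact (s p)) = tensor_lift E (\<lambda>x c. ?F (s x) (id c)) (\<Delta> p)"
    using lift_tensor_map[OF mBP mC mP mC E s_lin id_lin bil \<Delta>_closed[OF p]] by simp
  with 1 show ?thesis by (simp add: expand_left_def)
qed

abbreviation PP where "PP \<equiv> P \<boxtimes> P"

lemma mPP [simp, intro]: "module K PP" by (rule module_tensor) auto

text \<open>\<open>smul x y\<close> is \<open>x s(y)\<close>, as an element of \<open>P \<otimes> P\<close>.\<close>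

definition smul where "smul x y = tensor_lift PP (\<lambda>b q. pure P P (x \<otimes>\<^bsub>P\<^esub> b) q) (s y)"

lemma lin_mult_base_right: "x \<in> carrier P \<Longrightarrow> (\<lambda>b. x \<otimes>\<^bsub>P\<^esub> b) \<in> lin B P"
  by (rule lin_base_domain[OF mult_lin])

lemma bilinear_base_mult: "\<lbrakk>bilinear P W E F; x \<in> carrier P\<rbrakk> \<Longrightarrow> bilinear B W E (\<lambda>b q. F (x \<otimes>\<^bsub>P\<^esub> b) q)"
  using bilinear_compose[OF _ lin_mult_base_right lin_ident] by blast

lemma bilinear_smul: "bilinear P P PP smul"
  unfolding smul_def
proof (rule bilinearI)
  show "(\<lambda>w. tensor_lift PP (\<lambda>b q. pure P P (v \<otimes>\<^bsub>P\<^esub> b) q) (s w)) \<in> lin P PP" if v: "v \<in> carrier P" for v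
    by (rule lin_compose[OF lift_lin[OF mB mP mPP bilinear_base_mult[OF bilinear_pure[OF mP mP] v]] s_lin])
  show "(\<lambda>v. tensor_lift PP (\<lambda>b q. pure P P (v \<otimes>\<^bsub>P\<^esub> b) q) (s w)) \<in> lin P PP" if w: "w \<in> carrier P" for w
    by (rule lin_lift_fun'[OF s_closed[OF w]])
      (auto intro!: lin_pure_left lin_mult_left bilinear_base_mult[OF bilinear_pure])
qed

lemma smul_closed [simp, intro]: "\<lbrakk>x \<in> carrier P; y \<in> carrier P\<rbrakk> \<Longrightarrow> smul x y \<in> carrier PP"
  by (rule bilinear_closed[OF bilinear_smul])

lemma lift_smul:
  assumes E: "module K E" and F: "bilinear P P E F" and x: "x \<in> carrier P" and y: "y \<in> carrier P"
  shows "tensor_lift E F (smul x y) = tensor_lift E (\<lambda>b q. F (x \<otimes>\<^bsub>P\<^esub> b) q) (s y)"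
  unfolding smul_def lift_lift[OF mP mP mB mP E bilinear_base_mult[OF bilinear_pure[OF mP mP] x] F s_closed[OF y]]
  using x y
  by (intro lift_cong[OF mB mP E bilinear_base_mult[OF F x], symmetric]) (auto simp: lift_pure[OF mP mP E F])

lemma smul_base:
  assumes "x \<in> carrier P" "b \<in> carrier B" "y \<in> carrier P"
  shows "smul (x \<otimes>\<^bsub>P\<^esub> b) y = smul x (b \<otimes>\<^bsub>P\<^esub> y)"
  unfolding smul_def s_base[OF assms(2,3)]
    lift_bmul[OF s_closed[OF assms(3)] mPP assms(2) bilinear_base_mult[OF bilinear_pure[OF mP mP] assms(1)]]
  using assms
  by (intro lift_cong[OF mB mP mPP bilinear_base_mult[OF bilinear_pure[OF mP mP]]]) (auto simp: P.m_assoc)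

lemma lmul_smul:
  assumes x: "x \<in> carrier P" and y: "y \<in> carrier P" and z: "z \<in> carrier P"
  shows "lmul P x (smul y z) = smul (x \<otimes>\<^bsub>P\<^esub> y) z"
proof -
  have "lmul P x (smul y z) = tensor_lift PP (\<lambda>b q. lmul P x (pure P P (y \<otimes>\<^bsub>P\<^esub> b) q)) (s z)"
    unfolding smul_def
    by (rule hom_lift[OF mB mP mPP bilinear_base_mult[OF bilinear_pure[OF mP mP] y] mPP lmul_lin[OF mP x] s_closed[OF z]])
  also have "\<dots> = smul (x \<otimes>\<^bsub>P\<^esub> y) z"
    unfolding smul_def using x y z
    by (intro lift_cong[OF mB mP mPP bilinear_base_mult[OF bilinear_pure[OF mP mP]], symmetric]) (auto simp: P.m_assoc)
  finally show ?thesis .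
qed

text \<open>
  The composite of the inverse canonical map with \<open>x \<otimes> y \<mapsto> x s(y)\<close>.  It lifts the inverse canonical map
  to \<open>P \<otimes> P\<close>, so that \<open>\<otimes>\<^sub>B\<close> no longer occurs from here on.
\<close>

definition \<kappa> where "\<kappa> w = tensor_lift PP smul (canP_inv w)"

lemma balanced_smul: "balanced B (right_reg P) (left_reg P) PP smul"
  using bilinear_closed[OF bilinear_smul] bilinear_add[OF bilinear_smul]
  by (intro balancedI) (simp_all add: smul_base)

lemma \<kappa>_add_hom: "\<kappa> \<in> add_hom (P \<boxtimes> C) PP"
proof -
  have "(\<lambda>w. tensor_lift PP smul (canP_inv w)) \<in> add_hom (P \<boxtimes> C) PP"
    by (rule add_hom_compose[OF PBP.tensor_lift_hom[OF module_abelian[OF mPP] balanced_smul] can_inv_hom])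
  then show ?thesis by (simp add: \<kappa>_def[abs_def])
qed

lemma \<kappa>_lmul_\<Delta>: "\<lbrakk>x \<in> carrier P; y \<in> carrier P\<rbrakk> \<Longrightarrow> \<kappa> (lmul C x (\<Delta> y)) = smul x y"
  unfolding \<kappa>_def can_inv_pure
  by (rule PBP.tensor_lift_pure[OF module_abelian[OF mPP] balanced_smul]) simp_all

lemma \<kappa>_lmul:
  assumes x: "x \<in> carrier P" and w: "w \<in> carrier (P \<boxtimes> C)"
  shows "\<kappa> (lmul C x w) = lmul P x (\<kappa> w)"
  by (rule can_ext[OF module_abelian[OF mPP] add_hom_compose[OF \<kappa>_add_hom lin_add_hom[OF lmul_lin[OF mC x]]]
        add_hom_compose[OF lin_add_hom[OF lmul_lin[OF mP x]] \<kappa>_add_hom] _ w])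
    (simp add: x \<kappa>_lmul_\<Delta> lmul_smul flip: lmul_mult)

lemma \<kappa>_lin: "\<kappa> \<in> lin (P \<boxtimes> C) PP"
proof (rule linI)
  fix a w assume a: "a \<in> carrier K" and w: "w \<in> carrier (P \<boxtimes> C)"
  have "a \<odot>\<^bsub>P\<^esub> \<one>\<^bsub>P\<^esub> \<in> carrier P" using module.smult_closed[OF mP a] by simp
  then show "\<kappa> (a \<odot>\<^bsub>P \<boxtimes> C\<^esub> w) = a \<odot>\<^bsub>PP\<^esub> \<kappa> w"
    using \<kappa>_lmul[OF _ w] a w add_hom_closed[OF \<kappa>_add_hom w] by (simp flip: lmul_scalar)
qed (use \<kappa>_add_hom in \<open>auto simp: add_hom_closed add_hom_add\<close>)

lemma \<kappa>_closed [simp, intro]: "w \<in> carrier (P \<boxtimes> C) \<Longrightarrow> \<kappa> w \<in> carrier PP" by (rule lin_closed[OF \<kappa>_lin])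

lemma lin_\<kappa>: "f \<in> lin U (P \<boxtimes> C) \<Longrightarrow> (\<lambda>u. \<kappa> (f u)) \<in> lin U PP" by (rule lin_compose[OF \<kappa>_lin])

lemma \<kappa>_\<Delta>: "p \<in> carrier P \<Longrightarrow> \<kappa> (\<Delta> p) = smul \<one>\<^bsub>P\<^esub> p"
  using \<kappa>_lmul_\<Delta>[of "\<one>\<^bsub>P\<^esub>" p] by (simp add: lmul_one)

lemmas splitting_intros = entwining_intros lin_s lin_\<kappa> s_closed \<kappa>_closed

lemma bilinear_mult: "bilinear P P P (\<lambda>x y. x \<otimes>\<^bsub>P\<^esub> y)"
  by (intro bilinearI lin_mult_right lin_mult_left lin_ident)

lemma lift_mult_smul: "\<lbrakk>x \<in> carrier P; y \<in> carrier P\<rbrakk> \<Longrightarrow> tensor_lift P (\<lambda>x y. x \<otimes>\<^bsub>P\<^esub> y) (smul x y) = x \<otimes>\<^bsub>P\<^esub> y"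
proof -
  assume x: "x \<in> carrier P" and y: "y \<in> carrier P"
  have "tensor_lift P (\<lambda>x y. x \<otimes>\<^bsub>P\<^esub> y) (smul x y) = tensor_lift P (\<lambda>b q. x \<otimes>\<^bsub>P\<^esub> (b \<otimes>\<^bsub>P\<^esub> q)) (s y)"
    unfolding lift_smul[OF mP bilinear_mult x y]
    using x y by (intro lift_cong[OF mB mP mP bilinear_base_mult[OF bilinear_mult]]) (auto simp: P.m_assoc)
  also have "\<dots> = x \<otimes>\<^bsub>P\<^esub> mult_BP (s y)"
    unfolding mult_BP_def by (rule hom_lift[OF mB mP mP bilinear_mult_BP mP mult_lin[OF x] s_closed[OF y], symmetric])
  finally show ?thesis by (simp add: s_split[OF y])
qed

lemma lift_mult_\<kappa>:
  assumes "w \<in> carrier (P \<boxtimes> C)"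
  shows "tensor_lift P (\<lambda>x y. x \<otimes>\<^bsub>P\<^esub> y) (\<kappa> w) = apply_counit w"
  by (rule can_lin_ext[OF mP lin_compose[OF lift_lin[OF mP mP mP bilinear_mult] \<kappa>_lin] apply_counit_lin _ assms])
    (simp add: \<kappa>_lmul_\<Delta> lift_mult_smul apply_counit_lmul apply_counit_\<Delta>)

text \<open>On the spanning elements \<open>x \<Delta>(y)\<close>, which \<open>\<kappa>\<close> maps to \<open>x s(y)\<close>, this is colinearity of \<open>s\<close>.\<close>

lemma \<kappa>_right_colinear:
  assumes F: "trilinear P P C E F" and E: "module K E" and w: "w \<in> carrier (P \<boxtimes> C)"
  shows "expand_right E F \<Delta> (\<kappa> w) =
    expand_right E (\<lambda>x c d. tensor_lift E (\<lambda>u v. F u v d) (\<kappa> (pure P C x c))) (comult C) w"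
proof -
  let ?M = "\<lambda>x c d. tensor_lift E (\<lambda>u v. F u v d) (\<kappa> (pure P C x c))"
  note F' = trilinear_app[OF F] and comult = coalgebraD(2)[OF C]
  have M: "trilinear P C C E ?M" using E by - ((assumption | rule splitting_intros F' | simp)+)
  show ?thesis
  proof (rule can_lin_ext[OF E lin_compose[OF expand_right_lin[OF mP mP mC mP E F \<Delta>_lin] \<kappa>_lin]
        expand_right_lin[OF mP mC mC mC E M comult] _ w])
    fix x y assume x: "x \<in> carrier P" and y: "y \<in> carrier P"
    have Fx: "trilinear B P C E (\<lambda>b. F (x \<otimes>\<^bsub>P\<^esub> b))"
      by (intro trilinearI F' lin_mult_base_right x lin_ident) (auto simp: x)
    note Mx = trilinear_mult_left[OF M x]
    have "expand_right E F \<Delta> (\<kappa> (lmul C x (\<Delta> y))) = expand_right E (\<lambda>b. F (x \<otimes>\<^bsub>P\<^esub> b)) \<Delta> (s y)"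
      unfolding \<kappa>_lmul_\<Delta>[OF x y] expand_right_def
      by (rule lift_smul[OF E bilinear_expand_right[OF mP mP mC mP E F \<Delta>_lin] x y])
    also have "\<dots> = expand_left E (\<lambda>b. F (x \<otimes>\<^bsub>P\<^esub> b)) s (\<Delta> y)" by (rule s_colinear[OF Fx E y])
    also have "\<dots> = expand_left E (\<lambda>u. ?M (x \<otimes>\<^bsub>P\<^esub> u)) \<Delta> (\<Delta> y)"
      unfolding expand_left_def
    proof (rule lift_cong[OF mP mC E bilinear_expand_left[OF mB mP mC mP E Fx s_lin] _ \<Delta>_closed[OF y]])
      fix v d assume v: "v \<in> carrier P" and d: "d \<in> carrier C"
      have h: "(\<lambda>w. tensor_lift E (\<lambda>u v. F u v d) (\<kappa> w)) \<in> lin (P \<boxtimes> C) E"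
        by (rule lin_compose[OF lift_lin[OF mP mP E trilinearD(2)[OF F d]] \<kappa>_lin])
      show "tensor_lift E (\<lambda>b q. F (x \<otimes>\<^bsub>P\<^esub> b) q d) (s v) = tensor_lift E (\<lambda>u c. ?M (x \<otimes>\<^bsub>P\<^esub> u) c d) (\<Delta> v)"
        unfolding lift_lin_pure_mult[OF h E x \<Delta>_closed[OF v]] \<kappa>_lmul_\<Delta>[OF x v]
        by (rule lift_smul[OF E trilinearD(2)[OF F d] x v, symmetric])
    qed
    also have "\<dots> = expand_right E (\<lambda>u. ?M (x \<otimes>\<^bsub>P\<^esub> u)) (comult C) (\<Delta> y)" by (rule \<Delta>_coassoc[OF Mx E y, symmetric])
    also have "\<dots> = expand_right E ?M (comult C) (lmul C x (\<Delta> y))" using x y by (simp add: expand_right_lmul[OF M E])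
    finally show "expand_right E F \<Delta> (\<kappa> (lmul C x (\<Delta> y))) = expand_right E ?M (comult C) (lmul C x (\<Delta> y))" .
  qed
qed

text \<open>
  On \<open>x \<Delta>(y)\<close> the left coaction of the first factor of \<open>x s(y)\<close> is that of \<open>x\<close>, because the left coaction
  is right \<open>B\<close>-linear; and \<open>\<chi>\<close> maps \<open>x \<Delta>(y)\<close> to \<open>x\<^sub>- \<otimes> x\<^sub>0 y\<close>.
\<close>

lemma \<kappa>_left_colinear:
  assumes G: "trilinear C P P E G" and E: "module K E" and w: "w \<in> carrier (P \<boxtimes> C)"
  shows "expand_left E G lco (\<kappa> w) = expand_left E (\<lambda>c d q. tensor_lift E (G c) (\<kappa> (ent d q))) (comult C) (\<chi> w)"
proof -
  let ?H = "\<lambda>c d q. tensor_lift E (G c) (\<kappa> (ent d q))"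
  note G' = trilinear_app[OF G] and comult = coalgebraD(2)[OF C]
  have H: "trilinear C C P E ?H" using E by - ((assumption | rule splitting_intros G' | simp)+)
  show ?thesis
  proof (rule can_lin_ext[OF E lin_compose[OF expand_left_lin[OF mC mP mP mP E G lco_lin] \<kappa>_lin]
        lin_compose[OF expand_left_lin[OF mC mC mP mC E H comult] \<chi>_lin] _ w])
    fix x y assume x: "x \<in> carrier P" and y: "y \<in> carrier P"
    have bilG: "bilinear P P E (\<lambda>v q. tensor_lift E (\<lambda>d x'. G d x' q) (lco v))"
      by (rule bilinear_expand_left[OF mC mP mP mP E G lco_lin])
    have "expand_left E G lco (\<kappa> (lmul C x (\<Delta> y))) =
        tensor_lift E (\<lambda>b q. tensor_lift E (\<lambda>d x'. G d x' q) (lco (x \<otimes>\<^bsub>P\<^esub> b))) (s y)"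
      unfolding \<kappa>_lmul_\<Delta>[OF x y] expand_left_def by (rule lift_smul[OF E bilG x y])
    also have "\<dots> = tensor_lift E (\<lambda>b q. tensor_lift E (\<lambda>d x'. G d (x' \<otimes>\<^bsub>P\<^esub> b) q) (lco x)) (s y)"
      using x y
      by (intro lift_cong[OF mB mP E bilinear_base_mult[OF bilG x]])
        (auto simp: lco_base lift_rmul[OF _ E _ trilinearD(2)[OF G]])
    also have "\<dots> = tensor_lift E (\<lambda>d x'. tensor_lift E (\<lambda>b q. G d (x' \<otimes>\<^bsub>P\<^esub> b) q) (s y)) (lco x)"
      using x y by (intro lift_swap[OF mB mP mC mP E])
        (auto intro!: bilinearI G' lin_mult_left lin_mult_base_right)
    also have "\<dots> = tensor_lift E (\<lambda>d x'. tensor_lift E (G d) (smul x' y)) (lco x)"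
    proof (rule lift_cong[OF mC mP E, symmetric])
      show "bilinear C P E (\<lambda>d x'. tensor_lift E (G d) (smul x' y))"
        using bilinearD(2)[OF bilinear_smul y] bilinear_closed[OF bilinear_smul _ y] E
        by (intro bilinearI lin_lift_fun'[where V = P and W = P] lin_compose[OF lift_lin[OF mP mP E trilinearD(1)[OF G]]] G' trilinearD(1)[OF G]) auto
    qed (use x y in \<open>auto simp: lift_smul[OF E trilinearD(1)[OF G]]\<close>)
    also have "\<dots> = tensor_lift E (\<lambda>c q. tensor_lift E (\<lambda>d u. ?H c d (u \<otimes>\<^bsub>P\<^esub> y)) (lco q)) (lco x)"
    proof (rule lift_cong[OF mC mP E, symmetric])
      show "bilinear C P E (\<lambda>c q. tensor_lift E (\<lambda>d u. ?H c d (u \<otimes>\<^bsub>P\<^esub> y)) (lco q))"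
        using y E by - ((assumption | rule splitting_intros G' | simp)+)
      fix c q assume c: "c \<in> carrier C" and q: "q \<in> carrier P"
      let ?k = "\<lambda>t. tensor_lift E (G c) (\<kappa> t)"
      have k: "?k \<in> lin (P \<boxtimes> C) E" by (rule lin_compose[OF lift_lin[OF mP mP E trilinearD(1)[OF G c]] \<kappa>_lin])
      have "tensor_lift E (\<lambda>d u. ?k (ent d (u \<otimes>\<^bsub>P\<^esub> y))) (lco q) = ?k (\<psi> (rmul y (lco q)))"
        by (rule lift_unique[OF mC mP E _ lin_compose[OF k lin_compose[OF \<psi>_lin rmul_lin]]])
          (use y q in \<open>auto simp: \<psi>_pure intro!: bilinearI lin_compose[OF k] lin_ent_left lin_ent_right lin_mult_left\<close>)
      also have "\<dots> = tensor_lift E (G c) (smul q y)"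
        using q y by (simp add: \<psi>_rmul \<psi>_lco ract_pure \<Delta>_ent[symmetric] \<kappa>_lmul_\<Delta>)
      finally show "tensor_lift E (\<lambda>d u. ?H c d (u \<otimes>\<^bsub>P\<^esub> y)) (lco q) = tensor_lift E (G c) (smul q y)" .
    qed (use x in auto)
    also have "\<dots> = expand_left E (\<lambda>c d u. ?H c d (u \<otimes>\<^bsub>P\<^esub> y)) (comult C) (lco x)"
      unfolding expand_right_def[symmetric]
      using x y by (intro lco_coassoc[OF _ E] trilinearI trilinear_app[OF H] lin_mult_left lin_ident) auto
    also have "\<dots> = expand_left E ?H (comult C) (\<chi> (lmul C x (\<Delta> y)))"
      unfolding \<chi>_lmul_\<Delta>[OF x y] expand_left_def
      by (rule lift_rmul[OF lco_closed[OF x] E y bilinear_expand_left[OF mC mC mP mC E H comult], symmetric])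
    finally show "expand_left E G lco (\<kappa> (lmul C x (\<Delta> y))) = expand_left E ?H (comult C) (\<chi> (lmul C x (\<Delta> y)))" .
  qed
qed

text \<open>A lift of the translation map \<open>C \<rightarrow> P \<otimes>\<^sub>B P\<close> to \<open>P \<otimes> P\<close>.\<close>

definition translation :: "'c \<Rightarrow> ('p, 'p) tensor" where "translation c = \<kappa> (pure P C \<one>\<^bsub>P\<^esub> c)"

lemma lin_translation: "f \<in> lin U C \<Longrightarrow> (\<lambda>u. translation (f u)) \<in> lin U PP"
  unfolding translation_def by (intro lin_\<kappa> lin_pure_right) auto

lemma translation_closed [simp, intro]: "c \<in> carrier C \<Longrightarrow> translation c \<in> carrier PP"
  unfolding translation_def by auto

lemma translation_e: "translation e = smul \<one>\<^bsub>P\<^esub> \<one>\<^bsub>P\<^esub>"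
  unfolding translation_def \<Delta>_one[symmetric] by (simp add: \<kappa>_\<Delta>)

lemma translation_right_colinear:
  assumes F: "trilinear P P C E F" and E: "module K E" and c: "c \<in> carrier C"
  shows "expand_right E F \<Delta> (translation c) = tensor_lift E (\<lambda>c d. tensor_lift E (\<lambda>u v. F u v d) (translation c)) (comult C c)"
proof -
  let ?M = "\<lambda>x c d. tensor_lift E (\<lambda>u v. F u v d) (\<kappa> (pure P C x c))"
  note F' = trilinear_app[OF F]
  have M: "trilinear P C C E ?M" using E by - ((assumption | rule splitting_intros F' | simp)+)
  show ?thesis
    using \<kappa>_right_colinear[OF F E, of "pure P C \<one>\<^bsub>P\<^esub> c"] c
      expand_right_pure[OF mP mC mC mC E M coalgebraD(2)[OF C] P.one_closed c]
    by (simp add: translation_def)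
qed

lemma translation_left_colinear:
  assumes G: "trilinear C P P E G" and E: "module K E" and c: "c \<in> carrier C"
  shows "expand_left E G lco (translation c) = tensor_lift E (\<lambda>c d. tensor_lift E (G c) (translation d)) (comult C c)"
proof -
  let ?H = "\<lambda>c d q. tensor_lift E (G c) (\<kappa> (ent d q))"
  note G' = trilinear_app[OF G]
  have H: "trilinear C C P E ?H" using E by - ((assumption | rule splitting_intros G' | simp)+)
  have one: "ent d \<one>\<^bsub>P\<^esub> = pure P C \<one>\<^bsub>P\<^esub> d" if "d \<in> carrier C" for d using that by (simp add: ent_def ract_one)
  have "\<chi> (pure P C \<one>\<^bsub>P\<^esub> c) = pure C P c \<one>\<^bsub>P\<^esub>"
    using \<chi>_\<psi>[of "pure C P c \<one>\<^bsub>P\<^esub>"] c by (simp add: \<psi>_pure one)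
  then have "expand_left E G lco (translation c) = tensor_lift E (\<lambda>c d. ?H c d \<one>\<^bsub>P\<^esub>) (comult C c)"
    using \<kappa>_left_colinear[OF G E, of "pure P C \<one>\<^bsub>P\<^esub> c"] c
      expand_left_pure[OF mC mC mP mC E H coalgebraD(2)[OF C] c P.one_closed]
    by (simp add: translation_def)
  also have "\<dots> = tensor_lift E (\<lambda>c d. tensor_lift E (G c) (translation d)) (comult C c)"
    using c by (intro lift_cong[OF mC mC E trilinearD(2)[OF H P.one_closed]]) (auto simp: one translation_def)
  finally show ?thesis .
qed

lemma lift_mult_translation: "c \<in> carrier C \<Longrightarrow> tensor_lift P (\<lambda>x y. x \<otimes>\<^bsub>P\<^esub> y) (translation c) = counit C c \<odot>\<^bsub>P\<^esub> \<one>\<^bsub>P\<^esub>"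
  unfolding translation_def by (simp add: lift_mult_\<kappa> apply_counit_pure)

end

section \<open>Projections onto the coinvariants\<close>

context principal
begin

text \<open>
  \<open>B\<close> is the kernel of \<open>T: p \<mapsto> \<Delta>(p) - p \<otimes> e\<close>, and \<open>p - u(T(p))\<close> is a projection onto the kernel for every
  generalised inverse \<open>u\<close> of \<open>T\<close>.  As \<open>u(T(p))\<close> depends on \<open>T(p)\<close> only, the projection may be
  inserted wherever \<open>\<Delta>(p)\<close> and \<open>p \<otimes> e\<close> give the same value.
\<close>

lemma projection_exists:
  obtains r u where "r \<in> lin P B" "u \<in> lin (P \<boxtimes> C) P" "\<And>b. b \<in> carrier B \<Longrightarrow> r b = b"
    "\<And>p. p \<in> carrier P \<Longrightarrow> p = r p \<oplus>\<^bsub>P\<^esub> (u (\<Delta> p) \<ominus>\<^bsub>P\<^esub> u (pure P C p e))"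
proof -
  interpret T: module K "P \<boxtimes> C" by (rule mPC)
  let ?D = "\<lambda>p. \<Delta> p \<ominus>\<^bsub>P \<boxtimes> C\<^esub> pure P C p e"
  have D: "?D \<in> lin P (P \<boxtimes> C)" by (intro lin_difference \<Delta>_lin lin_pure_left lin_ident) auto
  obtain u where u: "u \<in> lin (P \<boxtimes> C) P" "\<And>p. p \<in> carrier P \<Longrightarrow> ?D (u (?D p)) = ?D p"
    using generalised_inverse[OF mP mPC D] by blast
  let ?r = "\<lambda>p. p \<ominus>\<^bsub>P\<^esub> u (?D p)"
  have uD: "(\<lambda>p. u (?D p)) \<in> lin P P" by (rule lin_compose[OF u(1) D])
  have r: "?r \<in> lin P P" by (intro lin_difference lin_ident uD mP)
  have base: "b \<in> carrier B \<longleftrightarrow> b \<in> carrier P \<and> ?D b = \<zero>\<^bsub>P \<boxtimes> C\<^esub>" for b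
  proof -
    have "?D b = \<zero>\<^bsub>P \<boxtimes> C\<^esub> \<longleftrightarrow> \<Delta> b = pure P C b e" if "b \<in> carrier P"
    proof -
      have "\<Delta> b \<in> carrier (P \<boxtimes> C)" "pure P C b e \<in> carrier (P \<boxtimes> C)" using that by auto
      then have "\<Delta> b = ?D b \<oplus>\<^bsub>P \<boxtimes> C\<^esub> pure P C b e" by (simp add: T.minus_eq T.a_assoc T.l_neg)
      then show ?thesis using \<open>pure P C b e \<in> _\<close> by (auto simp: T.minus_eq T.r_neg)
    qed
    then show ?thesis by (auto simp: base_iff)
  qed
  have uD_closed: "u (?D p) \<in> carrier P" "?D p \<in> carrier (P \<boxtimes> C)" if "p \<in> carrier P" for p
    using lin_closed[OF uD that] lin_closed[OF D that] by auto
  have "?r p \<in> carrier B" if p: "p \<in> carrier P" for p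
    unfolding base using lin_closed[OF r p] lin_diff[OF mP mPC D p uD_closed(1)[OF p]] u(2)[OF p] uD_closed[OF p]
    by (simp add: T.minus_eq T.r_neg)
  then have "?r \<in> lin P B"
    using lin_add[OF r] lin_smult[OF r] by (intro linI) simp_all
  moreover have "?r b = b" if "b \<in> carrier B" for b
    using that lin_zero[OF mPC mP u(1)] unfolding base by (auto simp: P.minus_eq)
  moreover have "p = ?r p \<oplus>\<^bsub>P\<^esub> (u (\<Delta> p) \<ominus>\<^bsub>P\<^esub> u (pure P C p e))" if p: "p \<in> carrier P" for p
    using p uD_closed[OF p] lin_diff[OF mPC mP u(1) \<Delta>_closed[OF p], of "pure P C p e"]
    by (simp add: P.minus_eq P.a_assoc P.l_neg)
  ultimately show thesis using that u(1) by blast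
qed

end

locale projected_splitting = splitting K C P \<Delta> e s
  for K :: "'k ring" (structure) and C :: "('k, 'c) coalgebra" and P :: "('k, 'p) module" and \<Delta> e s +
  fixes r :: "'p \<Rightarrow> 'p" and u :: "('p, 'c) tensor \<Rightarrow> 'p"
  assumes r_lin: "r \<in> lin P B" and u_lin: "u \<in> lin (P \<boxtimes> C) P"
    and r_base: "\<And>b. b \<in> carrier B \<Longrightarrow> r b = b"
    and r_split: "\<And>p. p \<in> carrier P \<Longrightarrow> p = r p \<oplus>\<^bsub>P\<^esub> (u (\<Delta> p) \<ominus>\<^bsub>P\<^esub> u (pure P C p e))"
begin

lemma r_closed [simp, intro]: "p \<in> carrier P \<Longrightarrow> r p \<in> carrier B" by (rule lin_closed[OF r_lin])

lemma lin_r: "f \<in> lin U P \<Longrightarrow> (\<lambda>x. r (f x)) \<in> lin U B" by (rule lin_compose[OF r_lin])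
lemma lin_r_P: "f \<in> lin U P \<Longrightarrow> (\<lambda>x. r (f x)) \<in> lin U P" by (rule lin_base[OF lin_r])
lemma r_linP: "r \<in> lin P P" by (rule lin_base[OF r_lin])

text \<open>
  A tensor on which \<open>id \<otimes> \<Delta>\<close> and \<open>p \<mapsto> p \<otimes> e\<close> agree lies in \<open>V \<otimes> B\<close>, and applying \<open>r\<close> to its second factor
  does not change it.
\<close>

lemma lift_projection:
  assumes V: "module K V" and E: "module K E" and t: "t \<in> carrier (V \<boxtimes> P)" and f: "bilinear V P E f"
    and eq: "tensor_lift E (\<lambda>x p. f x (u (\<Delta> p))) t = tensor_lift E (\<lambda>x p. f x (u (pure P C p e))) t"
  shows "tensor_lift E (\<lambda>x p. f x (r p)) t = tensor_lift E f t"
proof -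
  interpret E: module K E by fact
  have u\<Delta>: "(\<lambda>p. u (\<Delta> p)) \<in> lin P P" by (rule lin_compose[OF u_lin \<Delta>_lin])
  have ue: "(\<lambda>p. u (pure P C p e)) \<in> lin P P" by (intro lin_compose[OF u_lin] lin_pure_left lin_ident) auto
  note b = bilinear_compose[OF f lin_ident r_linP] bilinear_compose[OF f lin_ident u\<Delta>] bilinear_compose[OF f lin_ident ue]
  note cl = lift_closed[OF V mP E b(1) t] lift_closed[OF V mP E b(2) t]
  have "tensor_lift E (\<lambda>x p. f x p \<oplus>\<^bsub>E\<^esub> f x (u (pure P C p e))) t = tensor_lift E (\<lambda>x p. f x (r p) \<oplus>\<^bsub>E\<^esub> f x (u (\<Delta> p))) t"
  proof (rule lift_cong[OF V mP E _ _ t])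
    show "bilinear V P E (\<lambda>x p. f x p \<oplus>\<^bsub>E\<^esub> f x (u (pure P C p e)))"
      using bilinearD[OF f] bilinearD[OF b(3)] E by (intro bilinearI lin_sum) auto
    fix x p assume x: "x \<in> carrier V" and p: "p \<in> carrier P"
    have in_P: "r p \<in> carrier P" "u (\<Delta> p) \<in> carrier P" "u (pure P C p e) \<in> carrier P"
      using p lin_closed[OF u\<Delta> p] lin_closed[OF ue p] by auto
    have "p \<oplus>\<^bsub>P\<^esub> u (pure P C p e) = r p \<oplus>\<^bsub>P\<^esub> u (\<Delta> p)"
      by (subst r_split[OF p]) (use in_P in \<open>simp add: P.minus_eq P.a_assoc P.l_neg\<close>)
    then show "f x p \<oplus>\<^bsub>E\<^esub> f x (u (pure P C p e)) = f x (r p) \<oplus>\<^bsub>E\<^esub> f x (u (\<Delta> p))"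
      using x p in_P by (simp flip: bilinear_add(2)[OF f])
  qed
  then have "tensor_lift E f t \<oplus>\<^bsub>E\<^esub> tensor_lift E (\<lambda>x p. f x (u (pure P C p e))) t =
      tensor_lift E (\<lambda>x p. f x (r p)) t \<oplus>\<^bsub>E\<^esub> tensor_lift E (\<lambda>x p. f x (u (pure P C p e))) t"
    by (simp add: lift_add_fun[OF V mP E f b(3) t] lift_add_fun[OF V mP E b(1,2) t] eq)
  then show ?thesis
    using cl lift_closed[OF V mP E f t] lift_closed[OF V mP E b(3) t] by (simp add: E.add.r_cancel)
qed

text \<open>By colinearity of \<open>s\<close> and \<open>\<Delta>(1) = 1 \<otimes> e\<close>, the element \<open>s(1)\<close> lies in \<open>B \<otimes> B\<close>.\<close>

lemma lift_s_one:
  assumes E: "module K E" and f: "bilinear B P E f"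
  shows "tensor_lift E (\<lambda>b p. f b (r p)) (s \<one>\<^bsub>P\<^esub>) = tensor_lift E f (s \<one>\<^bsub>P\<^esub>)"
proof (rule lift_projection[OF mB E s_closed[OF P.one_closed] f])
  let ?F = "\<lambda>b q c. f b (u (pure P C q c))"
  have F: "trilinear B P C E ?F"
    by (intro trilinearI bilinear_app_left[OF f] bilinear_app_right[OF f] lin_compose[OF u_lin] lin_pure_left lin_pure_right
        lin_ident) (auto intro: lin_closed[OF u_lin])
  have inner: "tensor_lift E (?F b) (\<Delta> p) = f b (u (\<Delta> p))" if b: "b \<in> carrier B" and p: "p \<in> carrier P" for b p
    by (rule lift_unique[OF mP mC E trilinearD(1)[OF F b] lin_compose[OF bilinearD(1)[OF f b] u_lin] _ \<Delta>_closed[OF p]]) simp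
  have b1: "bilinear B P E (\<lambda>b p. f b (u (\<Delta> p)))" by (rule bilinear_compose[OF f lin_ident lin_compose[OF u_lin \<Delta>_lin]])
  have "tensor_lift E (\<lambda>b p. f b (u (\<Delta> p))) (s \<one>\<^bsub>P\<^esub>) = expand_right E ?F \<Delta> (s \<one>\<^bsub>P\<^esub>)"
    unfolding expand_right_def by (rule lift_cong[OF mB mP E b1]) (auto simp: inner)
  also have "\<dots> = expand_left E ?F s (\<Delta> \<one>\<^bsub>P\<^esub>)" by (rule s_colinear[OF F E P.one_closed])
  also have "\<dots> = tensor_lift E (\<lambda>b p. f b (u (pure P C p e))) (s \<one>\<^bsub>P\<^esub>)"
    unfolding \<Delta>_one by (rule expand_left_pure[OF mB mP mC mP E F s_lin P.one_closed e])
  finally show "tensor_lift E (\<lambda>b p. f b (u (\<Delta> p))) (s \<one>\<^bsub>P\<^esub>) = tensor_lift E (\<lambda>b p. f b (u (pure P C p e))) (s \<one>\<^bsub>P\<^esub>)" .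
qed

section \<open>The splitting on the right\<close>

text \<open>
  The section for the right module structure, before its values are recognised as elements of
  \<open>P \<otimes> B\<close>: it sends \<open>p\<close> to \<open>p\<^sub>-' \<otimes> p\<^sub>-'' p\<^sub>0\<close>.
\<close>

definition s_right where
  "s_right p = tensor_lift PP (\<lambda>c q. tensor_lift PP (\<lambda>x y. pure P P x (y \<otimes>\<^bsub>P\<^esub> q)) (translation c)) (lco p)"

lemma bilinear_translation:
  assumes E: "module K E" and f: "bilinear P P E f"
  shows "bilinear C P E (\<lambda>c q. tensor_lift E (\<lambda>x y. f x (y \<otimes>\<^bsub>P\<^esub> q)) (translation c))"
  using E bilinear_app_left[OF f] bilinear_app_right[OF f]
  by - ((assumption | rule splitting_intros lin_translation translation_closed bilinear_app_left[OF f] bilinear_app_right[OF f] | simp)+)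

lemma s_right_lin: "s_right \<in> lin P PP"
  unfolding s_right_def
  by (rule lin_compose[OF lift_lin[OF mC mP mPP bilinear_translation[OF mPP bilinear_pure[OF mP mP]]] lco_lin])

lemma s_right_closed [simp, intro]: "p \<in> carrier P \<Longrightarrow> s_right p \<in> carrier PP" by (rule lin_closed[OF s_right_lin])

lemma lift_s_right:
  assumes E: "module K E" and f: "bilinear P P E f" and p: "p \<in> carrier P"
  shows "tensor_lift E f (s_right p) = tensor_lift E (\<lambda>c q. tensor_lift E (\<lambda>x y. f x (y \<otimes>\<^bsub>P\<^esub> q)) (translation c)) (lco p)"
proof -
  note tr = bilinear_translation[OF mPP bilinear_pure[OF mP mP]]
  have "tensor_lift E f (s_right p) =
      tensor_lift E (\<lambda>c q. tensor_lift E f (tensor_lift PP (\<lambda>x y. pure P P x (y \<otimes>\<^bsub>P\<^esub> q)) (translation c))) (lco p)"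
    unfolding s_right_def by (rule lift_lift[OF mP mP mC mP E tr f lco_closed[OF p]])
  also have "\<dots> = tensor_lift E (\<lambda>c q. tensor_lift E (\<lambda>x y. f x (y \<otimes>\<^bsub>P\<^esub> q)) (translation c)) (lco p)"
  proof (rule lift_cong[OF mC mP E bilinear_translation[OF E f] _ lco_closed[OF p], symmetric])
    fix c q assume c: "c \<in> carrier C" and q: "q \<in> carrier P"
    have bf: "bilinear P P E (\<lambda>x y. f x (y \<otimes>\<^bsub>P\<^esub> q))"
      by (rule bilinear_compose[OF f lin_ident right_mult_lin[OF q]])
    have bp: "bilinear P P PP (\<lambda>x y. pure P P x (y \<otimes>\<^bsub>P\<^esub> q))"
      by (rule bilinear_compose[OF bilinear_pure[OF mP mP] lin_ident right_mult_lin[OF q]])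
    show "tensor_lift E (\<lambda>x y. f x (y \<otimes>\<^bsub>P\<^esub> q)) (translation c) =
        tensor_lift E f (tensor_lift PP (\<lambda>x y. pure P P x (y \<otimes>\<^bsub>P\<^esub> q)) (translation c))"
      unfolding lift_lift[OF mP mP mP mP E bp f translation_closed[OF c]]
      using q by (intro lift_cong[OF mP mP E bf]) (auto simp: lift_pure[OF mP mP E f] c)
  qed
  finally show ?thesis .
qed

text \<open>
  The values of \<open>s_right\<close> lie in \<open>P \<otimes> B\<close>: since \<open>\<Delta>(y q) = y\<^sub>0 \<psi>(y\<^sub>1 \<otimes> q)\<close>, right colinearity of the
  translation map and coassociativity of the left coaction reduce \<open>\<Delta>\<close> of the second factor to
  \<open>\<psi>(q\<^sub>- \<otimes> q\<^sub>0) = q \<otimes> e\<close>.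
\<close>

lemma lift_s_right_projection:
  assumes E: "module K E" and f: "bilinear P P E f" and p: "p \<in> carrier P"
  shows "tensor_lift E (\<lambda>x v. f x (r v)) (s_right p) = tensor_lift E f (s_right p)"
proof (rule lift_projection[OF mP E s_right_closed[OF p] f])
  have u\<Delta>: "(\<lambda>p. u (\<Delta> p)) \<in> lin P P" by (rule lin_compose[OF u_lin \<Delta>_lin])
  have ue: "(\<lambda>p. u (pure P C p e)) \<in> lin P P" by (intro lin_compose[OF u_lin] lin_pure_left lin_ident) auto
  have f\<Delta>: "bilinear P P E (\<lambda>x v. f x (u (\<Delta> v)))" by (rule bilinear_compose[OF f lin_ident u\<Delta>])
  have fe: "bilinear P P E (\<lambda>x v. f x (u (pure P C v e)))" by (rule bilinear_compose[OF f lin_ident ue])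
  have g: "bilinear P (P \<boxtimes> C) E (\<lambda>x w. f x (u w))" by (rule bilinear_compose[OF f lin_ident u_lin])
  note g' = bilinear_app_left[OF g] bilinear_app_right[OF g]
  let ?F = "\<lambda>q x y c. f x (u (ract q (pure P C y c)))"
  have F: "trilinear P P C E (?F q)" if "q \<in> carrier P" for q
    using that E by - ((assumption | rule splitting_intros g' | simp)+)
  let ?G = "\<lambda>c d q. tensor_lift E (\<lambda>x y. ?F q x y d) (translation c)"
  have G: "trilinear C C P E ?G"
    using E by - ((assumption | rule splitting_intros lin_translation translation_closed g' | simp)+)
  have "tensor_lift E (\<lambda>x v. f x (u (\<Delta> v))) (s_right p) =
      tensor_lift E (\<lambda>c q. tensor_lift E (\<lambda>x y. f x (u (\<Delta> (y \<otimes>\<^bsub>P\<^esub> q)))) (translation c)) (lco p)"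
    by (rule lift_s_right[OF E f\<Delta> p])
  also have "\<dots> = tensor_lift E (\<lambda>c q. tensor_lift E (\<lambda>c d. ?G c d q) (comult C c)) (lco p)"
  proof (rule lift_cong[OF mC mP E bilinear_translation[OF E f\<Delta>] _ lco_closed[OF p]])
    fix c q assume c: "c \<in> carrier C" and q: "q \<in> carrier P"
    have "tensor_lift E (\<lambda>x y. f x (u (\<Delta> (y \<otimes>\<^bsub>P\<^esub> q)))) (translation c) = expand_right E (?F q) \<Delta> (translation c)"
      unfolding expand_right_def
    proof (rule lift_cong[OF mP mP E bilinear_compose[OF f\<Delta> lin_ident right_mult_lin[OF q]] _ translation_closed[OF c]])
      fix x y assume x: "x \<in> carrier P" and y: "y \<in> carrier P"
      have "tensor_lift E (?F q x) (\<Delta> y) = f x (u (ract q (\<Delta> y)))"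
        by (rule lift_unique[OF mP mC E trilinearD(1)[OF F[OF q] x] lin_compose[OF bilinearD(1)[OF g x] ract_lin[OF q]]])
          (use x y q in auto)
      then show "f x (u (\<Delta> (y \<otimes>\<^bsub>P\<^esub> q))) = tensor_lift E (?F q x) (\<Delta> y)" using y q by (simp add: \<Delta>_mult)
    qed
    also have "\<dots> = tensor_lift E (\<lambda>c d. ?G c d q) (comult C c)" by (rule translation_right_colinear[OF F[OF q] E c])
    finally show "tensor_lift E (\<lambda>x y. f x (u (\<Delta> (y \<otimes>\<^bsub>P\<^esub> q)))) (translation c) = tensor_lift E (\<lambda>c d. ?G c d q) (comult C c)" .
  qed
  also have "\<dots> = expand_left E ?G (comult C) (lco p)" by (simp only: expand_left_def)
  also have "\<dots> = expand_right E ?G lco (lco p)" by (rule lco_coassoc[OF G E p, symmetric])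
  also have "\<dots> = tensor_lift E (\<lambda>c q. tensor_lift E (\<lambda>x y. f x (u (pure P C (y \<otimes>\<^bsub>P\<^esub> q) e))) (translation c)) (lco p)"
    unfolding expand_right_def
  proof (rule lift_cong[OF mC mP E bilinear_translation[OF E fe] _ lco_closed[OF p], symmetric])
    fix c q assume c: "c \<in> carrier C" and q: "q \<in> carrier P"
    have "tensor_lift E (?G c) (lco q) =
        tensor_lift E (\<lambda>x y. tensor_lift E (\<lambda>d v. ?F v x y d) (lco q)) (translation c)"
      using q c E by (intro lift_swap[OF mC mP mP mP E]) ((assumption | rule splitting_intros g' | simp)+)
    also have "\<dots> = tensor_lift E (\<lambda>x y. f x (u (pure P C (y \<otimes>\<^bsub>P\<^esub> q) e))) (translation c)"
    proof (rule lift_cong[OF mP mP E bilinear_compose[OF fe lin_ident right_mult_lin[OF q]] _ translation_closed[OF c], symmetric])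
      fix x y assume x: "x \<in> carrier P" and y: "y \<in> carrier P"
      have h: "(\<lambda>t. f x (u (lmul C y (\<psi> t)))) \<in> lin (C \<boxtimes> P) E"
        by (rule lin_compose[OF bilinearD(1)[OF g x] lin_compose[OF lmul_lin[OF mC y] \<psi>_lin]])
      have "tensor_lift E (\<lambda>d v. ?F v x y d) (lco q) = f x (u (lmul C y (\<psi> (lco q))))"
        by (rule lift_unique[OF mC mP E _ h])
          (use x y q in \<open>auto simp: \<psi>_pure ract_pure intro!: bilinearI g' lin_ract_left lin_ract_right lin_pure_right\<close>)
      then show "f x (u (pure P C (y \<otimes>\<^bsub>P\<^esub> q) e)) = tensor_lift E (\<lambda>d v. ?F v x y d) (lco q)"
        using y q by (simp add: \<psi>_lco)
    qed
    finally show "tensor_lift E (\<lambda>x y. f x (u (pure P C (y \<otimes>\<^bsub>P\<^esub> q) e))) (translation c) = tensor_lift E (?G c) (lco q)" ..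
  qed
  also have "\<dots> = tensor_lift E (\<lambda>x v. f x (u (pure P C v e))) (s_right p)" by (rule lift_s_right[OF E fe p, symmetric])
  finally show "tensor_lift E (\<lambda>x v. f x (u (\<Delta> v))) (s_right p) = tensor_lift E (\<lambda>x v. f x (u (pure P C v e))) (s_right p)" .
qed

text \<open>\<open>p\<^sub>-' p\<^sub>-'' p\<^sub>0 = \<epsilon>(p\<^sub>-) p\<^sub>0 = p\<close>.\<close>

lemma mult_s_right:
  assumes p: "p \<in> carrier P"
  shows "tensor_lift P (\<lambda>x y. x \<otimes>\<^bsub>P\<^esub> y) (s_right p) = p"
proof -
  have "tensor_lift P (\<lambda>x y. x \<otimes>\<^bsub>P\<^esub> y) (s_right p) = tensor_lift P (\<lambda>c q. counit C c \<odot>\<^bsub>P\<^esub> q) (lco p)"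
    unfolding lift_s_right[OF mP bilinear_mult p]
  proof (rule lift_cong[OF mC mP mP bilinear_translation[OF mP bilinear_mult] _ lco_closed[OF p]])
    fix c q assume c: "c \<in> carrier C" and q: "q \<in> carrier P"
    have "tensor_lift P (\<lambda>x y. x \<otimes>\<^bsub>P\<^esub> (y \<otimes>\<^bsub>P\<^esub> q)) (translation c) = tensor_lift P (\<lambda>x y. (x \<otimes>\<^bsub>P\<^esub> y) \<otimes>\<^bsub>P\<^esub> q) (translation c)"
      using c q by (intro lift_cong[OF mP mP mP bilinear_compose[OF bilinear_mult lin_ident right_mult_lin[OF q]]])
        (auto simp: P.m_assoc)
    also have "\<dots> = tensor_lift P (\<lambda>x y. x \<otimes>\<^bsub>P\<^esub> y) (translation c) \<otimes>\<^bsub>P\<^esub> q"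
      by (rule hom_lift[OF mP mP mP bilinear_mult mP right_mult_lin[OF q] translation_closed[OF c], symmetric])
    also have "\<dots> = counit C c \<odot>\<^bsub>P\<^esub> q"
      using c q algebraD(3)[OF algebra_P] by (simp add: lift_mult_translation)
    finally show "tensor_lift P (\<lambda>x y. x \<otimes>\<^bsub>P\<^esub> (y \<otimes>\<^bsub>P\<^esub> q)) (translation c) = counit C c \<odot>\<^bsub>P\<^esub> q" .
  qed
  then show ?thesis by (simp add: lco_counit[OF p])
qed

text \<open>The left coaction is right \<open>B\<close>-linear.\<close>

lemma lift_s_right_base:
  assumes E: "module K E" and f: "bilinear P P E f" and p: "p \<in> carrier P" and b: "b \<in> carrier B"
  shows "tensor_lift E f (s_right (p \<otimes>\<^bsub>P\<^esub> b)) = tensor_lift E (\<lambda>x v. f x (v \<otimes>\<^bsub>P\<^esub> b)) (s_right p)"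
proof -
  have fb: "bilinear P P E (\<lambda>x v. f x (v \<otimes>\<^bsub>P\<^esub> b))"
    using b by (intro bilinear_compose[OF f lin_ident right_mult_lin]) auto
  have "tensor_lift E f (s_right (p \<otimes>\<^bsub>P\<^esub> b)) =
      tensor_lift E (\<lambda>c q. tensor_lift E (\<lambda>x y. f x (y \<otimes>\<^bsub>P\<^esub> q)) (translation c)) (rmul b (lco p))"
    using p b by (simp add: lift_s_right[OF E f] lco_base)
  also have "\<dots> = tensor_lift E (\<lambda>c q. tensor_lift E (\<lambda>x y. f x (y \<otimes>\<^bsub>P\<^esub> (q \<otimes>\<^bsub>P\<^esub> b))) (translation c)) (lco p)"
    using p b by (intro lift_rmul[OF _ E _ bilinear_translation[OF E f]]) auto
  also have "\<dots> = tensor_lift E (\<lambda>c q. tensor_lift E (\<lambda>x y. f x ((y \<otimes>\<^bsub>P\<^esub> q) \<otimes>\<^bsub>P\<^esub> b)) (translation c)) (lco p)"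
  proof (rule lift_cong[OF mC mP E bilinear_translation[OF E fb] _ lco_closed[OF p], symmetric])
    fix c q assume c: "c \<in> carrier C" and q: "q \<in> carrier P"
    show "tensor_lift E (\<lambda>x y. f x ((y \<otimes>\<^bsub>P\<^esub> q) \<otimes>\<^bsub>P\<^esub> b)) (translation c) =
        tensor_lift E (\<lambda>x y. f x (y \<otimes>\<^bsub>P\<^esub> (q \<otimes>\<^bsub>P\<^esub> b))) (translation c)"
      using c q b by (intro lift_cong[OF mP mP E bilinear_compose[OF fb lin_ident right_mult_lin[OF q]]])
        (auto simp: P.m_assoc)
  qed
  also have "\<dots> = tensor_lift E (\<lambda>x v. f x (v \<otimes>\<^bsub>P\<^esub> b)) (s_right p)" by (rule lift_s_right[OF E fb p, symmetric])
  finally show ?thesis .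
qed

lemma lift_s_right_one:
  assumes E: "module K E" and f: "bilinear P P E f"
  shows "tensor_lift E f (s_right \<one>\<^bsub>P\<^esub>) = tensor_lift E f (s \<one>\<^bsub>P\<^esub>)"
proof -
  have bt: "bilinear P P E (\<lambda>x y. f x (y \<otimes>\<^bsub>P\<^esub> \<one>\<^bsub>P\<^esub>))"
    by (rule bilinear_compose[OF f lin_ident right_mult_lin[OF P.one_closed]])
  have "tensor_lift E f (s_right \<one>\<^bsub>P\<^esub>) = tensor_lift E (\<lambda>x y. f x (y \<otimes>\<^bsub>P\<^esub> \<one>\<^bsub>P\<^esub>)) (translation e)"
    unfolding lift_s_right[OF E f P.one_closed] lco_one
    by (rule lift_pure[OF mC mP E bilinear_translation[OF E f] e P.one_closed])
  also have "\<dots> = tensor_lift E f (translation e)"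
    by (rule lift_cong[OF mP mP E bt]) auto
  also have "\<dots> = tensor_lift E (\<lambda>b q. f (\<one>\<^bsub>P\<^esub> \<otimes>\<^bsub>P\<^esub> b) q) (s \<one>\<^bsub>P\<^esub>)"
    unfolding translation_e by (rule lift_smul[OF E f P.one_closed P.one_closed])
  also have "\<dots> = tensor_lift E f (s \<one>\<^bsub>P\<^esub>)"
    by (rule lift_cong[OF mB mP E bilinear_base_mult[OF f P.one_closed]]) auto
  finally show ?thesis .
qed

end

context ground_field
begin

lemma left_module_left_reg:
  assumes "ring A"
  shows "left_module A (left_reg A)"
proof -
  interpret A: ring A by fact
  have "abelian_group (left_reg A)"
  proof (rule abelian_groupI)
    show "\<exists>y\<in>carrier (left_reg A). y \<oplus>\<^bsub>left_reg A\<^esub> x = \<zero>\<^bsub>left_reg A\<^esub>" if "x \<in> carrier (left_reg A)" for x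
      using that A.l_neg A.a_inv_closed by (intro bexI[of _ "\<ominus>\<^bsub>A\<^esub> x"]) simp_all
  qed (simp_all add: A.a_ac)
  then show ?thesis
    using assms by (intro left_module.intro left_module_axioms.intro) (simp_all add: A.l_distr A.r_distr A.m_assoc)
qed

lemma scalars_left_reg: "assoc_algebra K A \<Longrightarrow> same_module K (scalars A (left_reg A)) A"
  by (simp add: same_module_def assoc_algebra_scalar(1))

lemma lin_scalars_left_reg:
  assumes "assoc_algebra K A" "f \<in> lin V A"
  shows "f \<in> lin V (scalars A (left_reg A))"
  using assms(2) lin_cong_eq[OF same_module_refl scalars_left_reg[OF assms(1)]] by blast

lemma tensor_lift_left_reg: "tensor_lift (left_reg A) = tensor_lift A"
  and tensor_lift_right_reg: "tensor_lift (right_reg A) = tensor_lift A"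
  by (rule tensor_lift_target_cong; simp)+

lemma lift_tensor_map_id:
  assumes V: "module K V" and C: "module K C" and W: "module K W" and E: "module K E"
    and f: "f \<in> lin V W" and F: "bilinear W C E F" and t: "t \<in> carrier (V \<boxtimes> C)"
  shows "tensor_lift E F (tensor_map K W C f id t) = tensor_lift E (\<lambda>x c. F (f x) c) t"
  using lift_tensor_map[OF W C V C E f id_lin F t] by simp

lemma tensor_map_add:
  assumes "module K V" "module K W" "module K C" "f \<in> lin V W" "g \<in> lin V W" "t \<in> carrier (V \<boxtimes> C)"
  shows "tensor_map K W C (\<lambda>x. f x \<oplus>\<^bsub>W\<^esub> g x) id t = tensor_map K W C f id t \<oplus>\<^bsub>W \<boxtimes> C\<^esub> tensor_map K W C g id t"
proof -
  note bil = bilinear_pure_maps[OF assms(2,3) _ id_lin]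
  have WC: "module K (W \<boxtimes> C)" by (rule module_tensor[OF assms(2,3)])
  have "tensor_map K W C (\<lambda>x. f x \<oplus>\<^bsub>W\<^esub> g x) id t =
      tensor_lift (W \<boxtimes> C) (\<lambda>x c. pure W C (f x) (id c) \<oplus>\<^bsub>W \<boxtimes> C\<^esub> pure W C (g x) (id c)) t"
    unfolding tensor_map_lift
    by (rule lift_cong[OF assms(1,3) WC bil[OF lin_sum[OF assms(2,4,5)]] _ assms(6)])
      (use assms in \<open>simp add: lin_closed bilinear_add(1)[OF bilinear_pure]\<close>)
  also have "\<dots> = tensor_map K W C f id t \<oplus>\<^bsub>W \<boxtimes> C\<^esub> tensor_map K W C g id t"
    unfolding tensor_map_lift by (rule lift_add_fun[OF assms(1,3) WC bil[OF assms(4)] bil[OF assms(5)] assms(6)])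
  finally show ?thesis .
qed

lemma right_comodule_homI:
  "\<lbrakk>f \<in> lin V W; \<And>v. v \<in> carrier V \<Longrightarrow> \<tau> (f v) = tensor_map K W C f id (\<rho> v)\<rbrakk> \<Longrightarrow> f \<in> right_comodule_hom K C V \<rho> W \<tau>"
  by (simp add: right_comodule_hom_def)

lemma right_comodule_homD:
  assumes "f \<in> right_comodule_hom K C V \<rho> W \<tau>"
  shows "f \<in> lin V W" "v \<in> carrier V \<Longrightarrow> \<tau> (f v) = tensor_map K W C f id (\<rho> v)"
  using assms by (simp_all add: right_comodule_hom_def)

lemma tensor_map_compose:
  assumes "module K U" "module K V" "module K W" "module K C" "f \<in> lin U V" "g \<in> lin V W" "t \<in> carrier (U \<boxtimes> C)"
  shows "tensor_map K W C g id (tensor_map K V C f id t) = tensor_map K W C (\<lambda>x. g (f x)) id t"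
  unfolding tensor_map_lift[of W]
  using lift_tensor_map_id[OF assms(1,4,2) module_tensor[OF assms(3,4)] assms(5) bilinear_pure_maps[OF assms(3,4,6) id_lin] assms(7)] .

lemma right_comodule_hom_compose:
  assumes "module K U" "module K V" "module K W" "module K C" "\<mu> \<in> lin U (U \<boxtimes> C)"
    and f: "f \<in> right_comodule_hom K C U \<mu> V \<rho>" and g: "g \<in> right_comodule_hom K C V \<rho> W \<tau>"
  shows "(\<lambda>x. g (f x)) \<in> right_comodule_hom K C U \<mu> W \<tau>"
proof (rule right_comodule_homI[OF lin_compose[OF right_comodule_homD(1)[OF g] right_comodule_homD(1)[OF f]]])
  fix u assume u: "u \<in> carrier U"
  then show "\<tau> (g (f u)) = tensor_map K W C (\<lambda>x. g (f x)) id (\<mu> u)"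
    using tensor_map_compose[OF assms(1-4) right_comodule_homD(1)[OF f] right_comodule_homD(1)[OF g] lin_closed[OF assms(5) u]]
    by (simp add: right_comodule_homD(2)[OF g lin_closed[OF right_comodule_homD(1)[OF f] u]] right_comodule_homD(2)[OF f u])
qed

end

context projected_splitting
begin

lemma submodule_base_reg: "submodule (carrier B) B (left_reg P)" "submodule (carrier B) B (right_reg P)"
  using submodule_base by (simp_all add: submodule_def submodule_axioms_def subgroup_def m_inv_def)

lemma lift_base_eq:
  assumes "module K V" "module K W" "bilinear V W B f" "t \<in> carrier (V \<boxtimes> W)"
  shows "tensor_lift B f t = tensor_lift P f t"
  by (rule hom_lift[OF assms(1,2) mB assms(3) mP lin_base[OF lin_ident] assms(4)])

lemma lift_mult_s: "p \<in> carrier P \<Longrightarrow> tensor_lift P (\<lambda>b q. b \<otimes>\<^bsub>P\<^esub> q) (s p) = p"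
  using s_split by (simp add: mult_BP_def)

lemma bilinear_mult_base: "bilinear B B B (\<lambda>a b. a \<otimes>\<^bsub>P\<^esub> b)"
  using algebraD[OF algebra_B] by (intro bilinearI linI) (auto simp: P.l_distr P.r_distr)

lemma bilinear_mult_r: "bilinear B P B (\<lambda>b x. b \<otimes>\<^bsub>P\<^esub> r x)" "bilinear B P B (\<lambda>b x. r x \<otimes>\<^bsub>P\<^esub> b)"
  "bilinear P P P (\<lambda>x v. x \<otimes>\<^bsub>P\<^esub> r v)" "bilinear P P P (\<lambda>x v. r x \<otimes>\<^bsub>P\<^esub> v)"
  "bilinear P P B (\<lambda>x v. r x \<otimes>\<^bsub>P\<^esub> r v)"
proof -
  show "bilinear B P B (\<lambda>b x. b \<otimes>\<^bsub>P\<^esub> r x)" by (rule bilinear_compose[OF bilinear_mult_base lin_ident r_lin])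
  show "bilinear P P P (\<lambda>x v. x \<otimes>\<^bsub>P\<^esub> r v)" by (rule bilinear_compose[OF bilinear_mult lin_ident r_linP])
  show "bilinear P P P (\<lambda>x v. r x \<otimes>\<^bsub>P\<^esub> v)" by (rule bilinear_compose[OF bilinear_mult r_linP lin_ident])
  show "bilinear P P B (\<lambda>x v. r x \<otimes>\<^bsub>P\<^esub> r v)" by (rule bilinear_compose[OF bilinear_mult_base r_lin r_lin])
  show "bilinear B P B (\<lambda>b x. r x \<otimes>\<^bsub>P\<^esub> b)"
    by (rule bilinearI; rule lin_compose[OF bilinearD(2)[OF bilinear_mult_base] r_lin] bilinearD(1)[OF bilinear_mult_base]) auto
qed

section \<open>Projectivity and faithful flatness\<close>

lemma relatively_projective_left: "relatively_projective K B (left_reg P) P s"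
proof (intro relatively_projective.intro relatively_projective_axioms.intro ground_field_axioms)
  show "assoc_algebra K B" by (rule algebra_B)
  show "left_module B (left_reg P)" by (rule left_module_P)
  show "a \<odot>\<^bsub>P\<^esub> x = (a \<odot>\<^bsub>B\<^esub> \<one>\<^bsub>B\<^esub>) \<odot>\<^bsub>left_reg P\<^esub> x" if "a \<in> carrier K" "x \<in> carrier (left_reg P)" for a x
    using that by (simp add: assoc_algebra_scalar(1)[OF algebra_P])
  show "tensor_lift (left_reg P) (\<lambda>r x. r \<odot>\<^bsub>left_reg P\<^esub> x) (s q) = q" if "q \<in> carrier (left_reg P)" for q
    using that lift_mult_s by (simp add: tensor_lift_left_reg)
  show "s (b \<odot>\<^bsub>left_reg P\<^esub> q) = tensor_map K B P (\<lambda>x. b \<otimes>\<^bsub>B\<^esub> x) id (s q)"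
    if "b \<in> carrier B" "q \<in> carrier (left_reg P)" for b q
    using that s_base by (simp add: bmul_def)
qed (simp_all add: lin_add[OF s_lin])

definition retract_left where "retract_left q = tensor_lift B (\<lambda>b x. b \<otimes>\<^bsub>P\<^esub> r x) (s q)"

lemma retract_left_hom: "retract_left \<in> module_hom B (left_reg P) (left_reg B)"
  using relatively_projective.lift_smult_hom[OF relatively_projective_left
      left_module_left_reg[OF algebraD(2)[OF algebra_B]] lin_scalars_left_reg[OF algebra_B r_lin]]
  by (simp add: tensor_lift_left_reg retract_left_def[abs_def])

text \<open>Since \<open>s(1) \<in> B \<otimes> B\<close>, the projection may be dropped: the value is \<open>s'(1) s''(1) = 1\<close>.\<close>

lemma retract_left_one: "retract_left \<one>\<^bsub>P\<^esub> = \<one>\<^bsub>P\<^esub>"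
  unfolding retract_left_def
    lift_base_eq[OF mB mP bilinear_mult_r(1) s_closed[OF P.one_closed]] lift_s_one[OF mP bilinear_mult_BP]
  by (rule lift_mult_s[OF P.one_closed])

lemma left_projective: "projective_left TYPE('m) TYPE('n) B (left_reg P)"
  by (rule relatively_projective.projective[OF relatively_projective_left])

lemma left_faithfully_flat: "faithfully_flat_left TYPE('l) TYPE('m) TYPE('n) B (left_reg P)"
proof (rule relatively_projective_retraction.faithfully_flat)
  show "relatively_projective_retraction K B (left_reg P) P s retract_left \<one>\<^bsub>P\<^esub>"
    by (rule relatively_projective_retraction.intro[OF relatively_projective_left
          relatively_projective_retraction_axioms.intro]) (simp_all add: retract_left_hom retract_left_one)
qed

lemma left_direct_summand: "direct_summand B (left_reg P) (carrier B)"
proof (rule direct_summand_retraction[OF abelian_reg(1) submodule_base_reg(1)])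
  note hom = retract_left_hom
  have closed: "retract_left x \<in> carrier B" if "x \<in> carrier P" for x
    using add_hom_closed[OF module_hom_add_hom[OF hom]] that by simp
  then show "retract_left x \<in> carrier B" if "x \<in> carrier (left_reg P)" for x using that by simp
  show "retract_left \<in> module_hom B (left_reg P) (left_reg P)"
    using closed add_hom_add[OF module_hom_add_hom[OF hom]] module_hom_smult[OF hom]
    by (intro module_homI) simp_all
  show "retract_left x = x" if "x \<in> carrier B" for x
    using module_hom_smult[OF hom that, of "\<one>\<^bsub>P\<^esub>"] that by (simp add: retract_left_one)
qed (simp_all add: abelian_reg)

abbreviation "Bop \<equiv> opposite B"

lemma same_module_Bop: "same_module K Bop B"
  by (simp add: same_module_def)

text \<open>The tensor product over the field sees only the vector space of the opposite algebra.\<close>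

lemma Bop_tensor: "Bop \<boxtimes> P = BP" "pure Bop P = pure B P" "tensor_map K Bop P = tensor_map K B P"
  by (simp_all add: tensor_space_def tensor_group_cong[OF same_module_Bop same_module_refl])

lemma tensor_lift_Bop: "tensor_lift Bop = tensor_lift B"
  by (rule tensor_lift_target_cong) simp_all

lemma lin_Bop: "lin U Bop = lin U B"
  by (simp add: module_hom_def hom_def)

lemma algebra_Bop: "assoc_algebra K Bop" by (rule assoc_algebra_opposite[OF algebra_B])

lemma right_module_P: "left_module Bop (right_reg P)"
  using algebraD(2)[OF algebra_Bop] abelian_reg(2)
  by (intro left_module.intro left_module_axioms.intro) (simp_all add: P.l_distr P.r_distr P.m_assoc)

lemma bilinear_flip:
  assumes F: "bilinear B P E F"
  shows "bilinear P P E (\<lambda>x v. F (r v) x)"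
  by (rule bilinearI; rule lin_compose[OF bilinearD(2)[OF F] r_lin] bilinearD(1)[OF F]) auto

text \<open>
  The section of \<open>P \<otimes> B \<rightarrow> P\<close>, with factors exchanged as required for modules over the opposite
  algebra and corestricted to \<open>B\<close> by the projection.
\<close>

definition s_op where "s_op p = tensor_lift BP (\<lambda>x v. pure B P (r v) x) (s_right p)"

lemma s_op_lin: "s_op \<in> lin P BP"
  unfolding s_op_def
  by (rule lin_compose[OF lift_lin[OF mP mP mBP bilinear_flip[OF bilinear_pure[OF mB mP]]] s_right_lin])

lemma lift_s_op:
  assumes E: "module K E" and F: "bilinear B P E F" and p: "p \<in> carrier P"
  shows "tensor_lift E F (s_op p) = tensor_lift E (\<lambda>x v. F (r v) x) (s_right p)"
  unfolding s_op_def lift_lift[OF mB mP mP mP E bilinear_flip[OF bilinear_pure[OF mB mP]] F s_right_closed[OF p]]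
  by (rule lift_cong[OF mP mP E bilinear_flip[OF F] _ s_right_closed[OF p], symmetric]) (simp add: lift_pure[OF mB mP E F])

lemma lin_mult_base_left: "b \<in> carrier B \<Longrightarrow> (\<lambda>x. x \<otimes>\<^bsub>P\<^esub> b) \<in> lin B B"
  by (rule bilinearD(2)[OF bilinear_mult_base])

text \<open>
  The projection need not be right \<open>B\<close>-linear, but it may be inserted once more before multiplying by \<open>b\<close>,
  and on products with an element of \<open>B\<close> it is the identity.
\<close>

lemma s_op_base:
  assumes b: "b \<in> carrier B" and p: "p \<in> carrier P"
  shows "s_op (p \<otimes>\<^bsub>P\<^esub> b) = tensor_map K B P (\<lambda>x. x \<otimes>\<^bsub>P\<^esub> b) id (s_op p)"
proof -
  let ?f = "\<lambda>x v. pure B P (r v) x" and ?g = "\<lambda>x v. pure B P (r (v \<otimes>\<^bsub>P\<^esub> b)) x"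
  have bP: "b \<in> carrier P" using b by simp
  have f: "bilinear P P BP ?f" by (rule bilinear_flip[OF bilinear_pure[OF mB mP]])
  have g: "bilinear P P BP ?g" by (rule bilinear_compose[OF f lin_ident right_mult_lin[OF bP]])
  have h: "bilinear B P BP (\<lambda>y x. pure B P (y \<otimes>\<^bsub>P\<^esub> b) x)"
    by (rule bilinear_compose[OF bilinear_pure[OF mB mP] lin_mult_base_left[OF b] lin_ident])
  have "s_op (p \<otimes>\<^bsub>P\<^esub> b) = tensor_lift BP ?g (s_right p)"
    unfolding s_op_def by (rule lift_s_right_base[OF mBP f p b])
  also have "\<dots> = tensor_lift BP (\<lambda>x v. ?g x (r v)) (s_right p)"
    by (rule lift_s_right_projection[OF mBP g p, symmetric])
  also have "\<dots> = tensor_lift BP (\<lambda>x v. pure B P (r v \<otimes>\<^bsub>P\<^esub> b) x) (s_right p)"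
    by (rule lift_cong[OF mP mP mBP bilinear_compose[OF g lin_ident r_linP] _ s_right_closed[OF p]]) (simp add: r_base b)
  also have "\<dots> = tensor_lift BP (\<lambda>y x. pure B P (y \<otimes>\<^bsub>P\<^esub> b) x) (s_op p)" by (rule lift_s_op[OF mBP h p, symmetric])
  finally show ?thesis by (simp add: tensor_map_lift)
qed

lemma relatively_projective_right: "relatively_projective K Bop (right_reg P) P s_op"
proof (intro relatively_projective.intro relatively_projective_axioms.intro ground_field_axioms)
  show "assoc_algebra K Bop" by (rule algebra_Bop)
  show "left_module Bop (right_reg P)" by (rule right_module_P)
  show "a \<odot>\<^bsub>P\<^esub> x = (a \<odot>\<^bsub>Bop\<^esub> \<one>\<^bsub>Bop\<^esub>) \<odot>\<^bsub>right_reg P\<^esub> x" if "a \<in> carrier K" "x \<in> carrier (right_reg P)" for a x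
    using that by (simp add: assoc_algebra_scalar(2)[OF algebra_P])
  show "tensor_lift (right_reg P) (\<lambda>r x. r \<odot>\<^bsub>right_reg P\<^esub> x) (s_op q) = q" if "q \<in> carrier (right_reg P)" for q
  proof -
    have q: "q \<in> carrier P" using that by simp
    have m: "bilinear B P P (\<lambda>b x. x \<otimes>\<^bsub>P\<^esub> b)"
      by (intro bilinearI lin_mult_right lin_mult_left lin_ident lin_base[OF lin_ident]) auto
    show ?thesis
      using lift_s_op[OF mP m q] lift_s_right_projection[OF mP bilinear_mult q] mult_s_right[OF q]
      by (simp add: tensor_lift_right_reg)
  qed
  show "s_op (b \<odot>\<^bsub>right_reg P\<^esub> q) = tensor_map K Bop P (\<lambda>x. b \<otimes>\<^bsub>Bop\<^esub> x) id (s_op q)"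
    if "b \<in> carrier Bop" "q \<in> carrier (right_reg P)" for b q
    using that s_op_base by (simp add: Bop_tensor)
qed (simp_all add: lin_add[OF s_op_lin] lin_closed[OF s_op_lin] Bop_tensor)

definition retract_right where "retract_right q = tensor_lift B (\<lambda>b x. r x \<otimes>\<^bsub>P\<^esub> b) (s_op q)"

lemma retract_right_hom: "retract_right \<in> module_hom B (right_reg P) (left_reg Bop)"
  using relatively_projective.lift_smult_hom[OF relatively_projective_right
      left_module_left_reg[OF algebraD(2)[OF algebra_Bop]] lin_scalars_left_reg[OF algebra_Bop, of r P]] r_lin
  by (simp add: tensor_lift_left_reg tensor_lift_Bop retract_right_def[abs_def] lin_Bop)

text \<open>\<open>s_right(1) = s(1)\<close> lies in \<open>B \<otimes> B\<close>.\<close>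

lemma retract_right_one: "retract_right \<one>\<^bsub>P\<^esub> = \<one>\<^bsub>P\<^esub>"
proof -
  note one = s_right_closed[OF P.one_closed]
  have "retract_right \<one>\<^bsub>P\<^esub> = tensor_lift B (\<lambda>x v. r x \<otimes>\<^bsub>P\<^esub> r v) (s_right \<one>\<^bsub>P\<^esub>)"
    unfolding retract_right_def by (rule lift_s_op[OF mB bilinear_mult_r(2) P.one_closed])
  also have "\<dots> = tensor_lift P (\<lambda>x v. r x \<otimes>\<^bsub>P\<^esub> v) (s_right \<one>\<^bsub>P\<^esub>)"
    unfolding lift_base_eq[OF mP mP bilinear_mult_r(5) one]
    by (rule lift_s_right_projection[OF mP bilinear_mult_r(4) P.one_closed])
  also have "\<dots> = tensor_lift P (\<lambda>x v. r x \<otimes>\<^bsub>P\<^esub> v) (s \<one>\<^bsub>P\<^esub>)" by (rule lift_s_right_one[OF mP bilinear_mult_r(4)])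
  also have "\<dots> = tensor_lift P (\<lambda>b v. b \<otimes>\<^bsub>P\<^esub> v) (s \<one>\<^bsub>P\<^esub>)"
    by (rule lift_cong[OF mB mP mP bilinear_mult_BP, symmetric]) (auto simp: r_base)
  finally show ?thesis by (simp add: lift_mult_s)
qed

lemma right_projective: "projective_right TYPE('m) TYPE('n) B (right_reg P)"
  unfolding projective_right_def by (rule relatively_projective.projective[OF relatively_projective_right])

lemma right_faithfully_flat: "faithfully_flat_right TYPE('l) TYPE('m) TYPE('n) B (right_reg P)"
proof (rule faithfully_flat_right_opposite[OF relatively_projective_retraction.faithfully_flat])
  show "relatively_projective_retraction K Bop (right_reg P) P s_op retract_right \<one>\<^bsub>P\<^esub>"
    by (rule relatively_projective_retraction.intro[OF relatively_projective_right
          relatively_projective_retraction_axioms.intro]) (simp_all add: retract_right_hom retract_right_one)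
qed

lemma right_direct_summand: "direct_summand B (right_reg P) (carrier B)"
proof (rule direct_summand_retraction[OF abelian_reg(2) submodule_base_reg(2)])
  note hom = retract_right_hom
  have closed: "retract_right x \<in> carrier B" if "x \<in> carrier P" for x
    using add_hom_closed[OF module_hom_add_hom[OF hom]] that by simp
  then show "retract_right x \<in> carrier B" if "x \<in> carrier (right_reg P)" for x using that by simp
  show "retract_right \<in> module_hom B (right_reg P) (right_reg P)"
    using closed add_hom_add[OF module_hom_add_hom[OF hom]] module_hom_smult[OF hom]
    by (intro module_homI) simp_all
  show "retract_right x = x" if "x \<in> carrier B" for x
    using module_hom_smult[OF hom that, of "\<one>\<^bsub>P\<^esub>"] that by (simp add: retract_right_one)
qed (simp_all add: abelian_reg)

section \<open>Coflatness\<close>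

lemma coact_retraction_lin: "(\<lambda>w. tensor_lift P (\<lambda>x y. r x \<otimes>\<^bsub>P\<^esub> y) (\<kappa> w)) \<in> lin (P \<boxtimes> C) P"
  by (rule lin_compose[OF lift_lin[OF mP mP mP bilinear_mult_r(4)] \<kappa>_lin])

text \<open>The left inverse of \<open>\<Delta>\<close>: it maps \<open>p \<otimes> c\<close> to \<open>r(x) y\<close>, where \<open>x \<otimes> y\<close> stands for \<open>\<kappa>(p \<otimes> c)\<close>.\<close>

definition coact_retraction where "coact_retraction p c = tensor_lift P (\<lambda>x y. r x \<otimes>\<^bsub>P\<^esub> y) (\<kappa> (pure P C p c))"

lemma bilinear_coact_retraction: "bilinear P C P coact_retraction"
  unfolding coact_retraction_def by (rule bilinear_hom[OF bilinear_pure[OF mP mC] coact_retraction_lin])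

text \<open>\<open>\<kappa>(\<Delta>(p)) = s(p)\<close> lies in \<open>B \<otimes> P\<close>, where \<open>r\<close> is the identity.\<close>

lemma coact_retraction_split:
  assumes p: "p \<in> carrier P"
  shows "tensor_lift P coact_retraction (\<Delta> p) = p"
proof -
  have "tensor_lift P coact_retraction (\<Delta> p) = tensor_lift P (\<lambda>x y. r x \<otimes>\<^bsub>P\<^esub> y) (\<kappa> (\<Delta> p))"
    by (rule lift_unique[OF mP mC mP bilinear_coact_retraction coact_retraction_lin]) (use p in \<open>auto simp: coact_retraction_def\<close>)
  also have "\<dots> = tensor_lift P (\<lambda>b q. r (\<one>\<^bsub>P\<^esub> \<otimes>\<^bsub>P\<^esub> b) \<otimes>\<^bsub>P\<^esub> q) (s p)"
    unfolding \<kappa>_\<Delta>[OF p] by (rule lift_smul[OF mP bilinear_mult_r(4) P.one_closed p])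
  also have "\<dots> = tensor_lift P (\<lambda>b q. b \<otimes>\<^bsub>P\<^esub> q) (s p)"
    using p by (intro lift_cong[OF mB mP mP bilinear_mult_BP, symmetric]) (auto simp: r_base)
  finally show ?thesis by (simp add: lift_mult_s p)
qed

text \<open>Right colinearity of \<open>\<kappa>\<close> suffices, as \<open>\<Delta>(r(x) y) = r(x) \<Delta>(y)\<close>.\<close>

lemma coact_retraction_colinear:
  assumes p: "p \<in> carrier P" and c: "c \<in> carrier C"
  shows "\<Delta> (coact_retraction p c) = tensor_lift (P \<boxtimes> C) (\<lambda>x y. pure P C (coact_retraction p x) y) (comult C c)"
proof -
  let ?F = "\<lambda>x y d. pure P C (r x \<otimes>\<^bsub>P\<^esub> y) d"
  let ?M = "\<lambda>x c d. tensor_lift (P \<boxtimes> C) (\<lambda>u v. ?F u v d) (\<kappa> (pure P C x c))"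
  note f' = bilinear_app_left[OF bilinear_mult_r(4)] bilinear_app_right[OF bilinear_mult_r(4)]
  have F: "trilinear P P C (P \<boxtimes> C) ?F"
    by - ((assumption | rule splitting_intros f' lin_r_P | simp)+)
  note F' = trilinear_app[OF F]
  have M: "trilinear P C C (P \<boxtimes> C) ?M" by - ((assumption | rule splitting_intros F' | simp)+)
  have w: "\<kappa> (pure P C p c) \<in> carrier PP" using p c by auto
  have "\<Delta> (coact_retraction p c) = tensor_lift (P \<boxtimes> C) (\<lambda>x y. \<Delta> (r x \<otimes>\<^bsub>P\<^esub> y)) (\<kappa> (pure P C p c))"
    unfolding coact_retraction_def by (rule hom_lift[OF mP mP mP bilinear_mult_r(4) mPC \<Delta>_lin w])
  also have "\<dots> = expand_right (P \<boxtimes> C) ?F \<Delta> (\<kappa> (pure P C p c))"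
    unfolding expand_right_def
    by (rule lift_cong[OF mP mP mPC bilinear_hom[OF bilinear_mult_r(4) \<Delta>_lin] _ w])
      (simp add: \<Delta>_base lmul_def tensor_map_lift)
  also have "\<dots> = expand_right (P \<boxtimes> C) ?M (comult C) (pure P C p c)"
    using p c by (intro \<kappa>_right_colinear[OF F mPC]) auto
  also have "\<dots> = tensor_lift (P \<boxtimes> C) (?M p) (comult C c)"
    by (rule expand_right_pure[OF mP mC mC mC mPC M coalgebraD(2)[OF C] p c])
  also have "\<dots> = tensor_lift (P \<boxtimes> C) (\<lambda>x y. pure P C (coact_retraction p x) y) (comult C c)"
    unfolding coact_retraction_def
    using p c by (intro lift_cong[OF mC mC mPC trilinearD(1)[OF M p]])
      (auto intro!: hom_lift[OF mP mP mP bilinear_mult_r(4) mPC, symmetric] lin_pure_left lin_ident)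
  finally show ?thesis .
qed

lemma right_coflat: "coflat_right TYPE('l) TYPE('m) TYPE('n) K C P \<Delta>"
proof (rule relatively_injective_right.coflat)
  show "relatively_injective_right K C P \<Delta> coact_retraction"
    by (rule relatively_injective_right.intro[OF ground_field_axioms relatively_injective_right_axioms.intro[OF C comodule_P
            bilinear_coact_retraction coact_retraction_split coact_retraction_colinear]])
qed

text \<open>
  The left inverse of the left coaction.  The projection is applied to the second factor because the
  left coaction is right \<open>B\<close>-linear.
\<close>

definition lco_retraction where "lco_retraction c p = tensor_lift P (\<lambda>x y. x \<otimes>\<^bsub>P\<^esub> r (y \<otimes>\<^bsub>P\<^esub> p)) (translation c)"

lemma bilinear_lco_retraction: "bilinear C P P lco_retraction"
  unfolding lco_retraction_def by (rule bilinear_translation[OF mP bilinear_mult_r(3)])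

text \<open>On \<open>p\<^sub>- \<otimes> p\<^sub>0\<close> the value is the product of the factors of \<open>s_right(p)\<close>, the second of which lies in \<open>B\<close>.\<close>

lemma lco_retraction_split:
  assumes p: "p \<in> carrier P"
  shows "tensor_lift P lco_retraction (lco p) = p"
  using lift_s_right[OF mP bilinear_mult_r(3) p] lift_s_right_projection[OF mP bilinear_mult p] mult_s_right[OF p]
  by (simp add: lco_retraction_def[abs_def])

text \<open>Left colinearity of the translation map suffices, as the left coaction is right \<open>B\<close>-linear.\<close>

lemma lco_retraction_colinear:
  assumes c: "c \<in> carrier C" and p: "p \<in> carrier P"
  shows "lco (lco_retraction c p) = tensor_lift (C \<boxtimes> P) (\<lambda>x y. pure C P x (lco_retraction y p)) (comult C c)"
proof -
  let ?f = "\<lambda>x y. x \<otimes>\<^bsub>P\<^esub> r (y \<otimes>\<^bsub>P\<^esub> p)"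
  let ?G = "\<lambda>d x y. pure C P d (?f x y)"
  have CP: "module K (C \<boxtimes> P)" by (rule module_tensor) auto
  have f: "bilinear P P P ?f" by (rule bilinear_compose[OF bilinear_mult_r(3) lin_ident right_mult_lin[OF p]])
  note f' = bilinear_app_left[OF bilinear_mult_r(3)] bilinear_app_right[OF bilinear_mult_r(3)]
  have G: "trilinear C P P (C \<boxtimes> P) ?G"
    using p by - ((assumption | rule splitting_intros f' lin_r_P | simp)+)
  note t = translation_closed[OF c]
  have "lco (lco_retraction c p) = tensor_lift (C \<boxtimes> P) (\<lambda>x y. lco (?f x y)) (translation c)"
    unfolding lco_retraction_def by (rule hom_lift[OF mP mP mP f CP lco_lin t])
  also have "\<dots> = expand_left (C \<boxtimes> P) ?G lco (translation c)"
    unfolding expand_left_def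
    by (rule lift_cong[OF mP mP CP bilinear_hom[OF f lco_lin] _ t])
      (simp add: p lco_base rmul_def tensor_map_lift)
  also have "\<dots> = tensor_lift (C \<boxtimes> P) (\<lambda>c d. tensor_lift (C \<boxtimes> P) (?G c) (translation d)) (comult C c)"
    by (rule translation_left_colinear[OF G CP c])
  also have "\<dots> = tensor_lift (C \<boxtimes> P) (\<lambda>x y. pure C P x (lco_retraction y p)) (comult C c)"
  proof (rule lift_cong[OF mC mC CP _ _ comult_closed[OF c], symmetric])
    show "bilinear C C (C \<boxtimes> P) (\<lambda>x y. pure C P x (lco_retraction y p))"
      by (rule bilinear_compose[OF bilinear_pure[OF mC mP] lin_ident bilinearD(2)[OF bilinear_lco_retraction p]])
    show "pure C P x (lco_retraction y p) = tensor_lift (C \<boxtimes> P) (?G x) (translation y)"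
      if "x \<in> carrier C" "y \<in> carrier C" for x y
      unfolding lco_retraction_def using that
      by (intro hom_lift[OF mP mP mP f CP] lin_pure_right lin_ident) auto
  qed
  finally show ?thesis .
qed

lemma left_coflat: "coflat_left TYPE('l) TYPE('m) TYPE('n) K C P (left_coaction K C P \<Delta> e)"
  unfolding left_coaction_lco
proof (rule relatively_injective_left.coflat)
  show "relatively_injective_left K C P lco lco_retraction"
    by (rule relatively_injective_left.intro[OF ground_field_axioms relatively_injective_left_axioms.intro[OF C left_comodule_P
            bilinear_lco_retraction lco_retraction_split lco_retraction_colinear]])
qed

section \<open>Strong connections\<close>

lemma coact_retraction_closed: "\<lbrakk>p \<in> carrier P; c \<in> carrier C\<rbrakk> \<Longrightarrow> coact_retraction p c \<in> carrier P"
  by (rule bilinear_closed[OF bilinear_coact_retraction])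

lemma lin_coact_retraction: "(\<lambda>c. coact_retraction \<one>\<^bsub>P\<^esub> c) \<in> lin C P"
  by (rule bilinearD(1)[OF bilinear_coact_retraction P.one_closed])

lemma coact_retraction_one: "coact_retraction \<one>\<^bsub>P\<^esub> e = \<one>\<^bsub>P\<^esub>"
  using coact_retraction_split[OF P.one_closed] lift_pure[OF mP mC mP bilinear_coact_retraction P.one_closed e] by (simp add: \<Delta>_one)

lemma bilinear_projected_expansion: "bilinear P C BP (\<lambda>x c. pure B P (r x) (coact_retraction \<one>\<^bsub>P\<^esub> c))"
  by (rule bilinear_compose[OF bilinear_pure[OF mB mP] r_lin lin_coact_retraction])

text \<open>\<open>q \<mapsto> r(q\<^sub>0) \<otimes> j(q\<^sub>1)\<close>, where \<open>j\<close> is the colinear map \<open>coact_retraction 1\<close> from \<open>C\<close> to \<open>P\<close>.\<close>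

definition projected_expansion where "projected_expansion p = tensor_lift BP (\<lambda>x c. pure B P (r x) (coact_retraction \<one>\<^bsub>P\<^esub> c)) (\<Delta> p)"

lemma projected_expansion_lin: "projected_expansion \<in> lin P BP"
  unfolding projected_expansion_def by (rule lin_compose[OF lift_lin[OF mP mC mBP bilinear_projected_expansion] \<Delta>_lin])

lemma projected_expansion_colinear: "projected_expansion \<in> right_comodule_hom K C P \<Delta> BP BP_coact"
proof (rule right_comodule_homI[OF projected_expansion_lin])
  fix p assume p: "p \<in> carrier P"
  let ?F = "\<lambda>x c d. pure BP C (pure B P (r x) (coact_retraction \<one>\<^bsub>P\<^esub> c)) d"
  note comult = coalgebraD(2)[OF C]
  have F: "trilinear P C C (BP \<boxtimes> C) ?F"
  proof (rule trilinearI)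
    note g = bilinear_compose[OF bilinear_pure[OF mBP mC] _ lin_ident]
    show "(\<lambda>x. ?F x c d) \<in> lin P (BP \<boxtimes> C)" if c: "c \<in> carrier C" and d: "d \<in> carrier C" for c d
      by (rule bilinearD(2)[OF g[OF bilinearD(2)[OF bilinear_projected_expansion c]] d])
    show "(\<lambda>c. ?F x c d) \<in> lin C (BP \<boxtimes> C)" if x: "x \<in> carrier P" and d: "d \<in> carrier C" for x d
      by (rule bilinearD(2)[OF g[OF bilinearD(1)[OF bilinear_projected_expansion x]] d])
    show "(\<lambda>d. ?F x c d) \<in> lin C (BP \<boxtimes> C)" if x: "x \<in> carrier P" and c: "c \<in> carrier C" for x c
      by (rule bilinearD(1)[OF g[OF bilinearD(1)[OF bilinear_projected_expansion x]] c])
  qed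
  have "BP_coact (projected_expansion p) = tensor_lift (BP \<boxtimes> C) (\<lambda>x c. BP_coact (pure B P (r x) (coact_retraction \<one>\<^bsub>P\<^esub> c))) (\<Delta> p)"
    unfolding projected_expansion_def by (rule hom_lift[OF mP mC mBP bilinear_projected_expansion mBPC BP_coact_lin \<Delta>_closed[OF p]])
  also have "\<dots> = expand_right (BP \<boxtimes> C) ?F (comult C) (\<Delta> p)"
    unfolding expand_right_def
  proof (rule lift_cong[OF mP mC mBPC bilinear_hom[OF bilinear_projected_expansion BP_coact_lin] _ \<Delta>_closed[OF p]])
    fix x c assume x: "x \<in> carrier P" and c: "c \<in> carrier C"
    have h: "tensor_lift (BP \<boxtimes> C) (pureBPC (r x)) \<in> lin (P \<boxtimes> C) (BP \<boxtimes> C)"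
      by (rule lift_lin[OF mP mC mBPC trilinearD(1)[OF trilinear_pureBPC r_closed[OF x]]])
    have b: "bilinear C C (P \<boxtimes> C) (\<lambda>y d. pure P C (coact_retraction \<one>\<^bsub>P\<^esub> y) d)"
      by (rule bilinear_compose[OF bilinear_pure[OF mP mC] lin_coact_retraction lin_ident])
    have "BP_coact (pure B P (r x) (coact_retraction \<one>\<^bsub>P\<^esub> c)) =
        tensor_lift (BP \<boxtimes> C) (pureBPC (r x)) (tensor_lift (P \<boxtimes> C) (\<lambda>y d. pure P C (coact_retraction \<one>\<^bsub>P\<^esub> y) d) (comult C c))"
      using x c by (simp add: BP_coact_pure coact_retraction_closed coact_retraction_colinear)
    also have "\<dots> = tensor_lift (BP \<boxtimes> C)
        (\<lambda>y d. tensor_lift (BP \<boxtimes> C) (pureBPC (r x)) (pure P C (coact_retraction \<one>\<^bsub>P\<^esub> y) d)) (comult C c)"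
      by (rule hom_lift[OF mC mC mPC b mBPC h comult_closed[OF c]])
    also have "\<dots> = tensor_lift (BP \<boxtimes> C) (?F x) (comult C c)"
      using x c
      by (intro lift_cong[OF mC mC mBPC trilinearD(1)[OF F x], symmetric])
        (auto simp: lift_pure[OF mP mC mBPC trilinearD(1)[OF trilinear_pureBPC]] coact_retraction_closed)
    finally show "BP_coact (pure B P (r x) (coact_retraction \<one>\<^bsub>P\<^esub> c)) = tensor_lift (BP \<boxtimes> C) (?F x) (comult C c)" .
  qed
  also have "\<dots> = expand_left (BP \<boxtimes> C) ?F \<Delta> (\<Delta> p)" by (rule \<Delta>_coassoc[OF F mBPC p])
  also have "\<dots> = tensor_map K BP C projected_expansion id (\<Delta> p)"
    unfolding expand_left_def tensor_map_lift
  proof (rule lift_cong[OF mP mC mBPC _ _ \<Delta>_closed[OF p], symmetric])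
    show "bilinear P C (BP \<boxtimes> C) (\<lambda>x c. pure BP C (projected_expansion x) (id c))"
      by (rule bilinear_pure_maps[OF mBP mC projected_expansion_lin id_lin])
    show "pure BP C (projected_expansion x) (id d) = tensor_lift (BP \<boxtimes> C) (\<lambda>y c. ?F y c d) (\<Delta> x)"
      if "x \<in> carrier P" "d \<in> carrier C" for x d
      unfolding projected_expansion_def id_apply
      by (rule hom_lift[OF mP mC mBP bilinear_projected_expansion mBPC lin_pure_left[OF mBP mC lin_ident that(2)] \<Delta>_closed[OF that(1)]])
  qed
  finally show "BP_coact (projected_expansion p) = tensor_map K BP C projected_expansion id (\<Delta> p)" .
qed

text \<open>
  The second summand corrects the first to a section of the multiplication.  It vanishes on \<open>B\<close>, so the
  value at \<open>b \<in> B\<close> is \<open>b \<otimes> 1\<close>.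
\<close>

definition normalised where
  "normalised p = projected_expansion p \<oplus>\<^bsub>BP\<^esub> pure B P \<one>\<^bsub>P\<^esub> (p \<ominus>\<^bsub>P\<^esub> mult_BP (projected_expansion p))"

lemma mult_projected_expansion_lin: "(\<lambda>p. mult_BP (projected_expansion p)) \<in> lin P P" by (rule lin_compose[OF mult_BP_lin projected_expansion_lin])

lemma defect_lin: "(\<lambda>p. p \<ominus>\<^bsub>P\<^esub> mult_BP (projected_expansion p)) \<in> lin P P"
  by (rule lin_difference[OF mP lin_ident mult_projected_expansion_lin])

lemma unit_lin: "(\<lambda>p. pure B P \<one>\<^bsub>P\<^esub> p) \<in> lin P BP"
  by (rule lin_pure_right[OF mB mP lin_ident one_base])

lemma normalised_lin: "normalised \<in> lin P BP"
  unfolding normalised_def by (rule lin_sum[OF mBP projected_expansion_lin lin_compose[OF unit_lin defect_lin]])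

lemma unit_colinear: "(\<lambda>p. pure B P \<one>\<^bsub>P\<^esub> p) \<in> right_comodule_hom K C P \<Delta> BP BP_coact"
  by (rule right_comodule_homI[OF unit_lin]) (simp add: BP_coact_pure tensor_map_lift)

text \<open>The identity is the sum of this map and a colinear map, and tensor maps are additive.\<close>

lemma defect_colinear: "(\<lambda>p. p \<ominus>\<^bsub>P\<^esub> mult_BP (projected_expansion p)) \<in> right_comodule_hom K C P \<Delta> P \<Delta>"
proof (rule right_comodule_homI[OF defect_lin])
  interpret T: module K "P \<boxtimes> C" by (rule mPC)
  fix p assume p: "p \<in> carrier P"
  let ?m = "\<lambda>p. mult_BP (projected_expansion p)" and ?d = "\<lambda>p. p \<ominus>\<^bsub>P\<^esub> mult_BP (projected_expansion p)"
  have closed: "?m p \<in> carrier P" "?d p \<in> carrier P" if "p \<in> carrier P" for p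
    using lin_closed[OF mult_projected_expansion_lin that] lin_closed[OF defect_lin that] by auto
  have sum: "?d q \<oplus>\<^bsub>P\<^esub> ?m q = q" if "q \<in> carrier P" for q
    using that closed(1)[OF that] by (simp add: P.minus_eq P.a_assoc P.l_neg)
  have "mult_BP \<in> right_comodule_hom K C BP BP_coact P \<Delta>"
    by (rule right_comodule_homI[OF mult_BP_lin]) (rule \<Delta>_mult_BP)
  then have m: "?m \<in> right_comodule_hom K C P \<Delta> P \<Delta>"
    by (rule right_comodule_hom_compose[OF mP mBP mP mC \<Delta>_lin projected_expansion_colinear])
  have "\<Delta> (?d p) \<oplus>\<^bsub>P \<boxtimes> C\<^esub> \<Delta> (?m p) = \<Delta> p"
    using lin_add[OF \<Delta>_lin closed(2)[OF p] closed(1)[OF p]] sum[OF p] by simp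
  also have "\<dots> = tensor_lift (P \<boxtimes> C) (pure P C) (\<Delta> p)"
    by (rule lift_pure_id[OF mP mC \<Delta>_closed[OF p], symmetric])
  also have "\<dots> = tensor_map K P C (\<lambda>q. ?d q \<oplus>\<^bsub>P\<^esub> ?m q) id (\<Delta> p)"
    unfolding tensor_map_lift
    by (rule lift_cong[OF mP mC mPC bilinear_pure[OF mP mC] _ \<Delta>_closed[OF p]]) (simp add: sum)
  also have "\<dots> = tensor_map K P C ?d id (\<Delta> p) \<oplus>\<^bsub>P \<boxtimes> C\<^esub> tensor_map K P C ?m id (\<Delta> p)"
    by (rule tensor_map_add[OF mP mP mC defect_lin mult_projected_expansion_lin \<Delta>_closed[OF p]])
  also have "tensor_map K P C ?m id (\<Delta> p) = \<Delta> (?m p)" by (rule right_comodule_homD(2)[OF m p, symmetric])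
  finally have "\<Delta> (?d p) \<oplus>\<^bsub>P \<boxtimes> C\<^esub> \<Delta> (?m p) = tensor_map K P C ?d id (\<Delta> p) \<oplus>\<^bsub>P \<boxtimes> C\<^esub> \<Delta> (?m p)" .
  then show "\<Delta> (?d p) = tensor_map K P C ?d id (\<Delta> p)"
    using \<Delta>_closed[OF closed(1)[OF p]] \<Delta>_closed[OF closed(2)[OF p]]
      lin_closed[OF tensor_map_lin[OF mP mC mP mC defect_lin id_lin] \<Delta>_closed[OF p]]
    by (simp only: T.add.r_cancel)
qed

lemma normalised_colinear: "normalised \<in> right_comodule_hom K C P \<Delta> BP BP_coact"
proof (rule right_comodule_homI[OF normalised_lin])
  note unit = right_comodule_hom_compose[OF mP mP mBP mC \<Delta>_lin defect_colinear unit_colinear]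
  fix p assume p: "p \<in> carrier P"
  have "BP_coact (normalised p) =
      BP_coact (projected_expansion p) \<oplus>\<^bsub>BP \<boxtimes> C\<^esub> BP_coact (pure B P \<one>\<^bsub>P\<^esub> (p \<ominus>\<^bsub>P\<^esub> mult_BP (projected_expansion p)))"
    unfolding normalised_def
    by (rule lin_add[OF BP_coact_lin lin_closed[OF projected_expansion_lin p] lin_closed[OF lin_compose[OF unit_lin defect_lin] p]])
  also have "\<dots> = tensor_map K BP C normalised id (\<Delta> p)"
    unfolding right_comodule_homD(2)[OF projected_expansion_colinear p] right_comodule_homD(2)[OF unit p] normalised_def[abs_def]
    by (rule tensor_map_add[OF mP mBP mC projected_expansion_lin lin_compose[OF unit_lin defect_lin] \<Delta>_closed[OF p], symmetric])
  finally show "BP_coact (normalised p) = tensor_map K BP C normalised id (\<Delta> p)" .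
qed

lemma mult_normalised:
  assumes p: "p \<in> carrier P"
  shows "mult_BP (normalised p) = p"
proof -
  have closed: "projected_expansion p \<in> carrier BP" "mult_BP (projected_expansion p) \<in> carrier P" "p \<ominus>\<^bsub>P\<^esub> mult_BP (projected_expansion p) \<in> carrier P"
    using lin_closed[OF projected_expansion_lin p] lin_closed[OF mult_projected_expansion_lin p] lin_closed[OF defect_lin p] by auto
  then have "mult_BP (normalised p) = mult_BP (projected_expansion p) \<oplus>\<^bsub>P\<^esub> (p \<ominus>\<^bsub>P\<^esub> mult_BP (projected_expansion p))"
    unfolding normalised_def using lin_add[OF mult_BP_lin closed(1) lin_closed[OF unit_lin closed(3)]] by simp
  then show ?thesis using closed p by (simp add: P.minus_eq P.a_ac P.r_neg)
qed

lemma normalised_base: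
  assumes b: "b \<in> carrier B"
  shows "normalised b = pure B P b \<one>\<^bsub>P\<^esub>"
proof -
  interpret T: module K BP by (rule mBP)
  have bP: "b \<in> carrier P" using b by simp
  have projected_expansion: "projected_expansion b = pure B P b \<one>\<^bsub>P\<^esub>"
    using b bP base_iff[of b] lift_pure[OF mP mC mBP bilinear_projected_expansion bP e]
    by (simp add: projected_expansion_def r_base coact_retraction_one)
  have "pure B P \<one>\<^bsub>P\<^esub> \<zero>\<^bsub>P\<^esub> = \<zero>\<^bsub>BP\<^esub>" by (rule lin_zero[OF mP mBP unit_lin])
  then show ?thesis unfolding normalised_def projected_expansion using b bP by (simp add: P.minus_eq P.r_neg)
qed

text \<open>
  The \<open>B\<close>-linear extension \<open>b \<otimes> q \<mapsto> b \<theta>(q)\<close> of \<open>\<theta> =\<close> \<open>normalised\<close>; composing it with \<open>s\<close> gives a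
  \<open>B\<close>-linear colinear section, as \<open>\<theta>\<close> is a colinear section.
\<close>

definition extend_normalised where "extend_normalised = tensor_lift BP (\<lambda>b q. bmul b (normalised q))"

lemma normalised_closed [simp, intro]: "p \<in> carrier P \<Longrightarrow> normalised p \<in> carrier BP"
  by (rule lin_closed[OF normalised_lin])

lemma bilinear_extend_normalised: "bilinear B P BP (\<lambda>b q. bmul b (normalised q))"
  by (rule bilinearI; rule lin_compose[OF bmul_lin normalised_lin] bmul_lin_left) auto

lemma extend_normalised_lin: "extend_normalised \<in> lin BP BP"
  unfolding extend_normalised_def by (rule lift_lin[OF mB mP mBP bilinear_extend_normalised])

lemma extend_normalised_pure: "\<lbrakk>b \<in> carrier B; q \<in> carrier P\<rbrakk> \<Longrightarrow> extend_normalised (pure B P b q) = bmul b (normalised q)"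
  unfolding extend_normalised_def by (rule lift_pure[OF mB mP mBP bilinear_extend_normalised])

lemma bmul_mult: "\<lbrakk>a \<in> carrier B; b \<in> carrier B; t \<in> carrier BP\<rbrakk> \<Longrightarrow> bmul (a \<otimes>\<^bsub>P\<^esub> b) t = bmul a (bmul b t)"
  using left_moduleD(6)[OF left_module_BP, of a b t] by (simp add: BP_left_simps)

lemma extend_normalised_bmul:
  assumes "b \<in> carrier B" "t \<in> carrier BP"
  shows "extend_normalised (bmul b t) = bmul b (extend_normalised t)"
  by (rule tensor_lin_ext[OF mB mP mBP lin_compose[OF extend_normalised_lin bmul_lin] lin_compose[OF bmul_lin extend_normalised_lin] _ assms(2)])
    (use assms in \<open>simp_all add: extend_normalised_pure bmul_mult\<close>)

lemma mult_extend_normalised: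
  assumes "t \<in> carrier BP"
  shows "mult_BP (extend_normalised t) = mult_BP t"
  by (rule tensor_lin_ext[OF mB mP mP lin_compose[OF mult_BP_lin extend_normalised_lin] mult_BP_lin _ assms])
    (simp add: extend_normalised_pure mult_BP_bmul mult_normalised)

lemma BP_coact_bmul:
  assumes "b \<in> carrier B" "t \<in> carrier BP"
  shows "BP_coact (bmul b t) = tensor_map K BP C (bmul b) id (BP_coact t)"
  using module_comodule_BP assms
  by (simp add: module_comodule_def BP_left_simps tensor_group_cong(3)[OF scalars_BP same_module_refl])

lemma extend_normalised_colinear: "extend_normalised \<in> right_comodule_hom K C BP BP_coact BP BP_coact"
proof (rule right_comodule_homI[OF extend_normalised_lin])
  note T = lin_compose[OF tensor_map_lin[OF mBP mC mBP mC extend_normalised_lin id_lin] BP_coact_lin]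
  fix t assume t: "t \<in> carrier BP"
  show "BP_coact (extend_normalised t) = tensor_map K BP C extend_normalised id (BP_coact t)"
  proof (rule tensor_lin_ext[OF mB mP mBPC lin_compose[OF BP_coact_lin extend_normalised_lin] T _ t])
    fix b q assume b: "b \<in> carrier B" and q: "q \<in> carrier P"
    have "BP_coact (extend_normalised (pure B P b q)) = tensor_map K BP C (bmul b) id (tensor_map K BP C normalised id (\<Delta> q))"
      using b q by (simp add: extend_normalised_pure BP_coact_bmul right_comodule_homD(2)[OF normalised_colinear])
    also have "\<dots> = tensor_map K BP C (\<lambda>q. bmul b (normalised q)) id (\<Delta> q)"
      by (rule tensor_map_compose[OF mP mBP mBP mC normalised_lin bmul_lin[OF b] \<Delta>_closed[OF q]])
    also have "\<dots> = tensor_lift (BP \<boxtimes> C) (\<lambda>q c. pure BP C (extend_normalised (pure B P b q)) (id c)) (\<Delta> q)"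
      unfolding tensor_map_lift
      by (rule lift_cong[OF mP mC mBPC bilinear_pure_maps[OF mBP mC lin_compose[OF bmul_lin[OF b] normalised_lin] id_lin] _
            \<Delta>_closed[OF q]])
        (simp add: extend_normalised_pure b)
    also have "\<dots> = tensor_map K BP C extend_normalised id (BP_coact (pure B P b q))"
      unfolding tensor_map_lift
      by (rule lift_BP_coact_pure[OF mBPC bilinear_pure_maps[OF mBP mC extend_normalised_lin id_lin] b q, symmetric])
    finally show "BP_coact (extend_normalised (pure B P b q)) = tensor_map K BP C extend_normalised id (BP_coact (pure B P b q))" .
  qed
qed

text \<open>\<open>s(1)\<close> lies in \<open>B \<otimes> B\<close>, and \<open>b \<theta>(b') = b b' \<otimes> 1\<close> for \<open>b, b' \<in> B\<close>.\<close>

lemma extend_normalised_s_one: "extend_normalised (s \<one>\<^bsub>P\<^esub>) = pure B P \<one>\<^bsub>P\<^esub> \<one>\<^bsub>P\<^esub>"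
proof -
  have one: "(\<lambda>x. pure B P x \<one>\<^bsub>P\<^esub>) \<in> lin B BP" by (rule lin_pure_left[OF mB mP lin_ident P.one_closed])
  have "extend_normalised (s \<one>\<^bsub>P\<^esub>) = tensor_lift BP (\<lambda>b q. bmul b (normalised (r q))) (s \<one>\<^bsub>P\<^esub>)"
    unfolding extend_normalised_def by (rule lift_s_one[OF mBP bilinear_extend_normalised, symmetric])
  also have "\<dots> = tensor_lift BP (\<lambda>b q. pure B P (b \<otimes>\<^bsub>P\<^esub> r q) \<one>\<^bsub>P\<^esub>) (s \<one>\<^bsub>P\<^esub>)"
    by (rule lift_cong[OF mB mP mBP bilinear_compose[OF bilinear_extend_normalised lin_ident r_linP]]) (auto simp: normalised_base)
  also have "\<dots> = pure B P (retract_left \<one>\<^bsub>P\<^esub>) \<one>\<^bsub>P\<^esub>"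
    unfolding retract_left_def
    by (rule hom_lift[OF mB mP mB bilinear_mult_r(1) mBP one s_closed[OF P.one_closed], symmetric])
  finally show ?thesis by (simp add: retract_left_one)
qed

theorem strong_connection_extend_normalised: "strong_connection K C P \<Delta> (\<lambda>p. extend_normalised (s p))"
  unfolding strong_connection_def base_tensor_eq
proof (intro conjI ballI)
  have s_hom: "s \<in> right_comodule_hom K C P \<Delta> BP BP_coact"
    using s by (simp add: colinear_splitting_def)
  show "(\<lambda>p. extend_normalised (s p)) \<in> right_comodule_hom K C P \<Delta> BP BP_coact"
    by (rule right_comodule_hom_compose[OF mP mBP mBP mC \<Delta>_lin s_hom extend_normalised_colinear])
  show "(\<lambda>p. extend_normalised (s p)) \<in> module_hom B (left_reg P) BP_left"
    by (intro module_homI)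
      (simp_all add: BP_left_simps s_base extend_normalised_bmul lin_closed[OF extend_normalised_lin] lin_add[OF extend_normalised_lin] lin_add[OF s_lin])
  show "tensor_lift P (\<lambda>b p'. b \<otimes>\<^bsub>P\<^esub> p') (extend_normalised (s p)) = p" if "p \<in> carrier P" for p
    using that mult_extend_normalised[of "s p"] s_split by (simp add: mult_BP_def)
qed (rule extend_normalised_s_one)

end

theorem theorem2p5:
  fixes K :: "'k ring" and C :: "('k, 'c) coalgebra"
    and P :: "('k, 'p) module" and \<Delta> :: "'p \<Rightarrow> ('p, 'c) tensor" and e :: 'c
  assumes "field K" and "is_coalgebra K C" and "principal_extension K C P \<Delta> e"
  shows "(\<exists>s. strong_connection K C P \<Delta> s) \<and>
    (projective_left TYPE('m1) TYPE('n1) (base K C P \<Delta>) (left_reg P) \<and>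
     projective_right TYPE('m2) TYPE('n2) (base K C P \<Delta>) (right_reg P)) \<and>
    (direct_summand (base K C P \<Delta>) (left_reg P) (carrier (base K C P \<Delta>)) \<and>
     direct_summand (base K C P \<Delta>) (right_reg P) (carrier (base K C P \<Delta>))) \<and>
    (faithfully_flat_left TYPE('l3) TYPE('m3) TYPE('n3) (base K C P \<Delta>) (left_reg P) \<and>
     faithfully_flat_right TYPE('l4) TYPE('m4) TYPE('n4) (base K C P \<Delta>) (right_reg P)) \<and>
    (coflat_left TYPE('l5) TYPE('m5) TYPE('n5) K C P (left_coaction K C P \<Delta> e) \<and>
     coflat_right TYPE('l6) TYPE('m6) TYPE('n6) K C P \<Delta>)"
proof -
  have principal: "principal K C P \<Delta> e"
    using assms by (simp add: principal_def principal_axioms_def ground_field_def)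
  obtain s where s: "principal.colinear_splitting K C P \<Delta> s"
    using principal.colinear_splitting_exists[OF principal] by blast
  obtain r u where ru: "r \<in> module_hom K P (base K C P \<Delta>)" "u \<in> module_hom K (tensor_space K P C) P"
    "\<And>b. b \<in> carrier (base K C P \<Delta>) \<Longrightarrow> r b = b"
    "\<And>p. p \<in> carrier P \<Longrightarrow> p = r p \<oplus>\<^bsub>P\<^esub> (u (\<Delta> p) \<ominus>\<^bsub>P\<^esub> u (pure_tensor K P C p e))"
    by (rule principal.projection_exists[OF principal]) blast
  interpret projected_splitting K C P \<Delta> e s r u
    using principal s ru
    by (intro projected_splitting.intro splitting.intro splitting_axioms.intro projected_splitting_axioms.intro)
  show ?thesis
    using strong_connection_extend_normalised left_projective right_projective left_direct_summand right_direct_summand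
      left_faithfully_flat right_faithfully_flat left_coflat right_coflat by blast
qed

end
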